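(* Let $d\in\{1,2,3\}$ and let $\mathbb{T}^d$ be the $d$-dimensional torus. Consider the stochastic Schr\"odinger equation $\mathrm{i}\,\mathrm{d}u=\Delta u\,\mathrm{d}t+V(x)u\,\mathrm{d}t+\mathrm{d}W$ on $\mathbb{T}^d\times(0,\infty)$, $u(\cdot,0)=u_0$, where $V$ is a real-valued potential, $u_0$ is an $\mathcal{F}_0$-measurable complex-valued random variable and $W$ is a $Q$-Wiener process. Let $$H(u)=\frac12\int_{\mathbb{T}^d}|\nabla u|^2\,\mathrm{d}x-\frac12\int_{\mathbb{T}^d}V(x)|u|^2\,\mathrm{d}x.$$ Assume that the initial data is such that $\mathbb{E}[H(u_0)]$ is finite, and that $Q^{1/2}\in\mathcal{L}_2^1$. If $d=1$, assume $V\in H^2$, and if $d=2,3$, assume $V\in H^3$. Then the exact solution, given by the mild equation $$u(t)=S(t)u_0-\mathrm{i}\int_0^tS(t-r)Vu(r)\,\mathrm{d}r-\mathrm{i}\int_0^tS(t-r)\,\mathrm{d}W(r),$$ satisfies, for $t\ge0$, the trace formula $$\mathbb{E}[H(u(t))]=\mathbb{E}[H(u_0)]+\frac t2\Bigl(\mathrm{Tr}(\nabla Q\nabla)-\mathrm{Tr}(Q^{1/2}VQ^{1/2})\Bigr).$$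
   Context: $L^2=L^2(\mathbb{T}^d)$ is the space of complex-valued square integrable functions on the torus, with inner product $(u,v)=\mathrm{Re}\int_{\mathbb{T}^d}u\bar v\,\mathrm{d}x$; $H^\sigma=H^\sigma(\mathbb{T}^d)$ is the Sobolev space of order $\sigma$; $\mathcal{L}_2^\sigma$ is the space of Hilbert--Schmidt operators from $L^2$ to $H^\sigma$. $S(t)=\mathrm{e}^{-\mathrm{i}t\Delta}$ is the unitary group generated by $-\mathrm{i}\Delta$. $(\Omega,\mathcal{F},\mathbb{P},\{\mathcal{F}_t\}_{t\ge0})$ is a filtered probability space with a normal filtration, and $W$ is a complex-valued (i.e. $L^2$-valued), square integrable $Q$-Wiener process with respect to $\{\mathcal{F}_t\}$, where the covariance operator $Q$ is a nonnegative self-adjoint operator on $L^2$; thus $W(t)=\sum_j\beta_j(t)Q^{1/2}e_j$ for an orthonormal basis $(e_j)$ of $L^2$ and independent standard Brownian motions $\beta_j$. Notation: $\mathrm{Tr}(\nabla Q\nabla)=\sum_j\|\nabla Q^{1/2}e_j\|_{L^2}^2$ and $\mathrm{Tr}(Q^{1/2}VQ^{1/2})=\sum_j(VQ^{1/2}e_j,Q^{1/2}e_j)$.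
   Formalization: "E[H(u_0)] finite" is taken as: u_0 in H^1 a.s., with E∫|∇u_0|^2 and E∫|V||u_0|^2 both finite; integrability of H(u_0) alone fails (d=1, V=2, u_0=R(1+e^{2ix}), E|R|=∞: H(u_0)=0 but E[H(u(t))] need not exist). *)

theory Defs
  imports "HOL-Probability.Probability"
begin

text \<open>The torus is \<open>(\<real> / 2\<pi>\<int>)\<^sup>d\<close>, represented by its fundamental cell with
  Lebesgue measure; values of functions outside the cell are irrelevant.\<close>

definition torus :: "(real^'d) measure"
  where "torus = restrict_space lborel {x. \<forall>i. 0 \<le> x $ i \<and> x $ i < 2 * pi}"

definition sq_integrable :: "(real^'d \<Rightarrow> complex) \<Rightarrow> bool"
  where "sq_integrable f \<longleftrightarrow>
    f \<in> borel_measurable torus \<and> integrable torus (\<lambda>x. (cmod (f x))\<^sup>2)"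

text \<open>\<open>L\<^sup>2\<close> of the torus with the real inner product \<open>Re \<integral> u v\<^sup>*\<close>, as a real Hilbert space.
  Linear operators on it are thus real-linear. The instances proved below (completeness and second
  countability) are what the Bochner integral needs.\<close>

quotient_type 'd l2_torus = "real^'d \<Rightarrow> complex" / partial:
  "\<lambda>f g. sq_integrable f \<and> sq_integrable g \<and> (AE x in torus. f x = g x)"
  morphisms fn_of class_of
proof (rule part_equivpI)
  show "\<exists>f::real^'d \<Rightarrow> complex. sq_integrable f \<and> sq_integrable f \<and> (AE x in torus. f x = f x)"
    by (rule exI[of _ "\<lambda>_. 0"]) (simp add: sq_integrable_def)
  show "symp (\<lambda>f g::real^'d \<Rightarrow> complex. sq_integrable f \<and> sq_integrable g \<and> (AE x in torus. f x = g x))"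
    by (auto intro!: sympI simp: eq_commute)
  show "transp (\<lambda>f g::real^'d \<Rightarrow> complex. sq_integrable f \<and> sq_integrable g \<and> (AE x in torus. f x = g x))"
  proof (rule transpI)
    fix f g h :: "real^'d \<Rightarrow> complex"
    assume fg: "sq_integrable f \<and> sq_integrable g \<and> (AE x in torus. f x = g x)"
      and gh: "sq_integrable g \<and> sq_integrable h \<and> (AE x in torus. g x = h x)"
    then have "AE x in torus. f x = g x" "AE x in torus. g x = h x" by blast+
    then have "AE x in torus. f x = h x" by eventually_elim simp
    with fg gh show "sq_integrable f \<and> sq_integrable h \<and> (AE x in torus. f x = h x)" by blast
  qed
qed

lemma sets_torus_cell [measurable]: "{x::real^'d. \<forall>i. 0 \<le> x $ i \<and> x $ i < 2 * pi} \<in> sets lborel"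
  by measurable

lemma finite_measure_torus: "finite_measure (torus :: (real^'d) measure)"
proof
  let ?C = "{x::real^'d. \<forall>i. 0 \<le> x $ i \<and> x $ i < 2 * pi}"
  have sub: "?C \<subseteq> cbox 0 (\<chi> i. 2 * pi)"
    by (auto simp: mem_box_cart) (meson less_eq_real_def)
  have "emeasure (torus :: (real^'d) measure) (space torus) = emeasure lborel ?C"
    unfolding torus_def by (subst emeasure_restrict_space) (auto simp: space_restrict_space)
  also have "\<dots> \<le> emeasure lborel (cbox 0 (\<chi> i. 2 * pi) :: (real^'d) set)"
    using sub by (intro emeasure_mono) auto
  also have "\<dots> < \<infinity>"
    by (rule emeasure_lborel_cbox_finite)
  finally show "emeasure (torus :: (real^'d) measure) (space torus) \<noteq> \<infinity>"
    by simp
qed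

interpretation torus: finite_measure "torus :: (real^'d) measure"
  by (rule finite_measure_torus)

lemma sq_integrable_measurable [measurable_dest]: "sq_integrable f \<Longrightarrow> f \<in> borel_measurable torus"
  by (simp add: sq_integrable_def)

lemma borel_measurable_cnj [measurable]:
  "f \<in> borel_measurable M \<Longrightarrow> (\<lambda>x. cnj (f x)) \<in> borel_measurable M"
  by (rule borel_measurable_continuous_on[where f = cnj]) (auto intro: continuous_intros)

lemma sq_integrable_mult_integrable:
  assumes "sq_integrable f" "sq_integrable g"
  shows "integrable torus (\<lambda>x. f x * cnj (g x))"
proof (rule Bochner_Integration.integrable_bound)
  show "integrable torus (\<lambda>x. (cmod (f x))\<^sup>2 + (cmod (g x))\<^sup>2)"
    using assms by (auto simp: sq_integrable_def)
  show "(\<lambda>x. f x * cnj (g x)) \<in> borel_measurable torus"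
    using assms[THEN sq_integrable_measurable] by measurable
  have "norm (f x * cnj (g x)) \<le> norm ((cmod (f x))\<^sup>2 + (cmod (g x))\<^sup>2)" for x
  proof -
    have "0 \<le> cmod (f x) * cmod (g x)" by simp
    then have "cmod (f x) * cmod (g x) \<le> (cmod (f x))\<^sup>2 + (cmod (g x))\<^sup>2"
      using sum_squares_bound[of "cmod (f x)" "cmod (g x)"] by linarith
    then show ?thesis by (simp add: norm_mult)
  qed
  then show "AE x in torus. norm (f x * cnj (g x)) \<le> norm ((cmod (f x))\<^sup>2 + (cmod (g x))\<^sup>2)"
    by simp
qed

lemma sq_integrable_add:
  assumes "sq_integrable f" "sq_integrable g"
  shows "sq_integrable (\<lambda>x. f x + g x)"
  unfolding sq_integrable_def
proof
  show "(\<lambda>x. f x + g x) \<in> borel_measurable torus"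
    using assms[THEN sq_integrable_measurable] by measurable
  show "integrable torus (\<lambda>x. (cmod (f x + g x))\<^sup>2)"
  proof (rule Bochner_Integration.integrable_bound)
    show "integrable torus (\<lambda>x. 2 * (cmod (f x))\<^sup>2 + 2 * (cmod (g x))\<^sup>2)"
      using assms by (auto simp: sq_integrable_def)
    show "(\<lambda>x. (cmod (f x + g x))\<^sup>2) \<in> borel_measurable torus"
      using assms[THEN sq_integrable_measurable] by measurable
    have "(cmod (f x + g x))\<^sup>2 \<le> 2 * (cmod (f x))\<^sup>2 + 2 * (cmod (g x))\<^sup>2" for x
    proof -
      have "(cmod (f x + g x))\<^sup>2 \<le> (cmod (f x) + cmod (g x))\<^sup>2"
        by (intro power_mono norm_triangle_ineq) simp
      also have "\<dots> \<le> 2 * (cmod (f x))\<^sup>2 + 2 * (cmod (g x))\<^sup>2"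
        using sum_squares_bound[of "cmod (f x)" "cmod (g x)"] by (simp add: power2_sum)
      finally show ?thesis .
    qed
    then show "AE x in torus. norm ((cmod (f x + g x))\<^sup>2) \<le> norm (2 * (cmod (f x))\<^sup>2 + 2 * (cmod (g x))\<^sup>2)"
      by simp
  qed
qed

lemma sq_integrable_cmult:
  assumes "sq_integrable f"
  shows "sq_integrable (\<lambda>x. c * f x)"
  using assms by (auto simp: sq_integrable_def norm_mult power_mult_distrib)

lemma sq_integrable_zero [simp]: "sq_integrable (\<lambda>_. 0)"
  by (simp add: sq_integrable_def)

lemma sq_integrable_fn_of [simp]: "sq_integrable (fn_of u)"
  using Quotient3_rep_reflp[OF Quotient3_l2_torus, of u] by simp

lemma class_of_fn_of [simp]: "class_of (fn_of u) = u"
  by (rule Quotient3_abs_rep[OF Quotient3_l2_torus])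

lemma class_of_eq_iff:
  "sq_integrable f \<Longrightarrow> sq_integrable g \<Longrightarrow> class_of f = class_of g \<longleftrightarrow> (AE x in torus. f x = g x)"
  using Quotient3_rel[OF Quotient3_l2_torus, of f g] by simp

lemma fn_of_class_of: "sq_integrable f \<Longrightarrow> AE x in torus. fn_of (class_of f) x = f x"
  using class_of_eq_iff[of "fn_of (class_of f)" f] by simp

lemma l2_eq_iff: "u = v \<longleftrightarrow> (AE x in torus. fn_of u x = fn_of v x)"
  using class_of_eq_iff[of "fn_of u" "fn_of v"] by simp

lemma measurable_fn_of [measurable]: "fn_of u \<in> borel_measurable torus"
  by (rule sq_integrable_measurable) simp

instantiation l2_torus :: (finite) real_inner
begin

definition "0 = class_of (\<lambda>_. 0)"
definition "u + v = class_of (\<lambda>x. fn_of u x + fn_of v x)"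
definition "- u = class_of (\<lambda>x. - fn_of u x)"
definition "u - v = class_of (\<lambda>x. fn_of u x - fn_of v x)"
definition "r *\<^sub>R u = class_of (\<lambda>x. r *\<^sub>R fn_of u x)"
definition "u \<bullet> v = Re (LINT x|torus. fn_of u x * cnj (fn_of v x))"
definition norm_l2_torus :: "'a l2_torus \<Rightarrow> real" where "norm_l2_torus u = sqrt (u \<bullet> u)"
definition "sgn u = inverse (norm u) *\<^sub>R u" for u :: "'a l2_torus"
definition "dist u v = norm (u - v)" for u v :: "'a l2_torus"
definition "(uniformity :: ('a l2_torus \<times> 'a l2_torus) filter) =
  (INF e\<in>{0<..}. principal {(u, v). dist u v < e})"
definition "open U = (\<forall>u\<in>U. eventually (\<lambda>(u', v). u' = u \<longrightarrow> v \<in> U) uniformity)"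
  for U :: "'a l2_torus set"

lemma fn_of_zero: "AE x in torus. fn_of 0 x = 0"
  unfolding zero_l2_torus_def by (rule fn_of_class_of) simp

lemma fn_of_plus: "AE x in torus. fn_of (u + v) x = fn_of u x + fn_of v x"
  unfolding plus_l2_torus_def by (intro fn_of_class_of sq_integrable_add) auto

lemma fn_of_scaleR: "AE x in torus. fn_of (r *\<^sub>R u) x = r *\<^sub>R fn_of u x"
  unfolding scaleR_l2_torus_def scaleR_conv_of_real
  by (intro fn_of_class_of sq_integrable_cmult) auto

lemma fn_of_uminus: "AE x in torus. fn_of (- u) x = - fn_of u x"
  unfolding uminus_l2_torus_def
  using sq_integrable_cmult[of "fn_of u" "-1"] by (intro fn_of_class_of) auto

lemma fn_of_minus: "AE x in torus. fn_of (u - v) x = fn_of u x - fn_of v x"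
  unfolding minus_l2_torus_def
  using sq_integrable_add[of "fn_of u" "\<lambda>x. -1 * fn_of v x"] sq_integrable_cmult[of "fn_of v" "-1"]
  by (intro fn_of_class_of) auto

lemma inner_l2_cong:
  assumes "AE x in torus. fn_of u x = f x" "AE x in torus. fn_of v x = g x"
    "f \<in> borel_measurable torus" "g \<in> borel_measurable torus"
  shows "u \<bullet> v = Re (LINT x|torus. f x * cnj (g x))"
proof -
  have "(LINT x|torus. fn_of u x * cnj (fn_of v x)) = (LINT x|torus. f x * cnj (g x))"
  proof (rule integral_cong_AE)
    show "(\<lambda>x. fn_of u x * cnj (fn_of v x)) \<in> borel_measurable torus" by measurable
    show "(\<lambda>x. f x * cnj (g x)) \<in> borel_measurable torus" using assms(3,4) by measurable
    show "AE x in torus. fn_of u x * cnj (fn_of v x) = f x * cnj (g x)"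
      using assms(1,2) by eventually_elim simp
  qed
  then show ?thesis by (simp add: inner_l2_torus_def)
qed

lemma inner_l2_self: "u \<bullet> u = (LINT x|torus. (cmod (fn_of u x))\<^sup>2)"
proof -
  have "u \<bullet> u = Re (LINT x|torus. complex_of_real ((cmod (fn_of u x))\<^sup>2))"
    by (simp add: inner_l2_torus_def complex_norm_square del: of_real_power)
  then show ?thesis by (simp del: of_real_power)
qed

instance
proof
  fix u v w :: "'a l2_torus" and r s :: real
  show "u + v + w = u + (v + w)"
    using fn_of_plus[of "u+v" w] fn_of_plus[of u v] fn_of_plus[of u "v+w"] fn_of_plus[of v w]
    unfolding l2_eq_iff by eventually_elim simp
  show "u + v = v + u"
    using fn_of_plus[of u v] fn_of_plus[of v u] unfolding l2_eq_iff by eventually_elim simp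
  show "0 + u = u"
    using fn_of_plus[of "0" u] fn_of_zero unfolding l2_eq_iff by eventually_elim simp
  show "- u + u = 0"
    using fn_of_plus[of "-u" u] fn_of_uminus[of u] fn_of_zero
    unfolding l2_eq_iff by eventually_elim simp
  show "u - v = u + - v"
    using fn_of_plus[of u "-v"] fn_of_uminus[of v] fn_of_minus[of u v]
    unfolding l2_eq_iff by eventually_elim simp
  show "r *\<^sub>R (u + v) = r *\<^sub>R u + r *\<^sub>R v"
    using fn_of_plus[of u v] fn_of_plus[of "r *\<^sub>R u" "r *\<^sub>R v"] fn_of_scaleR[of r "u+v"]
      fn_of_scaleR[of r u] fn_of_scaleR[of r v]
    unfolding l2_eq_iff by eventually_elim (simp add: scaleR_add_right)
  show "(r + s) *\<^sub>R u = r *\<^sub>R u + s *\<^sub>R u"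
    using fn_of_plus[of "r *\<^sub>R u" "s *\<^sub>R u"] fn_of_scaleR[of "r+s" u]
      fn_of_scaleR[of r u] fn_of_scaleR[of s u]
    unfolding l2_eq_iff by eventually_elim (simp add: scaleR_add_left)
  show "r *\<^sub>R s *\<^sub>R u = (r * s) *\<^sub>R u"
    using fn_of_scaleR[of r "s *\<^sub>R u"] fn_of_scaleR[of s u] fn_of_scaleR[of "r * s" u]
    unfolding l2_eq_iff by eventually_elim simp
  show "1 *\<^sub>R u = u"
    using fn_of_scaleR[of "1" u] unfolding l2_eq_iff by eventually_elim simp
  show "u \<bullet> v = v \<bullet> u"
  proof -
    have "(LINT x|torus. fn_of v x * cnj (fn_of u x)) = cnj (LINT x|torus. fn_of u x * cnj (fn_of v x))"
      using Bochner_Integration.integral_cnj[of torus "\<lambda>x. fn_of u x * cnj (fn_of v x)"]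
      by (simp add: mult.commute)
    then show ?thesis by (simp add: inner_l2_torus_def)
  qed
  show "(u + v) \<bullet> w = u \<bullet> w + v \<bullet> w"
  proof -
    have "(u + v) \<bullet> w = Re (LINT x|torus. (fn_of u x + fn_of v x) * cnj (fn_of w x))"
      by (rule inner_l2_cong[OF fn_of_plus]) auto
    also have "\<dots> = u \<bullet> w + v \<bullet> w"
      unfolding inner_l2_torus_def distrib_right
      by (subst Bochner_Integration.integral_add)
        (auto intro!: sq_integrable_mult_integrable)
    finally show ?thesis .
  qed
  show "(r *\<^sub>R u) \<bullet> v = r * (u \<bullet> v)"
  proof -
    have "(r *\<^sub>R u) \<bullet> v = Re (LINT x|torus. (r *\<^sub>R fn_of u x) * cnj (fn_of v x))"
      by (rule inner_l2_cong[OF fn_of_scaleR]) auto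
    also have "\<dots> = r * (u \<bullet> v)"
      by (simp add: inner_l2_torus_def)
    finally show ?thesis .
  qed
  show "0 \<le> u \<bullet> u"
    by (simp add: inner_l2_self)
  show "u \<bullet> u = 0 \<longleftrightarrow> u = 0"
  proof -
    have "u \<bullet> u = 0 \<longleftrightarrow> (AE x in torus. (cmod (fn_of u x))\<^sup>2 = 0)"
      unfolding inner_l2_self
      by (rule integral_nonneg_eq_0_iff_AE)
        (use sq_integrable_fn_of[of u] in \<open>auto simp: sq_integrable_def simp del: sq_integrable_fn_of\<close>)
    also have "\<dots> \<longleftrightarrow> u = 0"
      unfolding zero_l2_torus_def
      using class_of_eq_iff[of "fn_of u" "\<lambda>_. 0"] by simp
    finally show ?thesis .
  qed
qed (simp_all add: norm_l2_torus_def sgn_l2_torus_def dist_l2_torus_def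
      uniformity_l2_torus_def open_l2_torus_def)

end

lemma nn_integral_fn_of: "(\<integral>\<^sup>+x. ennreal ((cmod (fn_of u x))\<^sup>2) \<partial>torus) = ennreal ((norm u)\<^sup>2)"
proof -
  have "integrable torus (\<lambda>x. (cmod (fn_of u x))\<^sup>2)"
    using sq_integrable_fn_of[of u] by (simp add: sq_integrable_def del: sq_integrable_fn_of)
  then show ?thesis
    by (simp add: nn_integral_eq_integral power2_norm_eq_inner inner_l2_self)
qed

lemma nn_integral_fn_of_diff:
  "(\<integral>\<^sup>+x. ennreal ((cmod (fn_of u x - fn_of v x))\<^sup>2) \<partial>torus) = ennreal ((norm (u - v))\<^sup>2)"
proof -
  have "AE x in torus. ennreal ((cmod (fn_of u x - fn_of v x))\<^sup>2) = ennreal ((cmod (fn_of (u - v) x))\<^sup>2)"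
    using fn_of_minus[of u v] by eventually_elim simp
  from nn_integral_cong_AE[OF this] show ?thesis
    by (simp add: nn_integral_fn_of)
qed

lemma nn_integral_class_of_diff:
  assumes "sq_integrable f" "sq_integrable g"
  shows "ennreal ((norm (class_of f - class_of g))\<^sup>2) = (\<integral>\<^sup>+x. ennreal ((cmod (f x - g x))\<^sup>2) \<partial>torus)"
proof -
  have "AE x in torus. ennreal ((cmod (fn_of (class_of f) x - fn_of (class_of g) x))\<^sup>2)
      = ennreal ((cmod (f x - g x))\<^sup>2)"
    using fn_of_class_of[OF assms(1)] fn_of_class_of[OF assms(2)] by eventually_elim simp
  from nn_integral_cong_AE[OF this] show ?thesis
    by (simp add: nn_integral_fn_of_diff)
qed

lemma sq_integrableI_nn:
  assumes "f \<in> borel_measurable torus" "(\<integral>\<^sup>+x. ennreal ((cmod (f x))\<^sup>2) \<partial>torus) < \<infinity>"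
  shows "sq_integrable f"
  using assms by (auto simp: sq_integrable_def intro!: integrableI_bounded)

instance l2_torus :: (finite) banach
proof
  fix X :: "nat \<Rightarrow> 'a l2_torus"
  assume X: "Cauchy X"
  have "\<exists>N. \<forall>m\<ge>N. \<forall>n\<ge>N. norm (X m - X n) < (1/2)^k" for k :: nat
    using CauchyD[OF X, of "(1/2)^k"] by simp
  then obtain N where N: "norm (X m - X n) < (1/2)^k" if "m \<ge> N k" "n \<ge> N k" for m n k
    by metis
  define r where "r = rec_nat (N 0) (\<lambda>k p. max (Suc p) (N (Suc k)))"
  have r_Suc: "r (Suc k) = max (Suc (r k)) (N (Suc k))" for k
    by (simp add: r_def)
  have r_mono: "strict_mono r"
    by (rule strict_monoI_Suc) (simp add: r_Suc)
  have r_ge: "r k \<ge> N k" for k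
    by (cases k) (simp_all add: r_def)
  have fast: "norm (X (r (Suc k)) - X (r k)) < (1/2)^k" for k
    by (rule N) (use r_ge[of k] r_mono in \<open>auto simp: r_Suc\<close>)
  define g where "g k = fn_of (X (r k))" for k
  have g_meas [measurable]: "g k \<in> borel_measurable torus" for k
    by (simp add: g_def measurable_fn_of)
  define C where "C = measure (torus :: (real^'a) measure) (space torus)"
  have C: "C \<ge> 0" "emeasure (torus :: (real^'a) measure) (space torus) = ennreal C"
    by (auto simp: C_def torus.emeasure_eq_measure)
  have L1: "(\<integral>\<^sup>+x. ennreal (cmod (g (Suc k) x - g k x)) \<partial>torus) \<le> ennreal ((1 + C) * (1/2)^k)" for k
  proof -
    have am: "a \<le> 2^k * a\<^sup>2 + (1/2)^k" for a :: real
    proof -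
      have "2 * (2^k * a) \<le> (2^k * a)\<^sup>2 + 1"
        using sum_squares_bound[of "2^k * a" 1] by simp
      then have "2^k * a \<le> (2^k * a)\<^sup>2 + 1"
        using zero_le_power2[of "2^k * a"] by linarith
      also have "\<dots> = 2^k * (2^k * a\<^sup>2 + (1/2)^k)"
        by (simp add: power2_eq_square algebra_simps power_one_over)
      finally show ?thesis by simp
    qed
    have "(\<integral>\<^sup>+x. ennreal (cmod (g (Suc k) x - g k x)) \<partial>torus)
        \<le> (\<integral>\<^sup>+x. ennreal (2^k) * ennreal ((cmod (g (Suc k) x - g k x))\<^sup>2) + ennreal ((1/2)^k) \<partial>torus)"
      by (intro nn_integral_mono)
        (simp add: am flip: ennreal_mult ennreal_plus)
    also have "\<dots> = ennreal (2^k) * ennreal ((norm (X (r (Suc k)) - X (r k)))\<^sup>2) + ennreal ((1/2)^k) * ennreal C"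
      by (subst nn_integral_add)
        (simp_all add: nn_integral_cmult C(2) g_def nn_integral_fn_of_diff)
    also have "\<dots> \<le> ennreal (2^k) * ennreal (((1/2)^k)\<^sup>2) + ennreal ((1/2)^k) * ennreal C"
      using fast[of k] by (intro add_mono mult_left_mono ennreal_leI power_mono) auto
    also have "\<dots> = ennreal (2^k * ((1/2)^k)\<^sup>2 + (1/2)^k * C)"
      using C(1) by (simp add: ennreal_mult ennreal_plus)
    also have "2^k * ((1/2)^k)\<^sup>2 + (1/2)^k * C = (1 + C) * (1/2)^k"
      by (simp add: power2_eq_square power_one_over field_simps)
    finally show ?thesis .
  qed
  have "(\<integral>\<^sup>+x. (\<Sum>k. ennreal (cmod (g (Suc k) x - g k x))) \<partial>torus)
      = (\<Sum>k. \<integral>\<^sup>+x. ennreal (cmod (g (Suc k) x - g k x)) \<partial>torus)"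
    by (rule nn_integral_suminf) simp
  also have "\<dots> \<le> (\<Sum>k. ennreal ((1 + C) * (1/2)^k))"
    by (intro suminf_le L1) auto
  finally have le: "(\<integral>\<^sup>+x. (\<Sum>k. ennreal (cmod (g (Suc k) x - g k x))) \<partial>torus)
      \<le> (\<Sum>k. ennreal ((1 + C) * (1/2)^k))" .
  have "(\<lambda>k. (1 + C) * (1/2)^k) sums ((1 + C) * 2)"
    using sums_mult[OF geometric_sums[of "1/2 :: real"], of "1 + C"] by simp
  then have "(\<Sum>k. ennreal ((1 + C) * (1/2)^k)) < \<infinity>"
    using C(1) by (subst suminf_ennreal_eq[where x = "(1 + C) * 2"])
      auto
  with le have "(\<integral>\<^sup>+x. (\<Sum>k. ennreal (cmod (g (Suc k) x - g k x))) \<partial>torus) < \<infinity>"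
    by (rule le_less_trans)
  then have "AE x in torus. (\<Sum>k. ennreal (cmod (g (Suc k) x - g k x))) \<noteq> \<infinity>"
    by (intro nn_integral_PInf_AE) auto
  then have conv: "AE x in torus. convergent (\<lambda>k. g k x)"
  proof eventually_elim
    case (elim x)
    then have "summable (\<lambda>k. cmod (g (Suc k) x - g k x))"
      by (intro summable_suminf_not_top) auto
    then have "summable (\<lambda>k. g (Suc k) x - g k x)"
      by (rule summable_norm_cancel)
    then have "convergent (\<lambda>n. \<Sum>k<n. g (Suc k) x - g k x)"
      by (simp add: summable_iff_convergent)
    then have "convergent (\<lambda>n. g n x - g 0 x)"
      by (simp add: sum_lessThan_telescope[of "\<lambda>n. g n x"])
    then show ?case
      by (simp add: convergent_diff_const_right_iff)
  qed
  define f where "f x = lim (\<lambda>k. g k x)" for x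
  have f_meas [measurable]: "f \<in> borel_measurable torus"
    unfolding f_def by (rule borel_measurable_lim_metric) simp
  have fatou: "(\<integral>\<^sup>+x. ennreal ((cmod (f x - g m x))\<^sup>2) \<partial>torus) \<le> ennreal (e\<^sup>2)"
    if e: "\<And>n. n \<ge> M \<Longrightarrow> norm (X (r n) - X (r m)) \<le> e" for e M m
  proof -
    have "AE x in torus. ennreal ((cmod (f x - g m x))\<^sup>2)
        = liminf (\<lambda>n. ennreal ((cmod (g n x - g m x))\<^sup>2))"
      using conv
    proof eventually_elim
      case (elim x)
      then have "(\<lambda>k. g k x) \<longlonglongrightarrow> f x"
        by (simp add: f_def convergent_LIMSEQ_iff)
      then have "(\<lambda>n. ennreal ((cmod (g n x - g m x))\<^sup>2)) \<longlonglongrightarrow> ennreal ((cmod (f x - g m x))\<^sup>2)"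
        by (intro tendsto_intros)
      then show ?case by (intro lim_imp_Liminf[symmetric]) simp_all
    qed
    then have "(\<integral>\<^sup>+x. ennreal ((cmod (f x - g m x))\<^sup>2) \<partial>torus)
        = (\<integral>\<^sup>+x. liminf (\<lambda>n. ennreal ((cmod (g n x - g m x))\<^sup>2)) \<partial>torus)"
      by (rule nn_integral_cong_AE)
    also have "\<dots> \<le> liminf (\<lambda>n. \<integral>\<^sup>+x. ennreal ((cmod (g n x - g m x))\<^sup>2) \<partial>torus)"
      by (rule nn_integral_liminf) simp
    also have "\<dots> = liminf (\<lambda>n. ennreal ((norm (X (r n) - X (r m)))\<^sup>2))"
      by (simp add: g_def nn_integral_fn_of_diff)
    also have "\<dots> \<le> limsup (\<lambda>n. ennreal ((norm (X (r n) - X (r m)))\<^sup>2))"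
      by (rule Liminf_le_Limsup) simp
    also have "\<dots> \<le> ennreal (e\<^sup>2)"
      by (rule Limsup_bounded)
        (use e in \<open>auto intro!: eventually_sequentiallyI[of M] ennreal_leI power_mono\<close>)
    finally show ?thesis .
  qed
  have close: "\<exists>M. \<forall>m\<ge>M. (\<integral>\<^sup>+x. ennreal ((cmod (f x - g m x))\<^sup>2) \<partial>torus) \<le> ennreal (e\<^sup>2)" if "e > 0" for e
  proof -
    obtain M where M: "norm (X m - X n) < e" if "m \<ge> M" "n \<ge> M" for m n
      using CauchyD[OF X \<open>e > 0\<close>] by blast
    have "norm (X (r n) - X (r m)) \<le> e" if "n \<ge> M" "m \<ge> M" for n m
      using that seq_suble[OF r_mono] M by (meson less_imp_le order_trans)
    then show ?thesis using fatou by blast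
  qed
  have f: "sq_integrable f"
  proof -
    obtain m where m: "(\<integral>\<^sup>+x. ennreal ((cmod (f x - g m x))\<^sup>2) \<partial>torus) \<le> ennreal (1\<^sup>2)"
      using close[of 1] by auto
    then have "(\<integral>\<^sup>+x. ennreal ((cmod (f x - g m x))\<^sup>2) \<partial>torus) < \<infinity>"
      by (auto intro: le_less_trans)
    then have "sq_integrable (\<lambda>x. f x - g m x)"
      by (intro sq_integrableI_nn) simp_all
    from sq_integrable_add[OF this, of "g m"] show ?thesis
      by (simp add: g_def)
  qed
  have "(X \<circ> r) \<longlonglongrightarrow> class_of f"
  proof (rule metric_LIMSEQ_I)
    fix e :: real assume "e > 0"
    then obtain M where M: "(\<integral>\<^sup>+x. ennreal ((cmod (f x - g m x))\<^sup>2) \<partial>torus) \<le> ennreal ((e/2)\<^sup>2)" if "m \<ge> M" for m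
      using close[of "e/2"] by auto
    have "dist ((X \<circ> r) m) (class_of f) < e" if "m \<ge> M" for m
    proof -
      have "ennreal ((norm (class_of f - X (r m)))\<^sup>2) \<le> ennreal ((e/2)\<^sup>2)"
        using M[OF that] nn_integral_class_of_diff[OF f, of "g m"] by (simp add: g_def)
      then have "(norm (class_of f - X (r m)))\<^sup>2 \<le> (e/2)\<^sup>2"
        by (subst (asm) ennreal_le_iff) auto
      then have "norm (class_of f - X (r m)) \<le> e/2"
        by (rule power2_le_imp_le) (use \<open>e > 0\<close> in auto)
      then show ?thesis
        using \<open>e > 0\<close> by (simp add: dist_norm norm_minus_commute)
    qed
    then show "\<exists>M. \<forall>m\<ge>M. dist ((X \<circ> r) m) (class_of f) < e" by blast
  qed
  from Cauchy_converges_subseq[OF X r_mono this] show "convergent X"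
    by (rule convergentI)
qed


lemma class_of_add:
  assumes "sq_integrable f" "sq_integrable g"
  shows "class_of (\<lambda>x. f x + g x) = class_of f + class_of g"
  unfolding plus_l2_torus_def
proof (subst class_of_eq_iff)
  show "AE x in torus. f x + g x = fn_of (class_of f) x + fn_of (class_of g) x"
    using fn_of_class_of[OF assms(1)] fn_of_class_of[OF assms(2)] by eventually_elim simp
qed (auto intro: sq_integrable_add assms)

lemma sq_integrable_sum:
  "(\<And>i. i \<in> I \<Longrightarrow> sq_integrable (f i)) \<Longrightarrow> sq_integrable (\<lambda>x. \<Sum>i\<in>I. f i x)"
  by (induction I rule: infinite_finite_induct) (auto intro: sq_integrable_add)

lemma class_of_sum:
  "finite I \<Longrightarrow> (\<And>i. i \<in> I \<Longrightarrow> sq_integrable (f i)) \<Longrightarrow>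
    class_of (\<lambda>x. \<Sum>i\<in>I. f i x) = (\<Sum>i\<in>I. class_of (f i))"
  by (induction I rule: finite_induct)
    (simp_all add: zero_l2_torus_def class_of_add sq_integrable_sum)

lemma class_of_tendsto:
  fixes f :: "nat \<Rightarrow> real^'d \<Rightarrow> complex"
  assumes "\<And>n. sq_integrable (f n)" "sq_integrable g"
    and "\<And>x. x \<in> space torus \<Longrightarrow> (\<lambda>n. f n x) \<longlonglongrightarrow> g x"
    and "integrable torus w"
    and "\<And>n x. x \<in> space torus \<Longrightarrow> (cmod (f n x - g x))\<^sup>2 \<le> w x"
  shows "(\<lambda>n. class_of (f n)) \<longlonglongrightarrow> class_of g"
proof -
  note [measurable] = assms(1,2)[THEN sq_integrable_measurable]
  have "(\<lambda>n. \<integral>\<^sup>+x. ennreal ((cmod (f n x - g x))\<^sup>2) \<partial>torus) \<longlonglongrightarrow> (\<integral>\<^sup>+x. 0 \<partial>(torus :: (real^'d) measure))"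
  proof (rule nn_integral_dominated_convergence[where w = "\<lambda>x. ennreal (w x)"])
    show "(\<integral>\<^sup>+x. ennreal (w x) \<partial>torus) < \<infinity>"
    proof (rule le_less_trans)
      show "(\<integral>\<^sup>+x. ennreal (w x) \<partial>torus) \<le> (\<integral>\<^sup>+x. ennreal (norm (w x)) \<partial>torus)"
        by (intro nn_integral_mono ennreal_leI) auto
      show "\<dots> < \<infinity>"
        using assms(4) unfolding integrable_iff_bounded by blast
    qed
    show "(\<lambda>x. ennreal (w x)) \<in> borel_measurable torus"
      using assms(4) by measurable
    show "AE x in torus. ennreal ((cmod (f j x - g x))\<^sup>2) \<le> ennreal (w x)" for j
      by (intro AE_I2 ennreal_leI assms(5))
    show "AE x in torus. (\<lambda>i. ennreal ((cmod (f i x - g x))\<^sup>2)) \<longlonglongrightarrow> 0"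
    proof (rule AE_I2)
      fix x :: "real^'d" assume "x \<in> space torus"
      from assms(3)[OF this] have "(\<lambda>n. ennreal ((cmod (f n x - g x))\<^sup>2)) \<longlonglongrightarrow> ennreal ((cmod (g x - g x))\<^sup>2)"
        by (intro tendsto_intros)
      then show "(\<lambda>n. ennreal ((cmod (f n x - g x))\<^sup>2)) \<longlonglongrightarrow> 0" by simp
    qed
    show "(\<lambda>x. ennreal ((cmod (f j x - g x))\<^sup>2)) \<in> borel_measurable torus" for j
      by measurable
  qed simp
  then have "(\<lambda>n. ennreal ((norm (class_of (f n) - class_of g))\<^sup>2)) \<longlonglongrightarrow> ennreal 0"
    unfolding nn_integral_class_of_diff[OF assms(1,2)] by simp
  then have "(\<lambda>n. (norm (class_of (f n) - class_of g))\<^sup>2) \<longlonglongrightarrow> 0"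
    by (rule tendsto_ennrealD) simp_all
  then have "(\<lambda>n. norm (class_of (f n) - class_of g)) \<longlonglongrightarrow> 0"
    using tendsto_real_sqrt by fastforce
  then show ?thesis
    by (rule LIM_zero_cancel[OF tendsto_norm_zero_cancel])
qed

lemma sq_integrable_bounded:
  assumes "f \<in> borel_measurable torus" "\<And>x. cmod (f x) \<le> K"
  shows "sq_integrable f"
proof -
  have "norm ((cmod (f x))\<^sup>2) \<le> K\<^sup>2" for x
    using assms(2)[of x] by (auto intro!: power_mono)
  then have "integrable torus (\<lambda>x. (cmod (f x))\<^sup>2)"
    using assms(1) by (intro torus.integrable_const_bound[where B = "K\<^sup>2"] AE_I2) auto
  with assms(1) show ?thesis
    unfolding sq_integrable_def by blast
qed

lemma class_of_tendsto_bounded: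
  assumes "\<And>n. f n \<in> borel_measurable torus" "\<And>n x. cmod (f n x) \<le> K"
    and "\<And>x. (\<lambda>n. f n x) \<longlonglongrightarrow> g x"
  shows "(\<lambda>n. class_of (f n)) \<longlonglongrightarrow> class_of g"
proof (rule class_of_tendsto[where w = "\<lambda>_. (2 * K)\<^sup>2"])
  have g: "cmod (g x) \<le> K" for x
    by (rule tendsto_upperbound[OF tendsto_norm[OF assms(3)]]) (use assms(2) in auto)
  have "g \<in> borel_measurable torus"
    using assms(1,3) by (rule borel_measurable_LIMSEQ_metric)
  then show "sq_integrable g"
    using g by (rule sq_integrable_bounded)
  show "sq_integrable (f n)" for n
    using assms(1,2) by (rule sq_integrable_bounded)
  show "(cmod (f n x - g x))\<^sup>2 \<le> (2 * K)\<^sup>2" for n x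
    using norm_triangle_ineq4[of "f n x" "g x"] g[of x] assms(2)[of n x]
    by (intro power_mono) auto
qed (use assms(3) in auto)

lemma borel_measurable_torusI: "f \<in> borel_measurable borel \<Longrightarrow> f \<in> borel_measurable torus"
  unfolding torus_def by (rule measurable_restrict_space1) simp

lemma l2_torus_separable: "\<exists>D::'d::finite l2_torus set. countable D \<and> closure D = UNIV"
proof -
  obtain B :: "(real^'d) set set" where B: "countable B" "topological_basis B"
    using ex_countable_basis by blast
  define U where "U = (\<lambda>F. \<Inter>F) ` {F. finite F \<and> F \<subseteq> B}"
  have U_count: "countable U"
    unfolding U_def using B(1) by (intro countable_image countable_Collect_finite_subset)
  have U_Int: "Int_stable U"
  proof (rule Int_stableI)
    fix a b assume "a \<in> U" "b \<in> U"
    then obtain F G where "finite F" "F \<subseteq> B" "a = \<Inter>F" "finite G" "G \<subseteq> B" "b = \<Inter>G"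
      by (auto simp: U_def)
    then show "a \<inter> b \<in> U"
      unfolding U_def by (intro image_eqI[of _ _ "F \<union> G"]) auto
  qed
  have U_Pow: "U \<subseteq> Pow UNIV" by simp
  have U_UNIV: "UNIV \<in> U"
    unfolding U_def by (intro image_eqI[of _ _ "{}"]) auto
  have U_borel: "U \<subseteq> sets borel"
  proof
    fix a assume "a \<in> U"
    then obtain F where F: "finite F" "F \<subseteq> B" "a = \<Inter>F" by (auto simp: U_def)
    have "open (\<Inter>F)"
      using F topological_basis_open[OF B(2)] by (intro open_Inter) auto
    then show "a \<in> sets borel" using F(3) by simp
  qed
  have sets_eq: "sets borel = sigma_sets UNIV U"
  proof
    have "sets (borel :: (real^'d) measure) = sigma_sets UNIV B"
      using borel_eq_countable_basis[OF B] by (metis sets_measure_of subset_UNIV Pow_UNIV)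
    also have "\<dots> \<subseteq> sigma_sets UNIV U"
    proof (rule sigma_sets_mono')
      show "B \<subseteq> U"
        unfolding U_def by (auto intro!: image_eqI[of _ _ "{_}"])
    qed
    finally show "sets borel \<subseteq> sigma_sets UNIV U" .
    show "sigma_sets UNIV U \<subseteq> sets borel"
      using sets.sigma_sets_subset[OF U_borel] by simp
  qed
  define \<phi> :: "rat \<times> rat \<times> (real^'d) set \<Rightarrow> 'd l2_torus" where
    "\<phi> = (\<lambda>(p, q, A). class_of (\<lambda>x. Complex (of_rat p) (of_rat q) * indicator A x))"
  define D where "D = (\<lambda>l. sum_list (map \<phi> l)) ` lists (UNIV \<times> UNIV \<times> U)"
  have D_count: "countable D"
    unfolding D_def using U_count by (intro countable_image countable_lists countable_SIGMA) auto
  have D_add: "a + b \<in> D" if ab: "a \<in> D" "b \<in> D" for a b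
  proof -
    obtain k l where kl: "k \<in> lists (UNIV \<times> UNIV \<times> U)" "l \<in> lists (UNIV \<times> UNIV \<times> U)"
      "a = sum_list (map \<phi> k)" "b = sum_list (map \<phi> l)"
      using ab by (auto simp: D_def)
    then show ?thesis
      unfolding D_def by (intro image_eqI[of _ _ "k @ l"]) auto
  qed
  have D_0: "0 \<in> D"
    unfolding D_def by (intro image_eqI[of _ _ "[]"]) auto
  have cl_add: "a + b \<in> closure D" if a: "a \<in> closure D" and b: "b \<in> closure D" for a b
  proof -
    obtain x where "\<And>n. x n \<in> D" "x \<longlonglongrightarrow> a"
      using a unfolding closure_sequential by auto
    moreover obtain y where "\<And>n. y n \<in> D" "y \<longlonglongrightarrow> b"
      using b unfolding closure_sequential by auto
    ultimately show ?thesis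
      unfolding closure_sequential by (intro exI[of _ "\<lambda>n. x n + y n"]) (auto intro: D_add tendsto_add)
  qed
  have cl_0: "0 \<in> closure D"
    using D_0 closure_subset by blast
  have cl_sum: "(\<And>i. i \<in> I \<Longrightarrow> h i \<in> closure D) \<Longrightarrow> (\<Sum>i\<in>I. h i) \<in> closure D" for I :: "'z set" and h
    by (induction I rule: infinite_finite_induct) (auto intro: cl_add cl_0)
  have cl_lim: "a \<in> closure D" if "h \<longlonglongrightarrow> a" "\<And>n. h n \<in> closure D" for h a
    using closed_sequentially[OF closed_closure, of h D a] that by blast
  have sq_ind: "sq_integrable (\<lambda>x. c * indicator A x)" if "A \<in> sets borel" for A and c :: complex
    using that by (intro sq_integrable_bounded[where K = "cmod c"] borel_measurable_torusI)
      (auto simp: norm_mult split: split_indicator)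
  have cl_U: "class_of (\<lambda>x. c * indicator A x) \<in> closure D" if A: "A \<in> U" for A c
  proof -
    have rat: "\<exists>p. (\<lambda>n. of_rat (p n)) \<longlonglongrightarrow> y" for y :: real
    proof -
      obtain h where h: "\<And>n. h n \<in> \<rat>" "h \<longlonglongrightarrow> y"
        using Rats_closure_real closure_sequential[of y \<rat>] by auto
      then have "\<forall>n. \<exists>p. h n = of_rat p"
        by (auto simp: Rats_def)
      then obtain p where "\<And>n. h n = of_rat (p n)" by metis
      then have "h = (\<lambda>n. of_rat (p n))" by blast
      with h(2) show ?thesis by blast
    qed
    obtain p q where "(\<lambda>n. of_rat (p n)) \<longlonglongrightarrow> Re c" "(\<lambda>n. of_rat (q n)) \<longlonglongrightarrow> Im c"
      using rat by meson
    then have lim: "(\<lambda>n. Complex (of_rat (p n)) (of_rat (q n))) \<longlonglongrightarrow> c"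
      using tendsto_Complex by fastforce
    then obtain K where K: "cmod (Complex (of_rat (p n)) (of_rat (q n))) \<le> K" for n
      using convergent_imp_Bseq[OF convergentI[OF lim]] by (auto simp: Bseq_def)
    have "K \<ge> 0" using K[of 0] norm_ge_zero order_trans by blast
    have "(\<lambda>n. class_of (\<lambda>x. Complex (of_rat (p n)) (of_rat (q n)) * indicator A x))
        \<longlonglongrightarrow> class_of (\<lambda>x. c * indicator A x)"
    proof (rule class_of_tendsto_bounded[where K = K])
      show "(\<lambda>x. Complex (of_rat (p n)) (of_rat (q n)) * indicator A x) \<in> borel_measurable torus" for n
        using A U_borel by (intro borel_measurable_torusI) auto
      show "(\<lambda>n. Complex (of_rat (p n)) (of_rat (q n)) * indicator A x) \<longlonglongrightarrow> c * indicator A x" for x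
        by (intro tendsto_intros lim)
    qed (use K \<open>K \<ge> 0\<close> in \<open>auto split: split_indicator\<close>)
    moreover have "class_of (\<lambda>x. Complex (of_rat (p n)) (of_rat (q n)) * indicator A x) \<in> closure D" for n
    proof -
      have "\<phi> (p n, q n, A) \<in> D"
        unfolding D_def using A by (intro image_eqI[of _ _ "[(p n, q n, A)]"]) auto
      then show ?thesis using closure_subset[of D] by (auto simp: \<phi>_def)
    qed
    ultimately show ?thesis by (rule cl_lim)
  qed
  have cl_ind: "\<forall>c. class_of (\<lambda>x. c * indicator A x) \<in> closure D" if "A \<in> sets borel" for A
    using U_Int U_Pow that[unfolded sets_eq]
  proof (induction rule: sigma_sets_induct_disjoint)
    case (basic A)
    then show ?case using cl_U by blast
  next
    case empty
    then show ?case using cl_0 by (simp add: zero_l2_torus_def)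
  next
    case (compl A)
    show ?case
    proof
      fix c :: complex
      have A: "A \<in> sets borel" using compl(1) by (simp add: sets_eq)
      have eq: "(\<lambda>x. c * indicator (UNIV - A) x) = (\<lambda>x. c * indicator UNIV x + (- c) * indicator A x)"
        by (auto simp: fun_eq_iff split: split_indicator)
      have "class_of (\<lambda>x. c * indicator UNIV x) \<in> closure D"
        by (rule cl_U[OF U_UNIV])
      moreover have "class_of (\<lambda>x. (- c) * indicator A x) \<in> closure D"
        using compl(2) by blast
      moreover have "class_of (\<lambda>x. c * indicator (UNIV - A) x)
          = class_of (\<lambda>x. c * indicator UNIV x) + class_of (\<lambda>x. (- c) * indicator A x)"
        unfolding eq by (intro class_of_add sq_ind A) simp
      ultimately show "class_of (\<lambda>x. c * indicator (UNIV - A) x) \<in> closure D"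
        by (simp only: cl_add)
    qed
  next
    case (union A)
    show ?case
    proof
      fix c :: complex
      have A: "A i \<in> sets borel" for i using union(2) by (auto simp: sets_eq)
      show "class_of (\<lambda>x. c * indicator (\<Union>i. A i) x) \<in> closure D"
      proof (rule cl_lim)
        show "class_of (\<lambda>x. c * indicator (\<Union>i<n. A i) x) \<in> closure D" for n
        proof -
          have "(\<lambda>x. c * indicator (\<Union>i<n. A i) x) = (\<lambda>x. \<Sum>i<n. c * indicator (A i) x)"
            using union(1) by (auto simp: fun_eq_iff indicator_UN_disjoint sum_distrib_left disjoint_family_on_def)
          moreover have "class_of (\<lambda>x. \<Sum>i<n. c * indicator (A i) x)
              = (\<Sum>i<n. class_of (\<lambda>x. c * indicator (A i) x))"
            by (intro class_of_sum sq_ind A) simp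
          moreover have "\<dots> \<in> closure D"
            using union(3) by (intro cl_sum) blast
          ultimately show ?thesis by (simp only:)
        qed
        show "(\<lambda>n. class_of (\<lambda>x. c * indicator (\<Union>i<n. A i) x)) \<longlonglongrightarrow> class_of (\<lambda>x. c * indicator (\<Union>i. A i) x)"
        proof (rule class_of_tendsto_bounded[where K = "cmod c"])
          show "(\<lambda>x. c * indicator (\<Union>i<n. A i) x) \<in> borel_measurable torus" for n
            using A by (intro borel_measurable_torusI borel_measurable_times borel_measurable_indicator
                borel_measurable_const sets.finite_UN) auto
          show "(\<lambda>n. c * indicator (\<Union>i<n. A i) x) \<longlonglongrightarrow> c * indicator (\<Union>i. A i) x" for x
            by (intro tendsto_intros LIMSEQ_indicator_UN)
        qed (auto simp: norm_mult split: split_indicator)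
      qed
    qed
  qed
  have "u \<in> closure D" for u
  proof -
    obtain s where s: "\<And>i. simple_function torus (s i)"
      "\<And>x. x \<in> space torus \<Longrightarrow> (\<lambda>i. s i x) \<longlonglongrightarrow> fn_of u x"
      "\<And>i x. x \<in> space torus \<Longrightarrow> cmod (s i x) \<le> 2 * cmod (fn_of u x)"
      using borel_measurable_implies_sequence_metric[OF measurable_fn_of[of u], of 0] by auto metis
    have int_u: "integrable torus (\<lambda>x. (cmod (fn_of u x))\<^sup>2)"
      using sq_integrable_fn_of[of u] by (simp add: sq_integrable_def del: sq_integrable_fn_of)
    have sq_s: "sq_integrable (s i)" for i
      unfolding sq_integrable_def
    proof
      show m [measurable]: "s i \<in> borel_measurable torus"
        using s(1) by (rule borel_measurable_simple_function)
      show "integrable torus (\<lambda>x. (cmod (s i x))\<^sup>2)"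
      proof (rule Bochner_Integration.integrable_bound)
        show "integrable torus (\<lambda>x. 4 * (cmod (fn_of u x))\<^sup>2)" using int_u by simp
        show "AE x in torus. norm ((cmod (s i x))\<^sup>2) \<le> norm (4 * (cmod (fn_of u x))\<^sup>2)"
        proof (rule AE_I2)
          fix x assume "x \<in> space (torus :: (real^'d) measure)"
          from power_mono[OF s(3)[OF this, of i], of 2]
          show "norm ((cmod (s i x))\<^sup>2) \<le> norm (4 * (cmod (fn_of u x))\<^sup>2)"
            by (simp add: power_mult_distrib)
        qed
      qed measurable
    qed
    have "class_of (s i) \<in> closure D" for i
    proof -
      let ?A = "\<lambda>y. {x \<in> space torus. s i x = y}"
      have A: "?A y \<in> sets borel" for y
      proof -
        have "s i -` {y} \<inter> space torus \<in> sets torus"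
          using s(1) by (rule simple_functionD(2))
        moreover have "s i -` {y} \<inter> space torus = ?A y" by auto
        ultimately have "?A y \<in> sets torus" by simp
        then show ?thesis
          using sets_torus_cell unfolding torus_def by (simp add: sets_restrict_space_iff)
      qed
      have fin: "finite (s i ` space torus)" using s(1) by (rule simple_functionD)
      have "class_of (s i) = class_of (\<lambda>x. \<Sum>y\<in>s i ` space torus. y * indicator (?A y) x)"
      proof (subst class_of_eq_iff)
        show "AE x in torus. s i x = (\<Sum>y\<in>s i ` space torus. y * indicator (?A y) x)"
        proof (rule AE_I2)
          fix x assume x: "x \<in> space (torus :: (real^'d) measure)"
          have "(\<Sum>y\<in>s i ` space torus. y * indicator (?A y) x) = (\<Sum>y\<in>s i ` space torus. if y = s i x then y else 0)"
            using x by (intro sum.cong) (auto split: split_indicator)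
          also have "\<dots> = s i x" using fin x by simp
          finally show "s i x = (\<Sum>y\<in>s i ` space torus. y * indicator (?A y) x)" by simp
        qed
      qed (auto intro!: sq_s sq_integrable_sum sq_ind A)
      also have "\<dots> = (\<Sum>y\<in>s i ` space torus. class_of (\<lambda>x. y * indicator (?A y) x))"
        using fin A by (intro class_of_sum sq_ind)
      also have "\<dots> \<in> closure D"
        using cl_ind[OF A] by (intro cl_sum) blast
      finally show ?thesis .
    qed
    moreover have "(\<lambda>i. class_of (s i)) \<longlonglongrightarrow> class_of (fn_of u)"
    proof (rule class_of_tendsto[where w = "\<lambda>x. 9 * (cmod (fn_of u x))\<^sup>2"])
      fix n and x :: "real^'d" assume x: "x \<in> space torus"
      have "cmod (s n x - fn_of u x) \<le> 3 * cmod (fn_of u x)"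
        using norm_triangle_ineq4[of "s n x" "fn_of u x"] s(3)[OF x, of n] by linarith
      from power_mono[OF this, of 2] show "(cmod (s n x - fn_of u x))\<^sup>2 \<le> 9 * (cmod (fn_of u x))\<^sup>2"
        by (simp add: power_mult_distrib)
    qed (use sq_s s(2) int_u in auto)
    ultimately show ?thesis
      using cl_lim by simp
  qed
  then show ?thesis using D_count by blast
qed

instance l2_torus :: (finite) second_countable_topology
proof
  obtain D :: "'a l2_torus set" where D: "countable D" "closure D = UNIV"
    using l2_torus_separable by blast
  define B where "B = (\<lambda>(d, n). ball d (1 / real (Suc n))) ` (D \<times> UNIV)"
  have "topological_basis B"
  proof (rule topological_basisI)
    show "open b" if "b \<in> B" for b using that by (auto simp: B_def)
    fix S and u :: "'a l2_torus" assume "open S" "u \<in> S"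
    then obtain e where e: "e > 0" "ball u e \<subseteq> S" by (auto simp: open_contains_ball)
    obtain n where n: "1 / real (Suc n) < e / 2"
      using nat_approx_posE[of "e/2"] e(1) by auto
    obtain d where d: "d \<in> D" "dist d u < 1 / real (Suc n)"
      using D(2) closure_approachable[of u D] by (metis UNIV_I of_nat_0_less_iff zero_less_Suc zero_less_divide_1_iff)
    have "ball d (1 / real (Suc n)) \<subseteq> ball u e"
    proof
      fix v assume "v \<in> ball d (1 / real (Suc n))"
      then show "v \<in> ball u e"
        using d(2) n dist_triangle[of u v d] by (simp add: dist_commute)
    qed
    then show "\<exists>b\<in>B. u \<in> b \<and> b \<subseteq> S"
      using d e(2) unfolding B_def by (intro bexI[of _ "ball d (1 / real (Suc n))"]) auto
  qed
  moreover have "countable B"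
    unfolding B_def using D(1) by auto
  ultimately show "\<exists>B::'a l2_torus set set. countable B \<and> open = generate_topology B"
    using topological_basis_imp_subbasis by blast
qed


text \<open>Fourier coefficients with respect to the normalised characters, and Sobolev spaces.\<close>

definition character :: "int^'d \<Rightarrow> real^'d \<Rightarrow> complex"
  where "character k x =
    cis (\<Sum>i\<in>UNIV. real_of_int (k $ i) * x $ i) / complex_of_real (sqrt ((2 * pi) ^ CARD('d)))"

definition fourier :: "'d::finite l2_torus \<Rightarrow> int^'d \<Rightarrow> complex"
  where "fourier u k = (LINT x|torus. fn_of u x * cnj (character k x))"

definition freq_sq :: "int^'d \<Rightarrow> real"
  where "freq_sq k = (\<Sum>i\<in>UNIV. (real_of_int (k $ i))\<^sup>2)"

definition sobolev :: "real \<Rightarrow> 'd::finite l2_torus set"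
  where "sobolev \<sigma> = {u. (\<lambda>k. (1 + freq_sq k) powr \<sigma> * (cmod (fourier u k))\<^sup>2) summable_on UNIV}"

definition sobolev_norm :: "real \<Rightarrow> 'd::finite l2_torus \<Rightarrow> real"
  where "sobolev_norm \<sigma> u = sqrt (\<Sum>\<^sub>\<infinity>k. (1 + freq_sq k) powr \<sigma> * (cmod (fourier u k))\<^sup>2)"

text \<open>The operator with symbol \<open>m\<close>; meaningful for \<open>u\<close> with \<open>m \<cdot> fourier u\<close> square summable.\<close>

definition fourier_multiplier :: "(int^'d \<Rightarrow> complex) \<Rightarrow> 'd::finite l2_torus \<Rightarrow> 'd l2_torus"
  where "fourier_multiplier m u = (THE v. \<forall>k. fourier v k = m k * fourier u k)"

text \<open>The weak derivative \<open>\<partial>\<^sub>i\<close> (integration by parts against the characters);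
  \<open>grad_norm_sq u\<close> is \<open>\<integral> |\<nabla>u|\<^sup>2\<close>, meaningful for \<open>u \<in> sobolev 1\<close>.\<close>

definition weak_partial :: "'d \<Rightarrow> 'd::finite l2_torus \<Rightarrow> 'd l2_torus"
  where "weak_partial i = fourier_multiplier (\<lambda>k. \<i> * of_int (k $ i))"

definition grad_norm_sq :: "'d::finite l2_torus \<Rightarrow> real"
  where "grad_norm_sq u = (LINT x|torus. (\<Sum>i\<in>UNIV. (cmod (fn_of (weak_partial i u) x))\<^sup>2))"

text \<open>\<open>S(t) = exp (- i t \<Delta>)\<close>, where \<open>\<Delta>\<close> has symbol \<open>- freq_sq\<close>.\<close>

definition schroedinger_group :: "real \<Rightarrow> 'd::finite l2_torus \<Rightarrow> 'd l2_torus"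
  where "schroedinger_group t = fourier_multiplier (\<lambda>k. exp (- \<i> * of_real t * of_real (- freq_sq k)))"

definition cscale :: "complex \<Rightarrow> 'd::finite l2_torus \<Rightarrow> 'd l2_torus"
  where "cscale c u = class_of (\<lambda>x. c * fn_of u x)"

definition real_valued :: "'d::finite l2_torus \<Rightarrow> bool"
  where "real_valued V \<longleftrightarrow> (AE x in torus. fn_of V x \<in> \<real>)"

definition potential_mult :: "'d::finite l2_torus \<Rightarrow> 'd l2_torus \<Rightarrow> 'd l2_torus"
  where "potential_mult V u = class_of (\<lambda>x. fn_of V x * fn_of u x)"

definition energy :: "'d::finite l2_torus \<Rightarrow> 'd l2_torus \<Rightarrow> real"
  where "energy V u = 1/2 * grad_norm_sq u - 1/2 * (LINT x|torus. Re (fn_of V x) * (cmod (fn_of u x))\<^sup>2)"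

text \<open>Finiteness of \<open>E[H(u\<^sub>0)]\<close> means that \<open>E \<integral> (|\<nabla>u\<^sub>0|\<^sup>2 - V |u\<^sub>0|\<^sup>2)\<close> converges absolutely
  term by term. Integrability of \<open>H(u\<^sub>0)\<close> alone would allow cancellation between the two terms
  when they have infinite expectation, and then \<open>E[H(u(t))]\<close> need not exist.\<close>

definition finite_expected_energy :: "'w measure \<Rightarrow> 'd::finite l2_torus \<Rightarrow> ('w \<Rightarrow> 'd l2_torus) \<Rightarrow> bool"
  where "finite_expected_energy M V u\<^sub>0 \<longleftrightarrow>
    (AE \<omega> in M. u\<^sub>0 \<omega> \<in> sobolev 1) \<and>
    integrable M (\<lambda>\<omega>. grad_norm_sq (u\<^sub>0 \<omega>)) \<and>
    integrable M (\<lambda>\<omega>. LINT x|torus. \<bar>Re (fn_of V x)\<bar> * (cmod (fn_of (u\<^sub>0 \<omega>) x))\<^sup>2)"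

definition orthonormal_basis :: "(nat \<Rightarrow> 'a::real_inner) \<Rightarrow> bool"
  where "orthonormal_basis e \<longleftrightarrow>
    (\<forall>i j. e i \<bullet> e j = (if i = j then 1 else 0)) \<and> closure (span (range e)) = UNIV"

text \<open>Operators from \<open>L\<^sup>2\<close> to \<open>H\<^sup>\<sigma>\<close> with finite Hilbert--Schmidt norm, computed in the basis \<open>e\<close>.\<close>

definition hilbert_schmidt_sobolev ::
    "(nat \<Rightarrow> 'd::finite l2_torus) \<Rightarrow> real \<Rightarrow> ('d l2_torus \<Rightarrow>\<^sub>L 'd l2_torus) \<Rightarrow> bool"
  where "hilbert_schmidt_sobolev e \<sigma> R \<longleftrightarrow>
    range (blinfun_apply R) \<subseteq> sobolev \<sigma> \<and> summable (\<lambda>j. (sobolev_norm \<sigma> (blinfun_apply R (e j)))\<^sup>2)"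

definition hs_norm_sq :: "(nat \<Rightarrow> 'a::real_normed_vector) \<Rightarrow> ('a \<Rightarrow> 'b::real_normed_vector) \<Rightarrow> ennreal"
  where "hs_norm_sq e A = (\<Sum>j. ennreal ((norm (A (e j)))\<^sup>2))"

text \<open>\<open>Tr(\<nabla> Q \<nabla>)\<close> and \<open>Tr(Q\<^sup>1\<^sup>/\<^sup>2 V Q\<^sup>1\<^sup>/\<^sup>2)\<close>, where \<open>R\<close> is \<open>Q\<^sup>1\<^sup>/\<^sup>2\<close>.\<close>

definition trace_grad :: "(nat \<Rightarrow> 'd::finite l2_torus) \<Rightarrow> ('d l2_torus \<Rightarrow>\<^sub>L 'd l2_torus) \<Rightarrow> real"
  where "trace_grad e R = (\<Sum>j. grad_norm_sq (blinfun_apply R (e j)))"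

definition trace_potential ::
    "(nat \<Rightarrow> 'd::finite l2_torus) \<Rightarrow> 'd l2_torus \<Rightarrow> ('d l2_torus \<Rightarrow>\<^sub>L 'd l2_torus) \<Rightarrow> real"
  where "trace_potential e V R =
    (\<Sum>j. potential_mult V (blinfun_apply R (e j)) \<bullet> blinfun_apply R (e j))"

definition nonneg_selfadjoint :: "('a::real_inner \<Rightarrow>\<^sub>L 'a) \<Rightarrow> bool"
  where "nonneg_selfadjoint A \<longleftrightarrow>
    (\<forall>u v. blinfun_apply A u \<bullet> v = u \<bullet> blinfun_apply A v) \<and> (\<forall>u. 0 \<le> blinfun_apply A u \<bullet> u)"

definition is_operator_sqrt :: "('a::real_inner \<Rightarrow>\<^sub>L 'a) \<Rightarrow> ('a \<Rightarrow>\<^sub>L 'a) \<Rightarrow> bool"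
  where "is_operator_sqrt R Q \<longleftrightarrow> nonneg_selfadjoint R \<and> R o\<^sub>L R = Q"

definition normal_filtration :: "'w measure \<Rightarrow> (real \<Rightarrow> 'w measure) \<Rightarrow> bool"
  where "normal_filtration M F \<longleftrightarrow>
    (\<forall>t\<ge>0. subalgebra M (F t)) \<and>
    (\<forall>s t. 0 \<le> s \<and> s \<le> t \<longrightarrow> sets (F s) \<subseteq> sets (F t)) \<and>
    (\<forall>t\<ge>0. sets (F t) = (\<Inter>s\<in>{t<..}. sets (F s))) \<and>
    null_sets M \<subseteq> sets (F 0)"

definition centered_normal :: "real \<Rightarrow> real measure"
  where "centered_normal v =
    (if v = 0 then return borel 0 else density lborel (\<lambda>x. ennreal (normal_density 0 (sqrt v) x)))"

definition Q_wiener_process ::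
    "'w measure \<Rightarrow> (real \<Rightarrow> 'w measure) \<Rightarrow> ('d l2_torus \<Rightarrow>\<^sub>L 'd l2_torus) \<Rightarrow>
      (real \<Rightarrow> 'w \<Rightarrow> 'd::finite l2_torus) \<Rightarrow> bool"
  where "Q_wiener_process M F Q W \<longleftrightarrow>
    (\<forall>t\<ge>0. W t \<in> borel_measurable (F t) \<and> integrable M (\<lambda>\<omega>. (norm (W t \<omega>))\<^sup>2)) \<and>
    (AE \<omega> in M. W 0 \<omega> = 0) \<and>
    (AE \<omega> in M. continuous_on {0..} (\<lambda>t. W t \<omega>)) \<and>
    (\<forall>s t. 0 \<le> s \<and> s \<le> t \<longrightarrow>
      prob_space.indep_set M (sets (F s))
        (sets (vimage_algebra (space M) (\<lambda>\<omega>. W t \<omega> - W s \<omega>) borel)) \<and>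
      (\<forall>h. distr M borel (\<lambda>\<omega>. (W t \<omega> - W s \<omega>) \<bullet> h) =
        centered_normal ((t - s) * (blinfun_apply Q h \<bullet> h))))"

text \<open>The stochastic integral \<open>\<integral>\<^sub>0\<^sup>t \<Phi>(r) dW(r)\<close> of a deterministic operator-valued \<open>\<Phi>\<close>: the
  limit in \<open>L\<^sup>2(\<Omega>; L\<^sup>2)\<close> of the integrals of operator-valued step functions
  approximating \<open>\<Phi>\<close> in the norm \<open>(\<integral>\<^sub>0\<^sup>t \<parallel>\<Phi>(r) Q\<^sup>1\<^sup>/\<^sup>2\<parallel>\<^sup>2 dr)\<^sup>1\<^sup>/\<^sup>2\<close> of the Ito isometry, with the
  Hilbert--Schmidt norm inside. Here \<open>R\<close> is \<open>Q\<^sup>1\<^sup>/\<^sup>2\<close>.\<close>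

definition is_partition :: "real \<Rightarrow> nat \<Rightarrow> (nat \<Rightarrow> real) \<Rightarrow> bool"
  where "is_partition t n \<tau> \<longleftrightarrow> \<tau> 0 = 0 \<and> \<tau> n = t \<and> (\<forall>j<n. \<tau> j \<le> \<tau> (Suc j))"

definition step_operator :: "nat \<Rightarrow> (nat \<Rightarrow> real) \<Rightarrow> (nat \<Rightarrow> 'a::real_normed_vector \<Rightarrow>\<^sub>L 'a) \<Rightarrow> real \<Rightarrow> 'a \<Rightarrow>\<^sub>L 'a"
  where "step_operator n \<tau> A r = (\<Sum>j<n. indicator {\<tau> j<..\<tau> (Suc j)} r *\<^sub>R A j)"

definition step_integral ::
    "nat \<Rightarrow> (nat \<Rightarrow> real) \<Rightarrow> (nat \<Rightarrow> 'a::real_normed_vector \<Rightarrow>\<^sub>L 'a) \<Rightarrow> (real \<Rightarrow> 'w \<Rightarrow> 'a) \<Rightarrow> 'w \<Rightarrow> 'a"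
  where "step_integral n \<tau> A W \<omega> = (\<Sum>j<n. blinfun_apply (A j) (W (\<tau> (Suc j)) \<omega> - W (\<tau> j) \<omega>))"

definition has_wiener_integral ::
    "'w measure \<Rightarrow> (nat \<Rightarrow> 'd::finite l2_torus) \<Rightarrow> ('d l2_torus \<Rightarrow>\<^sub>L 'd l2_torus) \<Rightarrow>
      (real \<Rightarrow> 'w \<Rightarrow> 'd l2_torus) \<Rightarrow> real \<Rightarrow> (real \<Rightarrow> 'd l2_torus \<Rightarrow> 'd l2_torus) \<Rightarrow>
      ('w \<Rightarrow> 'd l2_torus) \<Rightarrow> bool"
  where "has_wiener_integral M e R W t \<Phi> Z \<longleftrightarrow>
    Z \<in> borel_measurable M \<and>
    (\<forall>h. (\<lambda>r. \<Phi> r (blinfun_apply R h)) \<in> borel_measurable borel) \<and>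
    (\<exists>n \<tau> A.
      (\<forall>m. is_partition t (n m) (\<tau> m)) \<and>
      (\<lambda>m. \<integral>\<^sup>+r\<in>{0..t}. hs_norm_sq e (\<lambda>h.
          blinfun_apply (step_operator (n m) (\<tau> m) (A m) r) (blinfun_apply R h)
          - \<Phi> r (blinfun_apply R h)) \<partial>lborel) \<longlonglongrightarrow> 0 \<and>
      (\<lambda>m. \<integral>\<^sup>+\<omega>. ennreal ((norm (step_integral (n m) (\<tau> m) (A m) W \<omega> - Z \<omega>))\<^sup>2) \<partial>M) \<longlonglongrightarrow> 0)"

definition mild_solution ::
    "'w measure \<Rightarrow> (real \<Rightarrow> 'w measure) \<Rightarrow> (nat \<Rightarrow> 'd::finite l2_torus) \<Rightarrow>
      ('d l2_torus \<Rightarrow>\<^sub>L 'd l2_torus) \<Rightarrow> (real \<Rightarrow> 'w \<Rightarrow> 'd l2_torus) \<Rightarrow> 'd l2_torus \<Rightarrow>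
      ('w \<Rightarrow> 'd l2_torus) \<Rightarrow> (real \<Rightarrow> 'w \<Rightarrow> 'd l2_torus) \<Rightarrow> bool"
  where "mild_solution M F e R W V u\<^sub>0 u \<longleftrightarrow>
    (\<forall>t\<ge>0. u t \<in> borel_measurable (F t)) \<and>
    (\<lambda>(t, \<omega>). u t \<omega>) \<in> borel_measurable (restrict_space borel {0..} \<Otimes>\<^sub>M M) \<and>
    (\<forall>t\<ge>0.
      (AE \<omega> in M. set_integrable lborel {0..t}
        (\<lambda>r. schroedinger_group (t - r) (potential_mult V (u r \<omega>)))) \<and>
      (\<exists>Z. has_wiener_integral M e R W t (\<lambda>r. schroedinger_group (t - r)) Z \<and>
        (AE \<omega> in M. u t \<omega> =
          schroedinger_group t (u\<^sub>0 \<omega>)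
          - cscale \<i> (LINT r:{0..t}|lborel. schroedinger_group (t - r) (potential_mult V (u r \<omega>)))
          - cscale \<i> (Z \<omega>))))"

end

theory Submission
  imports Defs
begin

text \<open>In the interaction picture \<open>S(-t) u(t)\<close> the equation becomes \<open>dy = A(t) y dt + dN\<close> with bounded
  skew-adjoint \<open>A(t)\<close> and additive Gaussian noise, so the flow \<open>ev\<close> of the noiseless equation expresses
  the solution as \<open>u\<^sub>0\<close> plus a centred Gaussian deviation, both transported by \<open>ev\<close>. The energy is a
  quadratic form which that flow conserves on \<open>H\<^sup>1\<close> (for this, multiplication by \<open>V\<close> has to be bounded
  on \<open>H\<^sup>1\<close>, which follows from the absolute convergence of its Fourier series). Hence the energy of
  the solution is that of \<open>u\<^sub>0\<close>, plus a cross term with mean zero, plus the energy of the deviation; by the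
  Ito isometry the mean of the last one is an integral over time of the energies of transported
  \<open>Q\<^sup>1\<^sup>/\<^sup>2 e\<^sub>j\<close>, and conservation makes the integrand constant.\<close>

section \<open>Orthonormal bases\<close>

text \<open>Ito's formula does not apply directly: the energy is unbounded on L2, and the mild
  equation gives each stochastic integral only for a fixed time and up to a null set. The proof
  therefore works with scalar second moments. Each tested noise variable is matched with a
  deterministic function of a noise direction \<open>i\<close> and a time \<open>s\<close>; the
  match preserves second moments and extends to time integrals by Fubini. Pairing with the noiseless
  flow writes the deviation as such a time integral, so its covariance is read off on the
  deterministic side. Finite expected energy does not bound the second moment of the L2 norm of
  \<open>u\<^sub>0\<close>: for V = 0 the constant mode is unconstrained. The cross term is
  therefore computed first on events where \<open>u\<^sub>0\<close> is bounded in H1, and the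
  truncation is removed by a dominating function built from the gradient and from |V| |u|^2. H1 is
  treated as the image of the operator \<open>Lam\<close>, and multiplication by \<open>\<i>\<close>
  as an operator \<open>J\<close> on a real Hilbert space, so that bounded operators on one space
  carry all arguments.\<close>

lemma orthonormal_basis_inner:
  "orthonormal_basis e \<Longrightarrow> e i \<bullet> e j = (if i = j then 1 else 0)"
  by (simp add: orthonormal_basis_def)

text \<open>The residual is orthogonal to the span of the first \<open>n\<close> vectors, and
  \<open>p - y\<close> lies in that span, so Pythagoras applies.\<close>

lemma orthonormal_best_approx:
  fixes e :: "nat \<Rightarrow> 'a::real_inner"
  assumes e: "orthonormal_basis e" and y: "y \<in> span (e ` {..<n})"
  shows "norm (x - (\<Sum>i<n. (x \<bullet> e i) *\<^sub>R e i)) \<le> norm (x - y)"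
proof -
  define p where "p = (\<Sum>i<n. (x \<bullet> e i) *\<^sub>R e i)"
  have orth: "(x - p) \<bullet> z = 0" if "z \<in> span (e ` {..<n})" for z
    using that
  proof (induction rule: span_induct_alt)
    case base
    then show ?case by simp
  next
    case (step c b z)
    then obtain i where i: "i < n" "b = e i" by auto
    have "p \<bullet> e i = (\<Sum>j<n. if j = i then x \<bullet> e i else 0)"
      unfolding p_def inner_sum_left
      by (intro sum.cong) (auto simp: orthonormal_basis_inner[OF e])
    also have "\<dots> = x \<bullet> e i" using i by simp
    finally show ?case using step i by (simp add: inner_add_right inner_diff_left)
  qed
  have "p \<in> span (e ` {..<n})"
    unfolding p_def by (intro span_sum span_scale span_base) auto
  then have "(x - p) \<bullet> (p - y) = 0"
    by (intro orth span_diff y)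
  then have "(norm (x - y))\<^sup>2 = (norm (x - p))\<^sup>2 + (norm (p - y))\<^sup>2"
    using norm_add_Pythagorean[of "x - p" "p - y"] by (simp add: orthogonal_def)
  then have "(norm (x - p))\<^sup>2 \<le> (norm (x - y))\<^sup>2" by simp
  then show ?thesis
    unfolding p_def[symmetric] by (rule power2_le_imp_le) simp
qed

text \<open>Density supplies only some finite combination close to \<open>x\<close>. It lies in the
  span of the first \<open>N\<close> basis vectors, and from index \<open>N\<close> on the partial
  sums are at least as close by best approximation.\<close>

lemma orthonormal_basis_sums:
  fixes e :: "nat \<Rightarrow> 'a::real_inner"
  assumes e: "orthonormal_basis e"
  shows "(\<lambda>n. (x \<bullet> e n) *\<^sub>R e n) sums x"
  unfolding sums_def
proof (rule metric_LIMSEQ_I)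
  fix r :: real assume "r > 0"
  moreover have "x \<in> closure (span (range e))"
    using e by (simp add: orthonormal_basis_def)
  ultimately obtain y where y: "y \<in> span (range e)" "dist y x < r"
    unfolding closure_approachable by blast
  have "\<exists>N. y \<in> span (e ` {..<N})"
    using y(1)
  proof (induction rule: span_induct_alt)
    case base
    then show ?case by (auto intro: span_0)
  next
    case (step c b z)
    then obtain i N where i: "b = e i" "z \<in> span (e ` {..<N})" by auto
    have "z \<in> span (e ` {..<max N (Suc i)})"
      by (rule subsetD[OF span_mono i(2)]) auto
    moreover have "b \<in> span (e ` {..<max N (Suc i)})"
      using i by (intro span_base) auto
    ultimately show ?case by (intro exI[of _ "max N (Suc i)"] span_add span_scale)
  qed
  then obtain N where N: "y \<in> span (e ` {..<N})" by blast
  have "dist (\<Sum>i<n. (x \<bullet> e i) *\<^sub>R e i) x < r" if "n \<ge> N" for n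
  proof -
    have "y \<in> span (e ` {..<n})"
      by (rule subsetD[OF span_mono N]) (use that in auto)
    from orthonormal_best_approx[OF e this, of x] show ?thesis
      using y(2) by (simp add: dist_norm norm_minus_commute)
  qed
  then show "\<exists>N. \<forall>n\<ge>N. dist (\<Sum>i<n. (x \<bullet> e i) *\<^sub>R e i) x < r" by blast
qed

lemma parseval_sums:
  assumes "orthonormal_basis e"
  shows "(\<lambda>n. (x \<bullet> e n) * (y \<bullet> e n)) sums (x \<bullet> y)"
  using bounded_linear.sums[OF bounded_linear_inner_left orthonormal_basis_sums[OF assms], of x y]
  by (simp add: mult.commute inner_commute[of "e _"])

lemma parseval_norm:
  assumes "orthonormal_basis e"
  shows "(\<lambda>n. (x \<bullet> e n)\<^sup>2) sums ((norm x)\<^sup>2)"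
  using parseval_sums[OF assms, of x x] by (simp add: power2_eq_square flip: power2_norm_eq_inner)

lemma orthonormal_basis_eqI:
  assumes "orthonormal_basis e" "\<And>n. x \<bullet> e n = y \<bullet> e n"
  shows "x = y"
  using orthonormal_basis_sums[OF assms(1), of x] orthonormal_basis_sums[OF assms(1), of y]
  by (simp add: assms(2) sums_unique2)

lemma norm_orthonormal_sum:
  assumes e: "\<And>i j. e i \<bullet> e j = (if i = j then 1 else 0)" and "finite I"
  shows "(norm (\<Sum>i\<in>I. a i *\<^sub>R e i))\<^sup>2 = (\<Sum>i\<in>I. (a i)\<^sup>2)"
proof -
  have "(\<Sum>i\<in>I. a i *\<^sub>R e i) \<bullet> (\<Sum>j\<in>I. a j *\<^sub>R e j) = (\<Sum>i\<in>I. \<Sum>j\<in>I. if i = j then (a i)\<^sup>2 else 0)"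
    unfolding inner_sum_left inner_sum_right
    by (rule sum.swap[THEN trans], intro sum.cong refl) (auto simp: e power2_eq_square)
  also have "\<dots> = (\<Sum>i\<in>I. (a i)\<^sup>2)" using \<open>finite I\<close> by simp
  finally show ?thesis by (simp add: power2_norm_eq_inner)
qed

text \<open>Orthonormality turns the squared norm of a block of terms into a block of the series of
  squares, so the partial sums are Cauchy. Stated before density is available, because
  \<open>orthonormal_basisI\<close> obtains density from it.\<close>

lemma orthonormal_series:
  fixes e :: "nat \<Rightarrow> 'a::{real_inner, banach}"
  assumes e: "\<And>i j. e i \<bullet> e j = (if i = j then 1 else 0)" and a: "summable (\<lambda>n. (a n)\<^sup>2)"
  shows "\<exists>x. (\<lambda>n. a n *\<^sub>R e n) sums x \<and> (\<forall>n. x \<bullet> e n = a n)"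
proof -
  have "summable (\<lambda>n. a n *\<^sub>R e n)"
    unfolding summable_Cauchy
  proof (intro allI impI)
    fix r :: real assume "r > 0"
    then obtain N where N: "\<forall>m\<ge>N. \<forall>n. norm (\<Sum>i=m..<n. (a i)\<^sup>2) < r\<^sup>2"
      using a[unfolded summable_Cauchy, rule_format, of "r\<^sup>2"] by auto
    have "norm (\<Sum>i=m..<n. a i *\<^sub>R e i) < r" if "m \<ge> N" for m n
    proof (rule power2_less_imp_less)
      show "(norm (\<Sum>i=m..<n. a i *\<^sub>R e i))\<^sup>2 < r\<^sup>2"
        using N that norm_orthonormal_sum[of e "{m..<n}" a, OF e] by (auto simp: sum_nonneg)
    qed (use \<open>r > 0\<close> in simp)
    then show "\<exists>N. \<forall>m\<ge>N. \<forall>n. norm (\<Sum>i = m..<n. a i *\<^sub>R e i) < r" by blast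
  qed
  then have s: "(\<lambda>n. a n *\<^sub>R e n) sums (\<Sum>n. a n *\<^sub>R e n)" by (rule summable_sums)
  have "(\<Sum>n. a n *\<^sub>R e n) \<bullet> e m = a m" for m
  proof -
    have "(\<lambda>n. (a n *\<^sub>R e n) \<bullet> e m) sums ((\<Sum>n. a n *\<^sub>R e n) \<bullet> e m)"
      by (rule bounded_linear.sums[OF bounded_linear_inner_left s])
    moreover have "(\<lambda>n. (a n *\<^sub>R e n) \<bullet> e m) sums a m"
      using sums_single[of m "\<lambda>n. a n"] by (simp add: e if_distrib cong: if_cong)
    ultimately show ?thesis by (rule sums_unique2)
  qed
  then show ?thesis using s by blast
qed

lemma riesz_fischer:
  fixes e :: "nat \<Rightarrow> 'a::{real_inner, banach}"
  assumes "orthonormal_basis e" "summable (\<lambda>n. (a n)\<^sup>2)"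
  shows "\<exists>x. \<forall>n. x \<bullet> e n = a n"
  using orthonormal_series[of e a] assms by (auto simp: orthonormal_basis_inner)

text \<open>By Bessel's inequality the coefficients of \<open>x\<close> are square summable, so
  their series has a sum \<open>y\<close>. Since \<open>x - y\<close> has only zero coefficients,
  \<open>inj\<close> gives \<open>x = y\<close>, which is a limit of elements of the span.\<close>

lemma orthonormal_basisI:
  fixes e :: "nat \<Rightarrow> 'a::{real_inner, banach}"
  assumes e: "\<And>i j. e i \<bullet> e j = (if i = j then 1 else 0)"
    and inj: "\<And>x. (\<And>n. x \<bullet> e n = 0) \<Longrightarrow> x = 0"
  shows "orthonormal_basis e"
proof -
  have "x \<in> closure (span (range e))" for x
  proof -
    have "(\<Sum>i<n. (x \<bullet> e i)\<^sup>2) \<le> (norm x)\<^sup>2" for n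
    proof -
      define p where "p = (\<Sum>i<n. (x \<bullet> e i) *\<^sub>R e i)"
      have "p \<bullet> p = (\<Sum>i<n. (x \<bullet> e i)\<^sup>2)"
        using norm_orthonormal_sum[of e "{..<n}" "\<lambda>i. x \<bullet> e i", OF e] by (simp add: p_def power2_norm_eq_inner)
      moreover have "x \<bullet> p = (\<Sum>i<n. (x \<bullet> e i)\<^sup>2)"
        by (simp add: p_def inner_sum_right power2_eq_square)
      moreover have "0 \<le> (x - p) \<bullet> (x - p)" by simp
      ultimately show ?thesis
        by (simp add: inner_diff_left inner_diff_right inner_commute power2_norm_eq_inner)
    qed
    then have "summable (\<lambda>n. (x \<bullet> e n)\<^sup>2)" by (intro summableI_nonneg_bounded) auto
    from orthonormal_series[of e, OF e this]
    obtain y where y: "(\<lambda>n. (x \<bullet> e n) *\<^sub>R e n) sums y" "\<And>n. y \<bullet> e n = x \<bullet> e n" by blast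
    have "x - y = 0" by (rule inj) (simp add: inner_diff_left y)
    then have "(\<lambda>n. \<Sum>i<n. (x \<bullet> e i) *\<^sub>R e i) \<longlonglongrightarrow> x"
      using y(1) by (simp add: sums_def)
    moreover have "(\<Sum>i<n. (x \<bullet> e i) *\<^sub>R e i) \<in> span (range e)" for n
      by (intro span_sum span_scale span_base) auto
    ultimately show ?thesis
      unfolding closure_sequential by (intro exI[of _ "\<lambda>n. \<Sum>i<n. (x \<bullet> e i) *\<^sub>R e i"]) auto
  qed
  then show ?thesis using e by (auto simp: orthonormal_basis_def)
qed

text \<open>The candidate has coefficients \<open>f (e n)\<close>. Testing \<open>f\<close> on its
  own truncated candidate gives \<open>s \<le> K * sqrt s\<close> for the partial sums
  \<open>s\<close> of their squares. Later the lemma moves a step operator of the Wiener integral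
  onto the test vector.\<close>

lemma riesz_representation:
  fixes e :: "nat \<Rightarrow> 'a::{real_inner, banach}"
  assumes e: "orthonormal_basis e" and f: "bounded_linear (f :: 'a \<Rightarrow> real)"
  shows "\<exists>a. \<forall>x. f x = x \<bullet> a"
proof -
  interpret f: bounded_linear f by fact
  obtain K where K: "K \<ge> 0" "\<And>x. norm (f x) \<le> norm x * K"
    using f.nonneg_bounded by blast
  have "summable (\<lambda>n. (f (e n))\<^sup>2)"
  proof (rule summableI_nonneg_bounded[where x = "K\<^sup>2"])
    fix n
    define s where "s = (\<Sum>i<n. (f (e i))\<^sup>2)"
    have s0: "s \<ge> 0" by (simp add: s_def sum_nonneg)
    have "s = f (\<Sum>i<n. f (e i) *\<^sub>R e i)"
      by (simp add: s_def f.sum f.scaleR power2_eq_square)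
    also have "\<dots> \<le> norm (\<Sum>i<n. f (e i) *\<^sub>R e i) * K"
      using K(2)[of "\<Sum>i<n. f (e i) *\<^sub>R e i"] by simp
    finally have "s\<^sup>2 \<le> (norm (\<Sum>i<n. f (e i) *\<^sub>R e i) * K)\<^sup>2"
      using s0 by (intro power_mono)
    also have "\<dots> = s * K\<^sup>2"
      using norm_orthonormal_sum[of e "{..<n}" "\<lambda>i. f (e i)", OF orthonormal_basis_inner[OF e]] by (simp add: s_def power_mult_distrib)
    finally have "s * s \<le> s * K\<^sup>2" by (simp add: power2_eq_square)
    then have "s \<le> K\<^sup>2" using s0 K(1) by (cases "s = 0") auto
    then show "(\<Sum>i<n. (f (e i))\<^sup>2) \<le> K\<^sup>2" by (simp add: s_def)
  qed simp
  from riesz_fischer[OF e this] obtain a where a: "\<And>n. a \<bullet> e n = f (e n)" by blast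
  have "f x = x \<bullet> a" for x
  proof -
    have "(\<lambda>n. f ((x \<bullet> e n) *\<^sub>R e n)) sums f x"
      by (rule f.sums[OF orthonormal_basis_sums[OF e]])
    then have "(\<lambda>n. (x \<bullet> e n) * (a \<bullet> e n)) sums f x" by (simp add: f.scaleR a)
    with parseval_sums[OF e, of x a] show ?thesis by (simp add: sums_unique2)
  qed
  then show ?thesis by blast
qed

section \<open>Bounded operators diagonal in an orthonormal basis\<close>

definition diag_op :: "(nat \<Rightarrow> 'a::real_inner) \<Rightarrow> (nat \<Rightarrow> real) \<Rightarrow> 'a \<Rightarrow>\<^sub>L 'a"
  where "diag_op e m = (SOME D. \<forall>x n. blinfun_apply D x \<bullet> e n = m n * (x \<bullet> e n))"

text \<open>Riesz-Fischer provides the image of each vector and Parseval bounds it.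
  \<open>diag_op\<close> is a choice and has this property only for bounded \<open>m\<close>, so
  every use supplies a bound \<open>C\<close>.\<close>

lemma diag_op_inner:
  fixes e :: "nat \<Rightarrow> 'a::{real_inner, banach}"
  assumes e: "orthonormal_basis e" and m: "\<And>n. \<bar>m n\<bar> \<le> C"
  shows "blinfun_apply (diag_op e m) x \<bullet> e n = m n * (x \<bullet> e n)"
proof -
  have le: "(m n * (x \<bullet> e n))\<^sup>2 \<le> C\<^sup>2 * (x \<bullet> e n)\<^sup>2" for x n
    using power_mono[OF m[of n], of 2] by (auto simp: power_mult_distrib intro!: mult_right_mono)
  have "summable (\<lambda>n. (m n * (x \<bullet> e n))\<^sup>2)" for x
    by (rule summable_comparison_test'[of "\<lambda>n. C\<^sup>2 * (x \<bullet> e n)\<^sup>2"])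
      (use le in \<open>auto intro!: summable_mult sums_summable[OF parseval_norm[OF e]]\<close>)
  then have "\<forall>x. \<exists>y. \<forall>n. y \<bullet> e n = m n * (x \<bullet> e n)"
    by (intro allI riesz_fischer[OF e])
  then obtain g where g: "\<And>x n. g x \<bullet> e n = m n * (x \<bullet> e n)" by metis
  have "bounded_linear g"
  proof (rule bounded_linear_intro)
    show "g (x + y) = g x + g y" for x y
      by (rule orthonormal_basis_eqI[OF e]) (simp add: g inner_add_left algebra_simps)
    show "g (r *\<^sub>R x) = r *\<^sub>R g x" for r x
      by (rule orthonormal_basis_eqI[OF e]) (simp add: g)
    show "norm (g x) \<le> norm x * \<bar>C\<bar>" for x
    proof (rule power2_le_imp_le)
      have "(norm (g x))\<^sup>2 \<le> C\<^sup>2 * (norm x)\<^sup>2"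
        by (rule sums_le[OF _ parseval_norm[OF e] sums_mult[OF parseval_norm[OF e]]])
          (simp add: g le)
      then show "(norm (g x))\<^sup>2 \<le> (norm x * \<bar>C\<bar>)\<^sup>2" by (simp add: power_mult_distrib mult.commute)
    qed simp
  qed
  then have "\<exists>D. \<forall>x n. blinfun_apply D x \<bullet> e n = m n * (x \<bullet> e n)"
    using g by (intro exI[of _ "Blinfun g"]) (simp add: bounded_linear_Blinfun_apply)
  from someI_ex[OF this] show ?thesis unfolding diag_op_def by blast
qed

section \<open>Linear differential equations with strongly continuous bounded coefficients\<close>

text \<open>The oriented integral from 0 to \<open>t\<close>. Negative times are included because
  the flow is also run backwards.\<close>

definition signed_integral :: "(real \<Rightarrow> 'a::banach) \<Rightarrow> real \<Rightarrow> 'a"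
  where "signed_integral g t = (if 0 \<le> t then integral {0..t} g else - integral {t..0} g)"

lemma signed_integral_has_vector_derivative:
  fixes g :: "real \<Rightarrow> 'a::banach"
  assumes g: "continuous_on UNIV g"
  shows "(signed_integral g has_vector_derivative g t) (at t)"
proof -
  define R where "R = \<bar>t\<bar> + 1"
  have int: "g integrable_on {a..b}" for a b
    using g continuous_on_subset by (intro integrable_continuous_real) blast
  \<comment> \<open>On the window both branches are the integral from \<open>-R\<close> up to one
    constant, so the derivative at 0 requires no gluing.\<close>
  have eq: "signed_integral g u = integral {-R..u} g - integral {-R..0} g" if u: "u \<in> {-R<..<R}" for u
  proof (cases "0 \<le> u")
    case True
    then have "integral {-R..0} g + integral {0..u} g = integral {-R..u} g"
      by (intro Henstock_Kurzweil_Integration.integral_combine int) (auto simp: R_def)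
    then show ?thesis using True by (simp add: signed_integral_def algebra_simps)
  next
    case False
    then have "integral {-R..u} g + integral {u..0} g = integral {-R..0} g"
      using u by (intro Henstock_Kurzweil_Integration.integral_combine int) auto
    then show ?thesis using False by (simp add: signed_integral_def algebra_simps)
  qed
  have t: "t \<in> {-R<..<R}" by (auto simp: R_def)
  have "((\<lambda>u. integral {-R..u} g) has_vector_derivative g t) (at t within {-R..R})"
    by (rule integral_has_vector_derivative) (use g continuous_on_subset t in \<open>auto intro: less_imp_le\<close>)
  then have "((\<lambda>u. integral {-R..u} g) has_vector_derivative g t) (at t)"
    using t by (simp add: at_within_Icc_at)
  then have "((\<lambda>u. integral {-R..u} g - integral {-R..0} g) has_vector_derivative g t - 0) (at t)"
    by (intro has_vector_derivative_diff has_vector_derivative_const)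
  then have "((\<lambda>u. integral {-R..u} g - integral {-R..0} g) has_vector_derivative g t) (at t)"
    by simp
  then show ?thesis
    by (rule has_vector_derivative_transform_within_open[where S="{-R<..<R}"]) (use t eq in auto)
qed

text \<open>Integrating \<open>exp (K * \<bar>r\<bar>)\<close> from 0 gains the factor
  \<open>1 / K\<close>. For \<open>K\<close> large compared with the operator bound, this gain makes
  the integral operator of the fixed point argument a contraction.\<close>

lemma norm_signed_integral_le:
  fixes g :: "real \<Rightarrow> 'a::banach"
  assumes g: "continuous_on UNIV g" and K: "K > 0" and le: "\<And>r. norm (g r) \<le> c * exp (K * \<bar>r\<bar>)"
  shows "norm (signed_integral g t) \<le> c / K * exp (K * \<bar>t\<bar>)"
proof -
  have c: "c \<ge> 0" using le[of 0] norm_ge_zero[of "g 0"] by (simp del: norm_ge_zero)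
  have "g integrable_on {a..b}" for a b
    using g continuous_on_subset by (intro integrable_continuous_real) blast
  note int = this
  show ?thesis
  proof (cases "0 \<le> t")
    case True
    have "((\<lambda>r. c * exp (K * r)) has_integral (c / K * exp (K * t) - c / K * exp (K * 0))) {0..t}"
      by (rule fundamental_theorem_of_calculus[OF True])
        (use K in \<open>auto intro!: derivative_eq_intros simp: has_real_derivative_iff_has_vector_derivative[symmetric]\<close>)
    moreover have "norm (g r) \<le> c * exp (K * r)" if "r \<in> {0..t}" for r
      using le[of r] that by simp
    ultimately have "norm (integral {0..t} g) \<le> c / K * exp (K * t) - c / K * exp (K * 0)"
      using integral_norm_bound_integral[OF int[of 0 t], of "\<lambda>r. c * exp (K * r)"]
      by (auto simp: has_integral_iff)
    also have "\<dots> \<le> c / K * exp (K * \<bar>t\<bar>)" using True c K by simp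
    finally show ?thesis using True by (simp add: signed_integral_def)
  next
    case False
    then have t: "t \<le> 0" by simp
    have "((\<lambda>r. c * exp (- (K * r))) has_integral (- c / K * exp (- (K * 0)) - (- c / K * exp (- (K * t))))) {t..0}"
      by (rule fundamental_theorem_of_calculus[OF t])
        (use K in \<open>auto intro!: derivative_eq_intros simp: has_real_derivative_iff_has_vector_derivative[symmetric]\<close>)
    moreover have "norm (g r) \<le> c * exp (- (K * r))" if "r \<in> {t..0}" for r
      using le[of r] that by simp
    ultimately have "norm (integral {t..0} g) \<le> - c / K * exp (- (K * 0)) - (- c / K * exp (- (K * t)))"
      using integral_norm_bound_integral[OF int[of t 0], of "\<lambda>r. c * exp (- (K * r))"]
      by (auto simp: has_integral_iff)
    also have "\<dots> \<le> c / K * exp (K * \<bar>t\<bar>)" using t c K by simp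
    finally show ?thesis using False by (simp add: signed_integral_def)
  qed
qed

text \<open>Continuity in time is available only for each fixed vector. Splitting
  \<open>A t (z t)\<close> into \<open>A t (z t - z s)\<close>, controlled by the uniform bound, and
  \<open>A t (z s)\<close>, controlled by strong continuity, handles a moving argument.\<close>

lemma continuous_on_blinfun_strong:
  fixes A :: "'t::metric_space \<Rightarrow> 'a::real_normed_vector \<Rightarrow>\<^sub>L 'b::real_normed_vector"
  assumes bound: "\<And>t. norm (A t) \<le> C" and A: "\<And>x. continuous_on UNIV (\<lambda>t. A t x)"
    and z: "continuous_on S z"
  shows "continuous_on S (\<lambda>t. A t (z t))"
  unfolding continuous_on_def
proof
  fix s assume "s \<in> S"
  have "((\<lambda>t. A t (z t - z s)) \<longlongrightarrow> 0) (at s within S)"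
  proof (rule Lim_null_comparison)
    show "\<forall>\<^sub>F t in at s within S. norm (A t (z t - z s)) \<le> C * norm (z t - z s)"
      by (intro always_eventually allI order_trans[OF norm_blinfun] mult_right_mono bound) simp
    have "(z \<longlongrightarrow> z s) (at s within S)"
      using z \<open>s \<in> S\<close> by (auto simp: continuous_on_def)
    then show "((\<lambda>t. C * norm (z t - z s)) \<longlongrightarrow> 0) (at s within S)"
      by (intro tendsto_mult_right_zero tendsto_norm_zero) (simp add: LIM_zero)
  qed
  moreover have "((\<lambda>t. A t (z s)) \<longlongrightarrow> A s (z s)) (at s within S)"
    using A[of "z s"] by (auto simp: continuous_on_def intro: tendsto_within_subset)
  ultimately have "((\<lambda>t. A t (z t - z s) + A t (z s)) \<longlongrightarrow> 0 + A s (z s)) (at s within S)"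
    by (rule tendsto_add)
  then show "((\<lambda>t. A t (z t)) \<longlongrightarrow> A s (z s)) (at s within S)"
    by (simp add: blinfun.diff_right)
qed

text \<open>A fixed point in the weighted supremum norm \<open>sup exp (- K \<bar>t\<bar>) \<parallel>y t\<parallel>\<close>, for which the
  integral operator is a contraction on the whole line.\<close>

lemma linear_ode_exists_at_0:
  fixes A :: "real \<Rightarrow> 'a::banach \<Rightarrow>\<^sub>L 'a"
  assumes bound: "\<And>t. norm (A t) \<le> C" and A: "\<And>x. continuous_on UNIV (\<lambda>t. A t x)"
  shows "\<exists>y. y 0 = x \<and> (\<forall>t. (y has_vector_derivative A t (y t)) (at t))"
proof -
  have C: "C \<ge> 0" using bound[of 0] norm_ge_zero order_trans by blast
  \<comment> \<open>\<open>2 * C\<close> yields the contraction factor 1/2 through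
    \<open>C / K \<le> 1/2\<close>; the summand 1 keeps \<open>K\<close> positive when
    \<open>C = 0\<close>.\<close>
  define K where "K = 2 * C + 1"
  have K: "K > 0" "C / K \<le> 1/2" using C by (auto simp: K_def field_simps)
  \<comment> \<open>The unknown \<open>z\<close> is the solution damped by
    \<open>exp (- (K * \<bar>t\<bar>))\<close>, hence bounded; \<open>G\<close> undoes the damping
    before \<open>A\<close> is applied.\<close>
  define G where "G z r = A r (exp (K * \<bar>r\<bar>) *\<^sub>R z r)" for z :: "real \<Rightarrow> 'a" and r
  define T where "T z t = exp (- (K * \<bar>t\<bar>)) *\<^sub>R (x + signed_integral (G z) t)" for z t
  have G_cont: "continuous_on UNIV (G z)" if "continuous_on UNIV z" for z
    unfolding G_def by (intro continuous_on_blinfun_strong[OF bound A] continuous_intros that)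
  have G_le: "norm (G z r) \<le> C * c * exp (K * \<bar>r\<bar>)" if "norm (z r) \<le> c" for z r c
  proof -
    have "norm (G z r) \<le> C * (exp (K * \<bar>r\<bar>) * c)"
      unfolding G_def using that C
      by (intro order_trans[OF norm_blinfun] mult_mono bound) auto
    then show ?thesis by (simp add: algebra_simps)
  qed
  have SI_cont: "continuous_on UNIV (signed_integral (G z))" if "continuous_on UNIV z" for z
    using signed_integral_has_vector_derivative[OF G_cont[OF that]]
    by (auto simp: continuous_on_eq_continuous_at intro: has_vector_derivative_continuous)
  have SI_le: "exp (- (K * \<bar>t\<bar>)) * norm (signed_integral (G z) t) \<le> c / 2"
    if z: "continuous_on UNIV z" "\<And>r. norm (z r) \<le> c" for z t c
  proof -
    have c: "c \<ge> 0" using z(2)[of 0] norm_ge_zero order_trans by blast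
    have "norm (signed_integral (G z) t) \<le> C * c / K * exp (K * \<bar>t\<bar>)"
      by (rule norm_signed_integral_le[OF G_cont[OF z(1)] K(1) G_le]) (rule z(2))
    then have "exp (- (K * \<bar>t\<bar>)) * norm (signed_integral (G z) t) \<le> exp (- (K * \<bar>t\<bar>)) * (C * c / K * exp (K * \<bar>t\<bar>))"
      by (intro mult_left_mono) auto
    also have "\<dots> = C / K * c" by (simp add: exp_minus field_simps)
    also have "\<dots> \<le> 1/2 * c" using c K by (intro mult_right_mono) auto
    finally show ?thesis by simp
  qed
  have T_b: "T (apply_bcontfun z) \<in> bcontfun" for z
  proof (rule bcontfun_normI)
    show "continuous_on UNIV (T (apply_bcontfun z))"
      unfolding T_def by (intro continuous_intros SI_cont) auto
    show "norm (T (apply_bcontfun z) t) \<le> norm x + norm z / 2" for t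
    proof -
      have "norm (T (apply_bcontfun z) t) \<le> exp (- (K * \<bar>t\<bar>)) * norm x + exp (- (K * \<bar>t\<bar>)) * norm (signed_integral (G z) t)"
        unfolding T_def norm_scaleR by (simp flip: distrib_left add: norm_triangle_ineq)
      also have "exp (- (K * \<bar>t\<bar>)) * norm x \<le> 1 * norm x"
        using K by (intro mult_right_mono) auto
      also have "exp (- (K * \<bar>t\<bar>)) * norm (signed_integral (G z) t) \<le> norm z / 2"
        by (rule SI_le) (auto intro: norm_bounded)
      finally show ?thesis by simp
    qed
  qed
  define TT where "TT z = Bcontfun (T (apply_bcontfun z))" for z
  have TT: "apply_bcontfun (TT z) = T (apply_bcontfun z)" for z
    unfolding TT_def using T_b by (simp add: Bcontfun_inverse)
  have "dist (TT z) (TT z') \<le> 1/2 * dist z z'" for z z'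
  proof (rule dist_bound)
    fix t
    have int: "G v integrable_on {a..b}" if "continuous_on UNIV v" for v a b
      using G_cont[OF that] continuous_on_subset by (intro integrable_continuous_real) blast
    have "signed_integral (G z) t - signed_integral (G z') t = signed_integral (G (\<lambda>r. z r - z' r)) t"
    proof -
      have "G (\<lambda>r. z r - z' r) = (\<lambda>r. G z r - G z' r)"
        by (auto simp: G_def blinfun.diff_right scaleR_diff_right)
      then show ?thesis
        by (simp add: signed_integral_def integral_diff int)
    qed
    then have "T z t - T z' t = exp (- (K * \<bar>t\<bar>)) *\<^sub>R signed_integral (G (\<lambda>r. z r - z' r)) t"
      by (simp add: T_def algebra_simps flip: scaleR_diff_right)
    moreover have "exp (- (K * \<bar>t\<bar>)) * norm (signed_integral (G (\<lambda>r. z r - z' r)) t) \<le> dist z z' / 2"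
      by (rule SI_le) (auto intro!: continuous_intros simp flip: dist_norm intro: dist_bounded)
    ultimately show "dist (apply_bcontfun (TT z) t) (apply_bcontfun (TT z') t) \<le> 1/2 * dist z z'"
      by (simp add: TT dist_norm)
  qed
  then obtain z where z: "TT z = z"
    using banach_fix_type[of "1/2" TT] by (auto simp: Ex1_def)
  define y where "y t = exp (K * \<bar>t\<bar>) *\<^sub>R apply_bcontfun z t" for t
  have "G z = (\<lambda>r. A r (y r))" by (auto simp: G_def y_def)
  moreover have "y t = x + signed_integral (G z) t" for t
  proof -
    have "apply_bcontfun z t = T z t" using TT[of z] z by simp
    then show ?thesis by (simp add: y_def T_def exp_minus)
  qed
  ultimately have y: "y = (\<lambda>t. x + signed_integral (\<lambda>r. A r (y r)) t)" by auto
  have "continuous_on UNIV (\<lambda>r. A r (y r))"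
    using G_cont[of z] \<open>G z = _\<close> by simp
  from signed_integral_has_vector_derivative[OF this]
  have "((\<lambda>t. x + signed_integral (\<lambda>r. A r (y r)) t) has_vector_derivative 0 + A t (y t)) (at t)" for t
    by (intro has_vector_derivative_add has_vector_derivative_const)
  then have "(y has_vector_derivative A t (y t)) (at t)" for t
    using y by simp
  moreover have "y 0 = x" by (subst y) (simp add: signed_integral_def)
  ultimately show ?thesis by blast
qed

lemma linear_ode_exists:
  fixes A :: "real \<Rightarrow> 'a::banach \<Rightarrow>\<^sub>L 'a"
  assumes bound: "\<And>t. norm (A t) \<le> C" and A: "\<And>x. continuous_on UNIV (\<lambda>t. A t x)"
  shows "\<exists>y. y s = x \<and> (\<forall>t. (y has_vector_derivative A t (y t)) (at t))"
proof -
  have "continuous_on UNIV (\<lambda>t. A (t + s) x)" for x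
    by (rule continuous_on_compose2[OF A]) (auto intro!: continuous_intros)
  from linear_ode_exists_at_0[of "\<lambda>t. A (t + s)", OF bound this]
  obtain z where z: "z 0 = x" "\<And>t. (z has_vector_derivative A (t + s) (z t)) (at t)" by blast
  have "((\<lambda>t. z (t - s)) has_vector_derivative A t (z (t - s))) (at t)" for t
  proof -
    have "((\<lambda>t. t - s) has_vector_derivative 1) (at t)"
      by (auto intro!: derivative_eq_intros)
    from vector_diff_chain_at[OF this, of z "A t (z (t - s))"]
    show ?thesis using z(2)[of "t - s"] by (simp add: o_def)
  qed
  then show ?thesis using z(1) by (intro exI[of _ "\<lambda>t. z (t - s)"]) simp
qed

section \<open>The interaction picture\<close>

lemma diag_op_symmetric:
  fixes e :: "nat \<Rightarrow> 'a::{real_inner, banach}"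
  assumes e: "orthonormal_basis e" and m: "\<And>n. \<bar>m n\<bar> \<le> C"
  shows "blinfun_apply (diag_op e m) x \<bullet> y = x \<bullet> blinfun_apply (diag_op e m) y"
proof -
  have "(\<lambda>n. m n * (x \<bullet> e n) * (y \<bullet> e n)) sums (blinfun_apply (diag_op e m) x \<bullet> y)"
    using parseval_sums[OF e, of "blinfun_apply (diag_op e m) x" y] by (simp add: diag_op_inner[OF e m])
  moreover have "(\<lambda>n. m n * (x \<bullet> e n) * (y \<bullet> e n)) sums (x \<bullet> blinfun_apply (diag_op e m) y)"
    using parseval_sums[OF e, of x "blinfun_apply (diag_op e m) y"]
    by (simp add: diag_op_inner[OF e m] mult.left_commute mult.assoc)
  ultimately show ?thesis by (rule sums_unique2)
qed

lemma diag_op_norm_le: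
  fixes e :: "nat \<Rightarrow> 'a::{real_inner, banach}"
  assumes e: "orthonormal_basis e" and m: "\<And>n. \<bar>m n\<bar> \<le> C"
  shows "norm (blinfun_apply (diag_op e m) x) \<le> C * norm x"
proof (rule power2_le_imp_le)
  have C: "C \<ge> 0" using m[of 0] by simp
  have "(norm (blinfun_apply (diag_op e m) x))\<^sup>2 \<le> C\<^sup>2 * (norm x)\<^sup>2"
  proof (rule sums_le[OF _ parseval_norm[OF e] sums_mult[OF parseval_norm[OF e]]])
    show "(blinfun_apply (diag_op e m) x \<bullet> e n)\<^sup>2 \<le> C\<^sup>2 * (x \<bullet> e n)\<^sup>2" for n
      using power_mono[OF m[of n], of 2]
      by (auto simp: diag_op_inner[OF e m] power_mult_distrib intro!: mult_right_mono)
  qed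
  then show "(norm (blinfun_apply (diag_op e m) x))\<^sup>2 \<le> (C * norm x)\<^sup>2" by (simp add: power_mult_distrib)
  show "0 \<le> C * norm x" using C by simp
qed

text \<open>Gronwall's inequality for the squared norm, whose derivative is at most
  \<open>2 * C\<close> times itself in modulus: the factors \<open>exp (- (2 * C * t))\<close> and
  \<open>exp (2 * C * t)\<close> make it monotone in one direction of time each. It serves the
  generator in the H1 coordinate, which is bounded but not known to be skew.\<close>

lemma linear_ode_growth:
  fixes A :: "real \<Rightarrow> 'a::real_inner \<Rightarrow>\<^sub>L 'a"
  assumes bound: "\<And>t. norm (A t) \<le> C"
    and y: "\<And>t. (y has_vector_derivative A t (y t)) (at t)"
  shows "(norm (y t))\<^sup>2 \<le> exp (2 * C * \<bar>t - s\<bar>) * (norm (y s))\<^sup>2"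
proof -
  have le: "\<bar>A r (y r) \<bullet> y r\<bar> \<le> C * (y r \<bullet> y r)" for r
  proof -
    have "\<bar>A r (y r) \<bullet> y r\<bar> \<le> norm (A r (y r)) * norm (y r)"
      by (rule Cauchy_Schwarz_ineq2)
    also have "\<dots> \<le> C * norm (y r) * norm (y r)"
      by (intro mult_right_mono order_trans[OF norm_blinfun] mult_right_mono bound) auto
    finally show ?thesis by (simp add: dot_square_norm power2_eq_square)
  qed
  have d: "((\<lambda>r. y r \<bullet> y r) has_real_derivative 2 * (A r (y r) \<bullet> y r)) (at r)" for r
    using bounded_bilinear.has_vector_derivative[OF bounded_bilinear_inner y y, of r]
    by (simp add: has_real_derivative_iff_has_vector_derivative inner_commute)
  show ?thesis
  proof (cases "s \<le> t")
    case True
    have "exp (- (2 * C * t)) * (y t \<bullet> y t) \<le> exp (- (2 * C * s)) * (y s \<bullet> y s)"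
    proof (rule DERIV_nonpos_imp_nonincreasing[OF True])
      fix r
      have D: "((\<lambda>r. exp (- (2 * C * r)) * (y r \<bullet> y r)) has_real_derivative
          exp (- (2 * C * r)) * (- (2 * C)) * (y r \<bullet> y r) + 2 * (A r (y r) \<bullet> y r) * exp (- (2 * C * r))) (at r)"
        by (rule DERIV_mult[OF _ d]) (auto intro!: derivative_eq_intros)
      have "exp (- (2 * C * r)) * (- (2 * C)) * (y r \<bullet> y r) + 2 * (A r (y r) \<bullet> y r) * exp (- (2 * C * r))
          = 2 * exp (- (2 * C * r)) * (A r (y r) \<bullet> y r - C * (y r \<bullet> y r))"
        by (simp add: algebra_simps)
      also have "\<dots> \<le> 0" using le[of r] by (intro mult_nonneg_nonpos) auto
      finally show "\<exists>z. ((\<lambda>r. exp (- (2 * C * r)) * (y r \<bullet> y r)) has_real_derivative z) (at r) \<and> z \<le> 0"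
        using D by blast
    qed
    then have "exp (2 * C * t) * (exp (- (2 * C * t)) * (y t \<bullet> y t)) \<le> exp (2 * C * t) * (exp (- (2 * C * s)) * (y s \<bullet> y s))"
      by (intro mult_left_mono) auto
    then have "y t \<bullet> y t \<le> exp (2 * C * (t - s)) * (y s \<bullet> y s)"
      by (simp add: right_diff_distrib exp_diff exp_minus field_simps)
    then show ?thesis using True by (simp add: power2_norm_eq_inner)
  next
    case False
    then have "t \<le> s" by simp
    then have "exp (2 * C * t) * (y t \<bullet> y t) \<le> exp (2 * C * s) * (y s \<bullet> y s)"
    proof (rule DERIV_nonneg_imp_nondecreasing)
      fix r
      have D: "((\<lambda>r. exp (2 * C * r) * (y r \<bullet> y r)) has_real_derivative
          exp (2 * C * r) * (2 * C) * (y r \<bullet> y r) + 2 * (A r (y r) \<bullet> y r) * exp (2 * C * r)) (at r)"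
        by (rule DERIV_mult[OF _ d]) (auto intro!: derivative_eq_intros)
      have "exp (2 * C * r) * (2 * C) * (y r \<bullet> y r) + 2 * (A r (y r) \<bullet> y r) * exp (2 * C * r)
          = 2 * exp (2 * C * r) * (A r (y r) \<bullet> y r + C * (y r \<bullet> y r))"
        by (simp add: algebra_simps)
      also have "\<dots> \<ge> 0" using le[of r] by (intro mult_nonneg_nonneg) auto
      finally show "\<exists>z. ((\<lambda>r. exp (2 * C * r) * (y r \<bullet> y r)) has_real_derivative z) (at r) \<and> z \<ge> 0"
        using D by blast
    qed
    then have "exp (- (2 * C * t)) * (exp (2 * C * t) * (y t \<bullet> y t)) \<le> exp (- (2 * C * t)) * (exp (2 * C * s) * (y s \<bullet> y s))"
      by (intro mult_left_mono) auto
    then have "y t \<bullet> y t \<le> exp (2 * C * (s - t)) * (y s \<bullet> y s)"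
      by (simp add: right_diff_distrib exp_diff exp_minus field_simps)
    then show ?thesis using False by (simp add: power2_norm_eq_inner)
  qed
qed

text \<open>The basis diagonalises \<open>- \<Delta>\<close> with eigenvalues \<open>w\<close>, and \<open>J\<close> is multiplication by \<open>\<i>\<close>.\<close>

locale free_schroedinger =
  fixes b :: "nat \<Rightarrow> 'a::{real_inner, banach, second_countable_topology}"
    and w :: "nat \<Rightarrow> real"
    and J :: "'a \<Rightarrow>\<^sub>L 'a"
  assumes onb: "orthonormal_basis b"
    and w_nonneg: "0 \<le> w n"
    and w_finite: "finite {n. w n \<le> R}"
    and J_J: "J (J x) = - x"
    and J_skew: "J x \<bullet> y = - (x \<bullet> J y)"
    and J_w: "w m \<noteq> w n \<Longrightarrow> J (b m) \<bullet> b n = 0"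
begin

definition Lam :: "'a \<Rightarrow>\<^sub>L 'a"
  where "Lam = diag_op b (\<lambda>n. 1 / sqrt (1 + w n))"

text \<open>The symbol of the group exp(- i t Laplacian) on the eigenvalue \<open>w n\<close> of
  minus the Laplacian is exp(i t w). On a real Hilbert space it becomes cosine plus \<open>J\<close>
  times sine.\<close>

definition S :: "real \<Rightarrow> 'a \<Rightarrow>\<^sub>L 'a"
  where "S t = diag_op b (\<lambda>n. cos (t * w n)) + (J o\<^sub>L diag_op b (\<lambda>n. sin (t * w n)))"

definition H1 :: "'a set"
  where "H1 = {x. summable (\<lambda>n. (1 + w n) * (x \<bullet> b n)\<^sup>2)}"

definition N1 :: "'a \<Rightarrow> real"
  where "N1 x = (\<Sum>n. (1 + w n) * (x \<bullet> b n)\<^sup>2)"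

lemma w1_pos: "0 < 1 + w n" "1 + w n \<noteq> 0"
  using w_nonneg[of n] by auto

lemma Lam_le: "\<bar>1 / sqrt (1 + w n)\<bar> \<le> 1"
  using w_nonneg[of n] by simp

lemma Lam_inner: "Lam x \<bullet> b n = (x \<bullet> b n) / sqrt (1 + w n)"
  unfolding Lam_def by (subst diag_op_inner[OF onb Lam_le]) simp

lemma norm_Lam_le: "norm (Lam x) \<le> norm x"
  using diag_op_norm_le[OF onb Lam_le, where x = x] by (simp add: Lam_def)

lemma Lam_sym: "Lam x \<bullet> y = x \<bullet> Lam y"
  unfolding Lam_def by (rule diag_op_symmetric[OF onb Lam_le])

text \<open>By \<open>J_w\<close>, \<open>J\<close> connects only basis vectors of equal weight, and
  on each such eigenspace the multiplier is constant. Thus \<open>J\<close> commutes with every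
  bounded function of the Laplacian.\<close>

lemma J_diag:
  assumes m: "\<And>n. \<bar>m n\<bar> \<le> C" and mw: "\<And>i j. w i = w j \<Longrightarrow> m i = m j"
  shows "J (blinfun_apply (diag_op b m) x) = blinfun_apply (diag_op b m) (J x)"
proof (rule orthonormal_basis_eqI[OF onb])
  fix n
  let ?D = "blinfun_apply (diag_op b m)"
  have "(\<lambda>k. (?D x \<bullet> b k) * (J (b n) \<bullet> b k)) sums (?D x \<bullet> J (b n))"
    by (rule parseval_sums[OF onb])
  moreover have "(?D x \<bullet> b k) * (J (b n) \<bullet> b k) = m n * ((x \<bullet> b k) * (J (b n) \<bullet> b k))" for k
    using mw[of k n] J_w[of n k] by (cases "w k = w n") (auto simp: diag_op_inner[OF onb m])
  ultimately have "(\<lambda>k. m n * ((x \<bullet> b k) * (J (b n) \<bullet> b k))) sums (?D x \<bullet> J (b n))"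
    by simp
  moreover have "(\<lambda>k. m n * ((x \<bullet> b k) * (J (b n) \<bullet> b k))) sums (m n * (x \<bullet> J (b n)))"
    by (rule sums_mult[OF parseval_sums[OF onb]])
  ultimately have "?D x \<bullet> J (b n) = m n * (x \<bullet> J (b n))" by (rule sums_unique2)
  then show "J (?D x) \<bullet> b n = ?D (J x) \<bullet> b n"
    by (simp add: J_skew diag_op_inner[OF onb m])
qed

lemma J_Lam: "J (Lam x) = Lam (J x)"
  unfolding Lam_def by (rule J_diag[OF Lam_le]) simp

lemma norm_J: "norm (J x) = norm x"
proof -
  have "J x \<bullet> J x = x \<bullet> x" by (simp add: J_skew J_J)
  then show ?thesis by (simp add: norm_eq_sqrt_inner)
qed

lemma J_self: "x \<bullet> J x = 0"
  using J_skew[of x x] by (simp add: inner_commute)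

lemma S_apply:
  "S t x = blinfun_apply (diag_op b (\<lambda>n. cos (t * w n))) x
    + J (blinfun_apply (diag_op b (\<lambda>n. sin (t * w n))) x)"
  by (simp add: S_def plus_blinfun.rep_eq)

lemma S_inner: "S t x \<bullet> b n = cos (t * w n) * (x \<bullet> b n) + sin (t * w n) * (J x \<bullet> b n)"
proof -
  have "J (blinfun_apply (diag_op b (\<lambda>n. sin (t * w n))) x)
      = blinfun_apply (diag_op b (\<lambda>n. sin (t * w n))) (J x)"
    by (rule J_diag[where C = 1]; simp)
  then show ?thesis
    by (simp add: S_apply inner_add_left diag_op_inner[OF onb, where C = 1])
qed

lemma S_J: "S t (J x) = J (S t x)"
proof -
  have "blinfun_apply (diag_op b (\<lambda>n. cos (t * w n))) (J x)
      = J (blinfun_apply (diag_op b (\<lambda>n. cos (t * w n))) x)"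
    "blinfun_apply (diag_op b (\<lambda>n. sin (t * w n))) (J x)
      = J (blinfun_apply (diag_op b (\<lambda>n. sin (t * w n))) x)"
    by (rule J_diag[where C = 1, symmetric]; simp)+
  then show ?thesis by (simp add: S_apply blinfun.add_right)
qed

lemma S_add: "S s (S t x) = S (s + t) x"
  by (rule orthonormal_basis_eqI[OF onb])
    (simp add: S_inner S_J[symmetric] J_J cos_add sin_add distrib_right algebra_simps)

lemma S_0: "S 0 x = x"
  by (rule orthonormal_basis_eqI[OF onb]) (simp add: S_inner)

lemma S_adj: "S t x \<bullet> y = x \<bullet> S (- t) y"
proof -
  have 1: "blinfun_apply (diag_op b (\<lambda>n. cos (t * w n))) x \<bullet> y = x \<bullet> blinfun_apply (diag_op b (\<lambda>n. cos (t * w n))) y"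
    by (rule diag_op_symmetric[OF onb, where C = 1]) simp
  have "blinfun_apply (diag_op b (\<lambda>n. sin (t * w n))) x \<bullet> J y
      = x \<bullet> blinfun_apply (diag_op b (\<lambda>n. sin (t * w n))) (J y)"
    by (rule diag_op_symmetric[OF onb, where C = 1]) simp
  also have "blinfun_apply (diag_op b (\<lambda>n. sin (t * w n))) (J y)
      = J (blinfun_apply (diag_op b (\<lambda>n. sin (t * w n))) y)"
    by (rule J_diag[where C = 1, symmetric]; simp)
  also have "blinfun_apply (diag_op b (\<lambda>n. sin (t * w n))) y = - blinfun_apply (diag_op b (\<lambda>n. sin (- t * w n))) y"
    by (rule orthonormal_basis_eqI[OF onb])
      (simp add: diag_op_inner[OF onb, where C = 1])
  finally show ?thesis
    by (simp add: S_apply 1 inner_add_left inner_add_right J_skew blinfun.minus_right)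
qed

lemma S_minus: "S (- t) (S t x) = x"
  "S t (S (- t) x) = x"
  by (simp_all add: S_add S_0)

lemma norm_S: "norm (S t x) = norm x"
  by (simp add: norm_eq_sqrt_inner S_adj S_minus)

lemma norm_S_le: "norm (S t) \<le> 1"
  by (rule norm_blinfun_bound) (simp_all add: norm_S)

lemma diag_basis:
  assumes "\<And>n. \<bar>m n\<bar> \<le> C"
  shows "blinfun_apply (diag_op b m) (b n) = m n *\<^sub>R b n"
  by (rule orthonormal_basis_eqI[OF onb])
    (simp add: diag_op_inner[OF onb assms] orthonormal_basis_inner[OF onb])

text \<open>\<open>S t\<close> is an isometry, so the basis expansion converges uniformly in
  \<open>t\<close>, and every finite sum is a combination of sines and cosines.\<close>

lemma S_cont: "continuous_on UNIV (\<lambda>t. S t x)"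
proof (rule uniform_limit_theorem)
  define p where "p n = (\<Sum>i<n. (x \<bullet> b i) *\<^sub>R b i)" for n
  have p: "p \<longlonglongrightarrow> x"
    using orthonormal_basis_sums[OF onb, of x] by (simp add: sums_def p_def[abs_def])
  have "continuous_on UNIV (\<lambda>t. S t (b i))" for i
    by (simp add: S_apply diag_basis[where C = 1] blinfun.scaleR_right) (intro continuous_intros)
  then show "\<forall>\<^sub>F n in sequentially. continuous_on UNIV (\<lambda>t. S t (p n))"
    unfolding p_def blinfun.sum_right blinfun.scaleR_right
    by (intro always_eventually allI continuous_on_sum continuous_on_scaleR continuous_on_const)
  show "uniform_limit UNIV (\<lambda>n t. S t (p n)) (\<lambda>t. S t x) sequentially"
  proof (rule uniform_limitI)
    fix r :: real assume "r > 0"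
    then have "\<forall>\<^sub>F n in sequentially. dist (p n) x < r" by (rule tendstoD[OF p])
    then show "\<forall>\<^sub>F n in sequentially. \<forall>t\<in>UNIV. dist (S t (p n)) (S t x) < r"
      by eventually_elim (simp add: dist_norm norm_S flip: blinfun.diff_right)
  qed
qed simp

lemma S_cont': "continuous_on X z \<Longrightarrow> continuous_on X f \<Longrightarrow> continuous_on X (\<lambda>t. S (f t) (z t))"
  for z :: "'t::metric_space \<Rightarrow> 'a" and f :: "'t \<Rightarrow> real"
proof -
  assume z: "continuous_on X z" and f: "continuous_on X f"
  have "continuous_on UNIV (\<lambda>p :: real \<times> 'a. S (fst p) x)" for x
    by (rule continuous_on_compose2[OF S_cont continuous_on_fst[OF continuous_on_id]]) auto
  then have "continuous_on UNIV (\<lambda>p :: real \<times> 'a. S (fst p) (snd p))"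
    by (rule continuous_on_blinfun_strong[where A = "\<lambda>p. S (fst p)" and C = 1, OF norm_S_le])
      (intro continuous_intros)
  from continuous_on_compose2[OF this continuous_on_Pair[OF f z]] show ?thesis by simp
qed

lemma S_Lam: "S t (Lam x) = Lam (S t x)"
  by (rule orthonormal_basis_eqI[OF onb]) (simp add: S_inner Lam_inner J_Lam add_divide_distrib)

text \<open>Together with \<open>H1_Lam\<close> this makes \<open>Lam\<close> an isometry from L2
  onto \<open>H1\<close> normed by \<open>N1\<close>. Facts about \<open>H1\<close> are proved by
  writing \<open>x = Lam z\<close> and commuting operators with \<open>Lam\<close>.\<close>

lemma Lam_H1: "Lam x \<in> H1" and N1_Lam: "N1 (Lam x) = (norm x)\<^sup>2"
proof -
  have "(1 + w n) * (Lam x \<bullet> b n)\<^sup>2 = (x \<bullet> b n)\<^sup>2" for n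
    using w1_pos[of n] by (simp add: Lam_inner power_divide)
  then have "(\<lambda>n. (1 + w n) * (Lam x \<bullet> b n)\<^sup>2) sums ((norm x)\<^sup>2)"
    using parseval_norm[OF onb, of x] by simp
  then show "Lam x \<in> H1" "N1 (Lam x) = (norm x)\<^sup>2"
    by (auto simp: H1_def N1_def sums_iff)
qed

lemma H1_Lam: "x \<in> H1 \<Longrightarrow> \<exists>z. x = Lam z"
proof -
  assume "x \<in> H1"
  then have "summable (\<lambda>n. (sqrt (1 + w n) * (x \<bullet> b n))\<^sup>2)"
    using w1_pos by (simp add: H1_def power_mult_distrib less_imp_le)
  from riesz_fischer[OF onb this] obtain z where z: "\<And>n. z \<bullet> b n = sqrt (1 + w n) * (x \<bullet> b n)" by blast
  have "x = Lam z"
    by (rule orthonormal_basis_eqI[OF onb]) (use w1_pos in \<open>simp add: Lam_inner z\<close>)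
  then show ?thesis by blast
qed

lemma norm_le_N1: "x \<in> H1 \<Longrightarrow> (norm x)\<^sup>2 \<le> N1 x"
  using H1_Lam[of x] by (auto simp: N1_Lam norm_Lam_le)

lemma N1_nonneg: "x \<in> H1 \<Longrightarrow> 0 \<le> N1 x"
  using H1_Lam[of x] by (auto simp: N1_Lam)

lemma H1_add: "x \<in> H1 \<Longrightarrow> y \<in> H1 \<Longrightarrow> x + y \<in> H1"
  using H1_Lam[of x] H1_Lam[of y] Lam_H1 by (auto simp flip: blinfun.add_right)

lemma S_H1: "x \<in> H1 \<Longrightarrow> S t x \<in> H1"
  using H1_Lam[of x] Lam_H1 by (auto simp: S_Lam)

lemma J_H1: "x \<in> H1 \<Longrightarrow> J x \<in> H1"
  using H1_Lam[of x] Lam_H1 by (auto simp: J_Lam)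

lemma N1_S: "x \<in> H1 \<Longrightarrow> N1 (S t x) = N1 x"
  using H1_Lam[of x] by (auto simp: S_Lam N1_Lam norm_S)

lemma N1_J: "x \<in> H1 \<Longrightarrow> N1 (J x) = N1 x"
  using H1_Lam[of x] by (auto simp: J_Lam N1_Lam norm_J)

end

text \<open>\<open>Lam\<close> is \<open>(1 - \<Delta>)\<^sup>-\<^sup>1\<^sup>/\<^sup>2\<close>, so the existence of \<open>V1\<close> says that \<open>V\<close> is bounded on \<open>H\<^sup>1\<close>.\<close>

locale schroedinger = free_schroedinger b w J
  for b :: "nat \<Rightarrow> 'a::{real_inner, banach, second_countable_topology}" and w J +
  fixes V V1 :: "'a \<Rightarrow>\<^sub>L 'a"
  assumes V_sym: "V x \<bullet> y = x \<bullet> V y"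
    and V_J: "V (J x) = J (V x)"
    and V_Lam: "V (Lam x) = Lam (V1 x)"
begin

definition A :: "real \<Rightarrow> 'a \<Rightarrow>\<^sub>L 'a"
  where "A t = - (S (- t) o\<^sub>L J o\<^sub>L V o\<^sub>L S t)"

text \<open>The operator \<open>A\<close> in the coordinate \<open>z\<close> of
  \<open>y = Lam z\<close>, see \<open>Lam_A1\<close>. Its boundedness makes the equation solvable
  inside \<open>H1\<close>.\<close>

definition A1 :: "real \<Rightarrow> 'a \<Rightarrow>\<^sub>L 'a"
  where "A1 t = - (S (- t) o\<^sub>L J o\<^sub>L V1 o\<^sub>L S t)"

text \<open>Twice the energy, polarised. The series is meaningful for arguments in
  \<open>H1\<close>, see \<open>form_sums\<close>.\<close>

definition form :: "'a \<Rightarrow> 'a \<Rightarrow> real"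
  where "form x y = (\<Sum>n. w n * (x \<bullet> b n) * (y \<bullet> b n)) - V x \<bullet> y"

lemma A_apply: "A t x = - S (- t) (J (V (S t x)))"
  by (simp add: A_def uminus_blinfun.rep_eq)

lemma A1_apply: "A1 t x = - S (- t) (J (V1 (S t x)))"
  by (simp add: A1_def uminus_blinfun.rep_eq)

lemma norm_A: "norm (A t) \<le> norm V"
proof (rule norm_blinfun_bound)
  show "norm (A t x) \<le> norm V * norm x" for x
    using norm_blinfun[of V "S t x"] by (simp add: A_apply norm_S norm_J)
qed simp

lemma norm_A1: "norm (A1 t) \<le> norm V1"
proof (rule norm_blinfun_bound)
  show "norm (A1 t x) \<le> norm V1 * norm x" for x
    using norm_blinfun[of V1 "S t x"] by (simp add: A1_apply norm_S norm_J)
qed simp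

lemma A_cont: "continuous_on UNIV (\<lambda>t. A t x)"
  unfolding A_apply by (intro S_cont' S_cont continuous_intros)

lemma A1_cont: "continuous_on UNIV (\<lambda>t. A1 t x)"
  unfolding A1_apply by (intro S_cont' S_cont continuous_intros)

lemma A_cont': "continuous_on X z \<Longrightarrow> continuous_on X (\<lambda>t. A t (z t))"
  by (rule continuous_on_blinfun_strong[OF norm_A A_cont])

text \<open>For a real potential \<open>V\<close> is symmetric and commutes with \<open>J\<close>,
  so \<open>J V\<close> is skew, and conjugation by the isometries \<open>S t\<close> preserves
  this.\<close>

lemma A_skew: "A t x \<bullet> y = - (x \<bullet> A t y)"
  by (simp add: A_apply S_adj J_skew V_sym V_J)

lemma Lam_A1: "Lam (A1 t x) = A t (Lam x)"
  by (simp add: A_apply A1_apply blinfun.minus_right S_Lam J_Lam V_Lam)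

section \<open>Solutions and propagator of the noiseless equation\<close>

definition solution :: "(real \<Rightarrow> 'a) \<Rightarrow> bool"
  where "solution y \<longleftrightarrow> (\<forall>t. (y has_vector_derivative A t (y t)) (at t))"

lemma solution_continuous: "solution y \<Longrightarrow> continuous_on X y"
  by (metis continuous_at_imp_continuous_on has_vector_derivative_continuous solution_def)

text \<open>Skewness cancels the two terms of the product rule. This identity yields uniqueness, the
  isometry of the flow, and the fact that the adjoint of the flow is its inverse.\<close>

lemma solution_inner:
  assumes "solution y" "solution z"
  shows "y t \<bullet> z t = y s \<bullet> z s"
proof -
  have "((\<lambda>r. y r \<bullet> z r) has_real_derivative 0) (at r)" for r
    using bounded_bilinear.has_vector_derivative[OF bounded_bilinear_inner
        assms(1)[unfolded solution_def, rule_format, of r] assms(2)[unfolded solution_def, rule_format, of r]]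
    by (simp add: has_real_derivative_iff_has_vector_derivative A_skew)
  then show ?thesis using DERIV_isconst_all by blast
qed

lemma solution_unique:
  assumes "solution y" "solution z" "y s = z s"
  shows "y t = z t"
proof -
  have "solution (\<lambda>r. y r - z r)"
    using assms(1,2) by (auto simp: solution_def blinfun.diff_right intro: has_vector_derivative_diff)
  from solution_inner[OF this this, of t s] assms(3) show ?thesis by simp
qed

text \<open>The propagator from time \<open>s\<close> to time \<open>t\<close>, in either order of
  the two times. By uniqueness its value does not depend on the choice, see
  \<open>ev_eqI\<close>.\<close>

definition ev :: "real \<Rightarrow> real \<Rightarrow> 'a \<Rightarrow> 'a"
  where "ev t s x = (SOME y. y s = x \<and> solution y) t"

lemma ev_solution: "solution (\<lambda>t. ev t s x)" and ev_same [simp]: "ev s s x = x"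
proof -
  have "\<exists>y. y s = x \<and> solution y"
    unfolding solution_def by (rule linear_ode_exists[OF norm_A A_cont])
  from someI_ex[OF this] show "solution (\<lambda>t. ev t s x)" "ev s s x = x"
    unfolding ev_def by auto
qed

lemma ev_eqI: "solution y \<Longrightarrow> ev t s (y s) = y t"
  by (rule solution_unique[OF ev_solution, where s = s]) auto

lemma ev_ev: "ev t s (ev s r x) = ev t r x"
  by (rule ev_eqI[OF ev_solution])

lemma ev_add: "ev t s (x + y) = ev t s x + ev t s y"
proof -
  have "solution (\<lambda>t. ev t s x + ev t s y)"
    using ev_solution by (auto simp: solution_def blinfun.add_right intro: has_vector_derivative_add)
  from ev_eqI[OF this, of t s] show ?thesis by simp
qed

lemma ev_scaleR: "ev t s (r *\<^sub>R x) = r *\<^sub>R ev t s x"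
proof -
  have "solution (\<lambda>t. r *\<^sub>R ev t s x)"
    using ev_solution[of s x] unfolding solution_def blinfun.scaleR_right
    by (auto intro!: bounded_linear.has_vector_derivative[OF bounded_linear_scaleR_right])
  from ev_eqI[OF this, of t s] show ?thesis by simp
qed

lemma ev_inner: "ev t s x \<bullet> ev t s y = x \<bullet> y"
  using solution_inner[OF ev_solution ev_solution, of t s x s y s] by simp

lemma ev_adj: "ev t s x \<bullet> y = x \<bullet> ev s t y"
  using ev_inner[of t s x "ev s t y"] by (simp add: ev_ev)

lemma norm_ev: "norm (ev t s x) = norm x"
  by (simp add: norm_eq_sqrt_inner ev_inner)

lemma bounded_linear_ev: "bounded_linear (ev t s)"
  by (rule bounded_linear_intro[where K = 1]) (simp_all add: ev_add ev_scaleR norm_ev)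

text \<open>H1 regularity propagates: the equation for the coordinate, with generator
  \<open>A1\<close>, is solved in L2, \<open>Lam\<close> carries its solution to a solution of the
  original equation, and uniqueness identifies the two.\<close>

lemma solution_Lam:
  assumes "solution y" "y s \<in> H1"
  shows "\<exists>z. (\<forall>t. y t = Lam (z t)) \<and> continuous_on UNIV z \<and>
    (\<forall>t. (norm (z t))\<^sup>2 \<le> exp (2 * norm V1 * \<bar>t - s\<bar>) * (norm (z s))\<^sup>2)"
proof -
  obtain x where x: "y s = Lam x" using H1_Lam[OF assms(2)] by blast
  obtain z where z: "z s = x" "\<And>t. (z has_vector_derivative A1 t (z t)) (at t)"
    using linear_ode_exists[OF norm_A1 A1_cont] by blast
  have "((\<lambda>t. Lam (z t)) has_vector_derivative Lam (A1 t (z t))) (at t)" for t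
    by (rule bounded_linear.has_vector_derivative[OF blinfun.bounded_linear_right z(2)])
  then have "solution (\<lambda>t. Lam (z t))"
    by (simp add: solution_def Lam_A1)
  then have "y t = Lam (z t)" for t
    by (rule solution_unique[OF assms(1), where s = s]) (simp add: x z)
  moreover have "continuous_on UNIV z"
    using z(2) by (metis continuous_at_imp_continuous_on has_vector_derivative_continuous)
  ultimately show ?thesis
    using linear_ode_growth[OF norm_A1 z(2)] by blast
qed

lemma ev_H1: "x \<in> H1 \<Longrightarrow> ev t s x \<in> H1"
  using solution_Lam[of "\<lambda>t. ev t s x" s, OF ev_solution] Lam_H1 by (metis ev_same)

lemma N1_ev:
  assumes "x \<in> H1"
  shows "N1 (ev t s x) \<le> exp (2 * norm V1 * \<bar>t - s\<bar>) * N1 x"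
proof -
  obtain z where z: "\<And>t. ev t s x = Lam (z t)"
    "\<And>t. (norm (z t))\<^sup>2 \<le> exp (2 * norm V1 * \<bar>t - s\<bar>) * (norm (z s))\<^sup>2"
    using solution_Lam[of "\<lambda>t. ev t s x" s, OF ev_solution] assms by auto
  have "x = Lam (z s)" using z(1)[of s] by simp
  then have "N1 x = (norm (z s))\<^sup>2" by (simp add: N1_Lam)
  then show ?thesis using z(2)[of t] by (simp add: z(1) N1_Lam)
qed

end

section \<open>Conservation of energy\<close>

context schroedinger
begin

text \<open>Cutting by weight and not by index makes the truncation a function of the Laplacian, so
  it commutes with \<open>J\<close> and \<open>S\<close>; by \<open>w_finite\<close> its range is
  finite dimensional.\<close>

definition cut :: "nat \<Rightarrow> 'a \<Rightarrow>\<^sub>L 'a"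
  where "cut k = diag_op b (\<lambda>n. if w n \<le> real k then 1 else 0)"

definition cut_w :: "nat \<Rightarrow> 'a \<Rightarrow>\<^sub>L 'a"
  where "cut_w k = diag_op b (\<lambda>n. if w n \<le> real k then w n else 0)"

text \<open>Formally \<open>Lam\<close> times minus the Laplacian times \<open>Lam\<close>: the
  gradient energy in the coordinate of \<open>H1\<close>, where it is a bounded operator.\<close>

definition ratio :: "'a \<Rightarrow>\<^sub>L 'a"
  where "ratio = diag_op b (\<lambda>n. w n / (1 + w n))"

lemma cut_le: "\<bar>if w n \<le> real k then 1 else 0\<bar> \<le> (1::real)"
  by simp

lemma cut_w_le: "\<bar>if w n \<le> real k then w n else 0\<bar> \<le> real k"
  using w_nonneg[of n] by simp

lemma ratio_le: "\<bar>w n / (1 + w n)\<bar> \<le> 1"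
  using w_nonneg[of n] by simp

lemma cut_inner: "cut k x \<bullet> b n = (if w n \<le> real k then x \<bullet> b n else 0)"
  unfolding cut_def by (subst diag_op_inner[OF onb cut_le]) simp

lemma cut_w_inner: "cut_w k x \<bullet> b n = (if w n \<le> real k then w n * (x \<bullet> b n) else 0)"
  unfolding cut_w_def by (subst diag_op_inner[OF onb cut_w_le]) simp

lemma ratio_inner: "ratio x \<bullet> b n = w n / (1 + w n) * (x \<bullet> b n)"
  unfolding ratio_def by (rule diag_op_inner[OF onb ratio_le])

lemma cut_sym: "cut k x \<bullet> y = x \<bullet> cut k y"
  unfolding cut_def by (rule diag_op_symmetric[OF onb cut_le])

lemma cut_w_sym: "cut_w k x \<bullet> y = x \<bullet> cut_w k y"
  unfolding cut_w_def by (rule diag_op_symmetric[OF onb cut_w_le])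

lemma norm_cut_le: "norm (cut k x) \<le> norm x"
  using diag_op_norm_le[OF onb cut_le, where x = x] by (simp add: cut_def)

lemma norm_ratio_le: "norm (ratio x) \<le> norm x"
  using diag_op_norm_le[OF onb ratio_le, where x = x] by (simp add: ratio_def)

lemma J_cut: "J (cut k x) = cut k (J x)"
  unfolding cut_def by (rule J_diag[OF cut_le]) simp

lemma J_cut_w: "J (cut_w k x) = cut_w k (J x)"
  unfolding cut_w_def by (rule J_diag[OF cut_w_le]) simp

lemma S_cut: "S t (cut k x) = cut k (S t x)"
  by (rule orthonormal_basis_eqI[OF onb]) (simp add: S_inner cut_inner J_cut)

lemma S_cut_w: "S t (cut_w k x) = cut_w k (S t x)"
  by (rule orthonormal_basis_eqI[OF onb]) (simp add: S_inner cut_w_inner J_cut_w algebra_simps)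

lemma cut_Lam: "cut k (Lam x) = Lam (cut k x)"
  by (rule orthonormal_basis_eqI[OF onb]) (simp add: cut_inner Lam_inner)

text \<open>Bounds the truncated Laplacian uniformly in \<open>k\<close> as a map from H1 to its
  dual, since \<open>ratio\<close> and \<open>cut k\<close> are contractions.\<close>

lemma Lam_cut_w_Lam: "Lam (cut_w k (Lam x)) = ratio (cut k x)"
  by (rule orthonormal_basis_eqI[OF onb])
    (use w1_pos in \<open>simp add: cut_inner Lam_inner cut_w_inner ratio_inner field_simps less_imp_le\<close>)

lemma cut_w_cut: "cut_w k (cut k x) = cut_w k x"
  by (rule orthonormal_basis_eqI[OF onb]) (simp add: cut_inner cut_w_inner)

lemma cut_cut_w: "cut k (cut_w k x) = cut_w k x"
  by (rule orthonormal_basis_eqI[OF onb]) (simp add: cut_inner cut_w_inner)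

lemma cut_cut: "cut k (cut k x) = cut k x"
  by (rule orthonormal_basis_eqI[OF onb]) (simp add: cut_inner)

lemma cut_tendsto: "(\<lambda>k. cut k x) \<longlonglongrightarrow> x"
proof (rule metric_LIMSEQ_I)
  fix r :: real assume r: "r > 0"
  have "(\<lambda>n. \<Sum>i<n. (x \<bullet> b i) *\<^sub>R b i) \<longlonglongrightarrow> x"
    using orthonormal_basis_sums[OF onb, of x] by (simp add: sums_def)
  from metric_LIMSEQ_D[OF this, of "r/2"] r
  obtain N where "dist (\<Sum>i<N. (x \<bullet> b i) *\<^sub>R b i) x < r/2" by auto
  moreover define p where "p = (\<Sum>i<N. (x \<bullet> b i) *\<^sub>R b i)"
  ultimately have p: "norm (x - p) < r/2" by (simp add: dist_norm norm_minus_commute)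
  \<comment> \<open>The sum of these finitely many weights dominates each of them, so for
    \<open>k \<ge> K\<close> the truncation fixes \<open>p\<close>.\<close>
  obtain K :: nat where K: "(\<Sum>i<N. w i) \<le> real K" using real_arch_simple by blast
  have "dist (cut k x) x < r" if k: "k \<ge> K" for k
  proof -
    have "w i \<le> real k" if "i < N" for i
    proof -
      have "w i \<le> (\<Sum>i<N. w i)" using that by (intro member_le_sum) (auto simp: w_nonneg)
      then show ?thesis using K k by linarith
    qed
    then have "cut k p = p"
      unfolding p_def cut_def blinfun.sum_right blinfun.scaleR_right
      by (intro sum.cong) (auto simp: diag_basis[OF cut_le])
    then have eq: "cut k x - x = cut k (x - p) - (x - p)"
      by (simp add: blinfun.diff_right)
    have "norm (cut k x - x) \<le> norm (x - p) + norm (x - p)"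
      unfolding eq using norm_triangle_ineq4[of "cut k (x - p)" "x - p"] norm_cut_le[of k "x - p"] by simp
    then show ?thesis using p by (simp add: dist_norm)
  qed
  then show "\<exists>K. \<forall>k\<ge>K. dist (cut k x) x < r" by blast
qed

lemma cut_sum: "cut k x = (\<Sum>n | w n \<le> real k. (x \<bullet> b n) *\<^sub>R b n)"
proof (rule orthonormal_basis_eqI[OF onb])
  fix m
  have "(\<Sum>n | w n \<le> real k. (x \<bullet> b n) *\<^sub>R b n) \<bullet> b m = (\<Sum>n | w n \<le> real k. if n = m then x \<bullet> b m else 0)"
    unfolding inner_sum_left by (intro sum.cong) (auto simp: orthonormal_basis_inner[OF onb])
  then show "cut k x \<bullet> b m = (\<Sum>n | w n \<le> real k. (x \<bullet> b n) *\<^sub>R b n) \<bullet> b m"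
    using w_finite[of "real k"] by (simp add: cut_inner)
qed

lemma cut_w_sum: "cut_w k x = (\<Sum>n | w n \<le> real k. (w n * (x \<bullet> b n)) *\<^sub>R b n)"
proof (rule orthonormal_basis_eqI[OF onb])
  fix m
  have "(\<Sum>n | w n \<le> real k. (w n * (x \<bullet> b n)) *\<^sub>R b n) \<bullet> b m = (\<Sum>n | w n \<le> real k. if n = m then w m * (x \<bullet> b m) else 0)"
    unfolding inner_sum_left by (intro sum.cong) (auto simp: orthonormal_basis_inner[OF onb])
  then show "cut_w k x \<bullet> b m = (\<Sum>n | w n \<le> real k. (w n * (x \<bullet> b n)) *\<^sub>R b n) \<bullet> b m"
    using w_finite[of "real k"] by (simp add: cut_w_inner)
qed

lemma S_basis: "S t (b n) = cos (t * w n) *\<^sub>R b n + sin (t * w n) *\<^sub>R J (b n)"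
  by (simp add: S_apply diag_basis[where C = 1] blinfun.scaleR_right)

text \<open>\<open>S r\<close> is differentiable in \<open>r\<close> on each basis vector, but not
  on a general vector. \<open>cut_sum\<close> reduces the claim to finitely many basis
  vectors.\<close>

lemma S_cut_derivative:
  assumes y: "(y has_vector_derivative y') (at t)"
  shows "((\<lambda>r. cut k (S r (y r))) has_vector_derivative
    cut k (S t y') + J (cut_w k (S t (y t)))) (at t)"
proof -
  have "((\<lambda>r. (y r \<bullet> b n) *\<^sub>R S r (b n)) has_vector_derivative
    (y' \<bullet> b n) *\<^sub>R S t (b n) + (w n * (y t \<bullet> b n)) *\<^sub>R J (S t (b n))) (at t)" for n
  proof -
    have 1: "((\<lambda>r. y r \<bullet> b n) has_vector_derivative y' \<bullet> b n) (at t)"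
      by (rule bounded_linear.has_vector_derivative[OF bounded_linear_inner_left y])
    have "((\<lambda>r. cos (r * w n)) has_real_derivative - sin (t * w n) * w n) (at t)"
      "((\<lambda>r. sin (r * w n)) has_real_derivative cos (t * w n) * w n) (at t)"
      by (auto intro!: derivative_eq_intros)
    then have "((\<lambda>r. cos (r * w n) *\<^sub>R b n + sin (r * w n) *\<^sub>R J (b n)) has_vector_derivative
        (- sin (t * w n) * w n) *\<^sub>R b n + (cos (t * w n) * w n) *\<^sub>R J (b n)) (at t)"
      by (intro has_vector_derivative_add bounded_linear.has_vector_derivative[OF bounded_linear_scaleR_left])
        (simp_all add: has_real_derivative_iff_has_vector_derivative)
    then have 2: "((\<lambda>r. S r (b n)) has_vector_derivative w n *\<^sub>R J (S t (b n))) (at t)"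
      by (simp add: S_basis[abs_def] blinfun.add_right blinfun.scaleR_right J_J scaleR_add_right algebra_simps)
    show ?thesis
      using bounded_bilinear.has_vector_derivative[OF bounded_bilinear_scaleR 1 2]
      by (simp add: algebra_simps)
  qed
  then have "((\<lambda>r. \<Sum>n | w n \<le> real k. (y r \<bullet> b n) *\<^sub>R S r (b n)) has_vector_derivative
    (\<Sum>n | w n \<le> real k. (y' \<bullet> b n) *\<^sub>R S t (b n) + (w n * (y t \<bullet> b n)) *\<^sub>R J (S t (b n)))) (at t)"
    by (intro has_vector_derivative_sum)
  moreover have "(\<Sum>n | w n \<le> real k. (y r \<bullet> b n) *\<^sub>R S r (b n)) = cut k (S r (y r))" for r
    unfolding S_cut[symmetric] unfolding cut_sum blinfun.sum_right blinfun.scaleR_right ..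
  moreover have "(\<Sum>n | w n \<le> real k. (y' \<bullet> b n) *\<^sub>R S t (b n) + (w n * (y t \<bullet> b n)) *\<^sub>R J (S t (b n)))
      = cut k (S t y') + J (cut_w k (S t (y t)))"
    unfolding S_cut[symmetric] S_cut_w[symmetric] unfolding cut_sum cut_w_sum blinfun.sum_right blinfun.scaleR_right sum.distrib ..
  ultimately show ?thesis by simp
qed

text \<open>In the coordinate of \<open>H1\<close> the form is a bounded bilinear form. Additivity,
  bounds and limits of the energy are taken from this identity.\<close>

lemma form_Lam: "form (Lam x) (Lam y) =
    ratio x \<bullet> y - V (Lam x) \<bullet> Lam y"
  and form_sums: "x \<in> H1 \<Longrightarrow> y \<in> H1 \<Longrightarrow> summable (\<lambda>n. w n * (x \<bullet> b n) * (y \<bullet> b n))"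
proof -
  have *: "(\<lambda>n. w n * (Lam x \<bullet> b n) * (Lam y \<bullet> b n)) sums (ratio x \<bullet> y)" for x y
  proof -
    have "w n * (Lam x \<bullet> b n) * (Lam y \<bullet> b n) = (ratio x \<bullet> b n) * (y \<bullet> b n)" for n
      using w1_pos[of n] by (simp add: Lam_inner ratio_inner field_simps less_imp_le)
    then show ?thesis using parseval_sums[OF onb, of "ratio x" y] by simp
  qed
  show "form (Lam x) (Lam y) =
    ratio x \<bullet> y - V (Lam x) \<bullet> Lam y"
    using *[of x y] by (simp add: form_def sums_iff)
  show "x \<in> H1 \<Longrightarrow> y \<in> H1 \<Longrightarrow> summable (\<lambda>n. w n * (x \<bullet> b n) * (y \<bullet> b n))"
    using * H1_Lam[of x] H1_Lam[of y] by (auto simp: sums_iff)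
qed

lemma form_sym: "form x y = form y x"
  using V_sym[of x y] by (simp add: form_def inner_commute[of _ "V y"] mult.commute mult.left_commute)

lemma form_add:
  assumes "x \<in> H1" "y \<in> H1" "z \<in> H1"
  shows "form (x + y) z = form x z + form y z"
proof -
  obtain x' y' z' where "x = Lam x'" "y = Lam y'" "z = Lam z'"
    using assms H1_Lam by metis
  then show ?thesis
    by (simp only: form_Lam blinfun.add_right[symmetric])
      (simp add: form_Lam blinfun.add_right inner_add_left)
qed

lemma abs_form_le: assumes "x \<in> H1" shows "\<bar>form x x\<bar> \<le> (1 + norm V) * N1 x"
proof -
  obtain z where z: "x = Lam z" using H1_Lam[OF assms] by blast
  have "\<bar>ratio z \<bullet> z\<bar> \<le> norm z * norm z"
    by (rule order_trans[OF Cauchy_Schwarz_ineq2]) (intro mult_right_mono norm_ratio_le norm_ge_zero)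
  moreover have "\<bar>V x \<bullet> x\<bar> \<le> norm V * norm z * norm z"
  proof (rule order_trans[OF Cauchy_Schwarz_ineq2])
    have "norm x \<le> norm z" by (simp add: z norm_Lam_le)
    then show "norm (V x) * norm x \<le> norm V * norm z * norm z"
      by (intro mult_mono order_trans[OF norm_blinfun] mult_left_mono) auto
  qed
  ultimately show ?thesis
    using form_Lam[of z z] N1_Lam[of z] unfolding z[symmetric] by (simp add: power2_eq_square algebra_simps)
qed

text \<open>The energy of the spectral truncation \<open>cut k (S t (y t))\<close> varies only through
  \<open>V (x - cut k x)\<close>, because \<open>\<langle>a, J a\<rangle> = 0\<close> removes the main term.\<close>

lemma form_conserved_le:
  assumes y: "solution y" and s: "y s \<in> H1" and st: "s \<le> t"
  shows "form (S t (y t)) (S t (y t)) = form (S s (y s)) (S s (y s))"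
proof -
  obtain z where z: "\<And>t. y t = Lam (z t)" "continuous_on UNIV z"
    using solution_Lam[OF y s] by blast
  define x where "x r = S r (y r)" for r
  define q where "q r = S r (z r)" for r
  have xq: "x r = Lam (q r)" for r by (simp add: x_def q_def z S_Lam)
  have nq: "norm (q r) = norm (z r)" for r by (simp add: q_def norm_S)
  define g where "g k r = (cut_w k (cut k (x r)) - V (cut k (x r)))
      \<bullet> cut k (x r)" for k r
  define a where "a k r = cut_w k (x r) - cut k (V (x r))" for k r
  define h where "h k r = 2 * (V (x r - cut k (x r)) \<bullet> J (a k r))" for k r
  have dg: "(g k has_vector_derivative h k r) (at r)" for k r
  proof -
    have "(y has_vector_derivative A r (y r)) (at r)"
      using y by (simp add: solution_def)
    from S_cut_derivative[OF this]
    have "((\<lambda>r. cut k (x r)) has_vector_derivative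
        cut k (S r (A r (y r))) + J (cut_w k (x r))) (at r)"
      unfolding x_def .
    moreover have "cut k (S r (A r (y r))) + J (cut_w k (x r))
        = J (a k r)"
      by (simp add: A_apply blinfun.minus_right S_minus x_def[symmetric] a_def blinfun.diff_right J_cut)
    ultimately have xk: "((\<lambda>r. cut k (x r)) has_vector_derivative J (a k r)) (at r)" by simp
    let ?xk = "cut k (x r)"
    let ?M = "\<lambda>u. cut_w k u - V u"
    have "((\<lambda>r. ?M (cut k (x r))) has_vector_derivative ?M (J (a k r))) (at r)"
      by (intro has_vector_derivative_diff bounded_linear.has_vector_derivative[OF blinfun.bounded_linear_right] xk)
    from bounded_bilinear.has_vector_derivative[OF bounded_bilinear_inner this xk]
    have "(g k has_vector_derivative ?M ?xk \<bullet> J (a k r) + ?M (J (a k r)) \<bullet> ?xk) (at r)"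
      unfolding g_def .
    moreover have "?M (J (a k r)) \<bullet> ?xk = ?M ?xk \<bullet> J (a k r)"
    proof -
      have "?M (J (a k r)) \<bullet> ?xk = J (a k r) \<bullet> ?M ?xk"
        by (simp add: inner_diff_left inner_diff_right cut_w_sym V_sym)
      also have "\<dots> = ?M ?xk \<bullet> J (a k r)" by (rule inner_commute)
      finally show ?thesis .
    qed
    moreover have "?M ?xk \<bullet> J (a k r) = V (x r - cut k (x r)) \<bullet> J (a k r)"
    proof -
      \<comment> \<open>\<open>J (a k r)\<close> lies in the range of \<open>cut k\<close>, so only
        the projection of \<open>?M ?xk\<close> to that range counts. This projection is
        \<open>a k r\<close> up to the truncation error of \<open>V\<close>.\<close>
      have ca: "cut k (J (a k r)) = J (a k r)"
        by (simp add: a_def blinfun.diff_right cut_cut_w cut_cut flip: J_cut)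
      have "?M ?xk \<bullet> J (a k r) = cut k (?M ?xk) \<bullet> J (a k r)"
        by (simp add: cut_sym ca)
      also have "cut k (?M ?xk) = a k r + cut k (V (x r - ?xk))"
        by (simp add: a_def blinfun.diff_right cut_cut_w cut_w_cut)
      also have "\<dots> \<bullet> J (a k r) = V (x r - ?xk) \<bullet> J (a k r)"
        by (simp add: inner_add_left J_self cut_sym ca)
      finally show ?thesis .
    qed
    ultimately show ?thesis by (simp add: h_def)
  qed
  have h_bound: "norm (h k r) \<le> 2 * (norm V1 * norm (q r - cut k (q r)) * ((1 + norm V1) * norm (q r)))" for k r
  proof -
    define e where "e = V1 (q r - cut k (q r))"
    have Ve: "V (x r - cut k (x r)) = Lam e"
      by (simp add: e_def xq cut_Lam V_Lam flip: blinfun.diff_right)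
    \<comment> \<open>\<open>a k r\<close> contains the Laplacian and has no bound uniform in
      \<open>k\<close>. Moving \<open>Lam\<close> from the error term to it pairs H1 with its dual,
      where \<open>Lam_cut_w_Lam\<close> applies.\<close>
    have "Lam e \<bullet> J (a k r) = e \<bullet> J (Lam (a k r))"
      by (simp add: Lam_sym J_Lam)
    also have "\<bar>\<dots>\<bar> \<le> norm e * norm (Lam (a k r))"
      using Cauchy_Schwarz_ineq2[of e "J (Lam (a k r))"] by (simp add: norm_J)
    also have "\<dots> \<le> (norm V1 * norm (q r - cut k (q r))) * ((1 + norm V1) * norm (q r))"
    proof (intro mult_mono)
      show "norm e \<le> norm V1 * norm (q r - cut k (q r))"
        unfolding e_def by (rule norm_blinfun)
      have "norm (Lam (cut_w k (x r))) \<le> norm (q r)"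
        by (simp add: xq Lam_cut_w_Lam) (rule order_trans[OF norm_ratio_le norm_cut_le])
      moreover have "norm (Lam (cut k (V (x r)))) \<le> norm V1 * norm (q r)"
        by (simp add: xq V_Lam cut_Lam)
          (rule order_trans[OF norm_Lam_le order_trans[OF norm_Lam_le order_trans[OF norm_cut_le norm_blinfun]]])
      ultimately show "norm (Lam (a k r)) \<le> (1 + norm V1) * norm (q r)"
        unfolding a_def blinfun.diff_right
        by (intro order_trans[OF norm_triangle_ineq4]) (simp add: algebra_simps)
    qed auto
    finally show ?thesis by (simp add: h_def Ve)
  qed
  have int_h: "(h k has_integral (g k t - g k s)) {s..t}" for k
    by (rule fundamental_theorem_of_calculus[OF st has_vector_derivative_at_within[OF dg]])
  define B where "B r = 2 * (norm V1 * (2 * norm (z r)) * ((1 + norm V1) * norm (z r)))" for r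
  have "(\<lambda>k. integral {s..t} (h k)) \<longlonglongrightarrow> integral {s..t} (\<lambda>_. 0)"
  proof (rule dominated_convergence(2))
    show "h k integrable_on {s..t}" for k using int_h by blast
    show "B integrable_on {s..t}"
      unfolding B_def by (intro integrable_continuous_real continuous_intros continuous_on_subset[OF z(2)]) auto
    show "norm (h k r) \<le> B r" for k r
    proof (rule order_trans[OF h_bound])
      have "norm (q r - cut k (q r)) \<le> 2 * norm (z r)"
        using norm_triangle_ineq4[of "q r" "cut k (q r)"] norm_cut_le[of k "q r"] by (simp add: nq)
      then show "2 * (norm V1 * norm (q r - cut k (q r)) * ((1 + norm V1) * norm (q r))) \<le> B r"
        unfolding B_def nq by (intro mult_left_mono mult_right_mono) auto
    qed
    show "(\<lambda>k. h k r) \<longlonglongrightarrow> 0" for r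
    proof (rule Lim_null_comparison[OF always_eventually[OF allI[OF h_bound]]])
      have "(\<lambda>k. q r - cut k (q r)) \<longlonglongrightarrow> q r - q r"
        by (intro tendsto_intros cut_tendsto)
      then have "(\<lambda>k. norm (q r - cut k (q r))) \<longlonglongrightarrow> 0"
        by (simp add: tendsto_norm_zero)
      then show "(\<lambda>k. 2 * (norm V1 * norm (q r - cut k (q r)) * ((1 + norm V1) * norm (q r)))) \<longlonglongrightarrow> 0"
        by (intro tendsto_mult_right_zero tendsto_mult_left_zero)
    qed
  qed
  then have 1: "(\<lambda>k. g k t - g k s) \<longlonglongrightarrow> 0"
    by (simp add: integral_unique[OF int_h])
  have g_lim: "(\<lambda>k. g k r) \<longlonglongrightarrow> form (x r) (x r)" for r
  proof -
    have "g k r = ratio (cut k (q r)) \<bullet> q r - V (cut k (x r)) \<bullet> cut k (x r)" for k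
    proof -
      have "cut_w k (cut k (x r)) \<bullet> cut k (x r) = cut_w k (x r) \<bullet> x r"
        by (simp add: cut_w_cut) (simp add: cut_cut_w flip: cut_sym)
      also have "\<dots> = ratio (cut k (q r)) \<bullet> q r"
        by (simp add: xq flip: Lam_cut_w_Lam Lam_sym)
      finally show ?thesis by (simp add: g_def inner_diff_left)
    qed
    moreover have "(\<lambda>k. ratio (cut k (q r)) \<bullet> q r - V (cut k (x r)) \<bullet> cut k (x r))
        \<longlonglongrightarrow> ratio (q r) \<bullet> q r - V (x r) \<bullet> x r"
      by (intro tendsto_intros cut_tendsto)
    ultimately show ?thesis by (simp add: xq form_Lam)
  qed
  have "(\<lambda>k. g k t - g k s) \<longlonglongrightarrow> form (x t) (x t) - form (x s) (x s)"
    by (intro tendsto_diff g_lim)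
  with 1 have "form (x t) (x t) - form (x s) (x s) = 0" by (metis LIMSEQ_unique)
  then show ?thesis by (simp add: x_def)
qed

text \<open>A trajectory may be read from either end, so the forward case also covers
  \<open>t < s\<close>.\<close>

lemma form_conserved:
  assumes "x \<in> H1"
  shows "form (S t (ev t s x)) (S t (ev t s x)) = form (S s x) (S s x)"
  using form_conserved_le[OF ev_solution[of s x], of s t] form_conserved_le[OF ev_solution[of s x], of t s]
    ev_H1[OF assms, of t s] assms by (cases "s \<le> t") auto

section \<open>Pairing a perturbed trajectory with the free solutions\<close>

lemma solution_FTC:
  assumes psi: "solution \<psi>" and "s \<le> t"
  shows "(LINT r:{s..t}|lborel. c \<bullet> A r (\<psi> r)) = c \<bullet> \<psi> t - c \<bullet> \<psi> s"
  unfolding set_lebesgue_integral_def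
proof (rule integral_FTC_Icc[OF \<open>s \<le> t\<close>, where F = "\<lambda>r. c \<bullet> \<psi> r"])
  show "((\<lambda>r. c \<bullet> \<psi> r) has_vector_derivative c \<bullet> A r (\<psi> r)) (at r within {s..t})" for r
    using psi unfolding solution_def
    by (blast intro: has_vector_derivative_at_within bounded_linear.has_vector_derivative[OF bounded_linear_inner_right])
  show "continuous_on {s..t} (\<lambda>r. c \<bullet> A r (\<psi> r))"
    by (rule continuous_on_inner[OF continuous_on_const A_cont'[OF solution_continuous[OF psi]]])
qed

text \<open>The perturbation \<open>N\<close> need not be differentiable in time, so the product
  rule is replaced by Fubini over the triangle \<open>0 \<le> s \<le> r \<le> T\<close>. Skewness
  cancels the drift of \<open>x\<close> against the derivative of \<open>\<psi>\<close>, and only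
  pairings of \<open>N\<close> with \<open>\<psi>\<close> and its derivative remain.\<close>

lemma solution_pairing:
  fixes x :: "real \<Rightarrow> 'a"
  assumes psi: "solution \<psi>" and T: "0 \<le> T"
    and g: "set_integrable lborel {0..T} (\<lambda>r. A r (x r))"
    and N: "\<And>r. r \<in> {0..T} \<Longrightarrow> N r = x r - x0 - (LINT s:{0..r}|lborel. A s (x s))"
  shows "x T \<bullet> \<psi> T = x0 \<bullet> \<psi> 0 + N T \<bullet> \<psi> T - (LINT r:{0..T}|lborel. N r \<bullet> A r (\<psi> r))"
proof -
  define G where "G r = indicator {0..T} r *\<^sub>R A r (x r)" for r
  define p where "p r = A r (\<psi> r)" for r
  have G: "integrable lborel G" using g by (simp add: set_integrable_def G_def[abs_def])
  then have G_meas [measurable]: "G \<in> borel_measurable borel" by auto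
  have p_cont: "continuous_on X p" for X
    unfolding p_def[abs_def] by (rule A_cont'[OF solution_continuous[OF psi]])
  then have p_meas [measurable]: "p \<in> borel_measurable borel"
    by (intro borel_measurable_continuous_onI)
  obtain K where K: "\<And>r. r \<in> {0..T} \<Longrightarrow> norm (p r) \<le> K"
    using compact_continuous_image[OF p_cont, of "{0..T}", THEN compact_imp_bounded]
    unfolding bounded_iff by (metis compact_Icc imageI)
  have K0: "K \<ge> 0" using K[of 0] T norm_ge_zero order_trans by (metis atLeastAtMost_iff order_refl)
  obtain K' where K': "\<And>r. r \<in> {0..T} \<Longrightarrow> norm (\<psi> r) \<le> K'"
    using compact_continuous_image[OF solution_continuous[OF psi], of "{0..T}", THEN compact_imp_bounded]
    unfolding bounded_iff by (metis compact_Icc imageI)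
  have psi_meas [measurable]: "\<psi> \<in> borel_measurable borel"
    by (intro borel_measurable_continuous_onI solution_continuous psi)
  \<comment> \<open>Integrating over \<open>r\<close> first leads to the fundamental theorem for
    \<open>\<psi>\<close> (fact \<open>L\<close>); integrating over \<open>s\<close> first produces
    the accumulated drift \<open>Y r\<close> (fact \<open>Y\<close>).\<close>
  define f where "f = (\<lambda>(s, r). indicator {0..T} s * indicator {s..T} r * (G s \<bullet> p r))"
  have pred: "Measurable.pred (borel \<Otimes>\<^sub>M borel) (\<lambda>z::real \<times> real. fst z \<le> snd z \<and> snd z \<le> T)"
    by measurable
  have f_alt: "f = (\<lambda>z. indicator {0..T} (fst z) * (if fst z \<le> snd z \<and> snd z \<le> T then 1 else 0) * (G (fst z) \<bullet> p (snd z)))"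
    by (auto simp: f_def fun_eq_iff indicator_def)
  have f_meas [measurable]: "f \<in> borel_measurable (lborel \<Otimes>\<^sub>M lborel)"
    unfolding f_alt by measurable
  have f_le: "norm (f (s, r)) \<le> norm (G s) * (K * indicator {0..T} r)" for s r
  proof (cases "0 \<le> s \<and> s \<le> r \<and> r \<le> T")
    case True
    then have "norm (G s \<bullet> p r) \<le> norm (G s) * K"
      using K[of r] by (intro order_trans[OF Cauchy_Schwarz_ineq2[unfolded real_norm_def[symmetric]]] mult_left_mono) auto
    then show ?thesis using True by (simp add: f_def)
  qed (use K0 in \<open>auto simp: f_def indicator_def\<close>)
  have ind: "integrable lborel (indicat_real {0..T})"
    using T by (intro integrable_real_indicator) auto
  have int1: "integrable lborel (\<lambda>r. f (s, r))" for s
  proof (rule Bochner_Integration.integrable_bound)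
    show "integrable lborel (\<lambda>r. norm (G s) * (K * indicator {0..T} r))" using ind by simp
    show "AE r in lborel. norm (f (s, r)) \<le> norm (norm (G s) * (K * indicator {0..T} r))"
      by (intro AE_I2 order_trans[OF f_le]) simp
  qed simp
  have int2: "integrable (lborel \<Otimes>\<^sub>M lborel) f"
  proof (rule lborel_pair.Fubini_integrable[OF f_meas])
    show "integrable lborel (\<lambda>s. LBINT r. norm (f (s, r)))"
    proof (rule Bochner_Integration.integrable_bound)
      show "integrable lborel (\<lambda>s. norm (G s) * (K * T))"
        using G by auto
      show "AE s in lborel. norm (LBINT r. norm (f (s, r))) \<le> norm (norm (G s) * (K * T))"
      proof (rule AE_I2)
        fix s
        have "(LBINT r. norm (f (s, r))) \<le> (LBINT r. norm (G s) * (K * indicator {0..T} r))"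
          using f_le[of s] ind by (intro integral_mono integrable_norm int1 integrable_mult_right) auto
        also have "\<dots> = norm (G s) * (K * T)" using T by simp
        finally show "norm (LBINT r. norm (f (s, r))) \<le> norm (norm (G s) * (K * T))" by simp
      qed
    qed simp
  qed (use int1 in simp)
  have swap: "(LBINT s. LBINT r. f (s, r)) = (LBINT r. LBINT s. f (s, r))"
    using lborel_pair.Fubini_integral[of "\<lambda>s r. f (s, r)"] int2 by (simp add: case_prod_unfold)
  have "(LBINT s. LBINT r. f (s, r)) = (LBINT s. G s \<bullet> \<psi> T - G s \<bullet> \<psi> s)"
  proof (rule Bochner_Integration.integral_cong)
    fix s :: real
    have "(LBINT r. f (s, r)) = indicator {0..T} s * (LINT r:{s..T}|lborel. G s \<bullet> p r)"
      by (simp add: f_def set_lebesgue_integral_def mult.assoc)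
    also have "\<dots> = G s \<bullet> \<psi> T - G s \<bullet> \<psi> s"
      unfolding p_def by (cases "s \<in> {0..T}") (auto simp: solution_FTC[OF psi] G_def)
    finally show "(LBINT r. f (s, r)) = G s \<bullet> \<psi> T - G s \<bullet> \<psi> s" .
  qed simp
  also have "\<dots> = (LBINT s. G s) \<bullet> \<psi> T - (LBINT s. G s \<bullet> \<psi> s)"
  proof -
    have "integrable lborel (\<lambda>s. G s \<bullet> \<psi> s)"
    proof (rule Bochner_Integration.integrable_bound)
      show "integrable lborel (\<lambda>s. norm (G s) * K')" using G by auto
      show "AE s in lborel. norm (G s \<bullet> \<psi> s) \<le> norm (norm (G s) * K')"
      proof (rule AE_I2)
        fix s
        show "norm (G s \<bullet> \<psi> s) \<le> norm (norm (G s) * K')"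
        proof (cases "s \<in> {0..T}")
          case True
          have "\<bar>G s \<bullet> \<psi> s\<bar> \<le> norm (G s) * norm (\<psi> s)" by (rule Cauchy_Schwarz_ineq2)
          also have "\<dots> \<le> norm (G s) * K'" using K'[OF True] by (intro mult_left_mono) auto
          also have "\<dots> \<le> norm (norm (G s) * K')" by simp
          finally show ?thesis by simp
        qed (simp add: G_def)
      qed
    qed simp
    then show ?thesis
      using G by (subst Bochner_Integration.integral_diff) (auto simp: integral_inner_left)
  qed
  finally have L: "(LBINT s. LBINT r. f (s, r)) = (LBINT s. G s) \<bullet> \<psi> T - (LBINT s. G s \<bullet> \<psi> s)" .
  define Y where "Y r = (LINT s:{0..r}|lborel. A s (x s))" for r
  have Y: "Y r \<bullet> p r = (LBINT s. f (s, r))" if "r \<in> {0..T}" for r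
  proof -
    have "Y r = (LBINT s. indicator {0..r} s *\<^sub>R G s)"
      unfolding Y_def set_lebesgue_integral_def using that
      by (intro Bochner_Integration.integral_cong) (auto simp: G_def indicator_def)
    moreover have "integrable lborel (\<lambda>s. indicator {0..r} s *\<^sub>R G s)"
      using G by (rule integrable_mult_indicator[rotated]) simp
    ultimately have "Y r \<bullet> p r = (LBINT s. (indicator {0..r} s *\<^sub>R G s) \<bullet> p r)"
      using integral_inner_left[of "p r" lborel "\<lambda>s. indicator {0..r} s *\<^sub>R G s"] by simp
    also have "\<dots> = (LBINT s. f (s, r))"
      using that by (intro Bochner_Integration.integral_cong) (auto simp: f_def indicator_def)
    finally show ?thesis .
  qed
  have f0: "f (s, r) = 0" if "r \<notin> {0..T}" for s r
    using that by (auto simp: f_def indicator_def)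
  have YT: "Y T = (LBINT s. G s)"
    by (simp add: Y_def G_def set_lebesgue_integral_def)
  have int_f: "integrable lborel (\<lambda>r. LBINT s. f (s, r))"
    using lborel_pair.integrable_snd[of "\<lambda>s r. f (s, r)"] int2 by (simp add: case_prod_unfold)
  have int_x: "integrable lborel (\<lambda>r. indicator {0..T} r * (x0 \<bullet> p r))"
    using borel_integrable_atLeastAtMost'[OF continuous_on_inner[OF continuous_on_const p_cont], of 0 T x0]
    by (simp add: set_integrable_def)
  have int_G: "integrable lborel (\<lambda>r. G r \<bullet> \<psi> r)"
  proof (rule Bochner_Integration.integrable_bound)
    show "integrable lborel (\<lambda>s. norm (G s) * K')" using G by auto
    show "AE s in lborel. norm (G s \<bullet> \<psi> s) \<le> norm (norm (G s) * K')"
    proof (rule AE_I2)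
      fix s
      show "norm (G s \<bullet> \<psi> s) \<le> norm (norm (G s) * K')"
      proof (cases "s \<in> {0..T}")
        case True
        have "\<bar>G s \<bullet> \<psi> s\<bar> \<le> norm (G s) * norm (\<psi> s)" by (rule Cauchy_Schwarz_ineq2)
        also have "\<dots> \<le> norm (G s) * K'" using K'[OF True] by (intro mult_left_mono) auto
        also have "\<dots> \<le> norm (norm (G s) * K')" by simp
        finally show ?thesis by simp
      qed (simp add: G_def)
    qed
  qed simp
  have "(LINT r:{0..T}|lborel. N r \<bullet> p r) = (LBINT r. - (G r \<bullet> \<psi> r) - indicator {0..T} r * (x0 \<bullet> p r) - (LBINT s. f (s, r)))"
    unfolding set_lebesgue_integral_def
  proof (rule Bochner_Integration.integral_cong)
    fix r :: real
    show "indicator {0..T} r *\<^sub>R (N r \<bullet> p r) = - (G r \<bullet> \<psi> r) - indicator {0..T} r * (x0 \<bullet> p r) - (LBINT s. f (s, r))"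
    proof (cases "r \<in> {0..T}")
      case True
      \<comment> \<open>Skewness moves the generator from \<open>\<psi>\<close> to \<open>x\<close>.
        The resulting integral cancels against the one that Fubini leaves behind.\<close>
      have "x r \<bullet> p r = - (G r \<bullet> \<psi> r)" using True by (simp add: G_def p_def A_skew)
      then show ?thesis using True N[OF True] Y[OF True] by (simp add: inner_diff_left Y_def)
    qed (simp add: G_def f0)
  qed simp
  also have "\<dots> = - (LBINT r. G r \<bullet> \<psi> r) - (LBINT r. indicator {0..T} r * (x0 \<bullet> p r)) - (LBINT r. LBINT s. f (s, r))"
    using int_f int_x int_G by (subst Bochner_Integration.integral_diff Bochner_Integration.integral_minus; auto)+
  also have "(LBINT r. indicator {0..T} r * (x0 \<bullet> p r)) = x0 \<bullet> \<psi> T - x0 \<bullet> \<psi> 0"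
    using solution_FTC[OF psi T, of x0] by (simp add: set_lebesgue_integral_def p_def)
  also have "(LBINT r. LBINT s. f (s, r)) = Y T \<bullet> \<psi> T - (LBINT s. G s \<bullet> \<psi> s)"
    using swap L by (simp add: YT)
  finally have "(LINT r:{0..T}|lborel. N r \<bullet> p r) = x0 \<bullet> \<psi> 0 - x0 \<bullet> \<psi> T - Y T \<bullet> \<psi> T" by simp
  moreover have "N T = x T - x0 - Y T" using N[of T] T by (simp add: Y_def)
  ultimately show ?thesis unfolding p_def by (simp add: inner_diff_left)
qed

end

section \<open>Completeness of the characters\<close>

lemma Basis_cart: "(Basis :: (real^'d) set) = range (\<lambda>i. axis i 1)"
  by (auto simp: Basis_vec_def)

text \<open>\<open>lborel\<close> is the image of a product measure indexed by \<open>Basis\<close>;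
  the injection of indices as \<open>axis i 1\<close> relabels its factors by coordinates.\<close>

lemma lborel_integral_prod_cart:
  fixes g :: "'d::finite \<Rightarrow> real \<Rightarrow> complex"
  assumes g: "\<And>i. integrable lborel (g i)"
  shows "(LINT x|lborel. (\<Prod>i\<in>UNIV. g i (x $ i))) = (\<Prod>i\<in>UNIV. integral\<^sup>L lborel (g i))"
proof -
  interpret product_sigma_finite "\<lambda>b :: real^'d. lborel :: real measure" ..
  have inj: "inj (\<lambda>i::'d. axis i (1::real) :: real^'d)"
    by (auto intro!: injI simp: axis_eq_axis)
  define ix where "ix = inv (\<lambda>i::'d. axis i (1::real))"
  have ix [simp]: "ix (axis i 1) = i" for i
    unfolding ix_def by (rule inv_f_f[OF inj])
  have gm [measurable]: "g i \<in> borel_measurable borel" for i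
    using g[of i] by auto
  have "(LINT x|lborel. (\<Prod>i\<in>UNIV. g i (x $ i)))
      = (LINT f|(\<Pi>\<^sub>M b\<in>(Basis :: (real^'d) set). lborel). (\<Prod>i\<in>UNIV. g i ((\<Sum>b\<in>Basis. f b *\<^sub>R b) $ i)))"
    by (subst lborel_eq, subst integral_distr) auto
  also have "\<dots> = (LINT f|(\<Pi>\<^sub>M b\<in>(Basis :: (real^'d) set). lborel). (\<Prod>b\<in>Basis. g (ix b) (f b)))"
  proof (rule Bochner_Integration.integral_cong[OF refl])
    fix f :: "real^'d \<Rightarrow> real"
    have "(\<Sum>b\<in>Basis. f b *\<^sub>R b) $ i = f (axis i 1)" for i
    proof -
      have "(\<Sum>b\<in>Basis. f b *\<^sub>R b) $ i = (\<Sum>j\<in>UNIV. f (axis j 1) * (axis j 1 $ i))"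
        by (simp add: Basis_cart sum.reindex[OF inj] sum_component)
      also have "\<dots> = (\<Sum>j\<in>UNIV. if j = i then f (axis i 1) else 0)"
        by (intro sum.cong) (auto simp: axis_def)
      finally show ?thesis by simp
    qed
    then show "(\<Prod>i\<in>UNIV. g i ((\<Sum>b\<in>Basis. f b *\<^sub>R b) $ i)) = (\<Prod>b\<in>Basis. g (ix b) (f b))"
      by (simp add: Basis_cart prod.reindex[OF inj])
  qed
  also have "\<dots> = (\<Prod>b\<in>(Basis :: (real^'d) set). integral\<^sup>L lborel (g (ix b)))"
    by (rule product_integral_prod) (auto intro: g)
  also have "\<dots> = (\<Prod>i\<in>UNIV. integral\<^sup>L lborel (g i))"
    by (simp add: Basis_cart prod.reindex[OF inj])
  finally show ?thesis .
qed

lemma integral_cis_period: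
  fixes n :: int
  shows "integrable lborel (\<lambda>y. indicator {0..<2*pi} y *\<^sub>R cis (real_of_int n * y))"
    and "(LINT y|lborel. indicator {0..<2*pi} y *\<^sub>R cis (real_of_int n * y)) = (if n = 0 then 2 * pi else 0)"
proof -
  have cont: "continuous_on {0..2*pi} (\<lambda>y. cis (real_of_int n * y))"
    by (intro continuous_intros)
  \<comment> \<open>The cell is half-open, while the fundamental theorem is applied on the closed
    interval; the two integrals differ by one point.\<close>
  have ae: "AE y in lborel. indicator {0..2*pi} y *\<^sub>R cis (real_of_int n * y) = indicator {0..<2*pi} y *\<^sub>R cis (real_of_int n * y)"
    using AE_lborel_singleton[of "2*pi :: real"] by eventually_elim (auto simp: indicator_def)
  have m: "(\<lambda>y. cis (real_of_int n * y)) \<in> borel_measurable borel"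
    by (intro borel_measurable_continuous_onI continuous_intros)
  have int: "integrable lborel (\<lambda>y. indicator {0..2*pi} y *\<^sub>R cis (real_of_int n * y))"
    using borel_integrable_atLeastAtMost'[OF cont] by (simp add: set_integrable_def)
  show "integrable lborel (\<lambda>y. indicator {0..<2*pi} y *\<^sub>R cis (real_of_int n * y))"
    by (rule integrable_cong_AE_imp[OF int]) (use m ae in \<open>auto elim: AE_mp\<close>)
  have eq: "(LINT y|lborel. indicator {0..<2*pi} y *\<^sub>R cis (real_of_int n * y)) = (LINT y|lborel. indicator {0..2*pi} y *\<^sub>R cis (real_of_int n * y))"
    by (rule integral_cong_AE) (use m ae in \<open>auto elim: AE_mp\<close>)
  show "(LINT y|lborel. indicator {0..<2*pi} y *\<^sub>R cis (real_of_int n * y)) = (if n = 0 then 2 * pi else 0)"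
  proof (cases "n = 0")
    case True
    then show ?thesis
      unfolding eq by (subst integral_FTC_Icc[where F = "\<lambda>y. complex_of_real y"])
        (auto intro!: derivative_eq_intros continuous_intros simp: has_vector_derivative_of_real)
  next
    case False
    have "(LINT y|lborel. indicator {0..2*pi} y *\<^sub>R cis (real_of_int n * y))
      = cis (real_of_int n * (2 * pi)) / (\<i> * of_int n) - cis (real_of_int n * 0) / (\<i> * of_int n)"
    proof (rule integral_FTC_Icc)
      show "((\<lambda>y. cis (real_of_int n * y) / (\<i> * of_int n)) has_vector_derivative cis (real_of_int n * y)) (at y within {0..2*pi})" for y
      proof -
        have "((\<lambda>z. exp (\<i> * of_int n * z) / (\<i> * of_int n)) has_field_derivative exp (\<i> * of_int n * of_real y)) (at (of_real y))"
          using False by (auto intro!: derivative_eq_intros)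
        then have "((\<lambda>x. exp (\<i> * of_int n * of_real x) / (\<i> * of_int n)) has_vector_derivative exp (\<i> * of_int n * of_real y)) (at y within {0..2*pi})"
          by (rule has_vector_derivative_real_field[THEN has_vector_derivative_at_within])
        then show ?thesis by (simp add: cis_conv_exp mult.assoc)
      qed
    qed (use cont in auto)
    moreover have "cis (real_of_int n * (2 * pi)) = 1"
      by (metis cis_multiple_2pi mult.commute Ints_of_int)
    ultimately show ?thesis using False unfolding eq by simp
  qed
qed

lemma character_measurable [measurable]: "character k \<in> borel_measurable torus"
proof (rule borel_measurable_torusI)
  show "character k \<in> borel_measurable borel"
    unfolding character_def[abs_def]
    by (intro borel_measurable_continuous_onI continuous_intros) auto
qed

lemma norm_character: "cmod (character (k :: int^'d) x) = 1 / sqrt ((2 * pi) ^ CARD('d))"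
  by (simp add: character_def norm_divide)

lemma sq_integrable_character: "sq_integrable (character (k :: int^'d))"
  by (rule sq_integrable_bounded[where K = "1 / sqrt ((2 * pi) ^ CARD('d))"]) (auto simp: norm_character)

lemma cis_sum: "finite I \<Longrightarrow> cis (\<Sum>i\<in>I. f i) = (\<Prod>i\<in>I. cis (f i))"
  by (induction I rule: finite_induct) (auto simp: cis_mult[symmetric])

lemma character_mult_cnj:
  "character (k :: int^'d) x * cnj (character l x)
    = (\<Prod>i\<in>UNIV. cis (real_of_int (k $ i - l $ i) * x $ i)) / complex_of_real ((2 * pi) ^ CARD('d))"
proof -
  have pos: "(0::real) < (2 * pi) ^ CARD('d)" by simp
  have "(\<Prod>i\<in>UNIV. cis (real_of_int (k $ i - l $ i) * x $ i)) = cis (\<Sum>i\<in>UNIV. real_of_int (k $ i - l $ i) * x $ i)"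
    by (simp add: cis_sum)
  also have "(\<Sum>i\<in>UNIV. real_of_int (k $ i - l $ i) * x $ i) = (\<Sum>i\<in>UNIV. real_of_int (k $ i) * x $ i) + - (\<Sum>i\<in>UNIV. real_of_int (l $ i) * x $ i)"
    by (simp add: left_diff_distrib sum_subtractf)
  also have "cis \<dots> = cis (\<Sum>i\<in>UNIV. real_of_int (k $ i) * x $ i) * cnj (cis (\<Sum>i\<in>UNIV. real_of_int (l $ i) * x $ i))"
    by (simp only: cis_mult[symmetric] cis_cnj[symmetric])
  finally show ?thesis
    using pos by (simp add: character_def flip: of_real_mult)
qed

lemma character_orthonormal:
  "(LINT x|torus. character (k :: int^'d) x * cnj (character l x)) = (if k = l then 1 else 0)"
proof -
  let ?C = "{x::real^'d. \<forall>i. 0 \<le> x $ i \<and> x $ i < 2 * pi}"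
  have "(LINT x|torus. character k x * cnj (character l x)) = (LINT x|lborel. indicator ?C x *\<^sub>R (character k x * cnj (character l x)))"
    unfolding torus_def by (rule integral_restrict_space) (use sets_torus_cell in auto)
  also have "\<dots> = (LINT x|lborel. (\<Prod>i\<in>UNIV. indicator {0..<2*pi} (x $ i) *\<^sub>R cis (real_of_int (k $ i - l $ i) * x $ i)) / complex_of_real ((2 * pi) ^ CARD('d)))"
  proof (rule Bochner_Integration.integral_cong[OF refl])
    fix x :: "real^'d"
    have ind: "complex_of_real (indicator ?C x) = (\<Prod>i\<in>UNIV. complex_of_real (indicator {0..<2*pi} (x $ i)))"
    proof (cases "x \<in> ?C")
      case False
      then obtain i where "x $ i \<notin> {0..<2*pi}" by auto
      then have "(\<Prod>i\<in>UNIV. complex_of_real (indicator {0..<2*pi} (x $ i))) = 0"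
        by (intro prod_zero bexI[of _ i]) auto
      then show ?thesis using False by simp
    qed simp
    show "indicator ?C x *\<^sub>R (character k x * cnj (character l x))
      = (\<Prod>i\<in>UNIV. indicator {0..<2*pi} (x $ i) *\<^sub>R cis (real_of_int (k $ i - l $ i) * x $ i)) / complex_of_real ((2 * pi) ^ CARD('d))"
      unfolding character_mult_cnj scaleR_conv_of_real ind prod.distrib by simp
  qed
  also have "\<dots> = (\<Prod>i\<in>UNIV. complex_of_real (if k $ i - l $ i = 0 then 2 * pi else 0)) / complex_of_real ((2 * pi) ^ CARD('d))"
    using lborel_integral_prod_cart[of "\<lambda>i y. indicator {0..<2*pi} y *\<^sub>R cis (real_of_int (k $ i - l $ i) * y)", OF integral_cis_period(1)]
    unfolding integral_cis_period(2) by simp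
  also have "\<dots> = (if k = l then 1 else 0)"
  proof (cases "k = l")
    case False
    then obtain i where "k $ i \<noteq> l $ i" by (auto simp: vec_eq_iff)
    then have "(\<Prod>i\<in>UNIV. complex_of_real (if k $ i - l $ i = 0 then 2 * pi else 0)) = 0"
      by (intro prod_zero bexI[of _ i]) auto
    then show ?thesis using False by simp
  qed simp
  finally show ?thesis .
qed

section \<open>Trigonometric polynomials and the map into a product of circles\<close>

inductive trig_poly :: "(real^'d \<Rightarrow> complex) \<Rightarrow> bool" where
  monomial: "trig_poly (\<lambda>x. c * cis (\<Sum>i\<in>UNIV. real_of_int (k $ i) * x $ i))"
| add: "trig_poly p \<Longrightarrow> trig_poly q \<Longrightarrow> trig_poly (\<lambda>x. p x + q x)"

lemma trig_poly_mult:
  assumes "trig_poly p" "trig_poly q"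
  shows "trig_poly (\<lambda>x. p x * q x)"
  using assms(1)
proof (induction rule: trig_poly.induct)
  case (monomial c k)
  from assms(2) show ?case
  proof (induction rule: trig_poly.induct)
    case (monomial c' k')
    have "(\<lambda>x. c * cis (\<Sum>i\<in>UNIV. real_of_int (k $ i) * x $ i) * (c' * cis (\<Sum>i\<in>UNIV. real_of_int (k' $ i) * x $ i)))
        = (\<lambda>x. (c * c') * cis (\<Sum>i\<in>UNIV. real_of_int ((k + k') $ i) * x $ i))"
      by (auto simp: fun_eq_iff distrib_right sum.distrib cis_mult[symmetric])
    then show ?case by (metis trig_poly.monomial)
  next
    case (add p q)
    then show ?case using trig_poly.add[OF add.IH] by (simp add: distrib_left)
  qed
next
  case (add p q)
  then show ?case using trig_poly.add[OF add.IH] by (simp add: distrib_right)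
qed

lemma trig_poly_const: "trig_poly (\<lambda>x. c)"
  using trig_poly.monomial[of c 0] by simp

lemma trig_poly_sum: "finite I \<Longrightarrow> (\<And>i. i \<in> I \<Longrightarrow> trig_poly (p i)) \<Longrightarrow> trig_poly (\<lambda>x. \<Sum>i\<in>I. p i x)"
  by (induction I rule: finite_induct) (auto intro: trig_poly.add trig_poly_const)

lemma trig_poly_bounded_measurable:
  "trig_poly (p :: real^'d \<Rightarrow> complex) \<Longrightarrow> p \<in> borel_measurable borel \<and> (\<exists>K. \<forall>x. cmod (p x) \<le> K)"
proof (induction rule: trig_poly.induct)
  case (monomial c k)
  have "(\<lambda>x::real^'d. c * cis (\<Sum>i\<in>UNIV. real_of_int (k $ i) * x $ i)) \<in> borel_measurable borel"
    by (intro borel_measurable_continuous_onI continuous_intros)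
  then show ?case by (auto simp: norm_mult)
next
  case (add p q)
  then obtain K L where "\<And>x. cmod (p x) \<le> K" "\<And>x. cmod (q x) \<le> L" by auto
  then have "cmod (p x + q x) \<le> K + L" for x
    by (intro order_trans[OF norm_triangle_ineq] add_mono)
  then show ?case using add by auto
qed

text \<open>Stone-Weierstrass asks for a compact set, which the half-open cell is not. Its image
  lies in a compact product of circles, where real polynomials pull back to trigonometric
  polynomials.\<close>

definition circle_map :: "real^'d \<Rightarrow> complex^'d"
  where "circle_map x = (\<chi> i. cis (x $ i))"

text \<open>In each circle the two real coordinates are the cosine and the sine, combinations of the
  frequencies 1 and -1, and trigonometric polynomials are closed under sums and products.\<close>

lemma trig_poly_circle_map:
  fixes g :: "complex^'d::finite \<Rightarrow> real"
  assumes "real_polynomial_function g"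
  shows "trig_poly (\<lambda>x. complex_of_real (g (circle_map x)))"
  using assms
proof (induction rule: real_polynomial_function.induct)
  case (linear f)
  have cis_axis: "trig_poly (\<lambda>x. c * cis (real_of_int n * x $ i))" for c n and i :: 'd
  proof -
    have "(\<Sum>j\<in>UNIV. real_of_int (axis i n $ j) * x $ j) = (\<Sum>j\<in>UNIV. if j = i then real_of_int n * x $ i else 0)" for x :: "real^'d"
      by (intro sum.cong) (auto simp: axis_def)
    then show ?thesis using trig_poly.monomial[of c "axis i n"] by simp
  qed
  have "trig_poly (\<lambda>x. complex_of_real (circle_map x \<bullet> b))" if "b \<in> Basis" for b :: "complex^'d"
  proof -
    from that obtain i u where b: "b = axis i u" "u = 1 \<or> u = \<i>"
      by (auto simp: Basis_vec_def Basis_complex_def)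
    have "trig_poly (\<lambda>x. (1/2) * cis (real_of_int 1 * x $ i) + (1/2) * cis (real_of_int (-1) * x $ i))"
      by (intro trig_poly.add cis_axis)
    moreover have "(1/2) * cis (real_of_int 1 * y) + (1/2) * cis (real_of_int (-1) * y) = complex_of_real (cos y)" for y
      by (simp add: complex_eq_iff)
    moreover have "trig_poly (\<lambda>x. (- \<i>/2) * cis (real_of_int 1 * x $ i) + (\<i>/2) * cis (real_of_int (-1) * x $ i))"
      by (intro trig_poly.add cis_axis)
    moreover have "(- \<i>/2) * cis (real_of_int 1 * y) + (\<i>/2) * cis (real_of_int (-1) * y) = complex_of_real (sin y)" for y
      by (simp add: complex_eq_iff)
    ultimately show ?thesis
      using b by (auto simp: inner_axis circle_map_def inner_complex_def)
  qed
  then have "trig_poly (\<lambda>x. \<Sum>b\<in>Basis. complex_of_real (f b) * complex_of_real (circle_map x \<bullet> b))"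
    by (intro trig_poly_sum trig_poly_mult trig_poly_const) auto
  moreover have "complex_of_real (f (circle_map x)) = (\<Sum>b\<in>Basis. complex_of_real (f b) * complex_of_real (circle_map x \<bullet> b))" for x
  proof -
    interpret f: bounded_linear f by fact
    have "f (circle_map x) = f (\<Sum>b\<in>Basis. (circle_map x \<bullet> b) *\<^sub>R b)" by (simp add: euclidean_representation)
    also have "\<dots> = (\<Sum>b\<in>Basis. f b * (circle_map x \<bullet> b))" by (simp add: f.sum f.scaleR mult.commute)
    finally show ?thesis by simp
  qed
  ultimately show ?case by simp
qed (auto intro: trig_poly_const trig_poly.add trig_poly_mult)

lemma circle_map_measurable [measurable]: "circle_map \<in> borel_measurable borel"
proof -
  have "continuous_on UNIV (circle_map :: real^'d \<Rightarrow> complex^'d)"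
    unfolding circle_map_def[abs_def] by (intro continuous_intros)
  then show ?thesis by (rule borel_measurable_continuous_onI)
qed

lemma fn_of_integrable: "integrable torus (fn_of u)"
proof (rule Bochner_Integration.integrable_bound)
  show "integrable torus (\<lambda>x. (cmod (fn_of u x))\<^sup>2 + 1)"
    using sq_integrable_fn_of[of u] by (auto simp: sq_integrable_def simp del: sq_integrable_fn_of)
  have "a \<le> a\<^sup>2 + 1" for a :: real
  proof -
    have "2 * a \<le> a\<^sup>2 + 1" using sum_squares_bound[of a 1] by simp
    moreover have "0 \<le> a\<^sup>2" by simp
    ultimately show ?thesis by linarith
  qed
  then show "AE x in torus. norm (fn_of u x) \<le> norm ((cmod (fn_of u x))\<^sup>2 + 1)" by simp
qed simp

lemma integrable_mult_bounded:
  fixes f :: "'a \<Rightarrow> complex"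
  assumes "integrable M f" "p \<in> borel_measurable M" "\<And>x. cmod (p x) \<le> K"
  shows "integrable M (\<lambda>x. f x * p x)"
proof (rule Bochner_Integration.integrable_bound)
  show "integrable M (\<lambda>x. norm (f x) * K)" using assms(1) by auto
  show "AE x in M. norm (f x * p x) \<le> norm (norm (f x) * K)"
  proof (rule AE_I2)
    fix x
    have "norm (f x) * cmod (p x) \<le> norm (f x) * K" using assms(3) by (intro mult_left_mono) auto
    also have "\<dots> \<le> norm (norm (f x) * K)" by simp
    finally show "norm (f x * p x) \<le> norm (norm (f x) * K)" by (simp add: norm_mult)
  qed
qed (use assms in \<open>auto intro!: borel_measurable_times\<close>)

lemma integral_trig_poly_zero:
  assumes u: "\<And>k. fourier u k = 0" and "trig_poly p"
  shows "(LINT x|torus. fn_of u x * p x) = 0"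
  using assms(2)
proof (induction rule: trig_poly.induct)
  case (monomial c k)
  have "fn_of u x * (c * cis (\<Sum>i\<in>UNIV. real_of_int (k $ i) * x $ i))
      = (c * complex_of_real (sqrt ((2 * pi) ^ CARD('a)))) * (fn_of u x * cnj (character (- k) x))" for x :: "real^'a"
    by (simp add: character_def sum_negf cis_cnj)
  then have "(LINT x|torus. fn_of u x * (c * cis (\<Sum>i\<in>UNIV. real_of_int (k $ i) * x $ i)))
      = (LINT x|torus. (c * complex_of_real (sqrt ((2 * pi) ^ CARD('a)))) * (fn_of u x * cnj (character (- k) x)))"
    by (intro Bochner_Integration.integral_cong refl)
  also have "\<dots> = (c * complex_of_real (sqrt ((2 * pi) ^ CARD('a)))) * fourier u (- k)"
    unfolding fourier_def by (rule integral_mult_right_zero)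
  finally have "(LINT x|torus. fn_of u x * (c * cis (\<Sum>i\<in>UNIV. real_of_int (k $ i) * x $ i)))
      = (c * complex_of_real (sqrt ((2 * pi) ^ CARD('a)))) * fourier u (- k)" .
  then show ?case by (simp add: u)
next
  case (add p q)
  have "integrable torus (\<lambda>x. fn_of u x * p x)" if "trig_poly p" for p
  proof -
    from trig_poly_bounded_measurable[OF that] obtain K where "p \<in> borel_measurable borel" "\<And>x. cmod (p x) \<le> K" by blast
    then show ?thesis by (intro integrable_mult_bounded[OF fn_of_integrable] borel_measurable_torusI)
  qed
  with add show ?case by (simp add: distrib_left)
qed

text \<open>On the product of circles \<open>g\<close> is a uniform limit of polynomials, whose
  integrals against \<open>u\<close> vanish. The error is at most \<open>e\<close> times the L1 norm
  of \<open>u\<close>.\<close>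

lemma integral_circle_continuous_zero:
  fixes g :: "complex^'d::finite \<Rightarrow> real"
  assumes u: "\<And>k. fourier (u :: 'd l2_torus) k = 0" and g: "continuous_on UNIV g"
  shows "(LINT x|torus. fn_of u x * complex_of_real (g (circle_map x))) = 0"
proof -
  define K where "K = {z :: complex^'d. \<forall>i. cmod (z $ i) = 1}"
  have "compact K"
  proof -
    have "bounded K"
      unfolding bounded_iff
    proof (intro exI ballI)
      fix z assume z: "z \<in> K"
      have "norm z \<le> (\<Sum>i\<in>UNIV. norm (z $ i))" unfolding norm_vec_def by (rule L2_set_le_sum) auto
      then show "norm z \<le> real CARD('d)" using z by (simp add: K_def)
    qed
    moreover have "closed K"
      unfolding K_def by (intro closed_Collect_all closed_Collect_eq continuous_intros)
    ultimately show ?thesis by (simp add: compact_eq_bounded_closed)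
  qed
  have E: "circle_map x \<in> K" for x :: "real^'d" by (simp add: K_def circle_map_def)
  obtain B where B: "\<And>z. z \<in> K \<Longrightarrow> \<bar>g z\<bar> \<le> B"
    using compact_continuous_image[OF continuous_on_subset[OF g] \<open>compact K\<close>, THEN compact_imp_bounded]
    unfolding bounded_iff by auto
  define I where "I = (LINT x|torus. cmod (fn_of u x))"
  have I0: "I \<ge> 0" by (simp add: I_def)
  have gm [measurable]: "g \<in> borel_measurable borel" using g by (rule borel_measurable_continuous_onI)
  have cm [measurable]: "circle_map \<in> borel_measurable (torus :: (real^'d) measure)"
    by (rule measurable_compose[OF _ circle_map_measurable]) (auto simp: torus_def intro: measurable_restrict_space1)
  have int_g: "integrable torus (\<lambda>x. fn_of u x * complex_of_real (g (circle_map x)))"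
    by (rule integrable_mult_bounded[OF fn_of_integrable, where K = B]) (use B E in auto)
  have "cmod (LINT x|torus. fn_of u x * complex_of_real (g (circle_map x))) \<le> e * I" if e: "e > 0" for e
  proof -
    obtain p where p: "real_polynomial_function p" "\<And>z. z \<in> K \<Longrightarrow> \<bar>g z - p z\<bar> < e"
      using Stone_Weierstrass_real_polynomial_function[OF \<open>compact K\<close> continuous_on_subset[OF g] e] by blast
    note tp = trig_poly_circle_map[OF p(1)]
    from trig_poly_bounded_measurable[OF tp] obtain L where L: "(\<lambda>x. complex_of_real (p (circle_map x))) \<in> borel_measurable borel"
      "\<And>x. cmod (complex_of_real (p (circle_map x))) \<le> L" by blast
    have int_p: "integrable torus (\<lambda>x. fn_of u x * complex_of_real (p (circle_map x)))"
      by (rule integrable_mult_bounded[OF fn_of_integrable borel_measurable_torusI[OF L(1)] L(2)])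
    have "(LINT x|torus. fn_of u x * complex_of_real (g (circle_map x)))
        = (LINT x|torus. fn_of u x * complex_of_real (g (circle_map x)) - fn_of u x * complex_of_real (p (circle_map x)))"
      using int_g int_p integral_trig_poly_zero[OF u tp] by simp
    also have "cmod \<dots> \<le> (LINT x|torus. cmod (fn_of u x * complex_of_real (g (circle_map x)) - fn_of u x * complex_of_real (p (circle_map x))))"
      by (rule integral_norm_bound)
    also have "\<dots> \<le> (LINT x|torus. e * cmod (fn_of u x))"
    proof (rule integral_mono)
      show "integrable torus (\<lambda>x. cmod (fn_of u x * complex_of_real (g (circle_map x)) - fn_of u x * complex_of_real (p (circle_map x))))"
        using int_g int_p by auto
      show "integrable torus (\<lambda>x. e * cmod (fn_of u x))" using fn_of_integrable by auto
      fix x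
      have "cmod (fn_of u x * complex_of_real (g (circle_map x)) - fn_of u x * complex_of_real (p (circle_map x)))
          = \<bar>g (circle_map x) - p (circle_map x)\<bar> * cmod (fn_of u x)"
        by (simp flip: right_diff_distrib of_real_diff add: norm_mult)
      also have "\<dots> \<le> e * cmod (fn_of u x)"
        using p(2)[OF E[of x]] by (intro mult_right_mono) auto
      finally show "cmod (fn_of u x * complex_of_real (g (circle_map x)) - fn_of u x * complex_of_real (p (circle_map x))) \<le> e * cmod (fn_of u x)" .
    qed
    also have "\<dots> = e * I" by (simp add: I_def)
    finally show ?thesis .
  qed
  note le = this
  have "cmod (LINT x|torus. fn_of u x * complex_of_real (g (circle_map x))) \<le> 0 + e" if "e > 0" for e
  proof -
    \<comment> \<open>\<open>I + 1\<close> in place of \<open>I\<close> also covers a vanishing L1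
      norm.\<close>
    have "e / (I + 1) * I \<le> e" using that I0 by (simp add: field_simps)
    then show ?thesis using le[of "e / (I + 1)"] that I0 by auto
  qed
  then have "cmod (LINT x|torus. fn_of u x * complex_of_real (g (circle_map x))) \<le> 0"
    by (rule field_le_epsilon)
  then show ?thesis by simp
qed

text \<open>The indicator of an open set is the limit of the continuous functions
  \<open>min 1 (n * infdist z (- U))\<close>. Open sets are stable under intersection and generate
  the Borel sets, so Dynkin induction extends the claim.\<close>

lemma integral_circle_borel_zero:
  fixes B :: "(complex^'d::finite) set"
  assumes u: "\<And>k. fourier (u :: 'd l2_torus) k = 0" and B: "B \<in> sets borel"
  shows "(LINT x|torus. fn_of u x * indicator B (circle_map x)) = 0"
proof -
  have cm [measurable]: "circle_map \<in> borel_measurable (torus :: (real^'d) measure)"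
    by (rule measurable_compose[OF _ circle_map_measurable]) (auto simp: torus_def intro: measurable_restrict_space1)
  have int_B: "integrable torus (\<lambda>x. fn_of u x * indicator B (circle_map x))" if [measurable]: "B \<in> sets borel" for B
    by (rule integrable_mult_bounded[OF fn_of_integrable, where K = 1]) (auto simp: indicator_def)
  have lim0: "(LINT x|torus. fn_of u x * f (circle_map x)) = 0"
    if "\<And>n::nat. (LINT x|torus. fn_of u x * F n (circle_map x)) = 0" "\<And>z. (\<lambda>n. F n z) \<longlonglongrightarrow> f z"
      "\<And>n z. cmod (F n z) \<le> 1" "\<And>n. F n \<in> borel_measurable borel" for F and f :: "complex^'d \<Rightarrow> complex"
  proof -
    note [measurable] = that(4)
    have [measurable]: "f \<in> borel_measurable borel"
      using that(4,2) by (rule borel_measurable_LIMSEQ_metric)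
    have "(\<lambda>n. LINT x|torus. fn_of u x * F n (circle_map x)) \<longlonglongrightarrow> (LINT x|torus. fn_of u x * f (circle_map x))"
    proof (rule integral_dominated_convergence[where w = "\<lambda>x. cmod (fn_of u x)"])
      show "AE x in torus. norm (fn_of u x * F n (circle_map x)) \<le> cmod (fn_of u x)" for n
        using that(3) by (auto simp: norm_mult mult_left_le)
      show "AE x in torus. (\<lambda>n. fn_of u x * F n (circle_map x)) \<longlonglongrightarrow> fn_of u x * f (circle_map x)"
        by (intro AE_I2 tendsto_intros that(2))
    qed (auto intro: fn_of_integrable)
    then show ?thesis using that(1) by (simp add: LIMSEQ_const_iff)
  qed
  have U: "(LINT x|torus. fn_of u x * indicator U (circle_map x)) = 0" if U: "open U" for U :: "(complex^'d) set"
  \<comment> \<open>For the whole space the complement is empty and \<open>infdist\<close> is 0 by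
    convention, so the approximating functions would all vanish.\<close>
  proof (cases "U = UNIV")
    case True
    then show ?thesis using integral_circle_continuous_zero[OF u, of "\<lambda>_. 1"] by simp
  next
    case False
    show ?thesis
    proof (rule lim0[where F = "\<lambda>n z. complex_of_real (min 1 (real n * infdist z (- U)))"])
      have cont: "continuous_on UNIV (\<lambda>z. min 1 (real n * infdist z (- U)))" for n
        by (intro continuous_intros)
      then show "(LINT x|torus. fn_of u x * complex_of_real (min 1 (real n * infdist (circle_map x) (- U)))) = 0" for n
        by (rule integral_circle_continuous_zero[OF u])
      show "(\<lambda>z. complex_of_real (min 1 (real n * infdist z (- U)))) \<in> borel_measurable borel" for n
        using borel_measurable_continuous_onI[OF cont] by measurable
      show "cmod (complex_of_real (min 1 (real n * infdist z (- U)))) \<le> 1" for n z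
        using infdist_nonneg[of z "- U"] by (auto simp: min_def)
      show "(\<lambda>n. complex_of_real (min 1 (real n * infdist z (- U)))) \<longlonglongrightarrow> indicator U z" for z
      proof (cases "z \<in> U")
        case True
        have "infdist z (- U) \<noteq> 0"
          using in_closed_iff_infdist_zero[of "- U" z] U False True by (auto simp: closed_Compl)
        then have d: "infdist z (- U) > 0" using infdist_nonneg[of z "- U"] by linarith
        obtain N :: nat where N: "1 / infdist z (- U) \<le> real N" using real_arch_simple by blast
        have "\<forall>\<^sub>F n in sequentially. complex_of_real (min 1 (real n * infdist z (- U))) = indicator U z"
        proof (rule eventually_sequentiallyI)
          fix n assume "N \<le> n"
          then have "1 / infdist z (- U) \<le> real n" using N by linarith
          then have "1 \<le> real n * infdist z (- U)" using d by (simp add: field_simps)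
          then show "complex_of_real (min 1 (real n * infdist z (- U))) = indicator U z" using True by simp
        qed
        then show ?thesis by (rule tendsto_eventually)
      next
        case False
        then show ?thesis by simp
      qed
    qed
  qed
  have "Int_stable {U :: (complex^'d) set. open U}" "{U :: (complex^'d) set. open U} \<subseteq> Pow UNIV"
    "B \<in> sigma_sets UNIV {U. open U}"
    using B by (auto simp: Int_stable_def borel_def)
  then show ?thesis
  proof (induction rule: sigma_sets_induct_disjoint)
    case (basic A)
    then show ?case using U by simp
  next
    case empty
    then show ?case by simp
  next
    case (compl A)
    then have A: "A \<in> sets borel" by (simp add: borel_def)
    have "(LINT x|torus. fn_of u x * indicator (UNIV - A) (circle_map x))
        = (LINT x|torus. fn_of u x * indicator UNIV (circle_map x) - fn_of u x * indicator A (circle_map x))"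
      by (intro Bochner_Integration.integral_cong) (auto simp: indicator_def)
    also have "\<dots> = (LINT x|torus. fn_of u x * indicator UNIV (circle_map x)) - (LINT x|torus. fn_of u x * indicator A (circle_map x))"
      by (intro Bochner_Integration.integral_diff int_B A) auto
    also have "\<dots> = 0" using compl U[of UNIV] by simp
    finally show ?case .
  next
    case (union A)
    then have A: "A i \<in> sets borel" for i by (auto simp: borel_def)
    show ?case
    proof (rule lim0[where F = "\<lambda>n. indicator (\<Union>i<n. A i)"])
      fix n
      have "fn_of u x * indicator (\<Union>i<n. A i) (circle_map x) = (\<Sum>i<n. fn_of u x * indicator (A i) (circle_map x))" for x
        using union(1) by (simp add: indicator_UN_disjoint sum_distrib_left disjoint_family_on_def)
      then have "(LINT x|torus. fn_of u x * indicator (\<Union>i<n. A i) (circle_map x))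
          = (LINT x|torus. (\<Sum>i<n. fn_of u x * indicator (A i) (circle_map x)))"
        by (intro Bochner_Integration.integral_cong refl)
      also have "\<dots> = (\<Sum>i<n. LINT x|torus. fn_of u x * indicator (A i) (circle_map x))"
        by (intro Bochner_Integration.integral_sum int_B A)
      finally show "(LINT x|torus. fn_of u x * indicator (\<Union>i<n. A i) (circle_map x)) = 0"
        using union(3) by simp
      show "(indicator (\<Union>i<n. A i) :: complex^'d \<Rightarrow> complex) \<in> borel_measurable borel"
        using A by (intro borel_measurable_indicator sets.finite_UN) auto
      show "cmod (indicator (\<Union>i<n. A i) z) \<le> 1" for z by (simp add: indicator_def)
      show "(\<lambda>n. indicator (\<Union>i<n. A i) z) \<longlonglongrightarrow> indicator (\<Union>i. A i) z" for z
        by (rule LIMSEQ_indicator_UN)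
    qed
  qed
qed

text \<open>A Borel left inverse shows that every Borel subset of the cell is the preimage under
  \<open>circle_map\<close> of a Borel set. Hence the vanishing of integrals over such preimages
  reaches all Borel subsets of the cell.\<close>

lemma circle_map_inverse:
  "\<exists>h :: complex^'d::finite \<Rightarrow> real^'d. h \<in> borel_measurable borel \<and> (\<forall>x\<in>space torus. h (circle_map x) = x)"
proof -
  \<comment> \<open>The angle between 0 and \<open>2 * pi\<close> of a point of the circle, with the
    branch chosen by the sign of the imaginary part. Clamping keeps \<open>arccos\<close> continuous
    off the circle, which gives measurability.\<close>
  define a where "a z = (if 0 \<le> Im z then arccos (max (-1) (min 1 (Re z))) else 2 * pi - arccos (max (-1) (min 1 (Re z))))" for z
  define h where "h z = (\<Sum>i\<in>UNIV. a (z $ i) *\<^sub>R axis i (1::real))" for z :: "complex^'d"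
  have "continuous_on UNIV (\<lambda>z. arccos (max (-1) (min 1 (Re z))))"
    by (intro continuous_intros) auto
  then have [measurable]: "(\<lambda>z. arccos (max (-1) (min 1 (Re z)))) \<in> borel_measurable borel"
    by (rule borel_measurable_continuous_onI)
  have [measurable]: "a \<in> borel_measurable borel"
    unfolding a_def[abs_def] by measurable
  have "h \<in> borel_measurable borel"
  proof -
    have [measurable]: "(\<lambda>z :: complex^'d. z $ i) \<in> borel_measurable borel" for i
      by (intro borel_measurable_continuous_onI continuous_intros)
    show ?thesis unfolding h_def[abs_def] by measurable
  qed
  moreover have "h (circle_map x) = x" if "x \<in> space torus" for x
  proof -
    have x: "0 \<le> x $ i" "x $ i < 2 * pi" for i
      using that by (auto simp: torus_def space_restrict_space)
    have ai: "a (cis y) = y" if y: "0 \<le> y" "y < 2 * pi" for y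
    proof (cases "0 \<le> sin y")
      case True
      then have "y \<le> pi" using y sin_lt_zero[of y] by linarith
      then show ?thesis using True y by (simp add: a_def arccos_cos)
    next
      case False
      then have "\<not> y \<le> pi" using y sin_ge_zero[of y] by auto
      moreover have "cos y = cos (2 * pi - y)" by simp
      ultimately have "arccos (cos y) = 2 * pi - y" using y by (metis arccos_cos diff_ge_0_iff_ge diff_le_eq le_add_diff_inverse2 less_eq_real_def linorder_le_cases mult_2 add_mono_thms_linordered_semiring(1) diff_add_cancel add_le_cancel_right)
      then show ?thesis using False by (simp add: a_def)
    qed
    show ?thesis
    proof (rule vec_eq_iff[THEN iffD2], rule allI)
      fix i
      have "h (circle_map x) $ i = (\<Sum>j\<in>UNIV. if j = i then x $ i else 0)"
        unfolding h_def sum_component using ai x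
        by (intro sum.cong) (auto simp: circle_map_def axis_def)
      then show "h (circle_map x) $ i = x $ i" by simp
    qed
  qed
  ultimately show ?thesis by blast
qed

theorem fourier_eq_zero_imp:
  assumes u: "\<And>k. fourier (u :: 'd::finite l2_torus) k = 0"
  shows "u = 0"
proof -
  obtain h :: "complex^'d \<Rightarrow> real^'d" where [measurable]: "h \<in> borel_measurable borel"
    and h: "\<And>x. x \<in> space torus \<Longrightarrow> h (circle_map x) = x"
    using circle_map_inverse by metis
  have "AE x in torus. fn_of u x = 0"
  proof (rule torus.density_zero[OF fn_of_integrable])
    fix C :: "(real^'d) set" assume C: "C \<in> sets torus"
    then have Cb: "C \<in> sets borel"
      using sets_torus_cell unfolding torus_def by (simp add: sets_restrict_space_iff)
    have "h -` C \<inter> space borel \<in> sets borel" by (rule measurable_sets[OF _ Cb]) simp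
    then have "h -` C \<in> sets borel" by simp
    from integral_circle_borel_zero[OF u this]
    have "(LINT x|torus. fn_of u x * indicator (h -` C) (circle_map x)) = 0" .
    moreover have "(LINT x|torus. fn_of u x * indicator (h -` C) (circle_map x)) = (LINT x|torus. indicator C x *\<^sub>R fn_of u x)"
      by (rule Bochner_Integration.integral_cong) (use h in \<open>auto simp: indicator_def\<close>)
    ultimately show "set_lebesgue_integral torus C (fn_of u) = 0"
      by (simp add: set_lebesgue_integral_def)
  qed
  then show ?thesis
    using class_of_eq_iff[of "fn_of u" "\<lambda>_. 0"] by (simp add: zero_l2_torus_def)
qed

section \<open>The real Fourier basis\<close>

lemma fourier_class_of:
  fixes f :: "real^'d::finite \<Rightarrow> complex"
  assumes f: "sq_integrable f"
  shows "fourier (class_of f) k = (LINT x|torus. f x * cnj (character k x))"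
proof -
  note [measurable] = sq_integrable_measurable[OF f]
  show ?thesis
    unfolding fourier_def
  proof (rule integral_cong_AE)
    show "AE x in torus. fn_of (class_of f) x * cnj (character k x) = f x * cnj (character k x)"
      using fn_of_class_of[OF f] by eventually_elim simp
  qed measurable
qed

lemma fourier_add: "fourier (u + v) k = fourier u k + fourier v k"
proof -
  have "fourier (u + v) k = (LINT x|torus. (fn_of u x + fn_of v x) * cnj (character k x))"
    unfolding plus_l2_torus_def by (rule fourier_class_of) (simp add: sq_integrable_add)
  also have "\<dots> = fourier u k + fourier v k"
    unfolding distrib_right fourier_def
    by (rule Bochner_Integration.integral_add) (auto intro!: sq_integrable_mult_integrable sq_integrable_character)
  finally show ?thesis .
qed

lemma fourier_scaleR: "fourier (r *\<^sub>R u) k = r *\<^sub>R fourier u k"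
proof -
  have "fourier (r *\<^sub>R u) k = (LINT x|torus. (r *\<^sub>R fn_of u x) * cnj (character k x))"
    unfolding scaleR_l2_torus_def
    by (rule fourier_class_of) (simp add: scaleR_conv_of_real sq_integrable_cmult)
  then show ?thesis by (simp add: fourier_def)
qed

lemma fourier_uminus: "fourier (- u) k = - fourier u k"
  using fourier_scaleR[of "-1" u k] by simp

lemma fourier_diff: "fourier (u - v) k = fourier u k - fourier v k"
  using fourier_add[of u "- v" k] by (simp add: fourier_uminus)

lemma fourier_eqI: "(\<And>k. fourier u k = fourier v k) \<Longrightarrow> u = v"
  using fourier_eq_zero_imp[of "u - v"] by (simp add: fourier_diff)

lemma infinite_UNIV_int_vec: "infinite (UNIV :: (int^'d) set)"
proof
  assume "finite (UNIV :: (int^'d) set)"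
  then have "finite (range (\<lambda>n::int. (\<chi> i. n) :: int^'d))" by (rule finite_subset[rotated]) simp
  moreover have "inj (\<lambda>n::int. (\<chi> i. n) :: int^'d)" by (auto intro!: injI simp: vec_eq_iff)
  ultimately have "finite (UNIV :: int set)" by (rule finite_imageD)
  then show False by simp
qed

text \<open>Each frequency occurs twice because L2 is taken as a real Hilbert space: the flag
  selects the character or its multiple by \<open>\<i>\<close>.\<close>

definition freq_enum :: "nat \<Rightarrow> (int^'d) \<times> bool"
  where "freq_enum = from_nat_into UNIV"

lemma bij_freq_enum: "bij (freq_enum :: nat \<Rightarrow> (int^'d) \<times> bool)"
proof -
  have "infinite (UNIV :: ((int^'d) \<times> bool) set)"
    using infinite_UNIV_int_vec by (simp add: finite_prod)
  then show ?thesis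
    unfolding freq_enum_def by (intro bij_betw_from_nat_into) auto
qed

lemma freq_enum_eq_iff: "freq_enum m = (freq_enum n :: (int^'d) \<times> bool) \<longleftrightarrow> m = n"
  using bij_freq_enum[where 'd = 'd] by (meson bij_def inj_eq)

lemma freq_enum_surj: "\<exists>n. freq_enum n = (p :: (int^'d) \<times> bool)"
  using bij_freq_enum[where 'd = 'd] by (metis bij_def surjD)

definition torus_basis :: "nat \<Rightarrow> 'd::finite l2_torus"
  where "torus_basis n = class_of (\<lambda>x. (if snd (freq_enum n :: (int^'d) \<times> bool) then \<i> else 1) * character (fst (freq_enum n)) x)"

definition torus_weight :: "'d::finite itself \<Rightarrow> nat \<Rightarrow> real"
  where "torus_weight _ n = freq_sq (fst (freq_enum n :: (int^'d) \<times> bool))"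

lemma sq_integrable_cmult_character: "sq_integrable (\<lambda>x. c * character k x)"
  by (rule sq_integrable_cmult[OF sq_integrable_character])

lemma inner_torus_basis:
  fixes u :: "'d::finite l2_torus"
  assumes "freq_enum n = (k, \<beta>)"
  shows "u \<bullet> torus_basis n = (if \<beta> then Im (fourier u k) else Re (fourier u k))"
proof -
  let ?c = "if \<beta> then \<i> else 1"
  have "u \<bullet> torus_basis n = Re (LINT x|torus. fn_of u x * cnj (?c * character k x))"
    unfolding torus_basis_def assms fst_conv snd_conv
    by (rule inner_l2_cong[OF _ fn_of_class_of[OF sq_integrable_cmult_character]]) auto
  also have "(LINT x|torus. fn_of u x * cnj (?c * character k x)) = (LINT x|torus. cnj ?c * (fn_of u x * cnj (character k x)))"
    by (rule Bochner_Integration.integral_cong) auto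
  also have "\<dots> = cnj ?c * fourier u k"
    unfolding fourier_def by (rule integral_mult_right_zero)
  finally show ?thesis by simp
qed

lemma fourier_torus_basis:
  assumes "freq_enum n = (l, \<beta>)"
  shows "fourier (torus_basis n :: 'd::finite l2_torus) k = (if k = l then (if \<beta> then \<i> else 1) else 0)"
proof -
  have "fourier (torus_basis n :: 'd l2_torus) k = (LINT x|torus. (if \<beta> then \<i> else 1) * (character l x * cnj (character k x)))"
    unfolding torus_basis_def assms fst_conv snd_conv
    by (simp add: fourier_class_of sq_integrable_cmult_character mult.assoc)
  also have "\<dots> = (if \<beta> then \<i> else 1) * (if l = k then 1 else 0)"
    by (simp only: integral_mult_right_zero character_orthonormal)
  finally show ?thesis by auto
qed

lemma orthonormal_basis_torus: "orthonormal_basis (torus_basis :: nat \<Rightarrow> 'd::finite l2_torus)"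
proof (rule orthonormal_basisI)
  fix m n
  obtain k \<beta> where m: "freq_enum m = (k :: int^'d, \<beta>)" by force
  obtain l \<gamma> where n: "freq_enum n = (l :: int^'d, \<gamma>)" by force
  have "m = n \<longleftrightarrow> k = l \<and> \<beta> = \<gamma>"
    using freq_enum_eq_iff[of m n, where 'd = 'd] m n by simp
  then show "torus_basis m \<bullet> (torus_basis n :: 'd l2_torus) = (if m = n then 1 else 0)"
    by (auto simp: inner_torus_basis[OF n] fourier_torus_basis[OF m])
next
  fix u :: "'d l2_torus"
  assume u: "\<And>n. u \<bullet> torus_basis n = 0"
  have "fourier u k = 0" for k
  proof -
    obtain m n where "freq_enum m = (k, False)" "freq_enum n = (k, True)"
      using freq_enum_surj by metis
    from inner_torus_basis[OF this(1), of u] inner_torus_basis[OF this(2), of u] u show ?thesis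
      by (simp add: complex_eq_iff)
  qed
  then show "u = 0" by (rule fourier_eq_zero_imp)
qed

text \<open>Here the multiplier is a function and not a class as in \<open>potential_mult\<close>,
  so that constants, single characters and sums of the Fourier series are covered by one pointwise
  bound.\<close>

definition bounded_mult :: "(real^'d::finite \<Rightarrow> complex) \<Rightarrow> 'd l2_torus \<Rightarrow> 'd l2_torus"
  where "bounded_mult g u = class_of (\<lambda>x. g x * fn_of u x)"

lemma sq_integrable_bounded_mult:
  assumes g: "g \<in> borel_measurable torus" "\<And>x. cmod (g x) \<le> K" and f: "sq_integrable f"
  shows "sq_integrable (\<lambda>x. g x * f x)"
  unfolding sq_integrable_def
proof
  note [measurable] = g(1) sq_integrable_measurable[OF f]
  show "(\<lambda>x. g x * f x) \<in> borel_measurable torus" by measurable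
  show "integrable torus (\<lambda>x. (cmod (g x * f x))\<^sup>2)"
  proof (rule Bochner_Integration.integrable_bound)
    show "integrable torus (\<lambda>x. K\<^sup>2 * (cmod (f x))\<^sup>2)" using f by (simp add: sq_integrable_def)
    have "(cmod (g x * f x))\<^sup>2 \<le> K\<^sup>2 * (cmod (f x))\<^sup>2" for x
      using g(2)[of x] by (auto simp: norm_mult power_mult_distrib intro!: mult_right_mono power_mono)
    then show "AE x in torus. norm ((cmod (g x * f x))\<^sup>2) \<le> norm (K\<^sup>2 * (cmod (f x))\<^sup>2)" by simp
  qed measurable
qed

context
  fixes g :: "real^'d::finite \<Rightarrow> complex" and K :: real
  assumes g_meas [measurable]: "g \<in> borel_measurable torus" and g_le: "\<And>x. cmod (g x) \<le> K"
begin

lemma fn_of_bounded_mult: "AE x in torus. fn_of (bounded_mult g u) x = g x * fn_of u x"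
  unfolding bounded_mult_def
  by (intro fn_of_class_of sq_integrable_bounded_mult[OF g_meas g_le] sq_integrable_fn_of)

lemma bounded_linear_bounded_mult: "bounded_linear (bounded_mult g)"
proof -
  have K: "K \<ge> 0" using g_le[of 0] norm_ge_zero order_trans by blast
  have norm: "norm (bounded_mult g u) \<le> K * norm u" for u
  proof (rule power2_le_imp_le)
    have "ennreal ((norm (bounded_mult g u))\<^sup>2) = (\<integral>\<^sup>+x. ennreal ((cmod (g x * fn_of u x))\<^sup>2) \<partial>torus)"
      unfolding nn_integral_fn_of[symmetric]
      by (rule nn_integral_cong_AE) (use fn_of_bounded_mult[of u] in eventually_elim, simp)
    also have "\<dots> \<le> (\<integral>\<^sup>+x. ennreal (K\<^sup>2) * ennreal ((cmod (fn_of u x))\<^sup>2) \<partial>torus)"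
    proof (intro nn_integral_mono)
      fix x
      have "(cmod (g x * fn_of u x))\<^sup>2 \<le> K\<^sup>2 * (cmod (fn_of u x))\<^sup>2"
        using g_le[of x] by (auto simp: norm_mult power_mult_distrib intro!: mult_right_mono power_mono)
      then show "ennreal ((cmod (g x * fn_of u x))\<^sup>2) \<le> ennreal (K\<^sup>2) * ennreal ((cmod (fn_of u x))\<^sup>2)"
        by (simp flip: ennreal_mult)
    qed
    also have "\<dots> = ennreal (K\<^sup>2) * ennreal ((norm u)\<^sup>2)"
      by (simp add: nn_integral_cmult nn_integral_fn_of)
    also have "\<dots> = ennreal ((K * norm u)\<^sup>2)"
      by (simp add: power_mult_distrib flip: ennreal_mult)
    finally show "(norm (bounded_mult g u))\<^sup>2 \<le> (K * norm u)\<^sup>2" by (simp add: ennreal_le_iff)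
    show "0 \<le> K * norm u" using K by simp
  qed
  show "bounded_linear (bounded_mult g)"
  proof (rule bounded_linear_intro)
    show "bounded_mult g (u + v) = bounded_mult g u + bounded_mult g v" for u v
      using fn_of_bounded_mult[of "u + v"] fn_of_bounded_mult[of u] fn_of_bounded_mult[of v]
        fn_of_plus[of u v] fn_of_plus[of "bounded_mult g u" "bounded_mult g v"]
      unfolding l2_eq_iff by eventually_elim (simp add: distrib_left)
    show "bounded_mult g (r *\<^sub>R u) = r *\<^sub>R bounded_mult g u" for r u
      using fn_of_bounded_mult[of "r *\<^sub>R u"] fn_of_bounded_mult[of u]
        fn_of_scaleR[of r u] fn_of_scaleR[of r "bounded_mult g u"]
      unfolding l2_eq_iff by eventually_elim simp
    show "norm (bounded_mult g u) \<le> norm u * K" for u using norm[of u] by (simp add: mult.commute)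
  qed
qed

lemma inner_bounded_mult: "bounded_mult g u \<bullet> v = Re (LINT x|torus. g x * (fn_of u x * cnj (fn_of v x)))"
  by (subst inner_l2_cong[OF fn_of_bounded_mult]) (auto simp: mult.assoc)

lemma bounded_mult_adj: "bounded_mult g u \<bullet> v = u \<bullet> bounded_mult (\<lambda>x. cnj (g x)) v"
proof -
  have "AE x in torus. fn_of (bounded_mult (\<lambda>x. cnj (g x)) v) x = cnj (g x) * fn_of v x"
    unfolding bounded_mult_def using g_le
    by (intro fn_of_class_of sq_integrable_bounded_mult[where K = K] sq_integrable_fn_of) auto
  then have "u \<bullet> bounded_mult (\<lambda>x. cnj (g x)) v = Re (LINT x|torus. fn_of u x * cnj (cnj (g x) * fn_of v x))"
    by (intro inner_l2_cong) auto
  then show ?thesis by (simp add: inner_bounded_mult mult.left_commute)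
qed

lemma fourier_bounded_mult: "fourier (bounded_mult g u) k = (LINT x|torus. g x * fn_of u x * cnj (character k x))"
  unfolding bounded_mult_def
  by (intro fourier_class_of sq_integrable_bounded_mult[OF g_meas g_le] sq_integrable_fn_of)

end

lemma cscale_bounded_mult: "cscale c = bounded_mult (\<lambda>_. c)"
  by (auto simp: cscale_def bounded_mult_def)

lemma fourier_cscale: "fourier (cscale c u) k = c * fourier u k"
proof -
  have "fourier (cscale c u) k = (LINT x|torus. c * (fn_of u x * cnj (character k x)))"
    unfolding cscale_bounded_mult by (subst fourier_bounded_mult[where K = "cmod c"]) (auto simp: mult.assoc)
  then show ?thesis by (simp add: fourier_def)
qed

definition torus_J :: "'d::finite l2_torus \<Rightarrow>\<^sub>L 'd l2_torus"
  where "torus_J = Blinfun (cscale \<i>)"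

lemma torus_J_apply: "torus_J u = cscale \<i> u"
  unfolding torus_J_def cscale_bounded_mult
  by (subst bounded_linear_Blinfun_apply[OF bounded_linear_bounded_mult[where K = 1]]) auto

lemma finite_freq_sq_le: "finite {k :: int^'d::finite. freq_sq k \<le> R}"
proof -
  define N where "N = \<lceil>R\<rceil> + 1"
  have "{k :: int^'d. freq_sq k \<le> R} \<subseteq> vec_lambda ` (PiE UNIV (\<lambda>_. {-N..N}))"
  proof
    fix k :: "int^'d" assume "k \<in> {k. freq_sq k \<le> R}"
    then have k: "freq_sq k \<le> R" by simp
    have "k $ i \<in> {-N..N}" for i
    proof -
      have "(real_of_int (k $ i))\<^sup>2 \<le> freq_sq k"
        unfolding freq_sq_def by (rule member_le_sum) auto
      then have "(real_of_int (k $ i))\<^sup>2 \<le> R" using k by linarith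
      moreover have "real_of_int \<bar>k $ i\<bar> \<le> (real_of_int (k $ i))\<^sup>2"
      proof -
        have "\<bar>k $ i\<bar> \<le> \<bar>k $ i\<bar> * \<bar>k $ i\<bar>"
        proof (cases "k $ i = 0")
          case False
          then have "1 \<le> \<bar>k $ i\<bar>" by linarith
          then show ?thesis using mult_left_mono[of 1 "\<bar>k $ i\<bar>" "\<bar>k $ i\<bar>"] by simp
        qed simp
        then have "real_of_int \<bar>k $ i\<bar> \<le> real_of_int (\<bar>k $ i\<bar> * \<bar>k $ i\<bar>)" by (rule of_int_le_iff[THEN iffD2])
        also have "\<dots> = (real_of_int (k $ i))\<^sup>2" by (simp add: power2_eq_square flip: abs_mult)
        finally show ?thesis .
      qed
      ultimately have "real_of_int \<bar>k $ i\<bar> \<le> R" by linarith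
      then have "\<bar>k $ i\<bar> \<le> N" unfolding N_def by linarith
      then show ?thesis by auto
    qed
    then have "vec_nth k \<in> PiE UNIV (\<lambda>_. {-N..N})" by auto
    then have "vec_lambda (vec_nth k) \<in> vec_lambda ` (PiE UNIV (\<lambda>_. {-N..N}))" by (rule imageI)
    then show "k \<in> vec_lambda ` (PiE UNIV (\<lambda>_. {-N..N}))" by simp
  qed
  moreover have "finite (vec_lambda ` (PiE (UNIV :: 'd set) (\<lambda>_. {-N..N})))"
    by (intro finite_imageI finite_PiE) auto
  ultimately show ?thesis by (rule finite_subset)
qed

lemma freq_sq_nonneg: "0 \<le> freq_sq k"
  by (simp add: freq_sq_def sum_nonneg)

interpretation tor: free_schroedinger "torus_basis :: nat \<Rightarrow> 'd::finite l2_torus" "torus_weight TYPE('d)" torus_J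
proof
  show "orthonormal_basis (torus_basis :: nat \<Rightarrow> 'd l2_torus)" by (rule orthonormal_basis_torus)
  show "0 \<le> torus_weight TYPE('d) n" for n by (simp add: torus_weight_def freq_sq_nonneg)
  show "finite {n. torus_weight TYPE('d) n \<le> R}" for R
  proof -
    have "{n. torus_weight TYPE('d) n \<le> R} = freq_enum -` ({k :: int^'d. freq_sq k \<le> R} \<times> UNIV)"
      by (auto simp: torus_weight_def mem_Times_iff)
    moreover have "inj (freq_enum :: nat \<Rightarrow> (int^'d) \<times> bool)" using bij_freq_enum by (rule bij_is_inj)
    ultimately show ?thesis
      by (simp add: finite_vimageI finite_freq_sq_le)
  qed
  show "torus_J (torus_J u) = - u" for u :: "'d l2_torus"
    by (rule fourier_eqI) (simp add: torus_J_apply fourier_cscale fourier_uminus flip: mult.assoc)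
  show "torus_J u \<bullet> v = - (u \<bullet> torus_J v)" for u v :: "'d l2_torus"
  proof -
    have "bounded_mult (\<lambda>_. - \<i>) v = - cscale \<i> v"
      by (rule fourier_eqI)
        (simp add: fourier_uminus fourier_cscale cscale_bounded_mult[of "- \<i>", symmetric])
    then show ?thesis
      using bounded_mult_adj[of "\<lambda>_. \<i>" 1 u v] by (simp add: torus_J_apply cscale_bounded_mult)
  qed
  show "torus_J (torus_basis m) \<bullet> (torus_basis n :: 'd l2_torus) = 0"
    if "torus_weight TYPE('d) m \<noteq> torus_weight TYPE('d) n" for m n
  proof -
    obtain k \<beta> where m: "freq_enum m = (k :: int^'d, \<beta>)" by force
    obtain l \<gamma> where n: "freq_enum n = (l :: int^'d, \<gamma>)" by force
    have "k \<noteq> l" using that by (auto simp: torus_weight_def m n)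
    then show ?thesis
      by (simp add: inner_torus_basis[OF n] torus_J_apply fourier_cscale fourier_torus_basis[OF m])
  qed
qed

section \<open>Fourier multipliers and Sobolev norms in the real basis\<close>

lemma fourier_multiplier_eqI:
  assumes "\<And>k. fourier v k = m k * fourier u k"
  shows "fourier_multiplier m u = v"
  unfolding fourier_multiplier_def by (rule the_equality) (auto simp: assms intro: fourier_eqI)

lemma schroedinger_group_eq:
  fixes u :: "'d::finite l2_torus"
  shows "schroedinger_group t u = tor.S t u"
  unfolding schroedinger_group_def
proof (rule fourier_multiplier_eqI)
  fix k :: "int^'d"
  obtain m n where mn: "freq_enum m = (k, False)" "freq_enum n = (k, True)"
    using freq_enum_surj by metis
  have w: "torus_weight TYPE('d) m = freq_sq k" "torus_weight TYPE('d) n = freq_sq k"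
    by (simp_all add: torus_weight_def mn)
  have "exp (- \<i> * complex_of_real t * complex_of_real (- freq_sq k)) = cis (t * freq_sq k)"
    by (simp add: cis_conv_exp mult.assoc)
  then show "fourier (tor.S t u) k = exp (- \<i> * complex_of_real t * complex_of_real (- freq_sq k)) * fourier u k"
    using tor.S_inner[of t u m] tor.S_inner[of t u n]
    by (simp add: inner_torus_basis[OF mn(1)] inner_torus_basis[OF mn(2)] w torus_J_apply fourier_cscale complex_eq_iff)
qed

lemma summable_pairs_iff:
  fixes g :: "'b \<Rightarrow> bool \<Rightarrow> real"
  assumes g: "\<And>k \<beta>. 0 \<le> g k \<beta>"
  shows "case_prod g summable_on UNIV \<longleftrightarrow> (\<lambda>k. g k False + g k True) summable_on UNIV"
    and "case_prod g summable_on UNIV \<Longrightarrow> infsum (case_prod g) UNIV = (\<Sum>\<^sub>\<infinity>k. g k False + g k True)"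
proof -
  let ?A = "\<lambda>\<beta>. range (\<lambda>k::'b. (k, \<beta>))"
  have U: "UNIV = ?A False \<union> ?A True" by (auto simp: image_iff)
  have disj: "?A False \<inter> ?A True = {}" by auto
  have bij: "bij_betw (\<lambda>k::'b. (k, \<beta>)) UNIV (?A \<beta>)" for \<beta> by (auto simp: bij_betw_def inj_on_def)
  have re: "case_prod g summable_on ?A \<beta> \<longleftrightarrow> (\<lambda>k. g k \<beta>) summable_on UNIV" for \<beta>
    using summable_on_reindex_bij_betw[OF bij[of \<beta>], of "case_prod g"] by simp
  have rei: "infsum (case_prod g) (?A \<beta>) = (\<Sum>\<^sub>\<infinity>k. g k \<beta>)" for \<beta>
    using infsum_reindex_bij_betw[OF bij[of \<beta>], of "case_prod g"] by simp
  have sub: "case_prod g summable_on UNIV \<Longrightarrow> case_prod g summable_on ?A \<beta>" for \<beta>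
    by (rule summable_on_subset_banach) auto
  show "case_prod g summable_on UNIV \<longleftrightarrow> (\<lambda>k. g k False + g k True) summable_on UNIV"
  proof
    assume "case_prod g summable_on UNIV"
    then show "(\<lambda>k. g k False + g k True) summable_on UNIV"
      using sub re by (intro summable_on_add) auto
  next
    assume *: "(\<lambda>k. g k False + g k True) summable_on UNIV"
    have "(\<lambda>k. g k \<beta>) summable_on UNIV" for \<beta>
      by (rule summable_on_comparison_test[OF *]) (use g in \<open>cases \<beta>; simp\<close>)+
    then have "case_prod g summable_on (?A False \<union> ?A True)"
      using re disj by (intro summable_on_Un_disjoint) auto
    then show "case_prod g summable_on UNIV" using U by simp
  qed
  assume *: "case_prod g summable_on UNIV"
  have "infsum (case_prod g) (?A False \<union> ?A True) = infsum (case_prod g) (?A False) + infsum (case_prod g) (?A True)"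
    using sub[OF *] disj by (intro infsum_Un_disjoint) auto
  also have "\<dots> = (\<Sum>\<^sub>\<infinity>k. g k False + g k True)"
    unfolding rei using sub[OF *] re by (intro infsum_add[symmetric]) auto
  finally show "infsum (case_prod g) UNIV = (\<Sum>\<^sub>\<infinity>k. g k False + g k True)" using U by simp
qed

text \<open>The two real coordinates at a frequency are the real and the imaginary part of its
  Fourier coefficient, so their squares add up to \<open>(cmod (fourier u k))\<^sup>2\<close>. This
  links series over \<open>nat\<close> with unordered sums over the lattice.\<close>

lemma torus_basis_sum:
  fixes u :: "'d::finite l2_torus"
  assumes c: "\<And>k. 0 \<le> c k"
  shows "summable (\<lambda>n. c (fst (freq_enum n)) * (u \<bullet> torus_basis n)\<^sup>2) \<longleftrightarrow> (\<lambda>k. c k * (cmod (fourier u k))\<^sup>2) summable_on UNIV"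
    and "summable (\<lambda>n. c (fst (freq_enum n)) * (u \<bullet> torus_basis n)\<^sup>2) \<Longrightarrow>
      (\<Sum>n. c (fst (freq_enum n)) * (u \<bullet> torus_basis n)\<^sup>2) = (\<Sum>\<^sub>\<infinity>k. c k * (cmod (fourier u k))\<^sup>2)"
proof -
  define g where "g k \<beta> = c k * (if \<beta> then Im (fourier u k) else Re (fourier u k))\<^sup>2" for k \<beta>
  have g0: "0 \<le> g k \<beta>" for k \<beta> using c by (simp add: g_def)
  have gs: "g k False + g k True = c k * (cmod (fourier u k))\<^sup>2" for k
    by (simp add: g_def cmod_power2 distrib_left)
  have eq: "c (fst (freq_enum n)) * (u \<bullet> torus_basis n)\<^sup>2 = case_prod g (freq_enum n)" for n
  proof -
    have "u \<bullet> torus_basis n = (if snd (freq_enum n :: (int^'d) \<times> bool) then Im (fourier u (fst (freq_enum n))) else Re (fourier u (fst (freq_enum n))))"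
      by (rule inner_torus_basis) simp
    then show ?thesis by (simp add: case_prod_unfold g_def)
  qed
  have 1: "summable (\<lambda>n. case_prod g (freq_enum n)) \<longleftrightarrow> (\<lambda>n. case_prod g (freq_enum n)) summable_on UNIV"
    by (rule summable_on_UNIV_nonneg_real_iff[symmetric]) (simp add: case_prod_unfold g0)
  have 2: "(\<lambda>n. case_prod g (freq_enum n)) summable_on UNIV \<longleftrightarrow> case_prod g summable_on UNIV"
    by (rule summable_on_reindex_bij_betw[OF bij_freq_enum])
  show "summable (\<lambda>n. c (fst (freq_enum n)) * (u \<bullet> torus_basis n)\<^sup>2) \<longleftrightarrow> (\<lambda>k. c k * (cmod (fourier u k))\<^sup>2) summable_on UNIV"
    unfolding eq 1 2 summable_pairs_iff(1)[of g, OF g0] gs ..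
  assume "summable (\<lambda>n. c (fst (freq_enum n)) * (u \<bullet> torus_basis n)\<^sup>2)"
  then have s: "(\<lambda>n. case_prod g (freq_enum n)) summable_on UNIV" unfolding eq 1 .
  have "(\<Sum>n. case_prod g (freq_enum n)) = (\<Sum>\<^sub>\<infinity>n. case_prod g (freq_enum n))"
    using has_sum_imp_sums[OF has_sum_infsum[OF s]] by (simp add: sums_iff)
  also have "\<dots> = infsum (case_prod g) UNIV"
    by (rule infsum_reindex_bij_betw[OF bij_freq_enum])
  also have "\<dots> = (\<Sum>\<^sub>\<infinity>k. c k * (cmod (fourier u k))\<^sup>2)"
    using s unfolding 2 by (subst summable_pairs_iff(2)[of g, OF g0]) (auto simp: gs)
  finally show "(\<Sum>n. c (fst (freq_enum n)) * (u \<bullet> torus_basis n)\<^sup>2) = (\<Sum>\<^sub>\<infinity>k. c k * (cmod (fourier u k))\<^sup>2)"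
    unfolding eq .
qed

lemma one_plus_freq_sq_pos: "0 < 1 + freq_sq k" "0 \<le> 1 + freq_sq k"
  using freq_sq_nonneg[of k] by linarith+

lemma H1_eq_sobolev: "tor.H1 = (sobolev 1 :: 'd::finite l2_torus set)"
  using torus_basis_sum(1)[of "\<lambda>k :: int^'d. 1 + freq_sq k", OF one_plus_freq_sq_pos(2)]
  by (auto simp: tor.H1_def sobolev_def torus_weight_def one_plus_freq_sq_pos)

lemma N1_eq_sobolev_norm:
  fixes u :: "'d::finite l2_torus"
  assumes "u \<in> tor.H1"
  shows "tor.N1 u = (sobolev_norm 1 u)\<^sup>2"
proof -
  have "tor.N1 u = (\<Sum>\<^sub>\<infinity>k. (1 + freq_sq k) * (cmod (fourier u k))\<^sup>2)"
    using torus_basis_sum(2)[of "\<lambda>k. 1 + freq_sq k" u, OF one_plus_freq_sq_pos(2)] assms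
    by (simp add: tor.H1_def tor.N1_def torus_weight_def)
  moreover have "\<dots> \<ge> 0" by (intro infsum_nonneg mult_nonneg_nonneg one_plus_freq_sq_pos) simp
  ultimately show ?thesis by (simp add: sobolev_norm_def one_plus_freq_sq_pos)
qed

section \<open>The gradient\<close>

definition deriv_term :: "'d \<Rightarrow> 'd::finite l2_torus \<Rightarrow> nat \<Rightarrow> real"
  where "deriv_term i u n = (real_of_int (fst (freq_enum n :: (int^'d) \<times> bool) $ i))\<^sup>2 * (u \<bullet> torus_basis n)\<^sup>2"

text \<open>Where the series diverges, \<open>weak_partial\<close> is a description without a witness, and hence a
  constant; this makes \<open>grad_norm_sq\<close> measurable on all of \<open>L\<^sup>2\<close>.\<close>

lemma norm_weak_partial:
  "(norm (weak_partial i u))\<^sup>2 =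
    (if summable (deriv_term i u) then suminf (deriv_term i u) else (norm (THE v :: 'd l2_torus. False))\<^sup>2)"
  for u :: "'d::finite l2_torus"
proof -
  define m where "m n = real_of_int (fst (freq_enum n :: (int^'d) \<times> bool) $ i)" for n
  let ?J = "blinfun_apply torus_J"
  \<comment> \<open>The factor \<open>\<i>\<close> of the symbol is absorbed into
    \<open>?J u\<close>, so that both real coordinates are scaled by the same real number
    \<open>m n\<close>.\<close>
  have coef: "fourier v = (\<lambda>k. \<i> * of_int (k $ i) * fourier u k) \<longleftrightarrow> (\<forall>n. v \<bullet> torus_basis n = m n * (?J u \<bullet> torus_basis n))" for v :: "'d l2_torus"
  proof
    assume F: "fourier v = (\<lambda>k. \<i> * of_int (k $ i) * fourier u k)"
    show "\<forall>n. v \<bullet> torus_basis n = m n * (?J u \<bullet> torus_basis n)"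
    proof
      fix n
      obtain k \<beta> where n: "freq_enum n = (k :: int^'d, \<beta>)" by force
      show "v \<bullet> torus_basis n = m n * (?J u \<bullet> torus_basis n)"
        by (simp add: inner_torus_basis[OF n] F m_def n torus_J_apply fourier_cscale)
    qed
  next
    assume V: "\<forall>n. v \<bullet> torus_basis n = m n * (?J u \<bullet> torus_basis n)"
    show "fourier v = (\<lambda>k. \<i> * of_int (k $ i) * fourier u k)"
    proof
      fix k :: "int^'d"
      obtain l n where mn: "freq_enum l = (k, False)" "freq_enum n = (k, True)"
        using freq_enum_surj by metis
      show "fourier v k = \<i> * of_int (k $ i) * fourier u k"
        using V[rule_format, of l] V[rule_format, of n]
        by (simp add: inner_torus_basis[OF mn(1)] inner_torus_basis[OF mn(2)] m_def mn torus_J_apply fourier_cscale complex_eq_iff)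
    qed
  qed
  have c: "fourier (?J u) k = \<i> * fourier u k" for k by (simp add: torus_J_apply fourier_cscale)
  have term_sum: "summable (deriv_term i u) \<longleftrightarrow> summable (\<lambda>n. (m n * (?J u \<bullet> torus_basis n))\<^sup>2)"
    "summable (deriv_term i u) \<Longrightarrow> suminf (deriv_term i u) = (\<Sum>n. (m n * (?J u \<bullet> torus_basis n))\<^sup>2)"
    using torus_basis_sum[of "\<lambda>k. (real_of_int (k $ i))\<^sup>2" u] torus_basis_sum[of "\<lambda>k. (real_of_int (k $ i))\<^sup>2" "?J u"]
    by (simp_all add: deriv_term_def[abs_def] m_def power_mult_distrib c norm_mult)
  show ?thesis
  proof (cases "summable (deriv_term i u)")
    case True
    then obtain v :: "'d l2_torus" where v: "\<And>n. v \<bullet> torus_basis n = m n * (?J u \<bullet> torus_basis n)"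
      using riesz_fischer[OF orthonormal_basis_torus] term_sum(1) by metis
    then have "fourier v = (\<lambda>k. \<i> * of_int (k $ i) * fourier u k)" using coef by blast
    then have "weak_partial i u = v"
      unfolding weak_partial_def by (intro fourier_multiplier_eqI) simp
    then show ?thesis
      using True parseval_norm[OF orthonormal_basis_torus, of v] by (simp add: v term_sum(2) sums_iff)
  next
    case False
    have "\<not> (\<forall>k. fourier v k = \<i> * of_int (k $ i) * fourier u k)" for v :: "'d l2_torus"
    proof
      assume "\<forall>k. fourier v k = \<i> * of_int (k $ i) * fourier u k"
      then have "\<forall>n. v \<bullet> torus_basis n = m n * (?J u \<bullet> torus_basis n)" using coef by blast
      then show False
        using False parseval_norm[OF orthonormal_basis_torus, of v] term_sum(1) by (simp add: sums_iff)
    qed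
    then have "(\<lambda>v. \<forall>k. fourier v k = \<i> * of_int (k $ i) * fourier u k) = (\<lambda>_ :: 'd l2_torus. False)"
      by (intro ext) simp
    then show ?thesis using False by (simp add: weak_partial_def fourier_multiplier_def)
  qed
qed

lemma grad_norm_sq_eq: "grad_norm_sq u = (\<Sum>i\<in>UNIV. (norm (weak_partial i u))\<^sup>2)"
proof -
  have "integrable torus (\<lambda>x. (cmod (fn_of v x))\<^sup>2)" for v :: "'a l2_torus"
    using sq_integrable_fn_of[of v] by (simp add: sq_integrable_def del: sq_integrable_fn_of)
  then show ?thesis
    by (simp add: grad_norm_sq_def Bochner_Integration.integral_sum power2_norm_eq_inner inner_l2_self)
qed

lemma grad_norm_sq_nonneg: "0 \<le> grad_norm_sq u"
  by (simp add: grad_norm_sq_eq sum_nonneg)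

lemma grad_norm_sq_measurable [measurable]: "(grad_norm_sq :: 'd::finite l2_torus \<Rightarrow> real) \<in> borel_measurable borel"
proof -
  define g where "g i n u = deriv_term i u n" for i n and u :: "'d l2_torus"
  have g_meas [measurable]: "g i n \<in> borel_measurable borel" for i n
    unfolding g_def[abs_def] deriv_term_def
    by (intro borel_measurable_times borel_measurable_const borel_measurable_power borel_measurable_inner measurable_ident_sets[OF refl])
  have g_eq: "deriv_term i u = (\<lambda>n. g i n u)" for i u by (simp add: g_def)
  \<comment> \<open>The extended nonnegative sum is measurable and is finite exactly where the
    series converges, so the case distinction of \<open>norm_weak_partial\<close> is Borel.\<close>
  have sum_iff: "summable (\<lambda>n. g i n u) \<longleftrightarrow> (\<Sum>n. ennreal (g i n u)) < top" for i u
  proof -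
    have "0 \<le> g i n u" for n by (simp add: g_def deriv_term_def)
    then show ?thesis
      using summable_suminf_not_top[of "\<lambda>n. g i n u"] ennreal_suminf_neq_top[of "\<lambda>n. g i n u"]
      unfolding less_top[symmetric] by blast
  qed
  have "(\<lambda>u :: 'd l2_torus. (norm (weak_partial i u))\<^sup>2) \<in> borel_measurable borel" for i
  proof -
    have "(\<lambda>u. if (\<Sum>n. ennreal (g i n u)) < top then (\<Sum>n. g i n u) else (norm (THE v :: 'd l2_torus. False))\<^sup>2) \<in> borel_measurable borel"
    proof (rule measurable_If)
      show "(\<lambda>u. \<Sum>n. g i n u) \<in> borel_measurable borel"
        by (rule borel_measurable_suminf[OF g_meas])
      have f: "(\<lambda>u. \<Sum>n. ennreal (g i n u)) \<in> borel_measurable borel"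
        by (intro borel_measurable_suminf_order measurable_compose[OF g_meas measurable_ennreal])
      show "{u \<in> space borel. (\<Sum>n. ennreal (g i n u)) < top} \<in> sets borel"
        by (rule borel_measurable_less[OF f borel_measurable_const])
    qed simp
    moreover have "(norm (weak_partial i u))\<^sup>2 = (if (\<Sum>n. ennreal (g i n u)) < top then (\<Sum>n. g i n u) else (norm (THE v :: 'd l2_torus. False))\<^sup>2)" for u
      by (subst norm_weak_partial) (simp only: g_eq sum_iff)
    ultimately show ?thesis by simp
  qed
  then show ?thesis
    unfolding grad_norm_sq_eq[abs_def] by (intro borel_measurable_sum)
qed

lemma grad_norm_sq_sums:
  fixes u :: "'d::finite l2_torus"
  assumes "u \<in> tor.H1"
  shows "(\<lambda>n. torus_weight TYPE('d) n * (u \<bullet> torus_basis n)\<^sup>2) sums grad_norm_sq u"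
proof -
  have w: "torus_weight TYPE('d) n * (u \<bullet> torus_basis n)\<^sup>2 = (\<Sum>i\<in>UNIV. deriv_term i u n)" for n
    by (simp add: torus_weight_def freq_sq_def deriv_term_def sum_distrib_right)
  have s: "summable (deriv_term i u)" for i
  proof (rule summable_comparison_test')
    show "summable (\<lambda>n. (1 + torus_weight TYPE('d) n) * (u \<bullet> torus_basis n)\<^sup>2)"
      using assms by (simp add: tor.H1_def)
    show "norm (deriv_term i u n) \<le> (1 + torus_weight TYPE('d) n) * (u \<bullet> torus_basis n)\<^sup>2" for n
    proof -
      have nn: "0 \<le> deriv_term i u n" for i by (simp add: deriv_term_def)
      have "deriv_term i u n \<le> (\<Sum>i\<in>UNIV. deriv_term i u n)"
        by (rule member_le_sum) (auto intro: nn)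
      also have "\<dots> \<le> (1 + torus_weight TYPE('d) n) * (u \<bullet> torus_basis n)\<^sup>2"
        unfolding w[symmetric] by (intro mult_right_mono) auto
      finally show ?thesis using nn by simp
    qed
  qed
  then have "(\<lambda>n. \<Sum>i\<in>UNIV. deriv_term i u n) sums (\<Sum>i\<in>UNIV. suminf (deriv_term i u))"
    by (intro sums_sum) (rule summable_sums)
  then show ?thesis
    unfolding w grad_norm_sq_eq norm_weak_partial using s by simp
qed

section \<open>Summability over the integer lattice\<close>

text \<open>In one coordinate the exponent has to exceed 1/2 for convergence. With 2/3, three
  coordinates cost exactly the exponent 2 that \<open>sobolev 3\<close> leaves in dimension
  three.\<close>

lemma int_powr_summable: "(\<lambda>m::int. (1 + (real_of_int m)\<^sup>2) powr (- 2/3)) summable_on UNIV"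
proof -
  define h where "h m = (1 + (real_of_int m)\<^sup>2) powr (- 2/3)" for m :: int
  have s: "summable (\<lambda>n::nat. h (int n))"
  proof (rule summable_comparison_test')
    show "summable (\<lambda>n. real n powr (- 4/3))" by (simp add: summable_real_powr_iff)
    show "norm (h (int n)) \<le> real n powr (- 4/3)" if "n \<ge> 1" for n
    proof -
      have "h (int n) \<le> ((real n)\<^sup>2) powr (- 2/3)"
        unfolding h_def using that by (intro powr_mono2') auto
      also have "\<dots> = (real n powr 2) powr (- 2/3)" using that by simp
      also have "\<dots> = real n powr (- 4/3)" unfolding powr_powr by simp
      finally show ?thesis by (simp add: h_def)
    qed
  qed
  have 1: "h summable_on range int"
  proof -
    have "(\<lambda>n. h (int n)) summable_on UNIV"
      using s by (subst summable_on_UNIV_nonneg_real_iff) (auto simp: h_def)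
    then show ?thesis
      using summable_on_reindex_bij_betw[of int UNIV "range int" h] by (simp add: bij_betw_def)
  qed
  have 2: "h summable_on range (\<lambda>n. - int (Suc n))"
  proof -
    have "summable (\<lambda>n. h (int (Suc n)))" using s by (subst summable_Suc_iff)
    moreover have "h (- m) = h m" for m by (simp add: h_def)
    ultimately have "summable (\<lambda>n. h (- int (Suc n)))" by (simp only:)
    then have "(\<lambda>n. h (- int (Suc n))) summable_on UNIV"
      by (subst summable_on_UNIV_nonneg_real_iff) (auto simp: h_def)
    then show ?thesis
      using summable_on_reindex_bij_betw[of "\<lambda>n. - int (Suc n)" UNIV "range (\<lambda>n. - int (Suc n))" h]
      by (simp add: bij_betw_def inj_on_def)
  qed
  have "h summable_on (range int \<union> range (\<lambda>n. - int (Suc n)))"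
    by (rule summable_on_Un_disjoint[OF 1 2]) auto
  moreover have "range int \<union> range (\<lambda>n. - int (Suc n)) = UNIV"
  proof -
    have "m \<in> range int \<union> range (\<lambda>n. - int (Suc n))" for m
      by (cases m rule: int_cases) auto
    then show ?thesis by blast
  qed
  ultimately show ?thesis by (simp add: h_def[abs_def])
qed

text \<open>A finite set of lattice points lies in a box, over which the sum of products is the
  product of the coordinate sums.\<close>

lemma lattice_prod_summable:
  fixes h :: "int \<Rightarrow> real"
  assumes h: "h summable_on UNIV" and nn: "\<And>m. 0 \<le> h m"
  shows "(\<lambda>k::int^'d. \<Prod>i\<in>UNIV. h (k $ i)) summable_on UNIV"
proof (rule nonneg_bdd_above_summable_on)
  show "0 \<le> (\<Prod>i\<in>UNIV. h (k $ i))" for k :: "int^'d" using nn by (simp add: prod_nonneg)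
  show "bdd_above (sum (\<lambda>k::int^'d. \<Prod>i\<in>UNIV. h (k $ i)) ` {F. F \<subseteq> UNIV \<and> finite F})"
  proof (rule bdd_aboveI2)
    fix F :: "(int^'d) set" assume "F \<in> {F. F \<subseteq> UNIV \<and> finite F}"
    then have F: "finite F" by simp
    define U where "U = (\<Union>i. (\<lambda>k. k $ i) ` F)"
    have U: "finite U" using F by (simp add: U_def)
    have inj: "inj_on vec_nth F" by (auto intro!: inj_onI simp: vec_nth_inject)
    have "(\<Sum>k\<in>F. \<Prod>i\<in>UNIV. h (k $ i)) = (\<Sum>g\<in>vec_nth ` F. \<Prod>i\<in>UNIV. h (g i))"
      by (simp add: sum.reindex[OF inj])
    also have "\<dots> \<le> (\<Sum>g\<in>PiE UNIV (\<lambda>_::'d. U). \<Prod>i\<in>UNIV. h (g i))"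
    proof (rule sum_mono2)
      show "finite (PiE UNIV (\<lambda>_::'d. U))" using U by (intro finite_PiE) auto
      show "vec_nth ` F \<subseteq> PiE UNIV (\<lambda>_. U)" by (auto simp: U_def)
      show "0 \<le> (\<Prod>i\<in>UNIV. h (g i))" for g :: "'d \<Rightarrow> int" using nn by (simp add: prod_nonneg)
    qed
    also have "\<dots> = (\<Prod>i\<in>(UNIV :: 'd set). \<Sum>m\<in>U. h m)"
      by (rule prod_sum_PiE[symmetric]) (use U in auto)
    also have "\<dots> \<le> (\<Prod>i\<in>(UNIV :: 'd set). infsum h UNIV)"
      using nn U by (intro prod_mono conjI sum_nonneg finite_sum_le_infsum[OF h]) auto
    finally show "(\<Sum>k\<in>F. \<Prod>i\<in>UNIV. h (k $ i)) \<le> (\<Prod>i\<in>(UNIV :: 'd set). infsum h UNIV)" .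
  qed
qed

text \<open>The decay is divided into one share of exponent 2/3 per coordinate. As
  \<open>1 + freq_sq k\<close> dominates each one-dimensional weight, each share is at most a
  one-dimensional term.\<close>

lemma lattice_powr_summable:
  assumes p: "2 * real CARD('d) / 3 \<le> p"
  shows "(\<lambda>k::int^'d::finite. (1 + freq_sq k) powr (- p)) summable_on UNIV"
proof (rule summable_on_comparison_test)
  show "(\<lambda>k::int^'d. \<Prod>i\<in>UNIV. (1 + (real_of_int (k $ i))\<^sup>2) powr (- 2/3)) summable_on UNIV"
    by (rule lattice_prod_summable[OF int_powr_summable]) simp
  show "(1 + freq_sq k) powr (- p) \<le> (\<Prod>i\<in>UNIV. (1 + (real_of_int (k $ i))\<^sup>2) powr (- 2/3))" for k :: "int^'d"
  proof -
    have "(1 + freq_sq k) powr (- p) \<le> (1 + freq_sq k) powr (real CARD('d) * (- 2/3))"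
      using p freq_sq_nonneg[of k] by (intro powr_mono) auto
    also have "\<dots> = (\<Prod>i\<in>(UNIV :: 'd set). (1 + freq_sq k) powr (- 2/3))"
      using one_plus_freq_sq_pos[of k] by (simp add: powr_realpow[symmetric] powr_powr mult.commute)
    also have "\<dots> \<le> (\<Prod>i\<in>UNIV. (1 + (real_of_int (k $ i))\<^sup>2) powr (- 2/3))"
    proof (intro prod_mono conjI)
      fix i
      have "(real_of_int (k $ i))\<^sup>2 \<le> freq_sq k" unfolding freq_sq_def by (rule member_le_sum) auto
      then show "(1 + freq_sq k) powr (- 2/3) \<le> (1 + (real_of_int (k $ i))\<^sup>2) powr (- 2/3)"
        by (intro powr_mono2') (auto intro: add_pos_nonneg)
    qed simp
    finally show ?thesis .
  qed
qed simp

text \<open>The weight splits as \<open>1/2 = \<sigma>/2 - (\<sigma> - 1)/2\<close>, and Young's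
  inequality separates the Sobolev sum of \<open>V\<close> from a lattice sum. The condition reads
  \<open>2/3 \<le> 1\<close> for dimension 1 and \<open>\<sigma> = 2\<close>, and
  \<open>4/3 \<le> 2\<close> and \<open>2 \<le> 2\<close> for dimensions 2 and 3 and
  \<open>\<sigma> = 3\<close>.\<close>

lemma sobolev_weighted_l1:
  fixes V :: "'d::finite l2_torus"
  assumes V: "V \<in> sobolev \<sigma>" and \<sigma>: "2 * real CARD('d) / 3 \<le> \<sigma> - 1"
  shows "(\<lambda>k. sqrt (1 + freq_sq k) * cmod (fourier V k)) summable_on UNIV"
proof (rule summable_on_comparison_test)
  show "(\<lambda>k. 1/2 * ((1 + freq_sq k) powr \<sigma> * (cmod (fourier V k))\<^sup>2 + (1 + freq_sq k) powr (- (\<sigma> - 1)))) summable_on UNIV"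
    using V lattice_powr_summable[OF \<sigma>] by (intro summable_on_cmult_right summable_on_add) (auto simp: sobolev_def)
  show "sqrt (1 + freq_sq k) * cmod (fourier V k) \<le> 1/2 * ((1 + freq_sq k) powr \<sigma> * (cmod (fourier V k))\<^sup>2 + (1 + freq_sq k) powr (- (\<sigma> - 1)))" for k
  proof -
    note pos = one_plus_freq_sq_pos[of k]
    define x where "x = (1 + freq_sq k) powr (\<sigma> / 2) * cmod (fourier V k)"
    define y where "y = (1 + freq_sq k) powr (- (\<sigma> - 1) / 2)"
    have "x * y = (1 + freq_sq k) powr (\<sigma> / 2 + - (\<sigma> - 1) / 2) * cmod (fourier V k)"
      by (simp add: x_def y_def powr_add)
    also have "\<sigma> / 2 + - (\<sigma> - 1) / 2 = 1 / 2" by (simp add: field_simps)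
    finally have xy: "x * y = sqrt (1 + freq_sq k) * cmod (fourier V k)"
      using pos by (simp add: powr_half_sqrt)
    have "x\<^sup>2 = (1 + freq_sq k) powr \<sigma> * (cmod (fourier V k))\<^sup>2"
      using pos by (simp add: x_def power_mult_distrib powr_powr flip: powr_numeral)
    moreover have "y\<^sup>2 = (1 + freq_sq k) powr (- (\<sigma> - 1))"
    proof -
      have "y\<^sup>2 = y powr 2" using pos by (simp add: y_def)
      also have "\<dots> = (1 + freq_sq k) powr (- (\<sigma> - 1) / 2 * 2)" unfolding y_def by (rule powr_powr)
      also have "- (\<sigma> - 1) / 2 * 2 = - (\<sigma> - 1)" by simp
      finally show ?thesis .
    qed
    ultimately show ?thesis using sum_squares_bound[of x y] xy by simp
  qed
  show "0 \<le> sqrt (1 + freq_sq k) * cmod (fourier V k)" for k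
    using one_plus_freq_sq_pos[of k] by simp
qed

section \<open>Multiplication by the potential\<close>

context free_schroedinger
begin

lemma Lam_inj: "Lam x = Lam y \<Longrightarrow> x = y"
  using N1_Lam[of "x - y"] by (simp add: blinfun.diff_right N1_def)

text \<open>Conjugation with \<open>Lam\<close> turns a bound on H1 into an operator norm on L2, so
  that a series of multipliers can be summed in the Banach space of bounded operators.\<close>

lemma H1_operator_lift:
  fixes T :: "'a \<Rightarrow>\<^sub>L 'a"
  assumes T: "\<And>x. blinfun_apply T (Lam x) \<in> H1"
    "\<And>x. N1 (blinfun_apply T (Lam x)) \<le> C\<^sup>2 * (norm x)\<^sup>2" and C: "0 \<le> C"
  shows "\<exists>T1. norm T1 \<le> C \<and> (\<forall>x. Lam (blinfun_apply T1 x) = blinfun_apply T (Lam x))"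
proof -
  have "\<forall>x. \<exists>z. blinfun_apply T (Lam x) = Lam z"
    using H1_Lam[OF T(1)] by blast
  then obtain g where g: "\<And>x. blinfun_apply T (Lam x) = Lam (g x)" by metis
  have norm: "norm (g x) \<le> C * norm x" for x
  proof (rule power2_le_imp_le)
    show "(norm (g x))\<^sup>2 \<le> (C * norm x)\<^sup>2"
      using T(2)[of x] by (simp add: g N1_Lam power_mult_distrib)
  qed (use C in simp)
  have "bounded_linear g"
  proof (rule bounded_linear_intro)
    show "g (x + y) = g x + g y" for x y
      by (rule Lam_inj) (simp add: blinfun.add_right g[symmetric])
    show "g (r *\<^sub>R x) = r *\<^sub>R g x" for r x
      by (rule Lam_inj) (simp add: blinfun.scaleR_right g[symmetric])
    show "norm (g x) \<le> norm x * C" for x using norm[of x] by (simp add: mult.commute)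
  qed
  then have "blinfun_apply (Blinfun g) = g" by (rule bounded_linear_Blinfun_apply)
  then show ?thesis
    using g norm C by (intro exI[of _ "Blinfun g"]) (auto intro: norm_blinfun_bound)
qed

end

lemma norm_cmult_character: "cmod (c * character (m :: int^'d) x) \<le> cmod c / sqrt ((2 * pi) ^ CARD('d))"
  by (simp add: norm_mult norm_character)

lemma fourier_mult_character:
  fixes u :: "'d::finite l2_torus"
  shows "fourier (bounded_mult (\<lambda>x. c * character m x) u) k = c / sqrt ((2 * pi) ^ CARD('d)) * fourier u (k - m)"
proof -
  have "character m x * cnj (character k x) = cnj (character (k - m) x) / sqrt ((2 * pi) ^ CARD('d))" for x :: "real^'d"
  proof -
    have s: "(\<Sum>i\<in>UNIV. real_of_int ((k - m) $ i) * x $ i) = (\<Sum>i\<in>UNIV. real_of_int (k $ i) * x $ i) + - (\<Sum>i\<in>UNIV. real_of_int (m $ i) * x $ i)"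
      by (simp add: left_diff_distrib sum_subtractf)
    show ?thesis
      unfolding character_def s cis_mult[symmetric] by (simp add: cis_cnj)
  qed
  then have eq: "c * character m x * fn_of u x * cnj (character k x)
      = c / sqrt ((2 * pi) ^ CARD('d)) * (fn_of u x * cnj (character (k - m) x))" for x
    by (simp add: mult.assoc mult.left_commute[of "character m x"])
  show ?thesis
    by (subst fourier_bounded_mult[OF _ norm_cmult_character]) (simp_all only: eq integral_mult_right_zero fourier_def, simp)
qed

text \<open>Multiplication by a character shifts the frequencies by \<open>m\<close>. Peetre's
  inequality bounds the change of weight by the factor \<open>2 * (1 + freq_sq m)\<close>, where 2
  stems from \<open>(a + b)\<^sup>2 \<le> 2 * a\<^sup>2 + 2 * b\<^sup>2\<close>.\<close>

lemma mult_character_H1: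
  fixes y :: "'d::finite l2_torus" and c :: complex and m :: "int^'d"
  assumes y: "y \<in> tor.H1"
  defines "z \<equiv> bounded_mult (\<lambda>x. c * character m x) y"
  shows "z \<in> tor.H1" and "tor.N1 z \<le> (sqrt 2 * cmod c * sqrt (1 + freq_sq m) / sqrt ((2 * pi) ^ CARD('d)))\<^sup>2 * tor.N1 y"
proof -
  define q where "q = cmod c / sqrt ((2 * pi) ^ CARD('d))"
  define G where "G k = (1 + freq_sq k) * (cmod (fourier y k))\<^sup>2" for k
  have Fz: "cmod (fourier z k) = q * cmod (fourier y (k - m))" for k
    by (simp add: z_def fourier_mult_character norm_mult norm_divide q_def)
  have bij: "bij_betw (\<lambda>k. k - m) UNIV (UNIV :: (int^'d) set)"
    by (rule bij_betwI[where g = "\<lambda>k. k + m"]) auto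
  have G: "G summable_on UNIV"
    using y torus_basis_sum(1)[of "\<lambda>k :: int^'d. 1 + freq_sq k" y, OF one_plus_freq_sq_pos(2)]
    by (simp add: tor.H1_def torus_weight_def G_def[abs_def])
  then have Gs: "(\<lambda>k. G (k - m)) summable_on UNIV"
    using summable_on_reindex_bij_betw[OF bij, of G] by simp
  have peetre: "1 + freq_sq k \<le> 2 * (1 + freq_sq m) * (1 + freq_sq (k - m))" for k
  proof -
    have "(real_of_int (k $ i))\<^sup>2 \<le> 2 * (real_of_int (m $ i))\<^sup>2 + 2 * (real_of_int ((k - m) $ i))\<^sup>2" for i
    proof -
      have "(a + b)\<^sup>2 \<le> 2 * a\<^sup>2 + 2 * b\<^sup>2" for a b :: real
        using sum_squares_bound[of a b] by (simp add: power2_sum)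
      from this[of "real_of_int (m $ i)" "real_of_int ((k - m) $ i)"] show ?thesis by simp
    qed
    then have "freq_sq k \<le> (\<Sum>i\<in>UNIV. 2 * (real_of_int (m $ i))\<^sup>2 + 2 * (real_of_int ((k - m) $ i))\<^sup>2)"
      unfolding freq_sq_def by (intro sum_mono)
    also have "\<dots> = 2 * freq_sq m + 2 * freq_sq (k - m)"
      by (simp add: freq_sq_def sum.distrib sum_distrib_left)
    also have "1 + (2 * freq_sq m + 2 * freq_sq (k - m)) \<le> 2 * (1 + freq_sq m) * (1 + freq_sq (k - m))"
      using freq_sq_nonneg[of m] freq_sq_nonneg[of "k - m"] by (simp add: algebra_simps)
    finally show ?thesis by simp
  qed
  define D where "D = q\<^sup>2 * (2 * (1 + freq_sq m))"
  have le: "(1 + freq_sq k) * (cmod (fourier z k))\<^sup>2 \<le> D * G (k - m)" for k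
  proof -
    have "(1 + freq_sq k) * (q\<^sup>2 * (cmod (fourier y (k - m)))\<^sup>2) \<le> (2 * (1 + freq_sq m) * (1 + freq_sq (k - m))) * (q\<^sup>2 * (cmod (fourier y (k - m)))\<^sup>2)"
      by (intro mult_right_mono peetre) simp
    then show ?thesis by (simp add: Fz power_mult_distrib D_def G_def algebra_simps)
  qed
  have s: "(\<lambda>k. (1 + freq_sq k) * (cmod (fourier z k))\<^sup>2) summable_on UNIV"
    by (rule summable_on_comparison_test[OF summable_on_cmult_right[OF Gs] le])
      (intro mult_nonneg_nonneg one_plus_freq_sq_pos zero_le_power2)
  have N: "tor.N1 v = (\<Sum>\<^sub>\<infinity>k. (1 + freq_sq k) * (cmod (fourier v k))\<^sup>2)" if "v \<in> tor.H1" for v :: "'d l2_torus"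
    using torus_basis_sum(2)[of "\<lambda>k :: int^'d. 1 + freq_sq k" v, OF one_plus_freq_sq_pos(2)] that
    by (simp add: tor.H1_def tor.N1_def torus_weight_def)
  show z: "z \<in> tor.H1"
    using s torus_basis_sum(1)[of "\<lambda>k :: int^'d. 1 + freq_sq k" z, OF one_plus_freq_sq_pos(2)]
    by (simp add: tor.H1_def torus_weight_def)
  have "tor.N1 z \<le> (\<Sum>\<^sub>\<infinity>k. D * G (k - m))"
    unfolding N[OF z] by (rule infsum_mono[OF s summable_on_cmult_right[OF Gs] le])
  also have "\<dots> = D * infsum G UNIV"
    using infsum_reindex_bij_betw[OF bij, of G] by (simp add: infsum_cmult_right')
  also have "infsum G UNIV = tor.N1 y" by (simp add: N[OF y] G_def[abs_def])
  also have "D = (sqrt 2 * cmod c * sqrt (1 + freq_sq m) / sqrt ((2 * pi) ^ CARD('d)))\<^sup>2"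
    using one_plus_freq_sq_pos[of m] by (simp add: D_def q_def power_mult_distrib power_divide)
  finally show "tor.N1 z \<le> (sqrt 2 * cmod c * sqrt (1 + freq_sq m) / sqrt ((2 * pi) ^ CARD('d)))\<^sup>2 * tor.N1 y" .
qed

lemma fourier_tendsto:
  assumes "X \<longlonglongrightarrow> (u :: 'd::finite l2_torus)"
  shows "(\<lambda>n. fourier (X n) k) \<longlonglongrightarrow> fourier u k"
proof -
  obtain l n where mn: "freq_enum l = (k, False)" "freq_enum n = (k, True)"
    using freq_enum_surj by metis
  have "(\<lambda>j. Complex (X j \<bullet> torus_basis l) (X j \<bullet> torus_basis n)) \<longlonglongrightarrow> Complex (u \<bullet> torus_basis l) (u \<bullet> torus_basis n)"
    by (intro tendsto_Complex tendsto_intros assms)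
  then show ?thesis by (simp add: inner_torus_basis[OF mn(1)] inner_torus_basis[OF mn(2)])
qed

text \<open>The Fourier series of the potential converges absolutely, and each term \<open>V\<^sub>k e\<^sub>k\<close> acts on \<open>H\<^sup>1\<close>
  with norm \<open>O((1 + \<bar>k\<bar>\<^sup>2)\<^sup>1\<^sup>/\<^sup>2 \<bar>V\<^sub>k\<bar>)\<close>.\<close>

lemma potential_operator:
  fixes V :: "'d::finite l2_torus"
  assumes real: "real_valued V"
    and V: "(\<lambda>k. sqrt (1 + freq_sq k) * cmod (fourier V k)) summable_on UNIV"
  shows "\<exists>V1. schroedinger torus_basis (torus_weight TYPE('d)) torus_J (Blinfun (potential_mult V)) V1"
    and "bounded_linear (potential_mult V)"
    and "\<exists>K. \<forall>u. (LINT x|torus. \<bar>Re (fn_of V x)\<bar> * (cmod (fn_of u x))\<^sup>2) \<le> K * (norm u)\<^sup>2"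
    and "potential_mult V u \<bullet> u = (LINT x|torus. Re (fn_of V x) * (cmod (fn_of u x))\<^sup>2)"
    and "2 * \<bar>potential_mult V u \<bullet> v\<bar> \<le> (LINT x|torus. \<bar>Re (fn_of V x)\<bar> * (cmod (fn_of u x))\<^sup>2)
      + (LINT x|torus. \<bar>Re (fn_of V x)\<bar> * (cmod (fn_of v x))\<^sup>2)"
proof -
  define \<iota> where "\<iota> = (from_nat_into UNIV :: nat \<Rightarrow> int^'d)"
  have bij: "bij_betw \<iota> UNIV UNIV"
    unfolding \<iota>_def by (intro bij_betw_from_nat_into infinite_UNIV_int_vec) simp
  define q where "q = 1 / sqrt ((2 * pi) ^ CARD('d))"
  have q: "q > 0" by (simp add: q_def)
  define a where "a n = fourier V (\<iota> n)" for n
  define f where "f n x = a n * character (\<iota> n) x" for n x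
  have sw: "summable (\<lambda>n. sqrt (1 + freq_sq (\<iota> n)) * cmod (a n))"
  proof -
    have "(\<lambda>n. sqrt (1 + freq_sq (\<iota> n)) * cmod (a n)) summable_on UNIV"
      unfolding a_def using V summable_on_reindex_bij_betw[OF bij, of "\<lambda>k. sqrt (1 + freq_sq k) * cmod (fourier V k)"] by simp
    then show ?thesis by (rule summable_on_imp_summable)
  qed
  have sa: "summable (\<lambda>n. cmod (a n))"
  proof (rule summable_comparison_test'[OF sw])
    fix n
    have "1 * cmod (a n) \<le> sqrt (1 + freq_sq (\<iota> n)) * cmod (a n)"
      using freq_sq_nonneg[of "\<iota> n"] by (intro mult_right_mono) auto
    then show "norm (cmod (a n)) \<le> sqrt (1 + freq_sq (\<iota> n)) * cmod (a n)" by simp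
  qed
  \<comment> \<open>Every character has modulus \<open>q\<close>, so \<open>G\<close> bounds all
    partial sums and the limit \<open>g\<close> uniformly.\<close>
  define G where "G = q * (\<Sum>n. cmod (a n))"
  define g where "g x = (\<Sum>n. f n x)" for x
  have f_norm: "cmod (f n x) = q * cmod (a n)" for n x
    by (simp add: f_def norm_mult norm_character q_def)
  have f_meas [measurable]: "f n \<in> borel_measurable torus" for n
    unfolding f_def[abs_def] by measurable
  have sf: "summable (\<lambda>n. cmod (f n x))" for x
    unfolding f_norm using sa by (rule summable_mult)
  have f_lim: "(\<lambda>n. \<Sum>i<n. f i x) \<longlonglongrightarrow> g x" for x
    unfolding g_def using summable_LIMSEQ[OF summable_norm_cancel[OF sf]] .
  have partial_le: "cmod (\<Sum>i<n. f i x) \<le> G" for n x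
  proof -
    have "cmod (\<Sum>i<n. f i x) \<le> (\<Sum>i<n. cmod (f i x))" by (rule norm_sum)
    also have "\<dots> = q * (\<Sum>i<n. cmod (a i))" by (simp add: f_norm sum_distrib_left)
    also have "\<dots> \<le> G" unfolding G_def using q sa by (intro mult_left_mono sum_le_suminf) auto
    finally show ?thesis .
  qed
  have partial_meas: "(\<lambda>x. \<Sum>i<n. f i x) \<in> borel_measurable torus" for n by measurable
  have g_meas [measurable]: "g \<in> borel_measurable torus"
    by (rule borel_measurable_LIMSEQ_metric[OF partial_meas f_lim])
  have g_le: "cmod (g x) \<le> G" for x
    by (rule tendsto_upperbound[OF tendsto_norm[OF f_lim]]) (use partial_le in auto)
  have sq_f: "sq_integrable (f n)" for n
    unfolding f_def[abs_def] by (rule sq_integrable_cmult_character)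
  \<comment> \<open>\<open>V\<close> is given only as an element of L2. Once it is represented by
    the bounded function \<open>g\<close>, multiplication by \<open>V\<close> is a bounded operator
    and can be approximated by partial sums.\<close>
  have "class_of g = V"
  proof (rule fourier_eqI)
    fix k
    have "(\<lambda>n. class_of (\<lambda>x. \<Sum>i<n. f i x)) \<longlonglongrightarrow> class_of g"
      by (rule class_of_tendsto_bounded[OF partial_meas partial_le f_lim])
    then have "(\<lambda>n. fourier (class_of (\<lambda>x. \<Sum>i<n. f i x)) k) \<longlonglongrightarrow> fourier (class_of g) k"
      by (rule fourier_tendsto)
    moreover have "\<forall>\<^sub>F n in sequentially. fourier (class_of (\<lambda>x. \<Sum>i<n. f i x)) k = fourier V k"
    proof -
      obtain j where j: "\<iota> j = k" using bij by (metis bij_def surjD)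
      have "fourier (class_of (\<lambda>x. \<Sum>i<n. f i x)) k = fourier V k" if "n > j" for n
      proof -
        have "fourier (class_of (\<lambda>x. \<Sum>i<n. f i x)) k = (LINT x|torus. (\<Sum>i<n. f i x) * cnj (character k x))"
          by (rule fourier_class_of) (intro sq_integrable_sum sq_f)
        also have "\<dots> = (LINT x|torus. (\<Sum>i<n. a i * (character (\<iota> i) x * cnj (character k x))))"
          by (simp add: sum_distrib_right f_def mult.assoc)
        also have "\<dots> = (\<Sum>i<n. LINT x|torus. a i * (character (\<iota> i) x * cnj (character k x)))"
          by (intro Bochner_Integration.integral_sum integrable_mult_right sq_integrable_mult_integrable sq_integrable_character)
        also have "\<dots> = (\<Sum>i<n. if i = j then a i else 0)"
        proof (intro sum.cong refl)
          fix i
          have "\<iota> i = k \<longleftrightarrow> i = j" using bij j by (metis bij_def injD)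
          then show "(LINT x|torus. a i * (character (\<iota> i) x * cnj (character k x))) = (if i = j then a i else 0)"
            by (simp only: integral_mult_right_zero character_orthonormal) simp
        qed
        also have "\<dots> = fourier V k" using that by (simp add: a_def j)
        finally show ?thesis .
      qed
      then show ?thesis by (auto simp: eventually_at_top_dense)
    qed
    then have "(\<lambda>n. fourier (class_of (\<lambda>x. \<Sum>i<n. f i x)) k) \<longlonglongrightarrow> fourier V k"
      by (rule tendsto_eventually)
    ultimately show "fourier (class_of g) k = fourier V k" by (rule LIMSEQ_unique)
  qed
  then have Vg: "AE x in torus. fn_of V x = g x"
    using fn_of_class_of[OF sq_integrable_bounded[OF g_meas g_le]] by simp
  have pm: "potential_mult V = bounded_mult g"
  proof
    fix u
    have ae: "AE x in torus. fn_of V x * fn_of u x = g x * fn_of u x"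
      using Vg by eventually_elim simp
    have sq: "sq_integrable (\<lambda>x. g x * fn_of u x)"
      by (rule sq_integrable_bounded_mult[OF g_meas g_le sq_integrable_fn_of])
    have "integrable torus (\<lambda>x. (cmod (fn_of V x * fn_of u x))\<^sup>2)"
    proof (rule integrable_cong_AE_imp)
      show "integrable torus (\<lambda>x. (cmod (g x * fn_of u x))\<^sup>2)" using sq by (simp add: sq_integrable_def)
      show "AE x in torus. (cmod (g x * fn_of u x))\<^sup>2 = (cmod (fn_of V x * fn_of u x))\<^sup>2"
        using ae by eventually_elim (simp only:)
    qed measurable
    then have "sq_integrable (\<lambda>x. fn_of V x * fn_of u x)" by (simp add: sq_integrable_def)
    then show "potential_mult V u = bounded_mult g u"
      unfolding potential_mult_def bounded_mult_def using sq ae by (simp add: class_of_eq_iff)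
  qed
  show bl: "bounded_linear (potential_mult V)"
    unfolding pm by (rule bounded_linear_bounded_mult[OF g_meas g_le])
  then have Vop: "blinfun_apply (Blinfun (potential_mult V)) = potential_mult V"
    by (rule bounded_linear_Blinfun_apply)
  have g_real: "AE x in torus. cnj (g x) = g x"
    using Vg real unfolding real_valued_def
    by eventually_elim (simp add: Reals_cnj_iff)
  have fn_g: "AE x in torus. fn_of (potential_mult V u) x = g x * fn_of u x" for u
    unfolding pm by (rule fn_of_bounded_mult[OF g_meas g_le])
  have sym: "potential_mult V u \<bullet> v = u \<bullet> potential_mult V v" for u v
  proof -
    have "bounded_mult (\<lambda>x. cnj (g x)) v = bounded_mult g v"
      unfolding bounded_mult_def
    proof (subst class_of_eq_iff)
      show "AE x in torus. cnj (g x) * fn_of v x = g x * fn_of v x"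
        using g_real by eventually_elim simp
    qed (use g_le in \<open>auto intro!: sq_integrable_bounded_mult[where K = G]\<close>)
    then show ?thesis unfolding pm by (subst bounded_mult_adj[OF g_meas g_le]) simp
  qed
  have Vi: "potential_mult V (cscale \<i> u) = cscale \<i> (potential_mult V u)" for u
  proof -
    have c: "AE x in torus. fn_of (cscale \<i> v) x = \<i> * fn_of v x" for v :: "'d l2_torus"
      unfolding cscale_bounded_mult by (rule fn_of_bounded_mult[where K = 1]) auto
    show ?thesis
      using fn_g[of "cscale \<i> u"] fn_g[of u] c[of u] c[of "potential_mult V u"]
      unfolding l2_eq_iff by eventually_elim simp
  qed
  have "\<exists>V1. \<forall>u. tor.Lam (blinfun_apply V1 u) = potential_mult V (tor.Lam u)"
  proof -
    define T where "T n = Blinfun (bounded_mult (f n))" for n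
    have fn_le: "cmod (f n x) \<le> q * cmod (a n)" for n x by (simp add: f_norm)
    have T: "blinfun_apply (T n) = bounded_mult (f n)" for n
      unfolding T_def by (rule bounded_linear_Blinfun_apply[OF bounded_linear_bounded_mult[OF f_meas fn_le]])
    \<comment> \<open>The operator norm on H1 allowed by Peetre's inequality; it is summable by the
      weighted hypothesis on the Fourier coefficients.\<close>
    define c where "c n = sqrt 2 * cmod (a n) * sqrt (1 + freq_sq (\<iota> n)) / sqrt ((2 * pi) ^ CARD('d))" for n
    have "\<exists>T1. norm T1 \<le> c n \<and> (\<forall>u. tor.Lam (blinfun_apply T1 u) = blinfun_apply (T n) (tor.Lam u))" for n
    proof (rule tor.H1_operator_lift)
      show "blinfun_apply (T n) (tor.Lam u) \<in> tor.H1" for u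
        unfolding T f_def[abs_def] by (rule mult_character_H1(1)[OF tor.Lam_H1])
      show "tor.N1 (blinfun_apply (T n) (tor.Lam u)) \<le> (c n)\<^sup>2 * (norm u)\<^sup>2" for u
        unfolding T f_def[abs_def] c_def
        using mult_character_H1(2)[OF tor.Lam_H1, of "a n" "\<iota> n" u] by (simp add: tor.N1_Lam)
      show "0 \<le> c n" using one_plus_freq_sq_pos[of "\<iota> n"] by (simp add: c_def)
    qed
    then obtain T1 where T1: "\<And>n. norm (T1 n) \<le> c n"
      "\<And>n u. tor.Lam (blinfun_apply (T1 n) u) = blinfun_apply (T n) (tor.Lam u)"
      by metis
    have "c = (\<lambda>n. sqrt 2 / sqrt ((2 * pi) ^ CARD('d)) * (sqrt (1 + freq_sq (\<iota> n)) * cmod (a n)))"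
      by (simp add: c_def fun_eq_iff)
    then have "summable c" by (simp only: summable_mult[OF sw])
    then have "summable (\<lambda>n. norm (T1 n))"
      by (rule summable_comparison_test'[where N = 0]) (simp add: T1(1))
    then have "summable T1" by (rule summable_norm_cancel)
    then have s1: "T1 sums suminf T1" by (rule summable_sums)
    have "tor.Lam (blinfun_apply (suminf T1) u) = potential_mult V (tor.Lam u)" for u
    proof -
      define y where "y = tor.Lam u"
      have "(\<lambda>n. blinfun_apply (T1 n) u) sums blinfun_apply (suminf T1) u"
        by (rule bounded_linear.sums[OF blinfun.bounded_linear_left s1])
      then have "(\<lambda>n. tor.Lam (blinfun_apply (T1 n) u)) sums tor.Lam (blinfun_apply (suminf T1) u)"
        by (rule bounded_linear.sums[OF blinfun.bounded_linear_right])
      then have 1: "(\<lambda>n. \<Sum>i<n. bounded_mult (f i) y) \<longlonglongrightarrow> tor.Lam (blinfun_apply (suminf T1) u)"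
        by (simp add: T1(2) T y_def sums_def)
      have sqy: "sq_integrable (\<lambda>x. f i x * fn_of y x)" for i
        by (rule sq_integrable_bounded_mult[OF f_meas fn_le sq_integrable_fn_of])
      have "(\<Sum>i<n. bounded_mult (f i) y) = class_of (\<lambda>x. (\<Sum>i<n. f i x) * fn_of y x)" for n
        using class_of_sum[of "{..<n}" "\<lambda>i x. f i x * fn_of y x", OF _ sqy]
        by (simp add: bounded_mult_def sum_distrib_right)
      moreover have "(\<lambda>n. class_of (\<lambda>x. (\<Sum>i<n. f i x) * fn_of y x)) \<longlonglongrightarrow> class_of (\<lambda>x. g x * fn_of y x)"
      proof (rule class_of_tendsto[where w = "\<lambda>x. (2 * G)\<^sup>2 * (cmod (fn_of y x))\<^sup>2"])
        show "sq_integrable (\<lambda>x. (\<Sum>i<n. f i x) * fn_of y x)" for n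
          by (rule sq_integrable_bounded_mult[OF partial_meas partial_le sq_integrable_fn_of])
        show "sq_integrable (\<lambda>x. g x * fn_of y x)"
          by (rule sq_integrable_bounded_mult[OF g_meas g_le sq_integrable_fn_of])
        show "(\<lambda>n. (\<Sum>i<n. f i x) * fn_of y x) \<longlonglongrightarrow> g x * fn_of y x" for x
          by (intro tendsto_intros f_lim)
        show "integrable torus (\<lambda>x. (2 * G)\<^sup>2 * (cmod (fn_of y x))\<^sup>2)"
          using sq_integrable_fn_of[of y] by (simp add: sq_integrable_def del: sq_integrable_fn_of)
        fix n x
        have "cmod ((\<Sum>i<n. f i x) - g x) \<le> 2 * G"
          using norm_triangle_ineq4[of "\<Sum>i<n. f i x" "g x"] partial_le[where n = n and x = x] g_le[of x] by linarith
        then have "cmod ((\<Sum>i<n. f i x) - g x) * cmod (fn_of y x) \<le> 2 * G * cmod (fn_of y x)"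
          by (intro mult_right_mono) auto
        from power_mono[OF this, of 2]
        show "(cmod ((\<Sum>i<n. f i x) * fn_of y x - g x * fn_of y x))\<^sup>2 \<le> (2 * G)\<^sup>2 * (cmod (fn_of y x))\<^sup>2"
          by (simp add: norm_mult power_mult_distrib flip: left_diff_distrib)
      qed
      ultimately have "(\<lambda>n. \<Sum>i<n. bounded_mult (f i) y) \<longlonglongrightarrow> bounded_mult g y"
        by (simp add: bounded_mult_def)
      with 1 show ?thesis unfolding pm y_def by (rule LIMSEQ_unique)
    qed
    then show ?thesis by blast
  qed
  then obtain V1 where V1: "\<And>u. tor.Lam (blinfun_apply V1 u) = potential_mult V (tor.Lam u)" by blast
  have "schroedinger torus_basis (torus_weight TYPE('d)) torus_J (Blinfun (potential_mult V)) V1"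
    by unfold_locales (simp_all add: Vop sym V1 torus_J_apply Vi)
  then show "\<exists>V1. schroedinger torus_basis (torus_weight TYPE('d)) torus_J (Blinfun (potential_mult V)) V1" by blast
  have G0: "G \<ge> 0" using g_le[of 0] norm_ge_zero order_trans by blast
  have int_u2: "integrable torus (\<lambda>x. (cmod (fn_of u x))\<^sup>2)" for u :: "'d l2_torus"
    using sq_integrable_fn_of[of u] by (simp add: sq_integrable_def del: sq_integrable_fn_of)
  have ReV: "AE x in torus. \<bar>Re (fn_of V x)\<bar> \<le> G"
    using Vg by eventually_elim (simp only:, rule order_trans[OF abs_Re_le_cmod g_le])
  have int_Vu2: "integrable torus (\<lambda>x. \<bar>Re (fn_of V x)\<bar> * (cmod (fn_of u x))\<^sup>2)" for u
  proof (rule Bochner_Integration.integrable_bound)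
    show "integrable torus (\<lambda>x. G * (cmod (fn_of u x))\<^sup>2)" using int_u2 by simp
    show "AE x in torus. norm (\<bar>Re (fn_of V x)\<bar> * (cmod (fn_of u x))\<^sup>2) \<le> norm (G * (cmod (fn_of u x))\<^sup>2)"
      using ReV by eventually_elim (use G0 in \<open>simp add: abs_mult mult_right_mono\<close>)
  qed measurable
  have "(LINT x|torus. \<bar>Re (fn_of V x)\<bar> * (cmod (fn_of u x))\<^sup>2) \<le> G * (norm u)\<^sup>2" for u
  proof -
    have "(LINT x|torus. \<bar>Re (fn_of V x)\<bar> * (cmod (fn_of u x))\<^sup>2) \<le> (LINT x|torus. G * (cmod (fn_of u x))\<^sup>2)"
    proof (rule integral_mono_AE)
      show "AE x in torus. \<bar>Re (fn_of V x)\<bar> * (cmod (fn_of u x))\<^sup>2 \<le> G * (cmod (fn_of u x))\<^sup>2"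
        using ReV by eventually_elim (simp add: mult_right_mono)
    qed (use int_Vu2 int_u2 in auto)
    also have "\<dots> = G * (norm u)\<^sup>2" by (simp add: power2_norm_eq_inner inner_l2_self)
    finally show ?thesis .
  qed
  then show "\<exists>K. \<forall>u. (LINT x|torus. \<bar>Re (fn_of V x)\<bar> * (cmod (fn_of u x))\<^sup>2) \<le> K * (norm u)\<^sup>2" by blast
  have gV: "AE x in torus. g x = complex_of_real (Re (fn_of V x))"
    using Vg real unfolding real_valued_def by eventually_elim simp
  show "potential_mult V u \<bullet> u = (LINT x|torus. Re (fn_of V x) * (cmod (fn_of u x))\<^sup>2)"
  proof -
    have "potential_mult V u \<bullet> u = Re (LINT x|torus. g x * (fn_of u x * cnj (fn_of u x)))"
      unfolding pm by (rule inner_bounded_mult[OF g_meas g_le])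
    also have "(LINT x|torus. g x * (fn_of u x * cnj (fn_of u x))) = (LINT x|torus. complex_of_real (Re (fn_of V x) * (cmod (fn_of u x))\<^sup>2))"
    proof (rule integral_cong_AE)
      show "AE x in torus. g x * (fn_of u x * cnj (fn_of u x)) = complex_of_real (Re (fn_of V x) * (cmod (fn_of u x))\<^sup>2)"
        using gV by eventually_elim (simp only: of_real_mult complex_norm_square)
    qed measurable
    also have "Re \<dots> = (LINT x|torus. Re (fn_of V x) * (cmod (fn_of u x))\<^sup>2)"
      unfolding integral_complex_of_real by simp
    finally show ?thesis .
  qed
  show "2 * \<bar>potential_mult V u \<bullet> v\<bar> \<le> (LINT x|torus. \<bar>Re (fn_of V x)\<bar> * (cmod (fn_of u x))\<^sup>2)
      + (LINT x|torus. \<bar>Re (fn_of V x)\<bar> * (cmod (fn_of v x))\<^sup>2)"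
  proof -
    have "\<bar>potential_mult V u \<bullet> v\<bar> \<le> cmod (LINT x|torus. g x * (fn_of u x * cnj (fn_of v x)))"
      unfolding pm inner_bounded_mult[OF g_meas g_le] by (rule abs_Re_le_cmod)
    also have "\<dots> \<le> (LINT x|torus. cmod (g x * (fn_of u x * cnj (fn_of v x))))"
      by (rule integral_norm_bound)
    \<comment> \<open>Young's inequality is applied pointwise under the weight |V|. The bound thus
      involves each factor only through its integral against |V|, which the energy assumption
      controls for \<open>u\<^sub>0\<close>.\<close>
    also have "\<dots> \<le> (LINT x|torus. 1/2 * (\<bar>Re (fn_of V x)\<bar> * (cmod (fn_of u x))\<^sup>2 + \<bar>Re (fn_of V x)\<bar> * (cmod (fn_of v x))\<^sup>2))"
    proof (rule integral_mono_AE)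
      show "integrable torus (\<lambda>x. cmod (g x * (fn_of u x * cnj (fn_of v x))))"
        using sq_integrable_mult_integrable[OF sq_integrable_bounded_mult[OF g_meas g_le sq_integrable_fn_of[of u]] sq_integrable_fn_of[of v]]
        by (intro integrable_norm) (simp add: mult.assoc)
      show "integrable torus (\<lambda>x. 1/2 * (\<bar>Re (fn_of V x)\<bar> * (cmod (fn_of u x))\<^sup>2 + \<bar>Re (fn_of V x)\<bar> * (cmod (fn_of v x))\<^sup>2))"
        using int_Vu2 by simp
      show "AE x in torus. cmod (g x * (fn_of u x * cnj (fn_of v x))) \<le> 1/2 * (\<bar>Re (fn_of V x)\<bar> * (cmod (fn_of u x))\<^sup>2 + \<bar>Re (fn_of V x)\<bar> * (cmod (fn_of v x))\<^sup>2)"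
        using gV
      proof eventually_elim
        case (elim x)
        have "cmod (fn_of u x) * cmod (fn_of v x) \<le> 1/2 * ((cmod (fn_of u x))\<^sup>2 + (cmod (fn_of v x))\<^sup>2)"
          using sum_squares_bound[of "cmod (fn_of u x)" "cmod (fn_of v x)"] by simp
        then have "\<bar>Re (fn_of V x)\<bar> * (cmod (fn_of u x) * cmod (fn_of v x)) \<le> \<bar>Re (fn_of V x)\<bar> * (1/2 * ((cmod (fn_of u x))\<^sup>2 + (cmod (fn_of v x))\<^sup>2))"
          by (rule mult_left_mono) simp
        then show ?case by (simp add: elim norm_mult algebra_simps)
      qed
    qed
    also have "\<dots> = 1/2 * ((LINT x|torus. \<bar>Re (fn_of V x)\<bar> * (cmod (fn_of u x))\<^sup>2) + (LINT x|torus. \<bar>Re (fn_of V x)\<bar> * (cmod (fn_of v x))\<^sup>2))"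
      using int_Vu2 by (simp add: Bochner_Integration.integral_add)
    finally show ?thesis by simp
  qed
qed

section \<open>Square integrable functions\<close>

definition square_integrable :: "'a measure \<Rightarrow> ('a \<Rightarrow> real) \<Rightarrow> bool"
  where "square_integrable M f \<longleftrightarrow> f \<in> borel_measurable M \<and> integrable M (\<lambda>x. (f x)\<^sup>2)"

lemma square_integrable_measurable [measurable_dest]: "square_integrable M f \<Longrightarrow> f \<in> borel_measurable M"
  by (simp add: square_integrable_def)

lemma square_integrable_mult:
  assumes "square_integrable M f" "square_integrable M g"
  shows "integrable M (\<lambda>x. f x * g x)"
proof (rule Bochner_Integration.integrable_bound)
  show "integrable M (\<lambda>x. (f x)\<^sup>2 + (g x)\<^sup>2)" using assms by (simp add: square_integrable_def)
  show "(\<lambda>x. f x * g x) \<in> borel_measurable M" using assms[THEN square_integrable_measurable] by measurable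
  have "\<bar>a * b\<bar> \<le> a\<^sup>2 + b\<^sup>2" for a b :: real
  proof -
    have "2 * (\<bar>a\<bar> * \<bar>b\<bar>) \<le> a\<^sup>2 + b\<^sup>2" using sum_squares_bound[of "\<bar>a\<bar>" "\<bar>b\<bar>"] by simp
    moreover have "0 \<le> \<bar>a\<bar> * \<bar>b\<bar>" by simp
    ultimately show ?thesis unfolding abs_mult by linarith
  qed
  then show "AE x in M. norm (f x * g x) \<le> norm ((f x)\<^sup>2 + (g x)\<^sup>2)" by simp
qed

lemma square_integrable_cmult: "square_integrable M f \<Longrightarrow> square_integrable M (\<lambda>x. c * f x)"
  by (auto simp: square_integrable_def power_mult_distrib)

lemma square_integrable_add:
  assumes "square_integrable M f" "square_integrable M g"
  shows "square_integrable M (\<lambda>x. f x + g x)"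
  using assms square_integrable_mult[OF assms]
  by (auto simp: square_integrable_def power2_sum mult.assoc)

lemma square_integrable_diff:
  assumes "square_integrable M f" "square_integrable M g"
  shows "square_integrable M (\<lambda>x. f x - g x)"
  using square_integrable_add[OF assms(1) square_integrable_cmult[OF assms(2), of "-1"]] by simp

lemma square_integrable_zero: "square_integrable M (\<lambda>_. 0)"
  by (simp add: square_integrable_def)

lemma square_integrable_sum:
  "(\<And>i. i \<in> I \<Longrightarrow> square_integrable M (f i)) \<Longrightarrow> square_integrable M (\<lambda>x. \<Sum>i\<in>I. f i x)"
  by (induction I rule: infinite_finite_induct) (auto intro: square_integrable_add square_integrable_zero)

lemma square_integrable_cong_AE:
  assumes "square_integrable M f" "g \<in> borel_measurable M" "AE x in M. f x = g x"
  shows "square_integrable M g"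
  unfolding square_integrable_def
proof
  note [measurable] = assms(2)
  show "integrable M (\<lambda>x. (g x)\<^sup>2)"
    by (rule integrable_cong_AE_imp[of M "\<lambda>x. (f x)\<^sup>2"])
      (use assms in \<open>auto simp: square_integrable_def\<close>)
qed (rule assms(2))

lemma integral_Cauchy_Schwarz:
  assumes "square_integrable M f" "square_integrable M g"
  shows "\<bar>LINT x|M. f x * g x\<bar> \<le> sqrt (LINT x|M. (f x)\<^sup>2) * sqrt (LINT x|M. (g x)\<^sup>2)"
proof -
  note [measurable] = assms[THEN square_integrable_measurable]
  define a where "a = (LINT x|M. (f x)\<^sup>2)"
  define b where "b = (LINT x|M. (g x)\<^sup>2)"
  define c where "c = (LINT x|M. \<bar>f x * g x\<bar>)"
  have nn: "0 \<le> a" "0 \<le> b" "0 \<le> c" by (simp_all add: a_def b_def c_def)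
  have sq: "(\<integral>\<^sup>+x. (ennreal \<bar>h x\<bar>)\<^sup>2 \<partial>M) = ennreal (LINT x|M. (h x)\<^sup>2)" if "square_integrable M h" for h
  proof -
    have "(\<integral>\<^sup>+x. (ennreal \<bar>h x\<bar>)\<^sup>2 \<partial>M) = (\<integral>\<^sup>+x. ennreal ((h x)\<^sup>2) \<partial>M)"
      by (intro nn_integral_cong) (subst ennreal_power; simp)
    also have "\<dots> = ennreal (LINT x|M. (h x)\<^sup>2)"
      using that by (intro nn_integral_eq_integral) (auto simp: square_integrable_def)
    finally show ?thesis .
  qed
  have "(\<integral>\<^sup>+x. ennreal \<bar>f x\<bar> * ennreal \<bar>g x\<bar> \<partial>M)\<^sup>2 \<le> (\<integral>\<^sup>+x. (ennreal \<bar>f x\<bar>)\<^sup>2 \<partial>M) * (\<integral>\<^sup>+x. (ennreal \<bar>g x\<bar>)\<^sup>2 \<partial>M)"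
    by (rule Cauchy_Schwarz_nn_integral) auto
  moreover have "(\<integral>\<^sup>+x. ennreal \<bar>f x\<bar> * ennreal \<bar>g x\<bar> \<partial>M) = ennreal c"
  proof -
    have "(\<integral>\<^sup>+x. ennreal \<bar>f x\<bar> * ennreal \<bar>g x\<bar> \<partial>M) = (\<integral>\<^sup>+x. ennreal \<bar>f x * g x\<bar> \<partial>M)"
      by (intro nn_integral_cong) (simp add: abs_mult ennreal_mult)
    also have "\<dots> = ennreal c"
      unfolding c_def by (rule nn_integral_eq_integral[OF integrable_abs[OF square_integrable_mult[OF assms]]]) simp
    finally show ?thesis .
  qed
  ultimately have "(ennreal c)\<^sup>2 \<le> ennreal a * ennreal b"
    using assms by (simp only: sq a_def b_def)
  then have "ennreal (c\<^sup>2) \<le> ennreal (a * b)"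
    using nn by (simp only: ennreal_power ennreal_mult)
  then have "c\<^sup>2 \<le> a * b" using nn by (subst (asm) ennreal_le_iff) auto
  then have "c\<^sup>2 \<le> (sqrt a * sqrt b)\<^sup>2" using nn by (simp add: power_mult_distrib)
  then have "c \<le> sqrt a * sqrt b" by (rule power2_le_imp_le) (use nn in simp)
  moreover have "\<bar>LINT x|M. f x * g x\<bar> \<le> c"
    using integral_norm_bound[of M "\<lambda>x. f x * g x"] by (simp add: c_def)
  ultimately show ?thesis by (simp add: a_def b_def)
qed

text \<open>Convergence is stated with extended integrals. A late index then makes the difference,
  hence also \<open>g\<close>, square integrable, and only afterwards do the real integrals carry
  the limit.\<close>

lemma square_integrable_limit:
  assumes f: "\<And>n::nat. square_integrable M (f n)" and [measurable]: "g \<in> borel_measurable M"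
    and lim: "(\<lambda>n. \<integral>\<^sup>+x. ennreal ((f n x - g x)\<^sup>2) \<partial>M) \<longlonglongrightarrow> 0"
  shows "square_integrable M g" and "(\<lambda>n. LINT x|M. (f n x - g x)\<^sup>2) \<longlonglongrightarrow> 0"
proof -
  note [measurable] = f[THEN square_integrable_measurable]
  have "\<forall>\<^sub>F n in sequentially. (\<integral>\<^sup>+x. ennreal ((f n x - g x)\<^sup>2) \<partial>M) < 1"
    by (rule order_tendstoD(2)[OF lim]) simp
  then obtain n where "(\<integral>\<^sup>+x. ennreal ((f n x - g x)\<^sup>2) \<partial>M) < 1"
    by (auto simp: eventually_sequentially)
  then have "(\<integral>\<^sup>+x. ennreal ((f n x - g x)\<^sup>2) \<partial>M) < \<infinity>"
    by (rule less_trans) simp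
  then have "square_integrable M (\<lambda>x. f n x - g x)"
    by (auto simp: square_integrable_def intro!: integrableI_bounded)
  from square_integrable_diff[OF f[of n] this] show g: "square_integrable M g" by simp
  have "(\<integral>\<^sup>+x. ennreal ((f n x - g x)\<^sup>2) \<partial>M) = ennreal (LINT x|M. (f n x - g x)\<^sup>2)" for n
    using square_integrable_diff[OF f[of n] g] by (simp add: nn_integral_eq_integral square_integrable_def)
  then have "(\<lambda>n. ennreal (LINT x|M. (f n x - g x)\<^sup>2)) \<longlonglongrightarrow> ennreal 0" using lim by simp
  then show "(\<lambda>n. LINT x|M. (f n x - g x)\<^sup>2) \<longlonglongrightarrow> 0"
    by (rule tendsto_ennrealD) auto
qed

text \<open>The difference of the products expands into three terms, each controlled by
  Cauchy-Schwarz. This carries the isometry and the orthogonality from step integrands to their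
  limits.\<close>

lemma integral_mult_limit:
  assumes f: "\<And>n::nat. square_integrable M (f n)" "square_integrable M f'" "(\<lambda>n. LINT x|M. (f n x - f' x)\<^sup>2) \<longlonglongrightarrow> 0"
    and g: "\<And>n. square_integrable M (g n)" "square_integrable M g'" "(\<lambda>n. LINT x|M. (g n x - g' x)\<^sup>2) \<longlonglongrightarrow> 0"
  shows "(\<lambda>n. LINT x|M. f n x * g n x) \<longlonglongrightarrow> (LINT x|M. f' x * g' x)"
proof -
  let ?a = "\<lambda>n. sqrt (LINT x|M. (f n x - f' x)\<^sup>2)" and ?b = "\<lambda>n. sqrt (LINT x|M. (g n x - g' x)\<^sup>2)"
  have "norm ((LINT x|M. f n x * g n x) - (LINT x|M. f' x * g' x))
      \<le> ?a n * ?b n + ?a n * sqrt (LINT x|M. (g' x)\<^sup>2) + sqrt (LINT x|M. (f' x)\<^sup>2) * ?b n" for n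
  proof -
    note d = square_integrable_diff[OF f(1)[of n] f(2)] square_integrable_diff[OF g(1)[of n] g(2)]
    have "(LINT x|M. f n x * g n x) - (LINT x|M. f' x * g' x) = (LINT x|M. f n x * g n x - f' x * g' x)"
      by (intro Bochner_Integration.integral_diff[symmetric] square_integrable_mult f g)
    also have "\<dots> = (LINT x|M. (f n x - f' x) * (g n x - g' x) + (f n x - f' x) * g' x + f' x * (g n x - g' x))"
      by (intro Bochner_Integration.integral_cong refl) (simp add: algebra_simps)
    also have "\<dots> = (LINT x|M. (f n x - f' x) * (g n x - g' x)) + (LINT x|M. (f n x - f' x) * g' x) + (LINT x|M. f' x * (g n x - g' x))"
      by (simp only: Bochner_Integration.integral_add Bochner_Integration.integrable_add
          square_integrable_mult[OF d] square_integrable_mult[OF d(1) g(2)] square_integrable_mult[OF f(2) d(2)])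
    finally show ?thesis
      using integral_Cauchy_Schwarz[OF d] integral_Cauchy_Schwarz[OF d(1) g(2)] integral_Cauchy_Schwarz[OF f(2) d(2)]
      unfolding real_norm_def by linarith
  qed
  moreover have "(\<lambda>n. ?a n * ?b n + ?a n * sqrt (LINT x|M. (g' x)\<^sup>2) + sqrt (LINT x|M. (f' x)\<^sup>2) * ?b n) \<longlonglongrightarrow> 0"
  proof -
    have "?a \<longlonglongrightarrow> 0" "?b \<longlonglongrightarrow> 0" using tendsto_real_sqrt[OF f(3)] tendsto_real_sqrt[OF g(3)] by simp_all
    then have "(\<lambda>n. ?a n * ?b n + ?a n * sqrt (LINT x|M. (g' x)\<^sup>2) + sqrt (LINT x|M. (f' x)\<^sup>2) * ?b n)
        \<longlonglongrightarrow> 0 * 0 + 0 * sqrt (LINT x|M. (g' x)\<^sup>2) + sqrt (LINT x|M. (f' x)\<^sup>2) * 0"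
      by (intro tendsto_add tendsto_mult tendsto_const)
    then show ?thesis by simp
  qed
  ultimately have "(\<lambda>n. (LINT x|M. f n x * g n x) - (LINT x|M. f' x * g' x)) \<longlonglongrightarrow> 0"
    by (rule Lim_null_comparison[OF always_eventually[OF allI]])
  then show ?thesis by (rule LIM_zero_cancel)
qed

lemma square_integrable_parallelogram:
  assumes "square_integrable M f" "square_integrable M g"
  shows "4 * (LINT x|M. f x * g x) = (LINT x|M. (f x + g x)\<^sup>2) - (LINT x|M. (f x - g x)\<^sup>2)"
proof -
  have "(LINT x|M. (f x + g x)\<^sup>2) - (LINT x|M. (f x - g x)\<^sup>2) = (LINT x|M. (f x + g x)\<^sup>2 - (f x - g x)\<^sup>2)"
    using square_integrable_add[OF assms] square_integrable_diff[OF assms]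
    by (intro Bochner_Integration.integral_diff[symmetric]) (auto simp: square_integrable_def)
  also have "\<dots> = (LINT x|M. 4 * (f x * g x))"
    by (intro Bochner_Integration.integral_cong refl) (simp add: power2_sum power2_diff)
  finally show ?thesis by simp
qed

section \<open>Moments of time integrals\<close>

text \<open>Uniformly bounded second moments over finite time measures give the absolute
  integrability that Fubini asks for. The two index spaces are kept separate so that one of them can
  be a single point, which yields the moment against a fixed variable.\<close>

lemma integral_time_product:
  fixes X :: "'r \<Rightarrow> 'w \<Rightarrow> real" and X' :: "'s \<Rightarrow> 'w \<Rightarrow> real"
  assumes M: "sigma_finite_measure M" and N: "finite_measure N" and N': "finite_measure N'"
    and meas: "(\<lambda>(r, \<omega>). X r \<omega>) \<in> borel_measurable (N \<Otimes>\<^sub>M M)" "(\<lambda>(r, \<omega>). X' r \<omega>) \<in> borel_measurable (N' \<Otimes>\<^sub>M M)"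
    and X: "\<And>r. r \<in> space N \<Longrightarrow> square_integrable M (X r)" "\<And>r. r \<in> space N \<Longrightarrow> (LINT \<omega>|M. (X r \<omega>)\<^sup>2) \<le> K"
    and X': "\<And>r. r \<in> space N' \<Longrightarrow> square_integrable M (X' r)" "\<And>r. r \<in> space N' \<Longrightarrow> (LINT \<omega>|M. (X' r \<omega>)\<^sup>2) \<le> K'"
  shows "integrable M (\<lambda>\<omega>. (LINT r|N. X r \<omega>) * (LINT s|N'. X' s \<omega>))"
    and "(LINT \<omega>|M. (LINT r|N. X r \<omega>) * (LINT s|N'. X' s \<omega>)) = (LINT r|N. LINT s|N'. LINT \<omega>|M. X r \<omega> * X' s \<omega>)"
proof -
  interpret M: sigma_finite_measure M by fact
  interpret N: finite_measure N by fact
  interpret N': finite_measure N' by fact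
  interpret NN: pair_sigma_finite N N' ..
  have fin: "finite_measure (N \<Otimes>\<^sub>M N')" by (rule finite_measure_pair_measure[OF N' N])
  interpret R: finite_measure "N \<Otimes>\<^sub>M N'" by fact
  interpret RM: pair_sigma_finite "N \<Otimes>\<^sub>M N'" M ..
  define f where "f = (\<lambda>(p, \<omega>). X (fst p) \<omega> * X' (snd p) \<omega>)"
  have f_meas [measurable]: "f \<in> borel_measurable ((N \<Otimes>\<^sub>M N') \<Otimes>\<^sub>M M)"
  proof -
    have "(\<lambda>x. (\<lambda>(r, \<omega>). X r \<omega>) (fst (fst x), snd x)) \<in> borel_measurable ((N \<Otimes>\<^sub>M N') \<Otimes>\<^sub>M M)"
      by (rule measurable_compose[OF _ meas(1)]) measurable
    moreover have "(\<lambda>x. (\<lambda>(r, \<omega>). X' r \<omega>) (snd (fst x), snd x)) \<in> borel_measurable ((N \<Otimes>\<^sub>M N') \<Otimes>\<^sub>M M)"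
      by (rule measurable_compose[OF _ meas(2)]) measurable
    ultimately show ?thesis by (simp add: f_def case_prod_unfold)
  qed
  have sp: "fst p \<in> space N" "snd p \<in> space N'" if "p \<in> space (N \<Otimes>\<^sub>M N')" for p
    using that by (auto simp: space_pair_measure)
  have int2: "integrable M (\<lambda>\<omega>. f (p, \<omega>))" if "p \<in> space (N \<Otimes>\<^sub>M N')" for p
    using square_integrable_mult[OF X(1)[OF sp(1)[OF that]] X'(1)[OF sp(2)[OF that]]] by (simp add: f_def)
  have int: "integrable ((N \<Otimes>\<^sub>M N') \<Otimes>\<^sub>M M) f"
  proof (rule RM.Fubini_integrable[OF f_meas])
    show "AE p in N \<Otimes>\<^sub>M N'. integrable M (\<lambda>\<omega>. f (p, \<omega>))" using int2 by (intro AE_I2)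
    show "integrable (N \<Otimes>\<^sub>M N') (\<lambda>p. LINT \<omega>|M. norm (f (p, \<omega>)))"
    proof (rule R.integrable_const_bound[where B = "K + K'"])
      show "AE p in N \<Otimes>\<^sub>M N'. norm (LINT \<omega>|M. norm (f (p, \<omega>))) \<le> K + K'"
      proof (rule AE_I2)
        fix p assume p: "p \<in> space (N \<Otimes>\<^sub>M N')"
        note s = X(1)[OF sp(1)[OF p]] X'(1)[OF sp(2)[OF p]]
        have "(LINT \<omega>|M. norm (f (p, \<omega>))) \<le> (LINT \<omega>|M. (X (fst p) \<omega>)\<^sup>2 + (X' (snd p) \<omega>)\<^sup>2)"
        proof (rule integral_mono)
          fix \<omega>
          have "\<bar>a * b\<bar> \<le> a\<^sup>2 + b\<^sup>2" for a b :: real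
          proof -
            have "2 * (\<bar>a\<bar> * \<bar>b\<bar>) \<le> a\<^sup>2 + b\<^sup>2" using sum_squares_bound[of "\<bar>a\<bar>" "\<bar>b\<bar>"] by simp
            moreover have "0 \<le> \<bar>a\<bar> * \<bar>b\<bar>" by simp
            ultimately show ?thesis unfolding abs_mult by linarith
          qed
          then show "norm (f (p, \<omega>)) \<le> (X (fst p) \<omega>)\<^sup>2 + (X' (snd p) \<omega>)\<^sup>2" by (simp add: f_def)
        qed (use int2[OF p] s in \<open>auto simp: square_integrable_def\<close>)
        also have "\<dots> \<le> K + K'"
          using s X(2)[OF sp(1)[OF p]] X'(2)[OF sp(2)[OF p]] by (simp add: square_integrable_def)
        finally show "norm (LINT \<omega>|M. norm (f (p, \<omega>))) \<le> K + K'" by simp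
      qed
    qed measurable
  qed
  have cur: "integrable ((N \<Otimes>\<^sub>M N') \<Otimes>\<^sub>M M) (case_prod (\<lambda>p \<omega>. f (p, \<omega>)))" using int by simp
  have prod: "AE \<omega> in M. (LINT p|(N \<Otimes>\<^sub>M N'). f (p, \<omega>)) = (LINT r|N. X r \<omega>) * (LINT s|N'. X' s \<omega>)"
    using RM.AE_integrable_snd[OF cur]
  proof eventually_elim
    case (elim \<omega>)
    then have "(LINT p|(N \<Otimes>\<^sub>M N'). f (p, \<omega>)) = (LINT r|N. LINT s|N'. X r \<omega> * X' s \<omega>)"
      using NN.integral_fst'[of "\<lambda>p. f (p, \<omega>)"] by (simp add: f_def)
    then show ?case by simp
  qed
  have Xm: "(\<lambda>\<omega>. LINT r|N. X r \<omega>) \<in> borel_measurable M"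
  proof -
    have "(\<lambda>(\<omega>, r). X r \<omega>) \<in> borel_measurable (M \<Otimes>\<^sub>M N)"
      using measurable_compose[OF measurable_pair_swap' meas(1)] by (simp add: case_prod_unfold)
    then show ?thesis by (rule N.borel_measurable_lebesgue_integral)
  qed
  have Xm': "(\<lambda>\<omega>. LINT r|N'. X' r \<omega>) \<in> borel_measurable M"
  proof -
    have "(\<lambda>(\<omega>, r). X' r \<omega>) \<in> borel_measurable (M \<Otimes>\<^sub>M N')"
      using measurable_compose[OF measurable_pair_swap' meas(2)] by (simp add: case_prod_unfold)
    then show ?thesis by (rule N'.borel_measurable_lebesgue_integral)
  qed
  have int_snd: "integrable M (\<lambda>\<omega>. LINT p|(N \<Otimes>\<^sub>M N'). f (p, \<omega>))"
    by (rule RM.integrable_snd[OF cur])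
  show "integrable M (\<lambda>\<omega>. (LINT r|N. X r \<omega>) * (LINT s|N'. X' s \<omega>))"
    by (rule integrable_cong_AE_imp[OF int_snd]) (use Xm Xm' prod in auto)
  have "(LINT \<omega>|M. (LINT r|N. X r \<omega>) * (LINT s|N'. X' s \<omega>)) = (LINT \<omega>|M. LINT p|(N \<Otimes>\<^sub>M N'). f (p, \<omega>))"
    by (rule integral_cong_AE) (use Xm Xm' prod int_snd in auto)
  also have "\<dots> = (LINT p|(N \<Otimes>\<^sub>M N'). LINT \<omega>|M. f (p, \<omega>))"
    by (rule RM.Fubini_integral[OF cur])
  also have "\<dots> = (LINT r|N. LINT s|N'. LINT \<omega>|M. f ((r, s), \<omega>))"
    using NN.integral_fst'[OF RM.integrable_fst[OF cur]] by simp
  finally show "(LINT \<omega>|M. (LINT r|N. X r \<omega>) * (LINT s|N'. X' s \<omega>)) = (LINT r|N. LINT s|N'. LINT \<omega>|M. X r \<omega> * X' s \<omega>)"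
    by (simp add: f_def)
qed

lemma count_space_unit: "finite_measure (count_space (UNIV :: unit set))"
  "(LINT x|count_space (UNIV :: unit set). h x) = h ()"
proof -
  show "finite_measure (count_space (UNIV :: unit set))" by (rule finite_measure_count_space) simp
  show "(LINT x|count_space (UNIV :: unit set). h x) = h ()"
    by (simp add: lebesgue_integral_count_space_finite UNIV_unit)
qed

lemma measurable_unit_pair:
  assumes "X \<in> borel_measurable M"
  shows "(\<lambda>(u :: unit, \<omega>). X \<omega>) \<in> borel_measurable (count_space UNIV \<Otimes>\<^sub>M M)"
  using measurable_compose[OF measurable_snd assms, of "count_space UNIV"] by (simp add: case_prod_unfold)

text \<open>The second moment of \<open>Z - \<integral> X\<close> involves only pairwise second
  moments of the family. Families on different spaces with equal covariances therefore give
  functionals with equal second moments; this is applied to the probability space and to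
  \<open>noise_space\<close>.\<close>

lemma time_functional_moments:
  fixes X :: "'r \<Rightarrow> 'w \<Rightarrow> real"
  assumes M: "sigma_finite_measure M" and N: "finite_measure N"
    and meas: "(\<lambda>(r, \<omega>). X r \<omega>) \<in> borel_measurable (N \<Otimes>\<^sub>M M)"
    and X: "\<And>r. r \<in> space N \<Longrightarrow> square_integrable M (X r)" "\<And>r. r \<in> space N \<Longrightarrow> (LINT \<omega>|M. (X r \<omega>)\<^sup>2) \<le> K"
    and Z: "square_integrable M Z"
  defines "G \<equiv> \<lambda>\<omega>. Z \<omega> - (LINT r|N. X r \<omega>)"
  shows "square_integrable M G"
    and "(LINT \<omega>|M. (G \<omega>)\<^sup>2) = (LINT \<omega>|M. Z \<omega> * Z \<omega>) - 2 * (LINT r|N. LINT \<omega>|M. Z \<omega> * X r \<omega>)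
      + (LINT r|N. LINT s|N. LINT \<omega>|M. X r \<omega> * X s \<omega>)"
    and "square_integrable M H \<Longrightarrow> (LINT \<omega>|M. H \<omega> * G \<omega>) = (LINT \<omega>|M. H \<omega> * Z \<omega>) - (LINT r|N. LINT \<omega>|M. H \<omega> * X r \<omega>)"
proof -
  interpret N: finite_measure N by fact
  have single: "integrable M (\<lambda>\<omega>. H \<omega> * (LINT r|N. X r \<omega>)) \<and>
      (LINT \<omega>|M. H \<omega> * (LINT r|N. X r \<omega>)) = (LINT r|N. LINT \<omega>|M. H \<omega> * X r \<omega>)" if H: "square_integrable M H" for H
    using integral_time_product[OF M count_space_unit(1) N measurable_unit_pair[OF square_integrable_measurable[OF H]] meas, of "LINT \<omega>|M. (H \<omega>)\<^sup>2" K]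
      H X by (simp add: count_space_unit)
  have I: "integrable M (\<lambda>\<omega>. (LINT r|N. X r \<omega>) * (LINT r|N. X r \<omega>))"
    "(LINT \<omega>|M. (LINT r|N. X r \<omega>) * (LINT r|N. X r \<omega>)) = (LINT r|N. LINT s|N. LINT \<omega>|M. X r \<omega> * X s \<omega>)"
    by (rule integral_time_product[OF M N N meas meas X X]; assumption)+
  have Xm: "(\<lambda>\<omega>. LINT r|N. X r \<omega>) \<in> borel_measurable M"
  proof -
    have "(\<lambda>(\<omega>, r). X r \<omega>) \<in> borel_measurable (M \<Otimes>\<^sub>M N)"
      using measurable_compose[OF measurable_pair_swap' meas] by (simp add: case_prod_unfold)
    then show ?thesis by (rule N.borel_measurable_lebesgue_integral)
  qed
  have sI: "square_integrable M (\<lambda>\<omega>. LINT r|N. X r \<omega>)"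
    using Xm I(1) by (simp add: square_integrable_def power2_eq_square)
  show G: "square_integrable M G"
    unfolding G_def by (rule square_integrable_diff[OF Z sI])
  have "(LINT \<omega>|M. (G \<omega>)\<^sup>2) = (LINT \<omega>|M. Z \<omega> * Z \<omega> - 2 * (Z \<omega> * (LINT r|N. X r \<omega>)) + (LINT r|N. X r \<omega>) * (LINT r|N. X r \<omega>))"
    by (intro Bochner_Integration.integral_cong refl) (simp add: G_def power2_eq_square algebra_simps)
  also have "\<dots> = (LINT \<omega>|M. Z \<omega> * Z \<omega>) - 2 * (LINT r|N. LINT \<omega>|M. Z \<omega> * X r \<omega>) + (LINT r|N. LINT s|N. LINT \<omega>|M. X r \<omega> * X s \<omega>)"
    using single[OF Z] I square_integrable_mult[OF Z Z] by simp
  finally show "(LINT \<omega>|M. (G \<omega>)\<^sup>2) = (LINT \<omega>|M. Z \<omega> * Z \<omega>) - 2 * (LINT r|N. LINT \<omega>|M. Z \<omega> * X r \<omega>)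
      + (LINT r|N. LINT s|N. LINT \<omega>|M. X r \<omega> * X s \<omega>)" .
  show "(LINT \<omega>|M. H \<omega> * G \<omega>) = (LINT \<omega>|M. H \<omega> * Z \<omega>) - (LINT r|N. LINT \<omega>|M. H \<omega> * X r \<omega>)" if H: "square_integrable M H"
  proof -
    have "(LINT \<omega>|M. H \<omega> * G \<omega>) = (LINT \<omega>|M. H \<omega> * Z \<omega> - H \<omega> * (LINT r|N. X r \<omega>))"
      by (intro Bochner_Integration.integral_cong refl) (simp add: G_def algebra_simps)
    then show ?thesis using single[OF H] square_integrable_mult[OF H Z] by simp
  qed
qed

section \<open>Second moments of Wiener integrals\<close>

lemma (in prob_space) centered_normal_moments:
  assumes X [measurable]: "X \<in> borel_measurable M" and D: "distr M borel X = centered_normal v" and v: "0 \<le> v"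
  shows "square_integrable M X" "integrable M X" "(LINT \<omega>|M. (X \<omega>)\<^sup>2) = v" "(LINT \<omega>|M. X \<omega>) = 0"
proof -
  have "square_integrable M X \<and> integrable M X \<and> (LINT \<omega>|M. (X \<omega>)\<^sup>2) = v \<and> (LINT \<omega>|M. X \<omega>) = 0"
  proof (cases "v = 0")
    case True
    have "AE x in distr M borel X. x = 0"
      unfolding D centered_normal_def using True by (simp add: AE_return)
    then have ae: "AE \<omega> in M. X \<omega> = 0" by (simp add: AE_distr_iff)
    then have ae2: "AE \<omega> in M. (X \<omega>)\<^sup>2 = 0" by eventually_elim simp
    have "integrable M X" by (rule integrable_cong_AE_imp[of M "\<lambda>_. 0"]) (use ae in \<open>auto elim: AE_mp\<close>)
    moreover have "integrable M (\<lambda>\<omega>. (X \<omega>)\<^sup>2)"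
      by (rule integrable_cong_AE_imp[of M "\<lambda>_. 0"]) (use ae2 in \<open>auto elim: AE_mp\<close>)
    moreover have "(LINT \<omega>|M. X \<omega>) = 0" "(LINT \<omega>|M. (X \<omega>)\<^sup>2) = 0"
      using ae ae2 by (auto intro!: integral_eq_zero_AE)
    ultimately show ?thesis using True X by (simp add: square_integrable_def)
  next
    case False
    define \<sigma> where "\<sigma> = sqrt v"
    have \<sigma>: "\<sigma> > 0" "\<sigma>\<^sup>2 = v" using False v by (simp_all add: \<sigma>_def)
    let ?n = "normal_density 0 \<sigma>"
    have D': "distr M borel X = density lborel (\<lambda>x. ennreal (?n x))"
      using D False by (simp add: centered_normal_def \<sigma>_def)
    have tr: "integrable M (\<lambda>\<omega>. f (X \<omega>)) \<longleftrightarrow> integrable lborel (\<lambda>x. ?n x * f x)"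
      "(LINT \<omega>|M. f (X \<omega>)) = (LINT x|lborel. ?n x * f x)" if [measurable]: "f \<in> borel_measurable borel" for f :: "real \<Rightarrow> real"
    proof -
      have "integrable M (\<lambda>\<omega>. f (X \<omega>)) \<longleftrightarrow> integrable (distr M borel X) f"
        by (rule integrable_distr_eq[symmetric]) auto
      also have "\<dots> \<longleftrightarrow> integrable lborel (\<lambda>x. ?n x * f x)"
        unfolding D' by (subst integrable_density) auto
      finally show "integrable M (\<lambda>\<omega>. f (X \<omega>)) \<longleftrightarrow> integrable lborel (\<lambda>x. ?n x * f x)" .
      have "(LINT \<omega>|M. f (X \<omega>)) = integral\<^sup>L (distr M borel X) f"
        by (rule integral_distr[symmetric]) auto
      also have "\<dots> = (LINT x|lborel. ?n x * f x)"
        unfolding D' by (subst integral_density) auto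
      finally show "(LINT \<omega>|M. f (X \<omega>)) = (LINT x|lborel. ?n x * f x)" .
    qed
    have "has_bochner_integral lborel (\<lambda>x. ?n x * x\<^sup>2) v"
      using normal_moment_even[OF \<sigma>(1), of 0 1] \<sigma> by (simp add: fact_numeral)
    moreover have "has_bochner_integral lborel (\<lambda>x. ?n x * x) 0"
      by (rule normal_moment_nz_1[OF \<sigma>(1)])
    ultimately show ?thesis
      using tr[of "\<lambda>x. x\<^sup>2"] tr[of "\<lambda>x. x"] X
      by (simp add: square_integrable_def has_bochner_integral_iff)
  qed
  then show "square_integrable M X" "integrable M X" "(LINT \<omega>|M. (X \<omega>)\<^sup>2) = v" "(LINT \<omega>|M. X \<omega>) = 0" by auto
qed

locale wiener_setting = prob_space M
  for M :: "'w measure" +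
  fixes F :: "real \<Rightarrow> 'w measure"
    and e :: "nat \<Rightarrow> 'd::finite l2_torus"
    and Qh Q :: "'d l2_torus \<Rightarrow>\<^sub>L 'd l2_torus"
    and W :: "real \<Rightarrow> 'w \<Rightarrow> 'd l2_torus"
  assumes filtration: "normal_filtration M F"
    and basis: "orthonormal_basis e"
    and sqrt_Q: "is_operator_sqrt Qh Q"
    and wiener: "Q_wiener_process M F Q W"
    and HS: "summable (\<lambda>j. (norm (Qh (e j)))\<^sup>2)"
begin

lemma F_subalgebra: "0 \<le> t \<Longrightarrow> subalgebra M (F t)"
  using filtration unfolding normal_filtration_def by blast

lemma F_mono: "0 \<le> s \<Longrightarrow> s \<le> t \<Longrightarrow> sets (F s) \<subseteq> sets (F t)"
  using filtration unfolding normal_filtration_def by blast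

lemma F_measurable: "0 \<le> t \<Longrightarrow> f \<in> measurable (F t) N \<Longrightarrow> f \<in> measurable M N"
  by (rule measurable_from_subalg[OF F_subalgebra])

lemma W_F: "0 \<le> t \<Longrightarrow> W t \<in> borel_measurable (F t)"
  using wiener by (simp add: Q_wiener_process_def)

lemma W_measurable [measurable]: "0 \<le> t \<Longrightarrow> W t \<in> borel_measurable M"
  by (rule F_measurable[OF _ W_F])

lemma Q_Qh: "Q u \<bullet> v = Qh u \<bullet> Qh v"
proof -
  have "Q = Qh o\<^sub>L Qh" "\<And>u v. Qh u \<bullet> v = u \<bullet> Qh v"
    using sqrt_Q by (auto simp: is_operator_sqrt_def nonneg_selfadjoint_def)
  then show ?thesis by simp
qed

lemma Qh_sym: "Qh u \<bullet> v = u \<bullet> Qh v"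
  using sqrt_Q by (simp add: is_operator_sqrt_def nonneg_selfadjoint_def)

text \<open>The process is specified by the laws of single functionals of an increment; the
  covariance of two of them follows by polarisation with \<open>h + k\<close> and
  \<open>h - k\<close>.\<close>

lemma increment_moments:
  assumes "0 \<le> s" "s \<le> t"
  shows "square_integrable M (\<lambda>\<omega>. (W t \<omega> - W s \<omega>) \<bullet> h)" "integrable M (\<lambda>\<omega>. (W t \<omega> - W s \<omega>) \<bullet> h)"
    "(LINT \<omega>|M. (W t \<omega> - W s \<omega>) \<bullet> h) = 0"
    "(LINT \<omega>|M. ((W t \<omega> - W s \<omega>) \<bullet> h) * ((W t \<omega> - W s \<omega>) \<bullet> k)) = (t - s) * (Qh h \<bullet> Qh k)"
proof -
  have [measurable]: "W s \<in> borel_measurable M" "W t \<in> borel_measurable M" using assms by auto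
  have D: "distr M borel (\<lambda>\<omega>. (W t \<omega> - W s \<omega>) \<bullet> h) = centered_normal ((t - s) * (Qh h \<bullet> Qh h))" for h
    using wiener assms by (simp add: Q_wiener_process_def Q_Qh)
  have v: "0 \<le> (t - s) * (Qh h \<bullet> Qh h)" for h using assms by simp
  have meas: "(\<lambda>\<omega>. (W t \<omega> - W s \<omega>) \<bullet> h) \<in> borel_measurable M" for h by measurable
  note m = centered_normal_moments[OF meas D v]
  show "square_integrable M (\<lambda>\<omega>. (W t \<omega> - W s \<omega>) \<bullet> h)" "integrable M (\<lambda>\<omega>. (W t \<omega> - W s \<omega>) \<bullet> h)"
    "(LINT \<omega>|M. (W t \<omega> - W s \<omega>) \<bullet> h) = 0"
    by (rule m)+
  have "4 * (LINT \<omega>|M. ((W t \<omega> - W s \<omega>) \<bullet> h) * ((W t \<omega> - W s \<omega>) \<bullet> k))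
      = (LINT \<omega>|M. ((W t \<omega> - W s \<omega>) \<bullet> (h + k))\<^sup>2) - (LINT \<omega>|M. ((W t \<omega> - W s \<omega>) \<bullet> (h - k))\<^sup>2)"
    unfolding inner_add_right inner_diff_right by (rule square_integrable_parallelogram[OF m(1) m(1)])
  also have "\<dots> = 4 * ((t - s) * (Qh h \<bullet> Qh k))"
    unfolding m(3)
    by (simp add: blinfun.add_right blinfun.diff_right inner_add_left inner_add_right inner_diff_left inner_diff_right
        inner_commute algebra_simps)
  finally show "(LINT \<omega>|M. ((W t \<omega> - W s \<omega>) \<bullet> h) * ((W t \<omega> - W s \<omega>) \<bullet> k)) = (t - s) * (Qh h \<bullet> Qh k)"
    by simp
qed

lemma increment_orthogonal:
  assumes st: "0 \<le> s" "s \<le> t" and g: "g \<in> borel_measurable (F s)" "integrable M g"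
  shows "(LINT \<omega>|M. g \<omega> * ((W t \<omega> - W s \<omega>) \<bullet> h)) = 0"
proof -
  let ?D = "\<lambda>\<omega>. W t \<omega> - W s \<omega>"
  have [measurable]: "W s \<in> borel_measurable M" "W t \<in> borel_measurable M" using st by auto
  have gM: "g \<in> borel_measurable M" by (rule F_measurable[OF st(1) g(1)])
  have space: "space (F s) = space M" using F_subalgebra[OF st(1)] by (simp add: subalgebra_def)
  have ind: "indep_set (sets (F s)) (sets (vimage_algebra (space M) ?D borel))"
    using wiener st by (simp add: Q_wiener_process_def)
  have "indep_var borel g borel (\<lambda>\<omega>. ?D \<omega> \<bullet> h)"
    unfolding indep_var_eq
  proof (intro conjI)
    show "g \<in> borel_measurable M" "(\<lambda>\<omega>. ?D \<omega> \<bullet> h) \<in> borel_measurable M" by (fact gM) measurable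
    show "indep_set (sigma_sets (space M) {g -` A \<inter> space M |A. A \<in> sets borel})
        (sigma_sets (space M) {(\<lambda>\<omega>. ?D \<omega> \<bullet> h) -` A \<inter> space M |A. A \<in> sets borel})"
      unfolding indep_set_def
    proof (rule indep_sets_mono_sets[OF ind[unfolded indep_set_def]])
      fix i :: bool
      have "sigma_sets (space M) {g -` A \<inter> space M |A. A \<in> sets borel} \<subseteq> sets (F s)"
      proof -
        have "{g -` A \<inter> space M |A. A \<in> sets borel} \<subseteq> sets (F s)"
          using measurable_sets[OF g(1)] by (auto simp: space)
        then show ?thesis using sets.sigma_sets_subset[of _ "F s"] by (simp add: space)
      qed
      moreover have "sigma_sets (space M) {(\<lambda>\<omega>. ?D \<omega> \<bullet> h) -` A \<inter> space M |A. A \<in> sets borel} \<subseteq> sets (vimage_algebra (space M) ?D borel)"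
      proof -
        have m: "(\<lambda>x. x \<bullet> h) \<in> borel_measurable (borel :: 'd l2_torus measure)" by measurable
        have "(\<lambda>\<omega>. ?D \<omega> \<bullet> h) -` A \<inter> space M \<in> sets (vimage_algebra (space M) ?D borel)" if "A \<in> sets borel" for A
        proof -
          have "(\<lambda>x. x \<bullet> h) -` A \<in> sets (borel :: 'd l2_torus measure)"
            using measurable_sets[OF m that] by simp
          then have "?D -` ((\<lambda>x. x \<bullet> h) -` A) \<inter> space M \<in> sets (vimage_algebra (space M) ?D borel)"
            by (rule in_vimage_algebra)
          then show ?thesis by (simp add: vimage_def)
        qed
        then have "{(\<lambda>\<omega>. ?D \<omega> \<bullet> h) -` A \<inter> space M |A. A \<in> sets borel} \<subseteq> sets (vimage_algebra (space M) ?D borel)" by auto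
        then show ?thesis using sets.sigma_sets_subset[of _ "vimage_algebra (space M) ?D borel"] by simp
      qed
      ultimately show "(case i of True \<Rightarrow> sigma_sets (space M) {g -` A \<inter> space M |A. A \<in> sets borel}
          | False \<Rightarrow> sigma_sets (space M) {(\<lambda>\<omega>. ?D \<omega> \<bullet> h) -` A \<inter> space M |A. A \<in> sets borel})
          \<subseteq> (case i of True \<Rightarrow> sets (F s) | False \<Rightarrow> sets (vimage_algebra (space M) ?D borel))"
        by (cases i) auto
    qed
  qed
  from indep_var_lebesgue_integral[OF this g(2) increment_moments(2)[OF st]] show ?thesis
    by (simp add: increment_moments(3)[OF st])
qed

lemma W_zero: "AE \<omega> in M. W 0 \<omega> = 0"
  using wiener by (simp add: Q_wiener_process_def)

lemma W_square_integrable: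
  assumes "0 \<le> s"
  shows "square_integrable M (\<lambda>\<omega>. W s \<omega> \<bullet> h)"
proof (rule square_integrable_cong_AE[OF increment_moments(1)[of 0 s h]])
  show "AE \<omega> in M. (W s \<omega> - W 0 \<omega>) \<bullet> h = W s \<omega> \<bullet> h"
    using W_zero by eventually_elim simp
  have [measurable]: "W s \<in> borel_measurable M" using assms by auto
  show "(\<lambda>\<omega>. W s \<omega> \<bullet> h) \<in> borel_measurable M" by measurable
qed (use assms in auto)

lemma square_integrable_imp_integrable: "square_integrable M f \<Longrightarrow> integrable M f"
  using square_integrable_mult[of M f "\<lambda>_. 1"] by (simp add: square_integrable_def)

lemma W_cov_le:
  assumes "0 \<le> s" "s \<le> r"
  shows "(LINT \<omega>|M. (W s \<omega> \<bullet> h) * (W r \<omega> \<bullet> k)) = s * (Qh h \<bullet> Qh k)"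
proof -
  have r: "0 \<le> r" using assms by simp
  have [measurable]: "W s \<in> borel_measurable M" "W r \<in> borel_measurable M" "W 0 \<in> borel_measurable M"
    using assms by auto
  have Wh: "(\<lambda>\<omega>. W s \<omega> \<bullet> h) \<in> borel_measurable (F s)"
    using borel_measurable_inner[OF W_F[OF assms(1)] borel_measurable_const] .
  have "(LINT \<omega>|M. (W s \<omega> \<bullet> h) * (W r \<omega> \<bullet> k))
      = (LINT \<omega>|M. (W s \<omega> \<bullet> h) * (W s \<omega> \<bullet> k) + (W s \<omega> \<bullet> h) * ((W r \<omega> - W s \<omega>) \<bullet> k))"
    by (intro Bochner_Integration.integral_cong refl) (simp add: inner_diff_left algebra_simps)
  also have "\<dots> = (LINT \<omega>|M. (W s \<omega> \<bullet> h) * (W s \<omega> \<bullet> k)) + (LINT \<omega>|M. (W s \<omega> \<bullet> h) * ((W r \<omega> - W s \<omega>) \<bullet> k))"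
    by (intro Bochner_Integration.integral_add square_integrable_mult W_square_integrable increment_moments assms)
  also have "(LINT \<omega>|M. (W s \<omega> \<bullet> h) * ((W r \<omega> - W s \<omega>) \<bullet> k)) = 0"
    by (intro increment_orthogonal assms Wh square_integrable_imp_integrable W_square_integrable)
  also have "(LINT \<omega>|M. (W s \<omega> \<bullet> h) * (W s \<omega> \<bullet> k)) = (LINT \<omega>|M. ((W s \<omega> - W 0 \<omega>) \<bullet> h) * ((W s \<omega> - W 0 \<omega>) \<bullet> k))"
  proof (rule integral_cong_AE)
    show "AE \<omega> in M. (W s \<omega> \<bullet> h) * (W s \<omega> \<bullet> k) = ((W s \<omega> - W 0 \<omega>) \<bullet> h) * ((W s \<omega> - W 0 \<omega>) \<bullet> k)"
      using W_zero by eventually_elim simp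
  qed measurable
  also have "\<dots> = s * (Qh h \<bullet> Qh k)"
    using increment_moments(4)[of 0 s h k] assms by simp
  finally show ?thesis by simp
qed

lemma W_cov:
  assumes "0 \<le> s" "0 \<le> r"
  shows "(LINT \<omega>|M. (W s \<omega> \<bullet> h) * (W r \<omega> \<bullet> k)) = min s r * (Qh h \<bullet> Qh k)"
proof (cases "s \<le> r")
  case True
  then show ?thesis using W_cov_le[OF assms(1) True] by simp
next
  case False
  then have "r \<le> s" by simp
  from W_cov_le[OF assms(2) this, of k h] show ?thesis
    using False by (simp add: mult.commute inner_commute)
qed

text \<open>The alternating sum of minima produced by \<open>W_cov\<close> is the length of the
  overlap. In this form it agrees with the integral of a product of two indicators.\<close>

lemma increment_cov:
  assumes "0 \<le> \<alpha>" "\<alpha> \<le> \<beta>" "0 \<le> \<gamma>" "\<gamma> \<le> \<delta>"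
  shows "(LINT \<omega>|M. ((W \<beta> \<omega> - W \<alpha> \<omega>) \<bullet> h) * ((W \<delta> \<omega> - W \<gamma> \<omega>) \<bullet> k))
    = measure lborel ({\<alpha><..\<beta>} \<inter> {\<gamma><..\<delta>}) * (Qh h \<bullet> Qh k)"
proof -
  define q where "q = Qh h \<bullet> Qh k"
  have nn: "0 \<le> \<beta>" "0 \<le> \<delta>" using assms by auto
  note int = square_integrable_mult[OF W_square_integrable W_square_integrable]
  have "(LINT \<omega>|M. ((W \<beta> \<omega> - W \<alpha> \<omega>) \<bullet> h) * ((W \<delta> \<omega> - W \<gamma> \<omega>) \<bullet> k))
      = (LINT \<omega>|M. ((W \<beta> \<omega> \<bullet> h) * (W \<delta> \<omega> \<bullet> k) - (W \<beta> \<omega> \<bullet> h) * (W \<gamma> \<omega> \<bullet> k))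
        - ((W \<alpha> \<omega> \<bullet> h) * (W \<delta> \<omega> \<bullet> k) - (W \<alpha> \<omega> \<bullet> h) * (W \<gamma> \<omega> \<bullet> k)))"
    by (intro Bochner_Integration.integral_cong refl) (simp add: inner_diff_left algebra_simps)
  also have "\<dots> = (min \<beta> \<delta> * q - min \<beta> \<gamma> * q) - (min \<alpha> \<delta> * q - min \<alpha> \<gamma> * q)"
    by (subst Bochner_Integration.integral_diff; (intro Bochner_Integration.integrable_diff int assms nn)?)+
      (simp add: W_cov assms nn q_def)
  also have "\<dots> = (min \<beta> \<delta> - min \<beta> \<gamma> - min \<alpha> \<delta> + min \<alpha> \<gamma>) * q"
    by (simp add: algebra_simps)
  also have "min \<beta> \<delta> - min \<beta> \<gamma> - min \<alpha> \<delta> + min \<alpha> \<gamma> = measure lborel ({\<alpha><..\<beta>} \<inter> {\<gamma><..\<delta>})"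
  proof -
    have "{\<alpha><..\<beta>} \<inter> {\<gamma><..\<delta>} = {max \<alpha> \<gamma><..min \<beta> \<delta>}" by auto
    moreover have "measure lborel {max \<alpha> \<gamma><..min \<beta> \<delta>} = (if max \<alpha> \<gamma> \<le> min \<beta> \<delta> then min \<beta> \<delta> - max \<alpha> \<gamma> else 0)"
    proof (cases "max \<alpha> \<gamma> \<le> min \<beta> \<delta>")
      case True
      then show ?thesis unfolding measure_def by (simp only: emeasure_lborel_Ioc enn2real_ennreal diff_ge_0_iff_ge if_True)
    next
      case False
      then have "{max \<alpha> \<gamma><..min \<beta> \<delta>} = {}" by auto
      then show ?thesis unfolding if_not_P[OF False] by (simp only: measure_empty)
    qed
    ultimately show ?thesis using assms by (auto simp: min_def max_def)
  qed
  finally show ?thesis by (simp add: q_def)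
qed

end

text \<open>The deterministic side of the Ito isometry: a point \<open>(i, s)\<close> is the noise
  direction \<open>e i\<close> at time \<open>s\<close>, and L2 of this measure receives the scalar
  Wiener integrals up to time \<open>T\<close>.\<close>

definition noise_space :: "real \<Rightarrow> (nat \<times> real) measure"
  where "noise_space T = count_space UNIV \<Otimes>\<^sub>M restrict_space lborel {0..T}"

lemma finite_time_measure: "finite_measure (restrict_space lborel {0..T::real})"
proof (rule finite_measureI)
  have "emeasure (restrict_space lborel {0..T}) (space (restrict_space lborel {0..T})) = emeasure lborel {0..T}"
    by (subst emeasure_restrict_space) (auto simp: space_restrict_space)
  also have "\<dots> < \<infinity>" by (simp add: emeasure_lborel_Icc_eq)
  finally show "emeasure (restrict_space lborel {0..T}) (space (restrict_space lborel {0..T})) \<noteq> \<infinity>" by simp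
qed

lemma sigma_finite_count_nat: "sigma_finite_measure (count_space (UNIV :: nat set))"
  by (rule sigma_finite_measure_count_space_countable) simp

lemma noise_pair: "pair_sigma_finite (count_space (UNIV :: nat set)) (restrict_space lborel {0..T::real})"
  unfolding pair_sigma_finite_def
  by (intro conjI sigma_finite_count_nat finite_measure.axioms(1)[OF finite_time_measure])

lemma sigma_finite_noise: "sigma_finite_measure (noise_space T)"
proof -
  interpret pair_sigma_finite "count_space (UNIV :: nat set)" "restrict_space lborel {0..T}" by (rule noise_pair)
  show ?thesis unfolding noise_space_def by (rule sigma_finite_measure_axioms)
qed

lemma noise_measurableI:
  assumes "\<And>i. f i \<in> borel_measurable borel"
  shows "(\<lambda>(i, s). f i s) \<in> borel_measurable (noise_space T)"
  unfolding noise_space_def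
  by (rule measurable_pair_measure_countable1)
    (use assms in \<open>auto intro: measurable_restrict_space1\<close>)

lemma noise_product:
  fixes f :: "nat \<Rightarrow> real" and g :: "real \<Rightarrow> real"
  assumes f: "summable (\<lambda>i. \<bar>f i\<bar>)" and g: "integrable (restrict_space lborel {0..T}) g"
  shows "integrable (noise_space T) (\<lambda>(i, s). f i * g s)"
    and "(LINT p|noise_space T. (case p of (i, s) \<Rightarrow> f i * g s)) = (\<Sum>i. f i) * (LINT s|restrict_space lborel {0..T}. g s)"
proof -
  interpret pair_sigma_finite "count_space (UNIV :: nat set)" "restrict_space lborel {0..T}" by (rule noise_pair)
  note gm = borel_measurable_integrable[OF g]
  have meas: "(\<lambda>(i, s). f i * g s) \<in> borel_measurable (noise_space T)"
    unfolding noise_space_def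
    by (rule measurable_pair_measure_countable1) (use gm in auto)
  have fint: "integrable (count_space UNIV) f" using f by (simp add: integrable_count_space_nat_iff)
  show int: "integrable (noise_space T) (\<lambda>(i, s). f i * g s)"
    unfolding noise_space_def
  proof (rule Fubini_integrable)
    show "(\<lambda>(i, s). f i * g s) \<in> borel_measurable (count_space UNIV \<Otimes>\<^sub>M restrict_space lborel {0..T})"
      using meas by (simp add: noise_space_def)
    show "integrable (count_space UNIV) (\<lambda>i. LINT s|restrict_space lborel {0..T}. norm (case (i, s) of (i, s) \<Rightarrow> f i * g s))"
      using integrable_mult_left[OF integrable_norm[OF fint], of "LINT s|restrict_space lborel {0..T}. \<bar>g s\<bar>"]
      by (simp add: abs_mult)
    show "AE i in count_space UNIV. integrable (restrict_space lborel {0..T}) (\<lambda>s. case (i, s) of (i, s) \<Rightarrow> f i * g s)"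
      using g by simp
  qed
  have "(LINT p|noise_space T. (case p of (i, s) \<Rightarrow> f i * g s)) = (LINT i|count_space UNIV. LINT s|restrict_space lborel {0..T}. f i * g s)"
    using integral_fst'[OF int[unfolded noise_space_def]] by (simp add: noise_space_def)
  also have "\<dots> = (\<Sum>i. f i) * (LINT s|restrict_space lborel {0..T}. g s)"
    using integral_count_space_nat[OF fint] by simp
  finally show "(LINT p|noise_space T. (case p of (i, s) \<Rightarrow> f i * g s)) = (\<Sum>i. f i) * (LINT s|restrict_space lborel {0..T}. g s)" .
qed

lemma nn_integral_noise:
  assumes f: "f \<in> borel_measurable (noise_space T)"
  shows "integral\<^sup>N (noise_space T) f = (\<integral>\<^sup>+s\<in>{0..T}. (\<Sum>i. f (i, s)) \<partial>lborel)"
proof -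
  interpret pair_sigma_finite "count_space (UNIV :: nat set)" "restrict_space lborel {0..T}" by (rule noise_pair)
  have "integral\<^sup>N (noise_space T) f = (\<integral>\<^sup>+s. (\<integral>\<^sup>+i. f (i, s) \<partial>count_space UNIV) \<partial>restrict_space lborel {0..T})"
    using nn_integral_snd[OF f[unfolded noise_space_def]] by (simp add: noise_space_def)
  also have "\<dots> = (\<integral>\<^sup>+s. (\<Sum>i. f (i, s)) \<partial>restrict_space lborel {0..T})"
    by (simp add: nn_integral_count_space_nat)
  also have "\<dots> = (\<integral>\<^sup>+s\<in>{0..T}. (\<Sum>i. f (i, s)) \<partial>lborel)"
    by (subst nn_integral_restrict_space) auto
  finally show ?thesis .
qed

section \<open>The Ito isometry for step integrands and its closure\<close>

context wiener_setting
begin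

text \<open>The image of the increment \<open>(W \<beta> - W \<alpha>) \<bullet> h\<close> on the
  deterministic side.\<close>

definition noise_step :: "real \<Rightarrow> real \<Rightarrow> 'd l2_torus \<Rightarrow> nat \<times> real \<Rightarrow> real"
  where "noise_step \<alpha> \<beta> h = (\<lambda>(i, s). (Qh (e i) \<bullet> h) * indicator {\<alpha><..\<beta>} s)"

lemma noise_step_cov:
  shows "square_integrable (noise_space T) (noise_step \<alpha> \<beta> h)"
    and "0 \<le> \<alpha> \<Longrightarrow> \<beta> \<le> T \<Longrightarrow> (LINT p|noise_space T. noise_step \<alpha> \<beta> h p * noise_step \<gamma> \<delta> k p)
      = measure lborel ({\<alpha><..\<beta>} \<inter> {\<gamma><..\<delta>}) * (Qh h \<bullet> Qh k)"
proof -
  have ps: "(\<lambda>i. (Qh (e i) \<bullet> h) * (Qh (e i) \<bullet> k)) sums (Qh h \<bullet> Qh k)" for h k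
  proof -
    have "Qh (e i) \<bullet> h = Qh h \<bullet> e i" for i h
      using Qh_sym[of "e i" h] by (simp only: inner_commute)
    then show ?thesis
      using parseval_sums[OF basis, of "Qh h" "Qh k"] by (simp only:)
  qed
  have sq: "summable (\<lambda>i. (Qh (e i) \<bullet> h)\<^sup>2)" for h
    using ps[of h h] by (simp add: sums_iff power2_eq_square)
  have abs: "summable (\<lambda>i. \<bar>(Qh (e i) \<bullet> h) * (Qh (e i) \<bullet> k)\<bar>)" for h k
  proof (rule summable_comparison_test'[where N = 0])
    show "summable (\<lambda>i. (Qh (e i) \<bullet> h)\<^sup>2 + (Qh (e i) \<bullet> k)\<^sup>2)"
      by (intro summable_add sq)
    have "\<bar>a * b\<bar> \<le> a\<^sup>2 + b\<^sup>2" for a b :: real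
    proof -
      have "2 * (\<bar>a\<bar> * \<bar>b\<bar>) \<le> a\<^sup>2 + b\<^sup>2" using sum_squares_bound[of "\<bar>a\<bar>" "\<bar>b\<bar>"] by simp
      moreover have "0 \<le> \<bar>a\<bar> * \<bar>b\<bar>" by simp
      ultimately show ?thesis unfolding abs_mult by linarith
    qed
    then show "norm \<bar>(Qh (e i) \<bullet> h) * (Qh (e i) \<bullet> k)\<bar> \<le> (Qh (e i) \<bullet> h)\<^sup>2 + (Qh (e i) \<bullet> k)\<^sup>2" for i
      by simp
  qed
  have ind: "integrable (restrict_space lborel {0..T}) (indicat_real ({\<alpha><..\<beta>} \<inter> {\<gamma><..\<delta>}))" for \<alpha> \<beta> \<gamma> \<delta>
  proof -
    interpret finite_measure "restrict_space lborel {0..T}" by (rule finite_time_measure)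
    show ?thesis
      by (rule integrable_const_bound[where B = 1])
        (auto simp: indicator_def intro!: measurable_restrict_space1)
  qed
  have prod: "noise_step \<alpha> \<beta> h p * noise_step \<gamma> \<delta> k p = (case p of (i, s) \<Rightarrow> ((Qh (e i) \<bullet> h) * (Qh (e i) \<bullet> k)) * indicat_real ({\<alpha><..\<beta>} \<inter> {\<gamma><..\<delta>}) s)" for \<alpha> \<beta> \<gamma> \<delta> h k p
    by (auto simp: noise_step_def indicator_def split: prod.split)
  have "noise_step \<alpha> \<beta> h \<in> borel_measurable (noise_space T)"
    unfolding noise_step_def by (rule noise_measurableI) measurable
  moreover have "integrable (noise_space T) (\<lambda>p. (noise_step \<alpha> \<beta> h p)\<^sup>2)"
    unfolding power2_eq_square prod by (rule noise_product(1)[OF abs ind])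
  ultimately show "square_integrable (noise_space T) (noise_step \<alpha> \<beta> h)" by (simp add: square_integrable_def)
  assume assms: "0 \<le> \<alpha>" "\<beta> \<le> T"
  have "(LINT s|restrict_space lborel {0..T}. indicat_real ({\<alpha><..\<beta>} \<inter> {\<gamma><..\<delta>}) s) = (LINT s|lborel. indicat_real ({\<alpha><..\<beta>} \<inter> {\<gamma><..\<delta>}) s)"
  proof -
    have "indicator {0..T} s *\<^sub>R indicat_real ({\<alpha><..\<beta>} \<inter> {\<gamma><..\<delta>}) s = indicat_real ({\<alpha><..\<beta>} \<inter> {\<gamma><..\<delta>}) s" for s
      using assms by (auto simp: indicator_def)
    then show ?thesis by (subst integral_restrict_space) (simp_all only: sets_lborel, simp_all)
  qed
  also have "\<dots> = measure lborel ({\<alpha><..\<beta>} \<inter> {\<gamma><..\<delta>})" by simp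
  finally have mi: "(LINT s|restrict_space lborel {0..T}. indicat_real ({\<alpha><..\<beta>} \<inter> {\<gamma><..\<delta>}) s) = measure lborel ({\<alpha><..\<beta>} \<inter> {\<gamma><..\<delta>})" .
  show "(LINT p|noise_space T. noise_step \<alpha> \<beta> h p * noise_step \<gamma> \<delta> k p)
      = measure lborel ({\<alpha><..\<beta>} \<inter> {\<gamma><..\<delta>}) * (Qh h \<bullet> Qh k)"
    unfolding prod noise_product(2)[OF abs ind] mi using ps[of h k] by (simp add: sums_iff mult.commute)
qed

text \<open>A random variable \<open>X\<close> and a function \<open>x\<close> of the noise are paired when they are the two sides
  of the Ito isometry for the same deterministic step integrand.\<close>

definition step_pair :: "real \<Rightarrow> ('w \<Rightarrow> real) \<Rightarrow> (nat \<times> real \<Rightarrow> real) \<Rightarrow> bool"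
  where "step_pair T X x \<longleftrightarrow> (\<exists>(n::nat) \<alpha> \<beta> h. (\<forall>j<n. 0 \<le> \<alpha> j \<and> \<alpha> j \<le> \<beta> j \<and> \<beta> j \<le> T) \<and>
    X = (\<lambda>\<omega>. \<Sum>j<n. (W (\<beta> j) \<omega> - W (\<alpha> j) \<omega>) \<bullet> h j) \<and> x = (\<lambda>p. \<Sum>j<n. noise_step (\<alpha> j) (\<beta> j) (h j) p))"

lemma step_pair_square_integrable:
  assumes "step_pair T X x"
  shows "square_integrable M X" "square_integrable (noise_space T) x"
proof -
  obtain n \<alpha> \<beta> h where *: "\<forall>j<n::nat. 0 \<le> \<alpha> j \<and> \<alpha> j \<le> \<beta> j \<and> \<beta> j \<le> T"
    "X = (\<lambda>\<omega>. \<Sum>j<n. (W (\<beta> j) \<omega> - W (\<alpha> j) \<omega>) \<bullet> h j)" "x = (\<lambda>p. \<Sum>j<n. noise_step (\<alpha> j) (\<beta> j) (h j) p)"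
    using assms unfolding step_pair_def by blast
  show "square_integrable M X"
    unfolding *(2) by (intro square_integrable_sum increment_moments(1)) (use *(1) in auto)
  show "square_integrable (noise_space T) x"
    unfolding *(3) by (intro square_integrable_sum noise_step_cov(1))
qed

lemma step_pair_isometry:
  assumes X: "step_pair T X x" and Y: "step_pair T Y y"
  shows "(LINT \<omega>|M. X \<omega> * Y \<omega>) = (LINT p|noise_space T. x p * y p)"
proof -
  obtain n \<alpha> \<beta> h where *: "\<forall>j<n::nat. 0 \<le> \<alpha> j \<and> \<alpha> j \<le> \<beta> j \<and> \<beta> j \<le> T"
    "X = (\<lambda>\<omega>. \<Sum>j<n. (W (\<beta> j) \<omega> - W (\<alpha> j) \<omega>) \<bullet> h j)" "x = (\<lambda>p. \<Sum>j<n. noise_step (\<alpha> j) (\<beta> j) (h j) p)"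
    using X unfolding step_pair_def by blast
  obtain m \<gamma> \<delta> k where **: "\<forall>j<m::nat. 0 \<le> \<gamma> j \<and> \<gamma> j \<le> \<delta> j \<and> \<delta> j \<le> T"
    "Y = (\<lambda>\<omega>. \<Sum>j<m. (W (\<delta> j) \<omega> - W (\<gamma> j) \<omega>) \<bullet> k j)" "y = (\<lambda>p. \<Sum>j<m. noise_step (\<gamma> j) (\<delta> j) (k j) p)"
    using Y unfolding step_pair_def by blast
  have "(LINT \<omega>|M. X \<omega> * Y \<omega>) = (\<Sum>i<n. \<Sum>j<m. LINT \<omega>|M. ((W (\<beta> i) \<omega> - W (\<alpha> i) \<omega>) \<bullet> h i) * ((W (\<delta> j) \<omega> - W (\<gamma> j) \<omega>) \<bullet> k j))"
    unfolding *(2) **(2) sum_product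
    by (subst Bochner_Integration.integral_sum;
        (intro sum.cong refl Bochner_Integration.integral_sum Bochner_Integration.integrable_sum square_integrable_mult increment_moments(1))?)
      (use *(1) **(1) in auto)
  also have "\<dots> = (\<Sum>i<n. \<Sum>j<m. LINT p|noise_space T. noise_step (\<alpha> i) (\<beta> i) (h i) p * noise_step (\<gamma> j) (\<delta> j) (k j) p)"
  proof (intro sum.cong refl)
    fix i j assume "i \<in> {..<n}" "j \<in> {..<m}"
    then have ij: "0 \<le> \<alpha> i" "\<alpha> i \<le> \<beta> i" "\<beta> i \<le> T" "0 \<le> \<gamma> j" "\<gamma> j \<le> \<delta> j" "\<delta> j \<le> T" using *(1) **(1) by auto
    show "(LINT \<omega>|M. ((W (\<beta> i) \<omega> - W (\<alpha> i) \<omega>) \<bullet> h i) * ((W (\<delta> j) \<omega> - W (\<gamma> j) \<omega>) \<bullet> k j))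
        = (LINT p|noise_space T. noise_step (\<alpha> i) (\<beta> i) (h i) p * noise_step (\<gamma> j) (\<delta> j) (k j) p)"
      by (simp only: increment_cov[OF ij(1,2,4,5)] noise_step_cov(2)[OF ij(1,3)])
  qed
  also have "\<dots> = (LINT p|noise_space T. x p * y p)"
    unfolding *(3) **(3) sum_product
    by (simp add: Bochner_Integration.integral_sum Bochner_Integration.integrable_sum square_integrable_mult noise_step_cov(1))
  finally show ?thesis .
qed

lemma step_pair_orthogonal:
  assumes X: "step_pair T X x" and g: "g \<in> borel_measurable (F 0)" "\<And>\<omega>. \<bar>g \<omega>\<bar> \<le> K"
  shows "(LINT \<omega>|M. g \<omega> * X \<omega>) = 0"
proof -
  obtain n \<alpha> \<beta> h where *: "\<forall>j<n::nat. 0 \<le> \<alpha> j \<and> \<alpha> j \<le> \<beta> j \<and> \<beta> j \<le> T"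
    "X = (\<lambda>\<omega>. \<Sum>j<n. (W (\<beta> j) \<omega> - W (\<alpha> j) \<omega>) \<bullet> h j)"
    using X unfolding step_pair_def by blast
  have gM: "g \<in> borel_measurable M" by (rule F_measurable[OF order_refl g(1)])
  have gi: "integrable M g" by (rule integrable_const_bound[where B = K]) (use gM g(2) in auto)
  have gs: "square_integrable M g"
  proof -
    have "\<bar>g \<omega>\<bar>\<^sup>2 \<le> K\<^sup>2" for \<omega> by (rule power_mono[OF g(2)]) simp
    then have "integrable M (\<lambda>\<omega>. (g \<omega>)\<^sup>2)"
      by (intro integrable_const_bound[where B = "K\<^sup>2"]) (use gM in auto)
    then show ?thesis using gM by (simp add: square_integrable_def)
  qed
  have "(LINT \<omega>|M. g \<omega> * X \<omega>) = (\<Sum>j<n. LINT \<omega>|M. g \<omega> * ((W (\<beta> j) \<omega> - W (\<alpha> j) \<omega>) \<bullet> h j))"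
    unfolding *(2) sum_distrib_left
    by (rule Bochner_Integration.integral_sum, rule square_integrable_mult[OF gs increment_moments(1)]) (use *(1) in auto)
  also have "\<dots> = 0"
  proof (rule sum.neutral, rule ballI)
    fix j assume "j \<in> {..<n}"
    then have j: "0 \<le> \<alpha> j" "\<alpha> j \<le> \<beta> j" using *(1) by auto
    have "space (F 0) = space M" "space (F (\<alpha> j)) = space M"
      using F_subalgebra j by (auto simp: subalgebra_def)
    then have "g \<in> borel_measurable (F (\<alpha> j))"
      using g(1) F_mono[OF order_refl j(1)] by (auto simp: measurable_def)
    then show "(LINT \<omega>|M. g \<omega> * ((W (\<beta> j) \<omega> - W (\<alpha> j) \<omega>) \<bullet> h j)) = 0"
      by (rule increment_orthogonal[OF j _ gi])
  qed
  finally show ?thesis .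
qed

text \<open>The closure of \<open>step_pair\<close> in L2 on both sides, along one common sequence.
  Isometry and orthogonality pass to it without the isometry being constructed as a map.\<close>

definition isometric_pair :: "real \<Rightarrow> ('w \<Rightarrow> real) \<Rightarrow> (nat \<times> real \<Rightarrow> real) \<Rightarrow> bool"
  where "isometric_pair T X x \<longleftrightarrow> X \<in> borel_measurable M \<and> x \<in> borel_measurable (noise_space T) \<and>
    (\<exists>Xm xm. (\<forall>m::nat. step_pair T (Xm m) (xm m)) \<and>
      (\<lambda>m. \<integral>\<^sup>+\<omega>. ennreal ((Xm m \<omega> - X \<omega>)\<^sup>2) \<partial>M) \<longlonglongrightarrow> 0 \<and>
      (\<lambda>m. \<integral>\<^sup>+p. ennreal ((xm m p - x p)\<^sup>2) \<partial>noise_space T) \<longlonglongrightarrow> 0)"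

lemma isometric_pair_square_integrable:
  assumes "isometric_pair T X x"
  shows "square_integrable M X" "square_integrable (noise_space T) x"
proof -
  obtain Xm xm where m: "\<And>m::nat. step_pair T (Xm m) (xm m)"
      "(\<lambda>m. \<integral>\<^sup>+\<omega>. ennreal ((Xm m \<omega> - X \<omega>)\<^sup>2) \<partial>M) \<longlonglongrightarrow> 0"
      "(\<lambda>m. \<integral>\<^sup>+p. ennreal ((xm m p - x p)\<^sup>2) \<partial>noise_space T) \<longlonglongrightarrow> 0"
    using assms unfolding isometric_pair_def by blast
  have meas: "X \<in> borel_measurable M" "x \<in> borel_measurable (noise_space T)"
    using assms by (auto simp: isometric_pair_def)
  show "square_integrable M X"
    by (rule square_integrable_limit(1)[OF step_pair_square_integrable(1)[OF m(1)] meas(1) m(2)])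
  show "square_integrable (noise_space T) x"
    by (rule square_integrable_limit(1)[OF step_pair_square_integrable(2)[OF m(1)] meas(2) m(3)])
qed

lemma isometric_pair_isometry:
  assumes X: "isometric_pair T X x" and Y: "isometric_pair T Y y"
  shows "(LINT \<omega>|M. X \<omega> * Y \<omega>) = (LINT p|noise_space T. x p * y p)"
proof -
  obtain Xm xm where m: "\<And>m::nat. step_pair T (Xm m) (xm m)"
      "(\<lambda>m. \<integral>\<^sup>+\<omega>. ennreal ((Xm m \<omega> - X \<omega>)\<^sup>2) \<partial>M) \<longlonglongrightarrow> 0"
      "(\<lambda>m. \<integral>\<^sup>+p. ennreal ((xm m p - x p)\<^sup>2) \<partial>noise_space T) \<longlonglongrightarrow> 0"
    using X unfolding isometric_pair_def by blast
  obtain Ym ym where k: "\<And>m::nat. step_pair T (Ym m) (ym m)"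
      "(\<lambda>m. \<integral>\<^sup>+\<omega>. ennreal ((Ym m \<omega> - Y \<omega>)\<^sup>2) \<partial>M) \<longlonglongrightarrow> 0"
      "(\<lambda>m. \<integral>\<^sup>+p. ennreal ((ym m p - y p)\<^sup>2) \<partial>noise_space T) \<longlonglongrightarrow> 0"
    using Y unfolding isometric_pair_def by blast
  note sX = isometric_pair_square_integrable[OF X] and sY = isometric_pair_square_integrable[OF Y]
  note pm = step_pair_square_integrable[OF m(1)] and pk = step_pair_square_integrable[OF k(1)]
  have "(\<lambda>n. LINT \<omega>|M. Xm n \<omega> * Ym n \<omega>) \<longlonglongrightarrow> (LINT \<omega>|M. X \<omega> * Y \<omega>)"
    by (rule integral_mult_limit[OF pm(1) sX(1) square_integrable_limit(2)[OF pm(1) square_integrable_measurable[OF sX(1)] m(2)]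
          pk(1) sY(1) square_integrable_limit(2)[OF pk(1) square_integrable_measurable[OF sY(1)] k(2)]])
  moreover have "(\<lambda>n. LINT p|noise_space T. xm n p * ym n p) \<longlonglongrightarrow> (LINT p|noise_space T. x p * y p)"
    by (rule integral_mult_limit[OF pm(2) sX(2) square_integrable_limit(2)[OF pm(2) square_integrable_measurable[OF sX(2)] m(3)]
          pk(2) sY(2) square_integrable_limit(2)[OF pk(2) square_integrable_measurable[OF sY(2)] k(3)]])
  ultimately show ?thesis
    unfolding step_pair_isometry[OF m(1) k(1)] by (rule LIMSEQ_unique)
qed

lemma isometric_pair_orthogonal:
  assumes X: "isometric_pair T X x" and g: "g \<in> borel_measurable (F 0)" "\<And>\<omega>. \<bar>g \<omega>\<bar> \<le> K"
  shows "square_integrable M g" "(LINT \<omega>|M. g \<omega> * X \<omega>) = 0"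
proof -
  obtain Xm xm where m: "\<And>m::nat. step_pair T (Xm m) (xm m)"
      "(\<lambda>m. \<integral>\<^sup>+\<omega>. ennreal ((Xm m \<omega> - X \<omega>)\<^sup>2) \<partial>M) \<longlonglongrightarrow> 0"
    using X unfolding isometric_pair_def by blast
  have gM: "g \<in> borel_measurable M" by (rule F_measurable[OF order_refl g(1)])
  show gs: "square_integrable M g"
  proof -
    have "\<bar>g \<omega>\<bar>\<^sup>2 \<le> K\<^sup>2" for \<omega> by (rule power_mono[OF g(2)]) simp
    then have "integrable M (\<lambda>\<omega>. (g \<omega>)\<^sup>2)"
      by (intro integrable_const_bound[where B = "K\<^sup>2"]) (use gM in auto)
    then show ?thesis using gM by (simp add: square_integrable_def)
  qed
  note sX = isometric_pair_square_integrable(1)[OF X] and pm = step_pair_square_integrable(1)[OF m(1)]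
  have "(\<lambda>n. LINT \<omega>|M. g \<omega> * Xm n \<omega>) \<longlonglongrightarrow> (LINT \<omega>|M. g \<omega> * X \<omega>)"
    by (rule integral_mult_limit[where f = "\<lambda>_. g", OF gs gs _ pm sX square_integrable_limit(2)[OF pm square_integrable_measurable[OF sX] m(2)]]) simp
  then have "(\<lambda>n. 0 :: real) \<longlonglongrightarrow> (LINT \<omega>|M. g \<omega> * X \<omega>)"
    unfolding step_pair_orthogonal[OF m(1) g] .
  then show "(LINT \<omega>|M. g \<omega> * X \<omega>) = 0" by (simp add: LIMSEQ_const_iff)
qed

text \<open>Testing against a fixed \<open>a\<close> reduces operator-valued integrals to scalars.
  By Cauchy-Schwarz the Hilbert-Schmidt distance of the integrands dominates the L2 distance of the
  tested ones, so the two limits of \<open>has_wiener_integral\<close> become those of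
  \<open>isometric_pair\<close>.\<close>

lemma wiener_integral_isometric_pair:
  assumes Z: "has_wiener_integral M e Qh W r \<Phi> Z" and r: "0 \<le> r" "r \<le> T"
  shows "isometric_pair T (\<lambda>\<omega>. Z \<omega> \<bullet> a) (\<lambda>(i, s). indicator {0<..r} s * (\<Phi> s (Qh (e i)) \<bullet> a))"
proof -
  from Z obtain n \<tau> A where part: "\<And>m. is_partition r (n m) (\<tau> m)"
    and Zm [measurable]: "Z \<in> borel_measurable M"
    and Pm [measurable]: "\<And>h. (\<lambda>s. \<Phi> s (Qh h)) \<in> borel_measurable borel"
    and hs: "(\<lambda>m. \<integral>\<^sup>+s\<in>{0..r}. hs_norm_sq e (\<lambda>h. blinfun_apply (step_operator (n m) (\<tau> m) (A m) s) (Qh h)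
          - \<Phi> s (Qh h)) \<partial>lborel) \<longlonglongrightarrow> 0"
    and lim: "(\<lambda>m. \<integral>\<^sup>+\<omega>. ennreal ((norm (step_integral (n m) (\<tau> m) (A m) W \<omega> - Z \<omega>))\<^sup>2) \<partial>M) \<longlonglongrightarrow> 0"
    unfolding has_wiener_integral_def by blast
  \<comment> \<open>The vector \<open>h\<close> is the adjoint of the step operator applied to
    \<open>a\<close>, obtained by Riesz representation; \<open>step_pair\<close> admits only such
    scalar steps.\<close>
  have "\<forall>m j. \<exists>h. \<forall>x. A m j x \<bullet> a = x \<bullet> h"
  proof (intro allI)
    fix m j
    show "\<exists>h. \<forall>x. A m j x \<bullet> a = x \<bullet> h"
      by (rule riesz_representation[OF basis bounded_linear_compose[OF bounded_linear_inner_left blinfun.bounded_linear_right]])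
  qed
  then obtain h where h: "\<And>m j x. A m j x \<bullet> a = x \<bullet> h m j" by metis
  define Xm where "Xm m \<omega> = (\<Sum>j<n m. (W (\<tau> m (Suc j)) \<omega> - W (\<tau> m j) \<omega>) \<bullet> h m j)" for m \<omega>
  define xm where "xm m p = (\<Sum>j<n m. noise_step (\<tau> m j) (\<tau> m (Suc j)) (h m j) p)" for m p
  define x where "x = (\<lambda>(i, s). indicator {0<..r} s * (\<Phi> s (Qh (e i)) \<bullet> a))"
  have tau: "0 \<le> \<tau> m j \<and> \<tau> m j \<le> r" if "j \<le> n m" for m j
  proof -
    have mono: "i \<le> j \<Longrightarrow> j \<le> n m \<Longrightarrow> \<tau> m i \<le> \<tau> m j" for i j
    proof (induction j)
      case (Suc j)
      have step: "\<tau> m j \<le> \<tau> m (Suc j)" using part[of m] Suc.prems by (simp add: is_partition_def)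
      show ?case
      proof (cases "i = Suc j")
        case False
        then have "\<tau> m i \<le> \<tau> m j" using Suc by simp
        then show ?thesis using step by simp
      qed simp
    qed simp
    show ?thesis using mono[of 0 j] mono[of j "n m"] that part[of m] by (simp add: is_partition_def)
  qed
  have tau_step: "\<tau> m j \<le> \<tau> m (Suc j)" if "j < n m" for m j
    using part[of m] that by (simp add: is_partition_def)
  have pair: "step_pair T (Xm m) (xm m)" for m
    unfolding step_pair_def
  proof (intro exI conjI)
    show "\<forall>j<n m. 0 \<le> \<tau> m j \<and> \<tau> m j \<le> \<tau> m (Suc j) \<and> \<tau> m (Suc j) \<le> T"
      using tau tau_step r by (metis Suc_leI less_imp_le_nat order_trans)
    show "Xm m = (\<lambda>\<omega>. \<Sum>j<n m. (W (\<tau> m (Suc j)) \<omega> - W (\<tau> m j) \<omega>) \<bullet> h m j)" by (auto simp: Xm_def)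
    show "xm m = (\<lambda>p. \<Sum>j<n m. noise_step (\<tau> m j) (\<tau> m (Suc j)) (h m j) p)" by (auto simp: xm_def)
  qed
  have Xm_alt: "Xm m \<omega> = step_integral (n m) (\<tau> m) (A m) W \<omega> \<bullet> a" for m \<omega>
    by (simp add: Xm_def step_integral_def inner_sum_left h)
  have xm_alt: "xm m (i, s) = blinfun_apply (step_operator (n m) (\<tau> m) (A m) s) (Qh (e i)) \<bullet> a" for m i s
    by (simp add: xm_def noise_step_def step_operator_def blinfun.sum_left blinfun.scaleR_left inner_sum_left h mult.commute)
  \<comment> \<open>Step operators vanish outside \<open>{0<..r}\<close>, like the indicator in
    \<open>x\<close>, so the comparison over \<open>{0..T}\<close> reduces to one over
    \<open>{0..r}\<close>.\<close>
  have step_0: "step_operator (n m) (\<tau> m) (A m) s = 0" if "s \<notin> {0<..r}" for m s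
    unfolding step_operator_def
  proof (rule sum.neutral, rule ballI)
    fix j assume "j \<in> {..<n m}"
    then have "0 \<le> \<tau> m j" "\<tau> m (Suc j) \<le> r" using tau[of j m] tau[of "Suc j" m] by auto
    then have "s \<notin> {\<tau> m j<..\<tau> m (Suc j)}" using that by auto
    then show "indicator {\<tau> m j<..\<tau> m (Suc j)} s *\<^sub>R A m j = 0" by simp
  qed
  have sq_le: "(u \<bullet> a)\<^sup>2 \<le> (norm a)\<^sup>2 * (norm u)\<^sup>2" for u
    using power_mono[OF Cauchy_Schwarz_ineq2[of u a], of 2] by (simp add: power_mult_distrib mult.commute)
  have x_meas [measurable]: "x \<in> borel_measurable (noise_space T)"
    unfolding x_def by (rule noise_measurableI) measurable
  have xm_meas [measurable]: "xm m \<in> borel_measurable (noise_space T)" for m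
    using step_pair_square_integrable(2)[OF pair[of m]] by (rule square_integrable_measurable)
  have 1: "(\<lambda>m. \<integral>\<^sup>+\<omega>. ennreal ((Xm m \<omega> - Z \<omega> \<bullet> a)\<^sup>2) \<partial>M) \<longlonglongrightarrow> 0"
  proof (rule tendsto_sandwich[OF _ _ tendsto_const])
    show "\<forall>\<^sub>F m in sequentially. 0 \<le> (\<integral>\<^sup>+\<omega>. ennreal ((Xm m \<omega> - Z \<omega> \<bullet> a)\<^sup>2) \<partial>M)" by simp
    show "\<forall>\<^sub>F m in sequentially. (\<integral>\<^sup>+\<omega>. ennreal ((Xm m \<omega> - Z \<omega> \<bullet> a)\<^sup>2) \<partial>M)
        \<le> ennreal ((norm a)\<^sup>2) * (\<integral>\<^sup>+\<omega>. ennreal ((norm (step_integral (n m) (\<tau> m) (A m) W \<omega> - Z \<omega>))\<^sup>2) \<partial>M)"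
    proof (rule always_eventually, rule allI)
      fix m
      have [measurable]: "step_integral (n m) (\<tau> m) (A m) W \<in> borel_measurable M"
      proof -
        have "(\<lambda>\<omega>. A m j (W (\<tau> m (Suc j)) \<omega> - W (\<tau> m j) \<omega>)) \<in> borel_measurable M" if "j < n m" for j
        proof -
          have "W (\<tau> m (Suc j)) \<in> borel_measurable M" "W (\<tau> m j) \<in> borel_measurable M"
            using tau[of j m] tau[of "Suc j" m] that by auto
          then have "(\<lambda>\<omega>. W (\<tau> m (Suc j)) \<omega> - W (\<tau> m j) \<omega>) \<in> borel_measurable M" by measurable
          moreover have "blinfun_apply (A m j) \<in> borel_measurable borel"
            by (intro borel_measurable_continuous_onI linear_continuous_on blinfun.bounded_linear_right)
          ultimately show ?thesis by (rule measurable_compose)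
        qed
        then show ?thesis
          unfolding step_integral_def[abs_def] by (intro borel_measurable_sum) auto
      qed
      have "(\<integral>\<^sup>+\<omega>. ennreal ((Xm m \<omega> - Z \<omega> \<bullet> a)\<^sup>2) \<partial>M)
          \<le> (\<integral>\<^sup>+\<omega>. ennreal ((norm a)\<^sup>2) * ennreal ((norm (step_integral (n m) (\<tau> m) (A m) W \<omega> - Z \<omega>))\<^sup>2) \<partial>M)"
        by (intro nn_integral_mono) (simp add: Xm_alt sq_le flip: inner_diff_left ennreal_mult)
      also have "\<dots> = ennreal ((norm a)\<^sup>2) * (\<integral>\<^sup>+\<omega>. ennreal ((norm (step_integral (n m) (\<tau> m) (A m) W \<omega> - Z \<omega>))\<^sup>2) \<partial>M)"
        by (rule nn_integral_cmult) measurable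
      finally show "(\<integral>\<^sup>+\<omega>. ennreal ((Xm m \<omega> - Z \<omega> \<bullet> a)\<^sup>2) \<partial>M)
        \<le> ennreal ((norm a)\<^sup>2) * (\<integral>\<^sup>+\<omega>. ennreal ((norm (step_integral (n m) (\<tau> m) (A m) W \<omega> - Z \<omega>))\<^sup>2) \<partial>M)" .
    qed
    show "(\<lambda>m. ennreal ((norm a)\<^sup>2) * (\<integral>\<^sup>+\<omega>. ennreal ((norm (step_integral (n m) (\<tau> m) (A m) W \<omega> - Z \<omega>))\<^sup>2) \<partial>M)) \<longlonglongrightarrow> 0"
      using ennreal_tendsto_cmult[OF _ lim, of "ennreal ((norm a)\<^sup>2)"] by simp
  qed
  have 2: "(\<lambda>m. \<integral>\<^sup>+p. ennreal ((xm m p - x p)\<^sup>2) \<partial>noise_space T) \<longlonglongrightarrow> 0"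
  proof (rule tendsto_sandwich[OF _ _ tendsto_const])
    show "\<forall>\<^sub>F m in sequentially. 0 \<le> (\<integral>\<^sup>+p. ennreal ((xm m p - x p)\<^sup>2) \<partial>noise_space T)" by simp
    define N where "N m s = hs_norm_sq e (\<lambda>h. blinfun_apply (step_operator (n m) (\<tau> m) (A m) s) (Qh h) - \<Phi> s (Qh h))" for m s
    have N_meas: "N m \<in> borel_measurable borel" for m
    proof -
      have "(\<lambda>s. blinfun_apply (step_operator (n m) (\<tau> m) (A m) s) (Qh (e j))) \<in> borel_measurable borel" for j
        unfolding step_operator_def blinfun.sum_left blinfun.scaleR_left by measurable
      then have "(\<lambda>s. ennreal ((norm (blinfun_apply (step_operator (n m) (\<tau> m) (A m) s) (Qh (e j)) - \<Phi> s (Qh (e j))))\<^sup>2)) \<in> borel_measurable borel" for j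
        using Pm[of "e j"] by measurable
      then show ?thesis
        unfolding N_def[abs_def] hs_norm_sq_def by (rule borel_measurable_suminf_order)
    qed
    show "\<forall>\<^sub>F m in sequentially. (\<integral>\<^sup>+p. ennreal ((xm m p - x p)\<^sup>2) \<partial>noise_space T)
        \<le> ennreal ((norm a)\<^sup>2) * (\<integral>\<^sup>+s\<in>{0..r}. N m s \<partial>lborel)"
    proof (rule always_eventually, rule allI)
      fix m
      have pt: "ennreal ((xm m (i, s) - x (i, s))\<^sup>2) \<le> ennreal ((norm a)\<^sup>2) *
          (ennreal ((norm (blinfun_apply (step_operator (n m) (\<tau> m) (A m) s) (Qh (e i)) - \<Phi> s (Qh (e i))))\<^sup>2) * indicator {0..r} s)" for i s
      proof (cases "s \<in> {0<..r}")
        case True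
        then show ?thesis by (simp add: xm_alt x_def sq_le flip: inner_diff_left ennreal_mult)
      next
        case False
        then have "xm m (i, s) - x (i, s) = 0" by (simp add: xm_alt x_def step_0)
        then show ?thesis by simp
      qed
      have "(\<integral>\<^sup>+p. ennreal ((xm m p - x p)\<^sup>2) \<partial>noise_space T) = (\<integral>\<^sup>+s\<in>{0..T}. (\<Sum>i. ennreal ((xm m (i, s) - x (i, s))\<^sup>2)) \<partial>lborel)"
        by (rule nn_integral_noise) measurable
      also have "\<dots> \<le> (\<integral>\<^sup>+s. ennreal ((norm a)\<^sup>2) * (N m s * indicator {0..r} s) \<partial>lborel)"
      proof (rule nn_integral_mono)
        fix s :: real
        have "(\<Sum>i. ennreal ((xm m (i, s) - x (i, s))\<^sup>2)) * indicator {0..T} s \<le> (\<Sum>i. ennreal ((xm m (i, s) - x (i, s))\<^sup>2)) * 1"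
          by (intro mult_left_mono) (auto simp: indicator_def)
        also have "\<dots> \<le> (\<Sum>i. ennreal ((norm a)\<^sup>2) *
          (ennreal ((norm (blinfun_apply (step_operator (n m) (\<tau> m) (A m) s) (Qh (e i)) - \<Phi> s (Qh (e i))))\<^sup>2) * indicator {0..r} s))"
          unfolding mult_1_right by (rule suminf_le) (use pt in auto)
        also have "\<dots> = ennreal ((norm a)\<^sup>2) * (N m s * indicator {0..r} s)"
          by (simp add: N_def hs_norm_sq_def ennreal_suminf_cmult ennreal_suminf_multc)
        finally show "(\<Sum>i. ennreal ((xm m (i, s) - x (i, s))\<^sup>2)) * indicator {0..T} s \<le> ennreal ((norm a)\<^sup>2) * (N m s * indicator {0..r} s)" .
      qed
      also have "\<dots> = ennreal ((norm a)\<^sup>2) * (\<integral>\<^sup>+s\<in>{0..r}. N m s \<partial>lborel)"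
        by (rule nn_integral_cmult) (use N_meas in measurable)
      finally show "(\<integral>\<^sup>+p. ennreal ((xm m p - x p)\<^sup>2) \<partial>noise_space T) \<le> ennreal ((norm a)\<^sup>2) * (\<integral>\<^sup>+s\<in>{0..r}. N m s \<partial>lborel)" .
    qed
    show "(\<lambda>m. ennreal ((norm a)\<^sup>2) * (\<integral>\<^sup>+s\<in>{0..r}. N m s \<partial>lborel)) \<longlonglongrightarrow> 0"
      using ennreal_tendsto_cmult[OF _ hs, of "ennreal ((norm a)\<^sup>2)"] by (simp add: N_def)
  qed
  have Za: "(\<lambda>\<omega>. Z \<omega> \<bullet> a) \<in> borel_measurable M" by measurable
  show ?thesis
    unfolding isometric_pair_def x_def[symmetric] using Za x_meas pair 1 2 by blast
qed

end

section \<open>Energy balance of the mild solution\<close>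

lemma space_noise: "space (noise_space T) = UNIV \<times> {0..T}"
  by (simp add: noise_space_def space_pair_measure space_restrict_space)

lemma noise_dominated:
  fixes x :: "nat \<times> real \<Rightarrow> real"
  assumes x: "x \<in> borel_measurable (noise_space T)" and T: "0 \<le> T" and c: "summable c"
    and le: "\<And>i s. s \<in> {0..T} \<Longrightarrow> \<bar>x (i, s)\<bar> \<le> c i"
  shows "integrable (noise_space T) x" and "(LINT p|noise_space T. x p) \<le> T * suminf c"
proof -
  have c0: "0 \<le> c i" for i using le[of 0 i] T by auto
  interpret finite_measure "restrict_space lborel {0..T}" by (rule finite_time_measure)
  have cs: "summable (\<lambda>i. \<bar>c i\<bar>)" using c c0 by simp
  have one: "integrable (restrict_space lborel {0..T}) (\<lambda>_. 1 :: real)" by simp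
  have len: "(LINT s|restrict_space lborel {0..T}. (1::real)) = T"
    using T by (subst integral_restrict_space) (simp_all add: measure_def)
  note c_int = noise_product[OF cs one]
  show int: "integrable (noise_space T) x"
  proof (rule Bochner_Integration.integrable_bound[OF c_int(1) x AE_I2])
    fix p assume "p \<in> space (noise_space T)"
    then show "norm (x p) \<le> norm (case p of (i, s) \<Rightarrow> c i * 1)"
      using le c0 by (auto simp: space_noise)
  qed
  have "(LINT p|noise_space T. x p) \<le> (LINT p|noise_space T. (case p of (i, s) \<Rightarrow> c i * 1))"
  proof (rule integral_mono[OF int c_int(1)])
    fix p assume "p \<in> space (noise_space T)"
    then show "x p \<le> (case p of (i, s) \<Rightarrow> c i * 1)"
      using le by (force simp: space_noise abs_le_iff)
  qed
  then show "(LINT p|noise_space T. x p) \<le> T * suminf c"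
    unfolding c_int(2) len by (simp add: mult.commute)
qed

text \<open>By Tonelli, an integrable sum on the side of \<open>N\<close> makes the series of
  integrals converge. As the integrals agree termwise, the series on the side of \<open>M\<close>
  has finite integral and therefore converges almost everywhere.\<close>

lemma integral_series_transfer:
  fixes h :: "nat \<Rightarrow> 'a \<Rightarrow> real" and k :: "nat \<Rightarrow> 'b \<Rightarrow> real"
  assumes h: "\<And>n. integrable M (h n)" "\<And>n x. 0 \<le> h n x" and k: "\<And>n. integrable N (k n)" "\<And>n x. 0 \<le> k n x"
    and eq: "\<And>n. (LINT x|M. h n x) = (LINT x|N. k n x)"
    and sum: "\<And>x. x \<in> space N \<Longrightarrow> summable (\<lambda>n. k n x)" and int: "integrable N (\<lambda>x. \<Sum>n. k n x)"
  shows "AE x in M. summable (\<lambda>n. h n x)" "integrable M (\<lambda>x. \<Sum>n. h n x)"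
    "(LINT x|M. (\<Sum>n. h n x)) = (LINT x|N. (\<Sum>n. k n x))"
proof -
  have s: "summable (\<lambda>n. LINT x|N. k n x)"
  proof (rule bounded_imp_summable)
    show "0 \<le> (LINT x|N. k n x)" for n using k by simp
    fix n
    have "(\<Sum>m\<le>n. LINT x|N. k m x) = (LINT x|N. (\<Sum>m\<le>n. k m x))"
      by (rule Bochner_Integration.integral_sum[symmetric]) (rule k)
    also have "\<dots> \<le> (LINT x|N. (\<Sum>m. k m x))"
      by (intro integral_mono int Bochner_Integration.integrable_sum k sum_le_suminf sum) (auto simp: k)
    finally show "(\<Sum>m\<le>n. LINT x|N. k m x) \<le> (LINT x|N. (\<Sum>m. k m x))" .
  qed
  have [measurable]: "h n \<in> borel_measurable M" for n using h(1) by (rule borel_measurable_integrable)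
  have "(\<integral>\<^sup>+x. (\<Sum>n. ennreal (h n x)) \<partial>M) = (\<Sum>n. \<integral>\<^sup>+x. ennreal (h n x) \<partial>M)"
    by (rule nn_integral_suminf) measurable
  also have "\<dots> = (\<Sum>n. ennreal (LINT x|N. k n x))"
    by (intro suminf_cong) (simp add: nn_integral_eq_integral h eq)
  also have "\<dots> = ennreal (\<Sum>n. LINT x|N. k n x)"
    using k by (intro suminf_ennreal2 s) simp
  finally have "(\<integral>\<^sup>+x. (\<Sum>n. ennreal (h n x)) \<partial>M) \<noteq> \<infinity>" by simp
  then have "AE x in M. (\<Sum>n. ennreal (h n x)) \<noteq> \<infinity>" by (intro nn_integral_PInf_AE) auto
  then show ae: "AE x in M. summable (\<lambda>n. h n x)"
    by eventually_elim (simp add: summable_suminf_not_top h)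
  have aeh: "AE x in M. summable (\<lambda>n. norm (h n x))" using ae by eventually_elim (simp add: h)
  have sh: "summable (\<lambda>n. LINT x|M. norm (h n x))" using s by (simp add: h eq)
  have aek: "AE x in N. summable (\<lambda>n. norm (k n x))" using sum k by (intro AE_I2) simp
  have sk: "summable (\<lambda>n. LINT x|N. norm (k n x))" using s by (simp add: k)
  show "integrable M (\<lambda>x. \<Sum>n. h n x)" by (rule integrable_suminf[OF h(1) aeh sh])
  show "(LINT x|M. (\<Sum>n. h n x)) = (LINT x|N. (\<Sum>n. k n x))"
    unfolding integral_suminf[OF h(1) aeh sh] integral_suminf[OF k(1) aek sk] eq ..
qed

lemma (in wiener_setting) isometric_pair_cong_AE:
  assumes "isometric_pair T X x" "Y \<in> borel_measurable M" "AE \<omega> in M. X \<omega> = Y \<omega>"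
  shows "isometric_pair T Y x"
proof -
  have "(\<integral>\<^sup>+\<omega>. ennreal ((Z \<omega> - X \<omega>)\<^sup>2) \<partial>M) = (\<integral>\<^sup>+\<omega>. ennreal ((Z \<omega> - Y \<omega>)\<^sup>2) \<partial>M)" for Z
    by (rule nn_integral_cong_AE) (use assms(3) in eventually_elim, simp)
  then show ?thesis using assms(1,2) unfolding isometric_pair_def by simp
qed

lemma blinfun_measurable:
  "f \<in> borel_measurable N \<Longrightarrow> (\<lambda>x. blinfun_apply B (f x)) \<in> borel_measurable N"
  by (erule measurable_compose)
    (intro borel_measurable_continuous_onI linear_continuous_on blinfun.bounded_linear_right)

context schroedinger
begin

lemma S_measurable:
  assumes "f \<in> borel_measurable N" "g \<in> borel_measurable N"
  shows "(\<lambda>x. S (f x) (g x)) \<in> borel_measurable N"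
proof -
  have "(\<lambda>p. S (fst p) (snd p)) \<in> borel_measurable borel"
    by (intro borel_measurable_continuous_onI S_cont' continuous_intros)
  from measurable_compose[OF borel_measurable_Pair[OF assms] this] show ?thesis by simp
qed

lemma A_measurable:
  assumes "f \<in> borel_measurable N" "g \<in> borel_measurable N"
  shows "(\<lambda>x. A (f x) (g x)) \<in> borel_measurable N"
proof -
  have "(\<lambda>x. - f x) \<in> borel_measurable N" using assms(1) by measurable
  then have "(\<lambda>x. S (- f x) (J (V (S (f x) (g x))))) \<in> borel_measurable N"
    by (intro S_measurable blinfun_measurable assms)
  then show ?thesis unfolding A_apply by measurable
qed

lemma H1_uminus: "x \<in> H1 \<Longrightarrow> - x \<in> H1" and N1_uminus: "N1 (- x) = N1 x"
  by (simp_all add: H1_def N1_def)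

text \<open>Separates the energy into \<open>N1\<close>, the norm and \<open>V\<close>. The
  invariance under \<open>J\<close> and the expectation of the energy of the deviation are derived
  from these parts.\<close>

lemma form_quadratic:
  assumes "x \<in> H1"
  shows "form x x = N1 x - (norm x)\<^sup>2 - V x \<bullet> x"
proof -
  have "(\<lambda>n. (1 + w n) * (x \<bullet> b n)\<^sup>2) sums N1 x"
    using assms by (simp add: H1_def N1_def summable_sums)
  from sums_diff[OF this parseval_norm[OF onb, of x]]
  have "(\<lambda>n. w n * (x \<bullet> b n) * (x \<bullet> b n)) sums (N1 x - (norm x)\<^sup>2)"
    by (simp add: algebra_simps power2_eq_square)
  then show ?thesis by (simp add: form_def sums_iff)
qed

lemma form_J:
  assumes "x \<in> H1"
  shows "form (- J x) (- J x) = form x x"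
proof -
  have "V (J x) \<bullet> J x = V x \<bullet> x"
    by (simp add: V_J J_skew J_J)
  then show ?thesis
    using assms by (simp add: form_quadratic H1_uminus N1_uminus J_H1 N1_J norm_J blinfun.minus_right)
qed

end

section \<open>The stochastic equation in the interaction picture and its covariance\<close>

locale stochastic_schroedinger = wiener_setting M F e Qh Q W + schroedinger b w J V V1
  for M :: "'w measure" and F :: "real \<Rightarrow> 'w measure" and e :: "nat \<Rightarrow> 'd::finite l2_torus"
    and Qh Q W and b :: "nat \<Rightarrow> 'd l2_torus" and w J V V1 +
  fixes u\<^sub>0 :: "'w \<Rightarrow> 'd l2_torus" and u :: "real \<Rightarrow> 'w \<Rightarrow> 'd l2_torus" and T :: real
  assumes T: "0 \<le> T"
    and u0_F: "u\<^sub>0 \<in> borel_measurable (F 0)"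
    and u_joint: "(\<lambda>(t, \<omega>). u t \<omega>) \<in> borel_measurable (restrict_space borel {0..} \<Otimes>\<^sub>M M)"
    and drift: "0 \<le> r \<Longrightarrow> AE \<omega> in M. set_integrable lborel {0..r} (\<lambda>s. S (r - s) (V (u s \<omega>)))"
    and mild: "0 \<le> r \<Longrightarrow> \<exists>Z. has_wiener_integral M e Qh W r (\<lambda>s. blinfun_apply (S (r - s))) Z \<and>
      (AE \<omega> in M. u r \<omega> = S r (u\<^sub>0 \<omega>)
        - J (LINT s:{0..r}|lborel. S (r - s) (V (u s \<omega>)))
        - J (Z \<omega>))"
    and HS_H1: "Qh (e i) \<in> H1" and HS_N1: "summable (\<lambda>i. N1 (Qh (e i)))"
begin

text \<open>In the interaction picture \<open>twisted\<close> the equation becomes an ordinary differential equation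
  perturbed by the additive process \<open>noise\<close>; \<open>max 0\<close> only makes the process total.\<close>

definition twisted :: "real \<Rightarrow> 'w \<Rightarrow> 'd l2_torus"
  where "twisted r \<omega> = S (- r) (u (max 0 r) \<omega>)"

definition noise :: "real \<Rightarrow> 'w \<Rightarrow> 'd l2_torus"
  where "noise r \<omega> = twisted r \<omega> - u\<^sub>0 \<omega> - (LINT s:{0..r}|lborel. A s (twisted s \<omega>))"

text \<open>Pulling the solution back to time 0 along the noiseless flow removes the drift; what is
  left beyond the initial value is the accumulated effect of the noise.\<close>

definition deviation :: "'w \<Rightarrow> 'd l2_torus"
  where "deviation \<omega> = ev 0 T (twisted T \<omega>) - u\<^sub>0 \<omega>"

text \<open>The noise in direction \<open>e i\<close> at time \<open>s\<close>, with the factor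
  \<open>- \<i>\<close> of the mild equation, seen in the interaction picture.\<close>

definition kick :: "nat \<Rightarrow> real \<Rightarrow> 'd l2_torus"
  where "kick i s = - J (S (- s) (Qh (e i)))"

text \<open>The counterpart of \<open>noise r \<omega> \<bullet> a\<close> on
  \<open>noise_space\<close>, see \<open>noise_isometric_pair\<close>.\<close>

definition kernel :: "real \<Rightarrow> 'd l2_torus \<Rightarrow> nat \<times> real \<Rightarrow> real"
  where "kernel r a = (\<lambda>(i, s). indicator {0<..r} s * (kick i s \<bullet> a))"

text \<open>The counterpart of \<open>deviation \<omega> \<bullet> \<phi>\<close>: each kick is
  transported back to time 0 by the noiseless flow.\<close>

definition response :: "'d l2_torus \<Rightarrow> nat \<times> real \<Rightarrow> real"
  where "response \<phi> = (\<lambda>(i, s). indicator {0<..T} s * (ev 0 s (kick i s) \<bullet> \<phi>))"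

lemma u0_measurable [measurable]: "u\<^sub>0 \<in> borel_measurable M"
  by (rule F_measurable[OF order_refl u0_F])

lemma twisted_measurable: "(\<lambda>(r, \<omega>). twisted r \<omega>) \<in> borel_measurable (borel \<Otimes>\<^sub>M M)"
proof -
  have "(\<lambda>p. (max (0::real) (fst p), snd p)) \<in> measurable (borel \<Otimes>\<^sub>M M) (restrict_space borel {0..} \<Otimes>\<^sub>M M)"
    by (intro measurable_Pair measurable_restrict_space2) auto
  from measurable_compose[OF this u_joint]
  have "(\<lambda>p. u (max 0 (fst p)) (snd p)) \<in> borel_measurable (borel \<Otimes>\<^sub>M M)" by simp
  then show ?thesis
    unfolding twisted_def split_beta' by (intro S_measurable) measurable
qed

lemma twisted_compose_measurable:
  assumes "f \<in> borel_measurable N" "g \<in> measurable N M"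
  shows "(\<lambda>x. twisted (f x) (g x)) \<in> borel_measurable N"
  using measurable_compose[OF measurable_Pair[OF assms] twisted_measurable] by simp

text \<open>Joint measurability is at hand because \<open>noise\<close> is read off from the
  solution. The stochastic integrals in \<open>mild\<close> are given for each time separately and
  up to null sets, which would not permit integration over time.\<close>

lemma noise_measurable: "(\<lambda>(r, \<omega>). noise r \<omega>) \<in> borel_measurable (borel \<Otimes>\<^sub>M M)"
proof -
  let ?N = "(borel \<Otimes>\<^sub>M M) \<Otimes>\<^sub>M (lborel :: real measure)"
  have m: "(\<lambda>q. snd q) \<in> borel_measurable ?N" "(\<lambda>q. snd (fst q)) \<in> measurable ?N M"
    "(\<lambda>q. fst (fst q)) \<in> borel_measurable ?N"
    by measurable
  have A: "(\<lambda>q. A (snd q) (twisted (snd q) (snd (fst q)))) \<in> borel_measurable ?N"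
    by (intro A_measurable twisted_compose_measurable m)
  have "(\<lambda>q. if 0 \<le> snd q \<and> snd q \<le> fst (fst q) then 1 else 0 :: real) \<in> borel_measurable ?N"
    using m by measurable
  then have "(\<lambda>q. indicator {0..fst (fst q)} (snd q) :: real) \<in> borel_measurable ?N"
    by (rule back_subst[of "\<lambda>f. f \<in> borel_measurable ?N"]) (auto simp: indicator_def)
  from borel_measurable_scaleR[OF this A]
  have "(\<lambda>(p, s). indicator {0..fst p} s *\<^sub>R A s (twisted s (snd p))) \<in> borel_measurable ?N"
    by (simp add: split_beta')
  from lborel.borel_measurable_lebesgue_integral[OF this]
  have I: "(\<lambda>p. LINT s:{0..fst p}|lborel. A s (twisted s (snd p))) \<in> borel_measurable (borel \<Otimes>\<^sub>M M)"
    by (simp add: set_lebesgue_integral_def)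
  have "(\<lambda>p. twisted (fst p) (snd p)) \<in> borel_measurable (borel \<Otimes>\<^sub>M M)"
    using twisted_measurable by (simp add: split_beta')
  moreover have "(\<lambda>p. u\<^sub>0 (snd p)) \<in> borel_measurable (borel \<Otimes>\<^sub>M M)" by measurable
  ultimately show ?thesis
    unfolding noise_def split_beta' using I by (intro borel_measurable_diff)
qed

lemma noise_measurable': "noise r \<in> borel_measurable M"
  using measurable_compose[OF measurable_Pair1'[of r borel M] noise_measurable] by simp

lemma twisted_measurable': "twisted r \<in> borel_measurable M"
  using measurable_compose[OF measurable_Pair1'[of r borel M] twisted_measurable] by simp

lemma deviation_measurable [measurable]: "deviation \<in> borel_measurable M"
proof -
  have "(\<lambda>\<omega>. ev 0 T (twisted T \<omega>)) \<in> borel_measurable M"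
    by (rule measurable_compose[OF twisted_measurable'])
      (intro borel_measurable_continuous_onI linear_continuous_on bounded_linear_ev)
  then show ?thesis unfolding deviation_def[abs_def] by measurable
qed

lemma twisted_drift:
  assumes r: "0 \<le> r" and int: "set_integrable lborel {0..r} (\<lambda>s. S (r - s) (V (u s \<omega>)))"
  shows "set_integrable lborel {0..r} (\<lambda>s. A s (twisted s \<omega>))"
    and "(LINT s:{0..r}|lborel. A s (twisted s \<omega>))
      = - J (S (- r) (LINT s:{0..r}|lborel. S (r - s) (V (u s \<omega>))))"
proof -
  define B where "B = - (J o\<^sub>L S (- r))"
  have B: "blinfun_apply B x = - J (S (- r) x)" for x
    by (simp add: B_def blinfun.minus_left)
  have eq: "indicat_real {0..r} s *\<^sub>R A s (twisted s \<omega>)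
      = blinfun_apply B (indicat_real {0..r} s *\<^sub>R S (r - s) (V (u s \<omega>)))" for s
  proof (cases "s \<in> {0..r}")
    case True
    then have "max 0 s = s" by simp
    then have "A s (twisted s \<omega>) = blinfun_apply B (S (r - s) (V (u s \<omega>)))"
      by (simp add: A_apply twisted_def B S_add S_J S_0)
    then show ?thesis using True by simp
  qed simp
  show "set_integrable lborel {0..r} (\<lambda>s. A s (twisted s \<omega>))"
    unfolding set_integrable_def eq
    by (rule integrable_bounded_linear[OF blinfun.bounded_linear_right int[unfolded set_integrable_def]])
  show "(LINT s:{0..r}|lborel. A s (twisted s \<omega>))
      = - J (S (- r) (LINT s:{0..r}|lborel. S (r - s) (V (u s \<omega>))))"
    unfolding set_lebesgue_integral_def eq B[symmetric]
    by (rule integral_bounded_linear[OF blinfun.bounded_linear_right int[unfolded set_integrable_def]])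
qed

text \<open>Tested against \<open>S r (J a)\<close>, the integrand \<open>S (r - s)\<close> turns
  into the vector \<open>kick i s\<close>, which is free of \<open>r\<close>. The kernel then
  depends on \<open>r\<close> only through its indicator and \<open>a\<close>.\<close>

lemma noise_isometric_pair:
  assumes r: "0 \<le> r" "r \<le> T"
  shows "isometric_pair T (\<lambda>\<omega>. noise r \<omega> \<bullet> a) (kernel r a)"
proof -
  obtain Z where Z: "has_wiener_integral M e Qh W r (\<lambda>s. blinfun_apply (S (r - s))) Z"
    and ae: "AE \<omega> in M. u r \<omega> = S r (u\<^sub>0 \<omega>)
        - J (LINT s:{0..r}|lborel. S (r - s) (V (u s \<omega>)))
        - J (Z \<omega>)"
    using mild[OF r(1)] by blast
  let ?a = "S r (J a)"
  have adj: "- J (S (- r) x) \<bullet> a = x \<bullet> ?a" for x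
    using S_adj[of "- r" x "J a"] by (simp add: J_skew)
  have 1: "AE \<omega> in M. Z \<omega> \<bullet> ?a = noise r \<omega> \<bullet> a"
    using ae drift[OF r(1)]
  proof eventually_elim
    case (elim \<omega>)
    have "noise r \<omega> = - J (S (- r) (Z \<omega>))"
      unfolding noise_def twisted_drift(2)[OF r(1) elim(2)]
      using r(1) by (simp add: twisted_def elim(1) blinfun.diff_right S_minus S_J)
    then show ?case by (simp only: adj)
  qed
  have 2: "(\<lambda>\<omega>. noise r \<omega> \<bullet> a) \<in> borel_measurable M" using noise_measurable'[of r] by measurable
  have 3: "(\<lambda>(i, s). indicator {0<..r} s * (S (r - s) (Qh (e i)) \<bullet> ?a)) = kernel r a"
    unfolding kernel_def
  proof (rule ext, clarify)
    fix i s
    have "kick i s \<bullet> a = S (- s) (Qh (e i)) \<bullet> J a"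
      by (simp add: kick_def J_skew)
    also have "\<dots> = S r (S (- s) (Qh (e i))) \<bullet> ?a"
      unfolding S_adj[of r "S (- s) (Qh (e i))" ?a] by (simp add: S_minus)
    finally show "indicator {0<..r} s * (S (r - s) (Qh (e i)) \<bullet> ?a) = indicator {0<..r} s * (kick i s \<bullet> a)"
      by (simp add: S_add)
  qed
  show ?thesis
    unfolding 3[symmetric] by (rule isometric_pair_cong_AE[OF wiener_integral_isometric_pair[OF Z r] 2 1])
qed

lemma norm_kick: "norm (kick i s) = norm (Qh (e i))"
  by (simp add: kick_def norm_J norm_S)

lemma kick_H1: "kick i s \<in> H1" and N1_kick: "N1 (kick i s) = N1 (Qh (e i))"
  by (simp_all add: kick_def H1_uminus N1_uminus J_H1 S_H1 N1_J N1_S HS_H1)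

lemma kick_continuous: "continuous_on UNIV (kick i)"
  unfolding kick_def[abs_def]
  by (intro continuous_intros S_cont' bounded_linear.continuous_on[OF blinfun.bounded_linear_right])

text \<open>The same functional of the family \<open>kernel\<close> as
  \<open>deviation_functional\<close> has for the family \<open>noise\<close>. Here the time
  integral can be evaluated, because the kernel merely switches on at time \<open>s\<close>.\<close>

lemma response_functional:
  assumes p: "p \<in> space (noise_space T)"
  shows "response \<phi> p = kernel T (ev T 0 \<phi>) p
    - (LINT r|restrict_space lborel {0..T}. kernel r (A r (ev r 0 \<phi>)) p)"
proof -
  obtain i s where ps: "p = (i, s)" "0 \<le> s" "s \<le> T" using p by (auto simp: space_noise)
  have I: "(LINT r|restrict_space lborel {0..T}. kernel r (A r (ev r 0 \<phi>)) p)
      = (LINT r|lborel. indicator {0..T} r * (indicator {0<..r} s * (kick i s \<bullet> A r (ev r 0 \<phi>))))"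
    by (subst integral_restrict_space) (simp_all add: ps kernel_def)
  show ?thesis
  proof (cases "0 < s")
    case True
    \<comment> \<open>For \<open>s > 0\<close> the integrand lives on \<open>{s..T}\<close>, so the
      integral is the increment of \<open>ev r 0 \<phi>\<close> tested against the kick. At
      \<open>s = 0\<close> all half-open indicators vanish.\<close>
    have eq: "indicator {0..T} r * (indicator {0<..r} s * (kick i s \<bullet> A r (ev r 0 \<phi>)))
        = indicator {s..T} r *\<^sub>R (kick i s \<bullet> A r (ev r 0 \<phi>))" for r
      using True by (auto simp: indicator_def)
    have "(LINT r|restrict_space lborel {0..T}. kernel r (A r (ev r 0 \<phi>)) p)
        = kick i s \<bullet> ev T 0 \<phi> - kick i s \<bullet> ev s 0 \<phi>"
      unfolding I eq using solution_FTC[OF ev_solution ps(3), of "kick i s" 0 \<phi>] by (simp only: set_lebesgue_integral_def)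
    then show ?thesis using True ps by (simp add: response_def kernel_def ev_adj)
  next
    case False
    then show ?thesis unfolding I by (simp add: response_def kernel_def ps)
  qed
qed

text \<open>For almost every path \<open>solution_pairing\<close> applies with the noiseless
  solution through \<open>\<phi>\<close> at time 0, since \<open>ev T 0\<close> is the adjoint of
  \<open>ev 0 T\<close>.\<close>

lemma deviation_functional:
  "AE \<omega> in M. deviation \<omega> \<bullet> \<phi> = noise T \<omega> \<bullet> ev T 0 \<phi>
    - (LINT r|restrict_space lborel {0..T}. noise r \<omega> \<bullet> A r (ev r 0 \<phi>))"
  using drift[OF T]
proof eventually_elim
  case (elim \<omega>)
  have "twisted T \<omega> \<bullet> ev T 0 \<phi> = u\<^sub>0 \<omega> \<bullet> ev 0 0 \<phi> + noise T \<omega> \<bullet> ev T 0 \<phi>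
      - (LINT r:{0..T}|lborel. noise r \<omega> \<bullet> A r (ev r 0 \<phi>))"
    by (rule solution_pairing[OF ev_solution T twisted_drift(1)[OF T elim]]) (simp add: noise_def)
  moreover have "(LINT r|restrict_space lborel {0..T}. noise r \<omega> \<bullet> A r (ev r 0 \<phi>))
      = (LINT r:{0..T}|lborel. noise r \<omega> \<bullet> A r (ev r 0 \<phi>))"
    by (subst integral_restrict_space) (simp_all add: set_lebesgue_integral_def)
  ultimately show ?case by (simp add: deviation_def inner_diff_left ev_adj)
qed

lemma kernel_bound:
  assumes r: "0 \<le> r" "r \<le> T" and a: "norm a \<le> R"
  shows "(LINT p|noise_space T. (kernel r a p)\<^sup>2) \<le> T * (\<Sum>i. R\<^sup>2 * (norm (Qh (e i)))\<^sup>2)"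
proof (rule noise_dominated(2)[OF _ T])
  show "(\<lambda>p. (kernel r a p)\<^sup>2) \<in> borel_measurable (noise_space T)"
    using isometric_pair_square_integrable(2)[OF noise_isometric_pair[OF r, of a]]
    by (auto simp: square_integrable_def)
  show "summable (\<lambda>i. R\<^sup>2 * (norm (Qh (e i)))\<^sup>2)" by (intro summable_mult HS)
  fix i s
  have "\<bar>kernel r a (i, s)\<bar> \<le> \<bar>kick i s \<bullet> a\<bar>" by (auto simp: kernel_def indicator_def)
  also have "\<dots> \<le> norm (kick i s) * norm a" by (rule Cauchy_Schwarz_ineq2)
  also have "\<dots> \<le> norm (Qh (e i)) * R"
    unfolding norm_kick using a by (intro mult_left_mono) auto
  finally have "\<bar>kernel r a (i, s)\<bar>\<^sup>2 \<le> (norm (Qh (e i)) * R)\<^sup>2" by (rule power_mono) simp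
  then show "\<bar>(kernel r a (i, s))\<^sup>2\<bar> \<le> R\<^sup>2 * (norm (Qh (e i)))\<^sup>2"
    by (simp add: power_mult_distrib mult.commute)
qed

lemma ev_generator_continuous: "continuous_on UNIV (\<lambda>r. A r (ev r 0 \<phi>))"
  by (intro A_cont' solution_continuous[OF ev_solution])

lemma norm_ev_generator: "norm (A r (ev r 0 \<phi>)) \<le> norm V * norm \<phi>"
  using norm_blinfun[of "A r" "ev r 0 \<phi>"] mult_right_mono[OF norm_A[of r], of "norm (ev r 0 \<phi>)"]
  by (simp add: norm_ev)

lemma noise_time_measurable:
  "(\<lambda>(r, \<omega>). noise r \<omega> \<bullet> A r (ev r 0 \<phi>)) \<in> borel_measurable (restrict_space lborel {0..T} \<Otimes>\<^sub>M M)"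
proof -
  have "(\<lambda>r. r) \<in> borel_measurable (restrict_space lborel {0..T})"
    by (rule measurable_restrict_space1) simp
  from measurable_compose[OF measurable_fst this]
  have f: "(\<lambda>p. fst p) \<in> borel_measurable (restrict_space lborel {0..T} \<Otimes>\<^sub>M M)" .
  have "(\<lambda>p. noise (fst p) (snd p)) \<in> borel_measurable (restrict_space lborel {0..T} \<Otimes>\<^sub>M M)"
    using measurable_compose[OF measurable_Pair[OF f measurable_snd] noise_measurable] by simp
  moreover have "(\<lambda>p. A (fst p) (ev (fst p) 0 \<phi>)) \<in> borel_measurable (restrict_space lborel {0..T} \<Otimes>\<^sub>M M)"
    by (rule measurable_compose[OF f borel_measurable_continuous_onI[OF ev_generator_continuous]])
  ultimately show ?thesis unfolding split_beta' by (rule borel_measurable_inner)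
qed

lemma kernel_time_measurable:
  "(\<lambda>(r, p). kernel r (A r (ev r 0 \<phi>)) p) \<in> borel_measurable (restrict_space lborel {0..T} \<Otimes>\<^sub>M noise_space T)"
proof -
  let ?N = "restrict_space lborel {0..T} \<Otimes>\<^sub>M noise_space T"
  have id: "(\<lambda>r. r) \<in> borel_measurable (restrict_space lborel {0..T})"
    by (rule measurable_restrict_space1) simp
  have f: "(\<lambda>q. fst q) \<in> borel_measurable ?N"
    by (rule measurable_compose[OF measurable_fst id])
  have sn: "(\<lambda>p. snd p) \<in> borel_measurable (noise_space T)"
    unfolding noise_space_def by (rule measurable_compose[OF measurable_snd id])
  then have s: "(\<lambda>q. snd (snd q)) \<in> borel_measurable ?N"
    by (rule measurable_compose[OF measurable_snd])
  have "(\<lambda>(i, s). kick i s) \<in> borel_measurable (noise_space T)"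
    by (intro noise_measurableI borel_measurable_continuous_onI kick_continuous)
  from measurable_compose[OF measurable_snd this]
  have k: "(\<lambda>q. kick (fst (snd q)) (snd (snd q))) \<in> borel_measurable ?N" by (simp add: split_beta')
  have a: "(\<lambda>q. A (fst q) (ev (fst q) 0 \<phi>)) \<in> borel_measurable ?N"
    by (rule measurable_compose[OF f borel_measurable_continuous_onI[OF ev_generator_continuous]])
  have i: "(\<lambda>q. if 0 < snd (snd q) \<and> snd (snd q) \<le> fst q then 1 else 0 :: real) \<in> borel_measurable ?N"
    using f s by measurable
  have "(\<lambda>(r, p). kernel r (A r (ev r 0 \<phi>)) p)
      = (\<lambda>q. (if 0 < snd (snd q) \<and> snd (snd q) \<le> fst q then 1 else 0)
        * (kick (fst (snd q)) (snd (snd q)) \<bullet> A (fst q) (ev (fst q) 0 \<phi>)))"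
    by (auto simp: kernel_def indicator_def fun_eq_iff)
  then show ?thesis using borel_measurable_times[OF i borel_measurable_inner[OF k a]] by simp
qed

text \<open>The tested deviation and \<open>response \<phi>\<close> arise from the families
  \<open>noise\<close> and \<open>kernel\<close> by one and the same time functional, and these
  families have equal covariances. By \<open>time_functional_moments\<close> the second moments
  agree, which replaces a stochastic Fubini theorem. Orthogonality to bounded variables of time 0
  passes through the same functional.\<close>

lemma deviation_square_integrable: "square_integrable M (\<lambda>\<omega>. deviation \<omega> \<bullet> \<phi>)"
  and response_square_integrable: "square_integrable (noise_space T) (response \<phi>)"
  and deviation_second_moment: "(LINT \<omega>|M. (deviation \<omega> \<bullet> \<phi>)\<^sup>2) = (LINT p|noise_space T. (response \<phi> p)\<^sup>2)"
  and deviation_orthogonal: "g \<in> borel_measurable (F 0) \<Longrightarrow> (\<And>\<omega>. \<bar>g \<omega>\<bar> \<le> C) \<Longrightarrow> (LINT \<omega>|M. g \<omega> * (deviation \<omega> \<bullet> \<phi>)) = 0"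
proof -
  let ?R = "restrict_space lborel {0..T}"
  define a where "a r = A r (ev r 0 \<phi>)" for r
  define K where "K = T * (\<Sum>i. (norm V * norm \<phi>)\<^sup>2 * (norm (Qh (e i)))\<^sup>2)"
  have sp: "r \<in> space ?R \<Longrightarrow> 0 \<le> r \<and> r \<le> T" for r by (simp add: space_restrict_space)
  note iso = isometric_pair_isometry[OF noise_isometric_pair noise_isometric_pair]
  have bound: "(LINT p|noise_space T. (kernel r (a r) p)\<^sup>2) \<le> K" if "r \<in> space ?R" for r
    unfolding K_def a_def using sp[OF that] by (intro kernel_bound norm_ev_generator) auto
  have bound': "(LINT \<omega>|M. (noise r \<omega> \<bullet> a r)\<^sup>2) \<le> K" if "r \<in> space ?R" for r
    using bound[OF that] iso[of r r "a r" "a r"] sp[OF that] by (simp add: power2_eq_square)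
  have sM: "square_integrable M (\<lambda>\<omega>. noise r \<omega> \<bullet> a r)" if "r \<in> space ?R" for r
    by (rule isometric_pair_square_integrable(1)[OF noise_isometric_pair]) (use sp[OF that] in simp_all)
  have sN: "square_integrable (noise_space T) (kernel r (a r))" if "r \<in> space ?R" for r
    by (rule isometric_pair_square_integrable(2)[OF noise_isometric_pair]) (use sp[OF that] in simp_all)
  have sMT: "square_integrable M (\<lambda>\<omega>. noise T \<omega> \<bullet> ev T 0 \<phi>)" and sNT: "square_integrable (noise_space T) (kernel T (ev T 0 \<phi>))"
    by (rule isometric_pair_square_integrable[OF noise_isometric_pair[OF T order_refl]])+
  note mM = time_functional_moments[where M = M and N = ?R and X = "\<lambda>r \<omega>. noise r \<omega> \<bullet> a r" and Z = "\<lambda>\<omega>. noise T \<omega> \<bullet> ev T 0 \<phi>" and K = K,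
      OF sigma_finite_measure_axioms finite_time_measure noise_time_measurable[of \<phi>, folded a_def]]
  note mN = time_functional_moments[where M = "noise_space T" and N = ?R and X = "\<lambda>r. kernel r (a r)" and Z = "kernel T (ev T 0 \<phi>)" and K = K,
      OF sigma_finite_noise finite_time_measure kernel_time_measurable[of \<phi>, folded a_def]]
  define G where "G \<omega> = noise T \<omega> \<bullet> ev T 0 \<phi> - (LINT r|?R. noise r \<omega> \<bullet> a r)" for \<omega>
  define H where "H p = kernel T (ev T 0 \<phi>) p - (LINT r|?R. kernel r (a r) p)" for p
  have G: "AE \<omega> in M. G \<omega> = deviation \<omega> \<bullet> \<phi>"
    using deviation_functional[of \<phi>] by eventually_elim (simp add: G_def a_def)
  have H: "H p = response \<phi> p" if "p \<in> space (noise_space T)" for p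
    unfolding response_functional[OF that] H_def a_def ..
  have Gs: "square_integrable M G"
    unfolding G_def[abs_def] by (rule mM(1); (erule sM | erule bound' | rule sMT))
  have Hs: "square_integrable (noise_space T) H"
    unfolding H_def[abs_def] by (rule mN(1); (erule sN | erule bound | rule sNT))
  have dm: "(\<lambda>\<omega>. deviation \<omega> \<bullet> \<phi>) \<in> borel_measurable M" by measurable
  show "square_integrable M (\<lambda>\<omega>. deviation \<omega> \<bullet> \<phi>)"
    by (rule square_integrable_cong_AE[OF Gs dm G])
  have Hm: "H \<in> borel_measurable (noise_space T)" using Hs by (rule square_integrable_measurable)
  then have rm: "response \<phi> \<in> borel_measurable (noise_space T)"
    by (subst measurable_cong[OF H[symmetric]])
  show "square_integrable (noise_space T) (response \<phi>)"
    by (rule square_integrable_cong_AE[OF Hs rm AE_I2[OF H]])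
  have "(LINT \<omega>|M. (G \<omega>)\<^sup>2) = (LINT \<omega>|M. (noise T \<omega> \<bullet> ev T 0 \<phi>) * (noise T \<omega> \<bullet> ev T 0 \<phi>))
      - 2 * (LINT r|?R. LINT \<omega>|M. (noise T \<omega> \<bullet> ev T 0 \<phi>) * (noise r \<omega> \<bullet> a r))
      + (LINT r|?R. LINT s|?R. LINT \<omega>|M. (noise r \<omega> \<bullet> a r) * (noise s \<omega> \<bullet> a s))"
    unfolding G_def by (rule mM(2); (erule sM | erule bound' | rule sMT))
  moreover have "(LINT p|noise_space T. (H p)\<^sup>2) = (LINT p|noise_space T. kernel T (ev T 0 \<phi>) p * kernel T (ev T 0 \<phi>) p)
      - 2 * (LINT r|?R. LINT p|noise_space T. kernel T (ev T 0 \<phi>) p * kernel r (a r) p)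
      + (LINT r|?R. LINT s|?R. LINT p|noise_space T. kernel r (a r) p * kernel s (a s) p)"
    unfolding H_def by (rule mN(2); (erule sN | erule bound | rule sNT))
  moreover have "(LINT \<omega>|M. (noise T \<omega> \<bullet> ev T 0 \<phi>) * (noise T \<omega> \<bullet> ev T 0 \<phi>))
      = (LINT p|noise_space T. kernel T (ev T 0 \<phi>) p * kernel T (ev T 0 \<phi>) p)"
    by (rule iso[OF T order_refl T order_refl])
  moreover have "(LINT r|?R. LINT \<omega>|M. (noise T \<omega> \<bullet> ev T 0 \<phi>) * (noise r \<omega> \<bullet> a r))
      = (LINT r|?R. LINT p|noise_space T. kernel T (ev T 0 \<phi>) p * kernel r (a r) p)"
  proof (rule Bochner_Integration.integral_cong[OF refl])
    fix r assume rs: "r \<in> space ?R"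
    note r = conjunct1[OF sp[OF rs]] conjunct2[OF sp[OF rs]]
    show "(LINT \<omega>|M. (noise T \<omega> \<bullet> ev T 0 \<phi>) * (noise r \<omega> \<bullet> a r)) = (LINT p|noise_space T. kernel T (ev T 0 \<phi>) p * kernel r (a r) p)"
      by (rule iso[OF T order_refl r])
  qed
  moreover have "(LINT r|?R. LINT s|?R. LINT \<omega>|M. (noise r \<omega> \<bullet> a r) * (noise s \<omega> \<bullet> a s))
      = (LINT r|?R. LINT s|?R. LINT p|noise_space T. kernel r (a r) p * kernel s (a s) p)"
  proof (intro Bochner_Integration.integral_cong[OF refl])
    fix r s assume rs: "r \<in> space ?R" "s \<in> space ?R"
    note r = conjunct1[OF sp[OF rs(1)]] conjunct2[OF sp[OF rs(1)]] conjunct1[OF sp[OF rs(2)]] conjunct2[OF sp[OF rs(2)]]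
    show "(LINT \<omega>|M. (noise r \<omega> \<bullet> a r) * (noise s \<omega> \<bullet> a s)) = (LINT p|noise_space T. kernel r (a r) p * kernel s (a s) p)"
      by (rule iso[OF r])
  qed
  ultimately have GH: "(LINT \<omega>|M. (G \<omega>)\<^sup>2) = (LINT p|noise_space T. (H p)\<^sup>2)" by (simp only:)
  have "(LINT \<omega>|M. (deviation \<omega> \<bullet> \<phi>)\<^sup>2) = (LINT \<omega>|M. (G \<omega>)\<^sup>2)"
    by (rule integral_cong_AE, intro borel_measurable_power, rule dm, intro borel_measurable_power, rule square_integrable_measurable[OF Gs]) (use G in eventually_elim, simp)
  also note GH
  also have "(LINT p|noise_space T. (H p)\<^sup>2) = (LINT p|noise_space T. (response \<phi> p)\<^sup>2)"
    by (rule Bochner_Integration.integral_cong[OF refl]) (simp only: H)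
  finally show "(LINT \<omega>|M. (deviation \<omega> \<bullet> \<phi>)\<^sup>2) = (LINT p|noise_space T. (response \<phi> p)\<^sup>2)" .
  assume g: "g \<in> borel_measurable (F 0)" "\<And>\<omega>. \<bar>g \<omega>\<bar> \<le> C"
  note orth = isometric_pair_orthogonal[OF noise_isometric_pair g]
  have gs: "square_integrable M g" by (rule orth(1)[OF T order_refl])
  have gm: "g \<in> borel_measurable M" using gs by (rule square_integrable_measurable)
  have "(LINT \<omega>|M. g \<omega> * (deviation \<omega> \<bullet> \<phi>)) = (LINT \<omega>|M. g \<omega> * G \<omega>)"
    by (rule integral_cong_AE, intro borel_measurable_times gm dm, intro borel_measurable_times gm square_integrable_measurable[OF Gs])
      (use G in eventually_elim, simp)
  also have "\<dots> = (LINT \<omega>|M. g \<omega> * (noise T \<omega> \<bullet> ev T 0 \<phi>)) - (LINT r|?R. LINT \<omega>|M. g \<omega> * (noise r \<omega> \<bullet> a r))"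
    unfolding G_def by (rule mM(3)[OF _ _ _ gs]; (erule sM | erule bound' | rule sMT))
  also have "\<dots> = 0"
  proof -
    have 1: "(LINT \<omega>|M. g \<omega> * (noise T \<omega> \<bullet> ev T 0 \<phi>)) = 0" by (rule orth(2)[OF T order_refl])
    have 2: "(LINT \<omega>|M. g \<omega> * (noise r \<omega> \<bullet> a r)) = 0" if "r \<in> space ?R" for r
      by (rule orth(2)) (use sp[OF that] in simp_all)
    have "(LINT r|?R. LINT \<omega>|M. g \<omega> * (noise r \<omega> \<bullet> a r)) = (LINT r|?R. 0)"
      by (rule Bochner_Integration.integral_cong[OF refl 2])
    then show ?thesis using 1 by simp
  qed
  finally show "(LINT \<omega>|M. g \<omega> * (deviation \<omega> \<bullet> \<phi>)) = 0" .
qed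

end

section \<open>Expected energy of the deviation\<close>

lemma (in schroedinger) form_measurable:
  assumes [measurable]: "f \<in> borel_measurable N" "g \<in> borel_measurable N"
  shows "(\<lambda>x. form (f x) (g x)) \<in> borel_measurable N"
proof -
  have [measurable]: "(\<lambda>x. V (f x)) \<in> borel_measurable N" by (rule blinfun_measurable) measurable
  show ?thesis unfolding form_def by measurable
qed

lemma (in schroedinger) summable_grad:
  assumes "x \<in> H1"
  shows "summable (\<lambda>n. w n * (x \<bullet> b n)\<^sup>2)"
  using form_sums[OF assms assms] by (simp add: power2_eq_square mult.assoc)

lemma abs_mult_le_squares: "\<bar>x * y\<bar> \<le> x\<^sup>2 + y\<^sup>2" for x y :: real
proof -
  have "2 * (\<bar>x\<bar> * \<bar>y\<bar>) \<le> x\<^sup>2 + y\<^sup>2" using sum_squares_bound[of "\<bar>x\<bar>" "\<bar>y\<bar>"] by simp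
  moreover have "0 \<le> \<bar>x\<bar> * \<bar>y\<bar>" by simp
  ultimately show ?thesis unfolding abs_mult by linarith
qed

text \<open>Deliberately asymmetric: apart from the potential term, \<open>x\<close> enters through
  its gradient only and \<open>y\<close> through the full \<open>N1\<close>. For
  \<open>x = u\<^sub>0\<close> the squared norm may fail to be integrable.\<close>

lemma (in schroedinger) abs_form_cross:
  assumes x: "x \<in> H1" and y: "y \<in> H1"
  shows "\<bar>form x y\<bar> \<le> (\<Sum>n. w n * (x \<bullet> b n)\<^sup>2) + N1 y + \<bar>V x \<bullet> y\<bar>"
proof -
  have le: "\<bar>w n * (x \<bullet> b n) * (y \<bullet> b n)\<bar> \<le> w n * (x \<bullet> b n)\<^sup>2 + (1 + w n) * (y \<bullet> b n)\<^sup>2" for n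
  proof -
    have "\<bar>w n * (x \<bullet> b n) * (y \<bullet> b n)\<bar> = w n * \<bar>(x \<bullet> b n) * (y \<bullet> b n)\<bar>"
      using w_nonneg[of n] by (simp add: abs_mult)
    also have "\<dots> \<le> w n * ((x \<bullet> b n)\<^sup>2 + (y \<bullet> b n)\<^sup>2)"
      by (intro mult_left_mono abs_mult_le_squares w_nonneg)
    finally show ?thesis using zero_le_power2[of "y \<bullet> b n"] unfolding distrib_left distrib_right by linarith
  qed
  have sy: "summable (\<lambda>n. (1 + w n) * (y \<bullet> b n)\<^sup>2)" using y by (simp add: H1_def)
  note s = summable_add[OF summable_grad[OF x] sy]
  have abs: "summable (\<lambda>n. \<bar>w n * (x \<bullet> b n) * (y \<bullet> b n)\<bar>)"
    by (rule summable_comparison_test'[OF s, where N = 0]) (use le in simp)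
  have "\<bar>\<Sum>n. w n * (x \<bullet> b n) * (y \<bullet> b n)\<bar> \<le> (\<Sum>n. \<bar>w n * (x \<bullet> b n) * (y \<bullet> b n)\<bar>)"
    by (rule summable_rabs[OF abs])
  also have "\<dots> \<le> (\<Sum>n. w n * (x \<bullet> b n)\<^sup>2 + (1 + w n) * (y \<bullet> b n)\<^sup>2)"
    by (rule suminf_le[OF le abs s])
  also have "\<dots> = (\<Sum>n. w n * (x \<bullet> b n)\<^sup>2) + N1 y"
    unfolding N1_def by (rule suminf_add[OF summable_grad[OF x] sy, symmetric])
  finally show ?thesis unfolding form_def by linarith
qed

context stochastic_schroedinger
begin

text \<open>\<open>deviation\<close> is Gaussian with covariance \<open>\<Sum>\<^sub>i \<integral> f\<^sub>i(s) \<otimes> f\<^sub>i(s) ds\<close> for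
  \<open>f\<^sub>i(s) = ev 0 s (kick i s)\<close>; \<open>transfers g\<close> is the resulting formula for the expectation of a
  quadratic functional.\<close>

definition transfers :: "('d l2_torus \<Rightarrow> real) \<Rightarrow> bool"
  where "transfers g \<longleftrightarrow> integrable M (\<lambda>\<omega>. g (deviation \<omega>)) \<and>
    integrable (noise_space T) (\<lambda>(i, s). indicator {0<..T} s * g (ev 0 s (kick i s))) \<and>
    (LINT \<omega>|M. g (deviation \<omega>)) = (LINT p|noise_space T. (case p of (i, s) \<Rightarrow> indicator {0<..T} s * g (ev 0 s (kick i s))))"

lemma transfers_diff:
  assumes "transfers g" "transfers h"
  shows "transfers (\<lambda>x. g x - h x)"
proof -
  have eq: "(\<lambda>(i, s). indicator {0<..T} s * (g (ev 0 s (kick i s)) - h (ev 0 s (kick i s))))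
      = (\<lambda>p. (case p of (i, s) \<Rightarrow> indicator {0<..T} s * g (ev 0 s (kick i s))) - (case p of (i, s) \<Rightarrow> indicator {0<..T} s * h (ev 0 s (kick i s))))"
    by (auto simp: fun_eq_iff right_diff_distrib)
  note g = assms(1)[unfolded transfers_def] and h = assms(2)[unfolded transfers_def]
  note M = g[THEN conjunct1] h[THEN conjunct1]
    and N = g[THEN conjunct2, THEN conjunct1] h[THEN conjunct2, THEN conjunct1]
    and I = g[THEN conjunct2, THEN conjunct2] h[THEN conjunct2, THEN conjunct2]
  show ?thesis
    unfolding transfers_def eq Bochner_Integration.integral_diff[OF M] Bochner_Integration.integral_diff[OF N] I
    by (intro conjI Bochner_Integration.integrable_diff M N refl)
qed

lemma transfers_scale:
  assumes "transfers g"
  shows "transfers (\<lambda>x. c * g x)"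
proof -
  have "(\<lambda>(i, s). indicator {0<..T} s * (c * g (ev 0 s (kick i s))))
      = (\<lambda>p. c * (case p of (i, s) \<Rightarrow> indicator {0<..T} s * g (ev 0 s (kick i s))))"
    by (auto simp: fun_eq_iff)
  then show ?thesis using assms unfolding transfers_def by simp
qed

text \<open>A sum of squares of linear functionals transfers term by term through
  \<open>deviation_second_moment\<close>. The bound by \<open>N1 (Qh (e i))\<close>, summable in
  \<open>i\<close>, supplies the integrability on the deterministic side.\<close>

lemma series_transfers:
  assumes g: "\<And>x. g x = (\<Sum>n. (x \<bullet> \<phi> n)\<^sup>2)"
    and sum: "\<And>i s. s \<in> {0..T} \<Longrightarrow> summable (\<lambda>n. (ev 0 s (kick i s) \<bullet> \<phi> n)\<^sup>2)"
    and le: "\<And>i s. s \<in> {0..T} \<Longrightarrow> g (ev 0 s (kick i s)) \<le> R * N1 (Qh (e i))"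
  shows "transfers g" and "AE \<omega> in M. summable (\<lambda>n. (deviation \<omega> \<bullet> \<phi> n)\<^sup>2)"
proof -
  have sq: "(response (\<phi> n) (i, s))\<^sup>2 = indicator {0<..T} s * (ev 0 s (kick i s) \<bullet> \<phi> n)\<^sup>2" for n i s
    by (simp add: response_def indicator_def)
  have k_sum: "summable (\<lambda>n. (response (\<phi> n) p)\<^sup>2)"
    and k_eq: "(\<Sum>n. (response (\<phi> n) p)\<^sup>2) = (case p of (i, s) \<Rightarrow> indicator {0<..T} s * g (ev 0 s (kick i s)))"
    if p: "p \<in> space (noise_space T)" for p
  proof -
    obtain i s where ps: "p = (i, s)" "s \<in> {0..T}" using p by (auto simp: space_noise)
    show "summable (\<lambda>n. (response (\<phi> n) p)\<^sup>2)"
      unfolding ps(1) sq by (rule summable_mult[OF sum[OF ps(2)]])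
    show "(\<Sum>n. (response (\<phi> n) p)\<^sup>2) = (case p of (i, s) \<Rightarrow> indicator {0<..T} s * g (ev 0 s (kick i s)))"
      unfolding ps(1) sq g prod.case by (rule suminf_mult[OF sum[OF ps(2)]])
  qed
  have g0: "0 \<le> g (ev 0 s (kick i s))" if "s \<in> {0..T}" for i s
    unfolding g by (rule suminf_nonneg[OF sum[OF that]]) simp
  have meas: "(\<lambda>p. \<Sum>n. (response (\<phi> n) p)\<^sup>2) \<in> borel_measurable (noise_space T)"
    by (intro borel_measurable_suminf borel_measurable_power square_integrable_measurable response_square_integrable)
  have int: "integrable (noise_space T) (\<lambda>p. \<Sum>n. (response (\<phi> n) p)\<^sup>2)"
  proof (rule noise_dominated(1)[OF meas T summable_mult[OF HS_N1, of R]])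
    fix i s assume s: "s \<in> {0..T}"
    have "\<bar>\<Sum>n. (response (\<phi> n) (i, s))\<^sup>2\<bar> = indicator {0<..T} s * g (ev 0 s (kick i s))"
      using k_eq[of "(i, s)"] g0[OF s, of i] s by (simp add: space_noise)
    also have "\<dots> \<le> g (ev 0 s (kick i s))" using g0[OF s, of i] by (simp add: indicator_def)
    finally show "\<bar>\<Sum>n. (response (\<phi> n) (i, s))\<^sup>2\<bar> \<le> R * N1 (Qh (e i))"
      using le[OF s, of i] by linarith
  qed
  have hM: "integrable M (\<lambda>\<omega>. (deviation \<omega> \<bullet> \<phi> n)\<^sup>2)" for n
    using deviation_square_integrable[of "\<phi> n"] by (simp add: square_integrable_def)
  have kN: "integrable (noise_space T) (\<lambda>p. (response (\<phi> n) p)\<^sup>2)" for n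
    using response_square_integrable[of "\<phi> n"] by (simp add: square_integrable_def)
  note tr = integral_series_transfer[OF hM zero_le_power2 kN zero_le_power2 deviation_second_moment k_sum int]
  show "AE \<omega> in M. summable (\<lambda>n. (deviation \<omega> \<bullet> \<phi> n)\<^sup>2)" by (rule tr(1))
  have "integrable (noise_space T) (\<lambda>(i, s). indicator {0<..T} s * g (ev 0 s (kick i s)))"
    using int by (subst Bochner_Integration.integrable_cong[OF refl k_eq[symmetric]])
  moreover have "(LINT p|noise_space T. (\<Sum>n. (response (\<phi> n) p)\<^sup>2))
      = (LINT p|noise_space T. (case p of (i, s) \<Rightarrow> indicator {0<..T} s * g (ev 0 s (kick i s))))"
    by (rule Bochner_Integration.integral_cong[OF refl k_eq])
  ultimately show "transfers g" unfolding transfers_def using tr(2,3) by (simp add: g)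
qed

text \<open>The stochastic integral is only a limit in L2, so membership of the deviation in
  \<open>H1\<close> has to be earned: \<open>N1\<close> is a series of squares, and the growth bound
  of the flow on H1 keeps its expectation finite.\<close>

lemma N1_transfers: "transfers N1" and deviation_H1: "AE \<omega> in M. deviation \<omega> \<in> H1"
proof -
  have sq: "(x \<bullet> (sqrt (1 + w n) *\<^sub>R b n))\<^sup>2 = (1 + w n) * (x \<bullet> b n)\<^sup>2" for x n
    using w1_pos(1)[of n] by (simp add: power_mult_distrib)
  have g: "N1 x = (\<Sum>n. (x \<bullet> (sqrt (1 + w n) *\<^sub>R b n))\<^sup>2)" for x unfolding sq N1_def ..
  have sum: "summable (\<lambda>n. (ev 0 s (kick i s) \<bullet> (sqrt (1 + w n) *\<^sub>R b n))\<^sup>2)" for i s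
    unfolding sq using ev_H1[OF kick_H1[of i s], of 0 s] by (simp add: H1_def)
  have le: "N1 (ev 0 s (kick i s)) \<le> exp (2 * norm V1 * T) * N1 (Qh (e i))" if "s \<in> {0..T}" for i s
  proof -
    have "N1 (ev 0 s (kick i s)) \<le> exp (2 * norm V1 * \<bar>0 - s\<bar>) * N1 (kick i s)" by (rule N1_ev[OF kick_H1])
    also have "\<dots> \<le> exp (2 * norm V1 * T) * N1 (kick i s)"
      using that by (intro mult_right_mono N1_nonneg kick_H1) (auto intro!: mult_left_mono)
    finally show ?thesis by (simp only: N1_kick)
  qed
  show "transfers N1" by (rule series_transfers(1)[OF g sum le])
  have "AE \<omega> in M. summable (\<lambda>n. (deviation \<omega> \<bullet> (sqrt (1 + w n) *\<^sub>R b n))\<^sup>2)"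
    by (rule series_transfers(2)[OF g sum le])
  then show "AE \<omega> in M. deviation \<omega> \<in> H1" unfolding sq by (simp add: H1_def)
qed

text \<open>By Parseval and the symmetry of \<open>B\<close>, the squared norm is the series of
  squares of the pairings with \<open>B (b n)\<close>.\<close>

lemma operator_transfers:
  assumes B: "\<And>x y. blinfun_apply B x \<bullet> y = x \<bullet> blinfun_apply B y"
  shows "transfers (\<lambda>x. (norm (blinfun_apply B x))\<^sup>2)"
proof (rule series_transfers(1)[where \<phi> = "\<lambda>n. blinfun_apply B (b n)" and R = "(norm B)\<^sup>2"])
  have ps: "(\<lambda>n. (x \<bullet> blinfun_apply B (b n))\<^sup>2) sums (norm (blinfun_apply B x))\<^sup>2" for x
    using parseval_norm[OF onb, of "blinfun_apply B x"] by (simp only: B)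
  show "(norm (blinfun_apply B x))\<^sup>2 = (\<Sum>n. (x \<bullet> blinfun_apply B (b n))\<^sup>2)" for x
    using ps[of x] by (simp add: sums_iff)
  show "summable (\<lambda>n. (ev 0 s (kick i s) \<bullet> blinfun_apply B (b n))\<^sup>2)" for i s
    using ps[of "ev 0 s (kick i s)"] by (simp add: sums_iff)
  show "(norm (blinfun_apply B (ev 0 s (kick i s))))\<^sup>2 \<le> (norm B)\<^sup>2 * N1 (Qh (e i))" for i s
  proof -
    have "(norm (blinfun_apply B (ev 0 s (kick i s))))\<^sup>2 \<le> (norm B * norm (Qh (e i)))\<^sup>2"
      using norm_blinfun[of B "ev 0 s (kick i s)"] by (intro power_mono) (simp_all add: norm_ev norm_kick)
    also have "\<dots> \<le> (norm B)\<^sup>2 * N1 (Qh (e i))"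
      unfolding power_mult_distrib by (intro mult_left_mono norm_le_N1 HS_H1) simp
    finally show ?thesis .
  qed
qed

lemma deviation_norm_integrable: "integrable M (\<lambda>\<omega>. (norm (deviation \<omega>))\<^sup>2)"
  using operator_transfers[of id_blinfun] by (simp add: transfers_def)

lemma form_kick: "form (ev 0 s (kick i s)) (ev 0 s (kick i s)) = form (Qh (e i)) (Qh (e i))"
proof -
  have "S s (kick i s) = - J (Qh (e i))"
    by (simp add: kick_def blinfun.minus_right S_J S_minus)
  then show ?thesis
    using form_conserved[OF kick_H1[of i s], of 0 s] form_J[OF HS_H1[of i]] by (simp add: S_0)
qed

lemma deviation_energy:
  shows "integrable M (\<lambda>\<omega>. form (deviation \<omega>) (deviation \<omega>))"
    and "(LINT \<omega>|M. form (deviation \<omega>) (deviation \<omega>)) = T * (\<Sum>i. form (Qh (e i)) (Qh (e i)))"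
proof -
  \<comment> \<open>The potential term is indefinite and hence no sum of squares. Polarisation
    writes \<open>V x \<bullet> x\<close> as a quarter of the difference of the squared norms of
    \<open>P x\<close> and \<open>D x\<close>, each of which transfers because \<open>P\<close> and
    \<open>D\<close> are symmetric.\<close>
  define P where "P = V + id_blinfun"
  define D where "D = V - id_blinfun"
  define q where "q x = N1 x - (norm (blinfun_apply id_blinfun x))\<^sup>2 - (1/4 * (norm (blinfun_apply P x))\<^sup>2 - 1/4 * (norm (blinfun_apply D x))\<^sup>2)" for x
  have "blinfun_apply P x \<bullet> y = x \<bullet> blinfun_apply P y" "blinfun_apply D x \<bullet> y = x \<bullet> blinfun_apply D y" for x y
    by (simp_all add: P_def D_def blinfun.add_left blinfun.diff_left inner_add_left inner_add_right inner_diff_left inner_diff_right V_sym)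
  then have q: "transfers q"
    unfolding q_def[abs_def] by (intro transfers_diff transfers_scale N1_transfers operator_transfers) simp_all
  have quarter: "1/4 * (norm (blinfun_apply P x))\<^sup>2 - 1/4 * (norm (blinfun_apply D x))\<^sup>2 = V x \<bullet> x" for x
  proof -
    have "(norm (blinfun_apply P x))\<^sup>2 - (norm (blinfun_apply D x))\<^sup>2 = 4 * (V x \<bullet> x)"
      unfolding power2_norm_eq_inner P_def D_def
      by (simp add: blinfun.add_left blinfun.diff_left inner_add_left inner_add_right inner_diff_left inner_diff_right inner_commute)
    then show ?thesis by simp
  qed
  have qf: "q x = form x x" if "x \<in> H1" for x
    unfolding q_def quarter form_quadratic[OF that] by simp
  have ae: "AE \<omega> in M. q (deviation \<omega>) = form (deviation \<omega>) (deviation \<omega>)"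
    using deviation_H1 by eventually_elim (rule qf)
  have qi: "integrable M (\<lambda>\<omega>. q (deviation \<omega>))" using q by (simp add: transfers_def)
  have fm: "(\<lambda>\<omega>. form (deviation \<omega>) (deviation \<omega>)) \<in> borel_measurable M"
    by (rule form_measurable; rule deviation_measurable)
  show "integrable M (\<lambda>\<omega>. form (deviation \<omega>) (deviation \<omega>))"
    by (rule integrable_cong_AE_imp[OF qi fm ae])
  let ?f = "\<lambda>i. form (Qh (e i)) (Qh (e i))"
  have fs: "summable (\<lambda>i. \<bar>?f i\<bar>)"
  proof (rule summable_comparison_test'[where N = 0])
    show "summable (\<lambda>i. (1 + norm V) * N1 (Qh (e i)))" by (intro summable_mult HS_N1)
    show "norm \<bar>?f i\<bar> \<le> (1 + norm V) * N1 (Qh (e i))" for i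
      using abs_form_le[OF HS_H1[of i]] by simp
  qed
  interpret time: finite_measure "restrict_space lborel {0..T}" by (rule finite_time_measure)
  have ind: "integrable (restrict_space lborel {0..T}) (indicat_real {0<..T})"
    by (rule time.integrable_const_bound[where B = 1]) (auto simp: indicator_def intro!: measurable_restrict_space1)
  have len: "(LINT s|restrict_space lborel {0..T}. indicat_real {0<..T} s) = T"
  proof -
    have "indicator {0..T} s *\<^sub>R indicat_real {0<..T} s = indicat_real {0<..T} s" for s by (auto simp: indicator_def)
    then have "(LINT s|restrict_space lborel {0..T}. indicat_real {0<..T} s) = (LINT s|lborel. indicat_real {0<..T} s)"
      by (subst integral_restrict_space) (simp_all only: sets_lborel, simp_all)
    then show ?thesis using T by (simp add: measure_def)
  qed
  have "(LINT \<omega>|M. form (deviation \<omega>) (deviation \<omega>)) = (LINT \<omega>|M. q (deviation \<omega>))"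
    by (rule integral_cong_AE[OF fm borel_measurable_integrable[OF qi]]) (use ae in eventually_elim, simp)
  also have "\<dots> = (LINT p|noise_space T. (case p of (i, s) \<Rightarrow> indicator {0<..T} s * q (ev 0 s (kick i s))))"
    using q by (simp add: transfers_def)
  also have "\<dots> = (LINT p|noise_space T. (case p of (i, s) \<Rightarrow> ?f i * indicator {0<..T} s))"
    by (intro Bochner_Integration.integral_cong refl)
      (simp add: qf ev_H1 kick_H1 form_kick mult.commute split: prod.split)
  also have "\<dots> = T * (\<Sum>i. ?f i)"
    unfolding noise_product(2)[OF fs ind] len by (rule mult.commute)
  finally show "(LINT \<omega>|M. form (deviation \<omega>) (deviation \<omega>)) = T * (\<Sum>i. ?f i)" .
qed

end

text \<open>\<open>q x\<close> stands for the integral of |V| times the squared modulus of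
  \<open>x\<close>. It bounds the potential part of the cross term by quantities that finite
  expected energy controls, without a second moment of the norm of \<open>u\<^sub>0\<close>.\<close>

locale finite_energy_solution = stochastic_schroedinger M F e Qh Q W b w J V V1 u\<^sub>0 u T
  for M :: "'w measure" and F and e :: "nat \<Rightarrow> 'd::finite l2_torus" and Qh Q W b w J V V1 u\<^sub>0 u T +
  fixes q :: "'d l2_torus \<Rightarrow> real" and K :: real
  assumes u0_H1: "AE \<omega> in M. u\<^sub>0 \<omega> \<in> H1"
    and grad_int: "integrable M (\<lambda>\<omega>. \<Sum>n. w n * (u\<^sub>0 \<omega> \<bullet> b n)\<^sup>2)"
    and q_bound: "2 * \<bar>V x \<bullet> y\<bar> \<le> q x + q y" "q x \<le> K * (norm x)\<^sup>2"
    and q_int: "integrable M (\<lambda>\<omega>. q (u\<^sub>0 \<omega>))"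
begin

lemma q_nonneg: "0 \<le> q x"
  using q_bound(1)[of x x] by linarith

lemma norm_b: "norm (b n) = 1"
  using orthonormal_basis_inner[OF onb, of n n] by (simp add: norm_eq_sqrt_inner)

lemma abs_inner_b: "\<bar>x \<bullet> b n\<bar> \<le> norm x"
  using Cauchy_Schwarz_ineq2[of x "b n"] by (simp add: norm_b)

text \<open>On \<open>E\<close> the initial value is bounded in H1, so its contribution to each mode
  is bounded and \<open>F 0\<close>-measurable, hence orthogonal to that mode of
  \<open>deviation\<close>; dominated convergence sums the modes. \<open>E\<close> bounds all
  partial sums and not \<open>N1\<close>, because boundedness of the partial sums also forces
  convergence of the series.\<close>

lemma truncated_cross_term:
  fixes k :: nat
  defines "E \<equiv> {\<omega> \<in> space M. \<forall>m. (\<Sum>n<m. (1 + w n) * (u\<^sub>0 \<omega> \<bullet> b n)\<^sup>2) \<le> real k}"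
  shows "(LINT \<omega>|M. indicator E \<omega> * form (u\<^sub>0 \<omega>) (deviation \<omega>)) = 0"
proof -
  have space: "space (F 0) = space M" using F_subalgebra[of 0] by (simp add: subalgebra_def)
  have [measurable]: "u\<^sub>0 \<in> borel_measurable (F 0)" by (rule u0_F)
  have Vu [measurable]: "(\<lambda>\<omega>. V (u\<^sub>0 \<omega>)) \<in> borel_measurable (F 0)" by (rule blinfun_measurable) measurable
  have [measurable]: "E \<in> sets (F 0)"
    unfolding E_def space[symmetric] by measurable
  have on_E: "u\<^sub>0 \<omega> \<in> H1" "N1 (u\<^sub>0 \<omega>) \<le> real k" if "\<omega> \<in> E" for \<omega>
  proof -
    have le: "(\<Sum>n<m. (1 + w n) * (u\<^sub>0 \<omega> \<bullet> b n)\<^sup>2) \<le> real k" for m using that by (simp add: E_def)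
    have "summable (\<lambda>n. (1 + w n) * (u\<^sub>0 \<omega> \<bullet> b n)\<^sup>2)"
    proof (rule bounded_imp_summable)
      show "0 \<le> (1 + w n) * (u\<^sub>0 \<omega> \<bullet> b n)\<^sup>2" for n using w1_pos(1)[of n] by simp
      show "(\<Sum>n\<le>m. (1 + w n) * (u\<^sub>0 \<omega> \<bullet> b n)\<^sup>2) \<le> real k" for m
        using le[of "Suc m"] by (simp only: lessThan_Suc_atMost)
    qed
    then show "u\<^sub>0 \<omega> \<in> H1" "N1 (u\<^sub>0 \<omega>) \<le> real k"
      unfolding N1_def H1_def using le by (auto intro: suminf_le_const)
  qed
  have norm_E: "norm (u\<^sub>0 \<omega>) \<le> sqrt (real k)" if "\<omega> \<in> E" for \<omega>
    using norm_le_N1[OF on_E(1)[OF that]] on_E(2)[OF that] by (intro real_le_rsqrt) linarith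
  define g where "g n \<omega> = indicator E \<omega> * (w n * (u\<^sub>0 \<omega> \<bullet> b n) - V (u\<^sub>0 \<omega>) \<bullet> b n)" for n \<omega>
  have g_F: "g n \<in> borel_measurable (F 0)" for n
    unfolding g_def[abs_def] by measurable
  have g_le: "\<bar>g n \<omega>\<bar> \<le> (w n + norm V) * sqrt (real k)" for n \<omega>
  proof (cases "\<omega> \<in> E")
    case True
    have "\<bar>V (u\<^sub>0 \<omega>) \<bullet> b n\<bar> \<le> norm V * norm (u\<^sub>0 \<omega>)"
      using abs_inner_b[of "V (u\<^sub>0 \<omega>)" n] norm_blinfun[of V "u\<^sub>0 \<omega>"] by linarith
    moreover have "\<bar>w n * (u\<^sub>0 \<omega> \<bullet> b n)\<bar> \<le> w n * norm (u\<^sub>0 \<omega>)"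
      using mult_left_mono[OF abs_inner_b w_nonneg] w_nonneg[of n] by (simp add: abs_mult)
    ultimately have "\<bar>g n \<omega>\<bar> \<le> (w n + norm V) * norm (u\<^sub>0 \<omega>)"
      using True unfolding g_def distrib_right by simp
    also have "\<dots> \<le> (w n + norm V) * sqrt (real k)"
      using w_nonneg[of n] by (intro mult_left_mono norm_E[OF True]) simp
    finally show ?thesis .
  next
    case False
    then show ?thesis using w_nonneg[of n] by (simp add: g_def)
  qed
  have g_int: "integrable M (\<lambda>\<omega>. g n \<omega> * (deviation \<omega> \<bullet> b n))" for n
    by (intro square_integrable_mult deviation_square_integrable
        isometric_pair_orthogonal(1)[OF noise_isometric_pair[OF T order_refl] g_F g_le])
  define s where "s m \<omega> = (\<Sum>n<m. g n \<omega> * (deviation \<omega> \<bullet> b n))" for m \<omega>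
  have s_0: "(LINT \<omega>|M. s m \<omega>) = 0" for m
    unfolding s_def by (subst Bochner_Integration.integral_sum) (auto intro!: g_int sum.neutral deviation_orthogonal[OF g_F g_le])
  have s_meas: "s m \<in> borel_measurable M" for m
    unfolding s_def[abs_def] by (intro borel_measurable_sum borel_measurable_integrable g_int)
  have EM [measurable]: "E \<in> sets M" using F_subalgebra[of 0] \<open>E \<in> sets (F 0)\<close> by (auto simp: subalgebra_def)
  have f_meas: "(\<lambda>\<omega>. indicator E \<omega> * form (u\<^sub>0 \<omega>) (deviation \<omega>)) \<in> borel_measurable M"
    by (intro borel_measurable_times form_measurable u0_measurable deviation_measurable borel_measurable_indicator EM)
  define B where "B \<omega> = real k + (norm V)\<^sup>2 * real k + N1 (deviation \<omega>)" for \<omega>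
  have B_int: "integrable M B"
    unfolding B_def[abs_def] using N1_transfers by (simp add: transfers_def)
  have lim: "AE \<omega> in M. (\<lambda>m. s m \<omega>) \<longlonglongrightarrow> indicator E \<omega> * form (u\<^sub>0 \<omega>) (deviation \<omega>)"
    using deviation_H1
  proof eventually_elim
    case (elim \<omega>)
    show ?case
    proof (cases "\<omega> \<in> E")
      case True
      have "(\<lambda>n. w n * (u\<^sub>0 \<omega> \<bullet> b n) * (deviation \<omega> \<bullet> b n) - (V (u\<^sub>0 \<omega>) \<bullet> b n) * (deviation \<omega> \<bullet> b n))
          sums form (u\<^sub>0 \<omega>) (deviation \<omega>)"
        unfolding form_def
        by (rule sums_diff[OF summable_sums[OF form_sums[OF on_E(1)[OF True] elim]] parseval_sums[OF onb]])
      then show ?thesis using True by (simp add: sums_def s_def g_def left_diff_distrib)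
    qed (simp add: s_def g_def)
  qed
  have dom: "AE \<omega> in M. norm (s m \<omega>) \<le> B \<omega>" for m
    using deviation_H1
  proof eventually_elim
    case (elim \<omega>)
    have Y: "summable (\<lambda>n. (1 + w n) * (deviation \<omega> \<bullet> b n)\<^sup>2)" using elim by (simp add: H1_def)
    show ?case
    proof (cases "\<omega> \<in> E")
      case True
      let ?V = "V (u\<^sub>0 \<omega>)"
      have U: "summable (\<lambda>n. (1 + w n) * (u\<^sub>0 \<omega> \<bullet> b n)\<^sup>2)" using on_E(1)[OF True] by (simp add: H1_def)
      have Vs: "summable (\<lambda>n. (?V \<bullet> b n)\<^sup>2)" "(\<Sum>n. (?V \<bullet> b n)\<^sup>2) = (norm ?V)\<^sup>2"
        using parseval_norm[OF onb, of ?V] by (simp_all add: sums_iff)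
      have termwise: "\<bar>g n \<omega> * (deviation \<omega> \<bullet> b n)\<bar> \<le> (1 + w n) * (u\<^sub>0 \<omega> \<bullet> b n)\<^sup>2 + (?V \<bullet> b n)\<^sup>2 + (1 + w n) * (deviation \<omega> \<bullet> b n)\<^sup>2" for n
      proof -
        have "g n \<omega> * (deviation \<omega> \<bullet> b n) = w n * ((u\<^sub>0 \<omega> \<bullet> b n) * (deviation \<omega> \<bullet> b n)) - (?V \<bullet> b n) * (deviation \<omega> \<bullet> b n)"
          using True by (simp add: g_def left_diff_distrib)
        moreover have "\<bar>w n * ((u\<^sub>0 \<omega> \<bullet> b n) * (deviation \<omega> \<bullet> b n))\<bar> \<le> w n * ((u\<^sub>0 \<omega> \<bullet> b n)\<^sup>2 + (deviation \<omega> \<bullet> b n)\<^sup>2)"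
          using mult_left_mono[OF abs_mult_le_squares[of "u\<^sub>0 \<omega> \<bullet> b n" "deviation \<omega> \<bullet> b n"] w_nonneg[of n]] w_nonneg[of n] by (simp add: abs_mult)
        moreover have "\<bar>(?V \<bullet> b n) * (deviation \<omega> \<bullet> b n)\<bar> \<le> (?V \<bullet> b n)\<^sup>2 + (deviation \<omega> \<bullet> b n)\<^sup>2"
          by (rule abs_mult_le_squares)
        ultimately show ?thesis
          using zero_le_power2[of "u\<^sub>0 \<omega> \<bullet> b n"] unfolding distrib_left distrib_right by linarith
      qed
      have "norm (s m \<omega>) \<le> (\<Sum>n<m. \<bar>g n \<omega> * (deviation \<omega> \<bullet> b n)\<bar>)"
        unfolding s_def real_norm_def by (rule sum_abs)
      also have "\<dots> \<le> (\<Sum>n<m. (1 + w n) * (u\<^sub>0 \<omega> \<bullet> b n)\<^sup>2 + (?V \<bullet> b n)\<^sup>2 + (1 + w n) * (deviation \<omega> \<bullet> b n)\<^sup>2)"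
        by (rule sum_mono[OF termwise])
      also have "\<dots> \<le> N1 (u\<^sub>0 \<omega>) + (norm ?V)\<^sup>2 + N1 (deviation \<omega>)"
        unfolding sum.distrib N1_def Vs(2)[symmetric]
        by (intro add_mono sum_le_suminf U Y Vs(1)) (auto simp: less_imp_le w1_pos)
      also have "\<dots> \<le> B \<omega>"
      proof -
        have "(norm ?V)\<^sup>2 \<le> (norm V * norm (u\<^sub>0 \<omega>))\<^sup>2" by (intro power_mono norm_blinfun) simp
        also have "\<dots> \<le> (norm V)\<^sup>2 * real k"
          unfolding power_mult_distrib
          using norm_le_N1[OF on_E(1)[OF True]] on_E(2)[OF True] by (intro mult_left_mono) auto
        finally show ?thesis using on_E(2)[OF True] by (simp add: B_def)
      qed
      finally show ?thesis .
    next
      case False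
      then show ?thesis using N1_nonneg[OF elim] by (simp add: s_def g_def B_def)
    qed
  qed
  have "(\<lambda>m. LINT \<omega>|M. s m \<omega>) \<longlonglongrightarrow> (LINT \<omega>|M. indicator E \<omega> * form (u\<^sub>0 \<omega>) (deviation \<omega>))"
    by (rule integral_dominated_convergence[OF f_meas s_meas B_int lim dom])
  then show ?thesis unfolding s_0 by (simp add: LIMSEQ_const_iff)
qed

text \<open>As \<open>k\<close> grows the events exhaust almost every path. The dominating function
  consists of the gradient of \<open>u\<^sub>0\<close>, of \<open>q\<close>, and of moments of
  \<open>deviation\<close>, all of which are integrable.\<close>

lemma cross_term:
  shows "integrable M (\<lambda>\<omega>. form (u\<^sub>0 \<omega>) (deviation \<omega>))" and "(LINT \<omega>|M. form (u\<^sub>0 \<omega>) (deviation \<omega>)) = 0"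
proof -
  define E where "E k = {\<omega> \<in> space M. \<forall>m. (\<Sum>n<m. (1 + w n) * (u\<^sub>0 \<omega> \<bullet> b n)\<^sup>2) \<le> real k}" for k
  define B where "B \<omega> = (\<Sum>n. w n * (u\<^sub>0 \<omega> \<bullet> b n)\<^sup>2) + N1 (deviation \<omega>) + (q (u\<^sub>0 \<omega>) + K * (norm (deviation \<omega>))\<^sup>2)" for \<omega>
  have B_int: "integrable M B"
    unfolding B_def[abs_def] using N1_transfers
    by (intro Bochner_Integration.integrable_add grad_int q_int integrable_mult_right deviation_norm_integrable)
      (simp add: transfers_def)
  have f_meas: "(\<lambda>\<omega>. form (u\<^sub>0 \<omega>) (deviation \<omega>)) \<in> borel_measurable M"
    by (intro form_measurable u0_measurable deviation_measurable)
  have le: "AE \<omega> in M. \<bar>form (u\<^sub>0 \<omega>) (deviation \<omega>)\<bar> \<le> B \<omega>"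
    using u0_H1 deviation_H1
  proof eventually_elim
    case (elim \<omega>)
    show ?case
      using abs_form_cross[OF elim] q_bound(1)[of "u\<^sub>0 \<omega>" "deviation \<omega>"] q_bound(2)[of "deviation \<omega>"]
        q_nonneg[of "u\<^sub>0 \<omega>"] q_nonneg[of "deviation \<omega>"]
      unfolding B_def by linarith
  qed
  show "integrable M (\<lambda>\<omega>. form (u\<^sub>0 \<omega>) (deviation \<omega>))"
    by (rule Bochner_Integration.integrable_bound[OF B_int f_meas]) (use le in eventually_elim, simp)
  have E_meas: "E k \<in> sets M" for k
    unfolding E_def by measurable
  have lim: "AE \<omega> in M. (\<lambda>k. indicator (E k) \<omega> * form (u\<^sub>0 \<omega>) (deviation \<omega>)) \<longlonglongrightarrow> form (u\<^sub>0 \<omega>) (deviation \<omega>)"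
    using u0_H1 AE_space
  proof eventually_elim
    case (elim \<omega>)
    obtain k0 :: nat where k0: "N1 (u\<^sub>0 \<omega>) \<le> real k0" using real_arch_simple by blast
    have "\<omega> \<in> E k" if "k0 \<le> k" for k
    proof -
      have "(\<Sum>n<m. (1 + w n) * (u\<^sub>0 \<omega> \<bullet> b n)\<^sup>2) \<le> real k" for m
      proof -
        have "(\<Sum>n<m. (1 + w n) * (u\<^sub>0 \<omega> \<bullet> b n)\<^sup>2) \<le> N1 (u\<^sub>0 \<omega>)"
          unfolding N1_def using elim(1) by (intro sum_le_suminf) (simp_all add: H1_def less_imp_le[OF w1_pos(1)])
        also have "\<dots> \<le> real k" using k0 that by linarith
        finally show ?thesis .
      qed
      then show ?thesis using elim(2) by (simp add: E_def)
    qed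
    then have "\<forall>\<^sub>F k in sequentially. indicator (E k) \<omega> * form (u\<^sub>0 \<omega>) (deviation \<omega>) = form (u\<^sub>0 \<omega>) (deviation \<omega>)"
      unfolding eventually_sequentially by (intro exI[of _ k0]) simp
    then show ?case by (rule tendsto_eventually)
  qed
  have dom: "AE \<omega> in M. norm (indicator (E k) \<omega> * form (u\<^sub>0 \<omega>) (deviation \<omega>)) \<le> B \<omega>" for k
    using le by eventually_elim (auto simp: indicator_def)
  have m: "(\<lambda>\<omega>. indicator (E k) \<omega> * form (u\<^sub>0 \<omega>) (deviation \<omega>)) \<in> borel_measurable M" for k
    by (intro borel_measurable_times f_meas borel_measurable_indicator E_meas)
  have "(\<lambda>k. LINT \<omega>|M. indicator (E k) \<omega> * form (u\<^sub>0 \<omega>) (deviation \<omega>)) \<longlonglongrightarrow> (LINT \<omega>|M. form (u\<^sub>0 \<omega>) (deviation \<omega>))"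
    by (rule integral_dominated_convergence[OF f_meas m B_int lim dom])
  then show "(LINT \<omega>|M. form (u\<^sub>0 \<omega>) (deviation \<omega>)) = 0"
    unfolding E_def truncated_cross_term by (simp add: LIMSEQ_const_iff)
qed

lemma energy_balance:
  shows "AE \<omega> in M. u T \<omega> \<in> H1"
    and "integrable M (\<lambda>\<omega>. form (u T \<omega>) (u T \<omega>))"
    and "(LINT \<omega>|M. form (u T \<omega>) (u T \<omega>)) = (LINT \<omega>|M. form (u\<^sub>0 \<omega>) (u\<^sub>0 \<omega>))
      + T * (\<Sum>i. form (Qh (e i)) (Qh (e i)))"
proof -
  \<comment> \<open>The flow carries the initial value and the deviation together, so by
    conservation the energy at time \<open>T\<close> is the quadratic form of their sum at time
    0.\<close>
  have uT: "u T \<omega> = S T (ev T 0 (u\<^sub>0 \<omega> + deviation \<omega>))" for \<omega>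
    using T by (simp add: deviation_def ev_ev twisted_def S_minus)
  have split: "AE \<omega> in M. u T \<omega> \<in> H1 \<and> form (u\<^sub>0 \<omega>) (u\<^sub>0 \<omega>) + 2 * form (u\<^sub>0 \<omega>) (deviation \<omega>) + form (deviation \<omega>) (deviation \<omega>) = form (u T \<omega>) (u T \<omega>)"
    using u0_H1 deviation_H1
  proof eventually_elim
    case (elim \<omega>)
    let ?x = "u\<^sub>0 \<omega>" and ?y = "deviation \<omega>"
    have v: "?x + ?y \<in> H1" by (rule H1_add[OF elim])
    have "form (u T \<omega>) (u T \<omega>) = form (?x + ?y) (?x + ?y)"
      unfolding uT form_conserved[OF v] S_0 ..
    also have "\<dots> = form ?x (?x + ?y) + form ?y (?x + ?y)" by (rule form_add[OF elim v])
    also have "form ?x (?x + ?y) = form ?x ?x + form ?y ?x"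
      unfolding form_sym[of ?x "?x + ?y"] by (rule form_add[OF elim elim(1)])
    also have "form ?y (?x + ?y) = form ?x ?y + form ?y ?y"
      unfolding form_sym[of ?y "?x + ?y"] by (rule form_add[OF elim elim(2)])
    finally have "form ?x ?x + 2 * form ?x ?y + form ?y ?y = form (u T \<omega>) (u T \<omega>)"
      using form_sym[of ?y ?x] by linarith
    moreover have "u T \<omega> \<in> H1" unfolding uT by (intro S_H1 ev_H1 v)
    ultimately show ?case by simp
  qed
  then show "AE \<omega> in M. u T \<omega> \<in> H1" by eventually_elim simp
  have form_u0: "integrable M (\<lambda>\<omega>. form (u\<^sub>0 \<omega>) (u\<^sub>0 \<omega>))"
  proof -
    have Vm: "(\<lambda>\<omega>. V (u\<^sub>0 \<omega>) \<bullet> u\<^sub>0 \<omega>) \<in> borel_measurable M"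
      by (intro borel_measurable_inner blinfun_measurable u0_measurable)
    have "integrable M (\<lambda>\<omega>. V (u\<^sub>0 \<omega>) \<bullet> u\<^sub>0 \<omega>)"
    proof (rule Bochner_Integration.integrable_bound[OF q_int Vm AE_I2])
      show "norm (V (u\<^sub>0 \<omega>) \<bullet> u\<^sub>0 \<omega>) \<le> norm (q (u\<^sub>0 \<omega>))" for \<omega>
        using q_bound(1)[of "u\<^sub>0 \<omega>" "u\<^sub>0 \<omega>"] q_nonneg[of "u\<^sub>0 \<omega>"] by simp
    qed
    from Bochner_Integration.integrable_diff[OF grad_int this] show ?thesis
      by (simp add: form_def power2_eq_square mult.assoc)
  qed
  note ints = form_u0 integrable_mult_right[OF cross_term(1), of 2] deviation_energy(1)
  have sum_int: "integrable M (\<lambda>\<omega>. form (u\<^sub>0 \<omega>) (u\<^sub>0 \<omega>) + 2 * form (u\<^sub>0 \<omega>) (deviation \<omega>) + form (deviation \<omega>) (deviation \<omega>))"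
    by (intro Bochner_Integration.integrable_add ints)
  have uTm: "u T \<in> borel_measurable M"
  proof -
    have "(\<lambda>\<omega>. S T (twisted T \<omega>)) \<in> borel_measurable M"
      by (rule blinfun_measurable[OF twisted_measurable'])
    then show ?thesis using T by (simp add: twisted_def S_minus)
  qed
  have fm: "(\<lambda>\<omega>. form (u T \<omega>) (u T \<omega>)) \<in> borel_measurable M" by (intro form_measurable uTm)
  have ae: "AE \<omega> in M. form (u\<^sub>0 \<omega>) (u\<^sub>0 \<omega>) + 2 * form (u\<^sub>0 \<omega>) (deviation \<omega>) + form (deviation \<omega>) (deviation \<omega>) = form (u T \<omega>) (u T \<omega>)"
    using split by eventually_elim simp
  show "integrable M (\<lambda>\<omega>. form (u T \<omega>) (u T \<omega>))" by (rule integrable_cong_AE_imp[OF sum_int fm ae])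
  have "(LINT \<omega>|M. form (u T \<omega>) (u T \<omega>))
      = (LINT \<omega>|M. form (u\<^sub>0 \<omega>) (u\<^sub>0 \<omega>) + 2 * form (u\<^sub>0 \<omega>) (deviation \<omega>) + form (deviation \<omega>) (deviation \<omega>))"
    by (rule integral_cong_AE[OF fm borel_measurable_integrable[OF sum_int]]) (use ae in eventually_elim, simp)
  also have "\<dots> = (LINT \<omega>|M. form (u\<^sub>0 \<omega>) (u\<^sub>0 \<omega>)) + 2 * (LINT \<omega>|M. form (u\<^sub>0 \<omega>) (deviation \<omega>)) + (LINT \<omega>|M. form (deviation \<omega>) (deviation \<omega>))"
    using ints by simp
  finally show "(LINT \<omega>|M. form (u T \<omega>) (u T \<omega>)) = (LINT \<omega>|M. form (u\<^sub>0 \<omega>) (u\<^sub>0 \<omega>))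
      + T * (\<Sum>i. form (Qh (e i)) (Qh (e i)))"
    by (simp add: cross_term(2) deviation_energy(2))
qed

end

theorem proposition4p7:
  fixes M :: "'w measure"
    and F :: "real \<Rightarrow> 'w measure"
    and e :: "nat \<Rightarrow> 'd::finite l2_torus"
    and Q Qh :: "'d l2_torus \<Rightarrow>\<^sub>L 'd l2_torus"
    and W u :: "real \<Rightarrow> 'w \<Rightarrow> 'd l2_torus"
    and V :: "'d l2_torus"
    and u\<^sub>0 :: "'w \<Rightarrow> 'd l2_torus"
  assumes dim: "CARD('d) \<in> {1, 2, 3}"
    and prob: "prob_space M"
    and filtration: "normal_filtration M F"
    and basis: "orthonormal_basis e"
    and Q: "nonneg_selfadjoint Q"
    and sqrt_Q: "is_operator_sqrt Qh Q"
    and W: "Q_wiener_process M F Q W"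
    and HS: "hilbert_schmidt_sobolev e 1 Qh"
    and V_real: "real_valued V"
    and V_1: "CARD('d) = 1 \<Longrightarrow> V \<in> sobolev 2"
    and V_23: "CARD('d) \<in> {2, 3} \<Longrightarrow> V \<in> sobolev 3"
    and u0: "u\<^sub>0 \<in> borel_measurable (F 0)"
    and u0_energy: "finite_expected_energy M V u\<^sub>0"
    and mild: "mild_solution M F e Qh W V u\<^sub>0 u"
    and t: "0 \<le> t"
  shows "(AE \<omega> in M. u t \<omega> \<in> sobolev 1) \<and>
    integrable M (\<lambda>\<omega>. energy V (u t \<omega>)) \<and>
    (LINT \<omega>|M. energy V (u t \<omega>)) =
      (LINT \<omega>|M. energy V (u\<^sub>0 \<omega>)) + t / 2 * (trace_grad e Qh - trace_potential e V Qh)"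
proof -
  let ?V = "Blinfun (potential_mult V) :: 'd l2_torus \<Rightarrow>\<^sub>L 'd l2_torus"
  have V_weighted: "(\<lambda>k. sqrt (1 + freq_sq k) * cmod (fourier V k)) summable_on UNIV"
  proof (cases "CARD('d) = 1")
    case True
    show ?thesis by (rule sobolev_weighted_l1[OF V_1[OF True]]) (simp add: True)
  next
    case False
    then have d: "CARD('d) \<in> {2, 3}" using dim by auto
    show ?thesis by (rule sobolev_weighted_l1[OF V_23[OF d]]) (use d in auto)
  qed
  note pot = potential_operator[OF V_real V_weighted]
  have V_apply: "blinfun_apply ?V x = potential_mult V x" for x
    by (simp add: bounded_linear_Blinfun_apply pot(2))
  obtain V1 where V1: "schroedinger torus_basis (torus_weight TYPE('d)) torus_J ?V V1"
    using pot(1) by blast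
  interpret sch: schroedinger torus_basis "torus_weight TYPE('d)" torus_J ?V V1 by (rule V1)
  obtain K where K: "\<And>x. (LINT y|torus. \<bar>Re (fn_of V y)\<bar> * (cmod (fn_of x y))\<^sup>2) \<le> K * (norm x)\<^sup>2"
    using pot(3) by blast
  have Qh_H1: "Qh x \<in> tor.H1" for x
    using HS by (auto simp: hilbert_schmidt_sobolev_def H1_eq_sobolev)
  have Qh_N1: "summable (\<lambda>i. tor.N1 (Qh (e i)))"
    using HS by (simp add: hilbert_schmidt_sobolev_def N1_eq_sobolev_norm[OF Qh_H1])
  have Qh_norm: "summable (\<lambda>i. (norm (Qh (e i)))\<^sup>2)"
    by (rule summable_comparison_test'[OF Qh_N1, where N = 0]) (simp add: tor.norm_le_N1[OF Qh_H1])
  have group: "schroedinger_group r = blinfun_apply (tor.S r)" for r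
    by (rule ext) (rule schroedinger_group_eq)
  have u_F: "\<And>r. 0 \<le> r \<Longrightarrow> u r \<in> borel_measurable (F r)"
    and u_joint: "(\<lambda>(r, \<omega>). u r \<omega>) \<in> borel_measurable (restrict_space borel {0..} \<Otimes>\<^sub>M M)"
    and drift: "\<And>r. 0 \<le> r \<Longrightarrow> AE \<omega> in M. set_integrable lborel {0..r} (\<lambda>s. tor.S (r - s) (blinfun_apply ?V (u s \<omega>)))"
    and duhamel: "\<And>r. 0 \<le> r \<Longrightarrow> \<exists>Z. has_wiener_integral M e Qh W r (\<lambda>s. blinfun_apply (tor.S (r - s))) Z \<and>
      (AE \<omega> in M. u r \<omega> = tor.S r (u\<^sub>0 \<omega>)
        - torus_J (LINT s:{0..r}|lborel. tor.S (r - s) (blinfun_apply ?V (u s \<omega>)))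
        - torus_J (Z \<omega>))"
    using mild unfolding mild_solution_def group V_apply torus_J_apply by blast+
  have init: "AE \<omega> in M. u\<^sub>0 \<omega> \<in> tor.H1" "integrable M (\<lambda>\<omega>. grad_norm_sq (u\<^sub>0 \<omega>))"
    "integrable M (\<lambda>\<omega>. LINT x|torus. \<bar>Re (fn_of V x)\<bar> * (cmod (fn_of (u\<^sub>0 \<omega>) x))\<^sup>2)"
    using u0_energy by (simp_all add: finite_expected_energy_def H1_eq_sobolev)
  have grad: "(\<Sum>n. torus_weight TYPE('d) n * (x \<bullet> torus_basis n)\<^sup>2) = grad_norm_sq x" if "x \<in> tor.H1" for x :: "'d l2_torus"
    using grad_norm_sq_sums[OF that] by (simp add: sums_iff)
  have wiener: "wiener_setting M F e Qh Q W"
    by (intro wiener_setting.intro wiener_setting_axioms.intro prob filtration basis sqrt_Q W Qh_norm)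
  interpret wien: wiener_setting M F e Qh Q W by (rule wiener)
  have u0_meas: "u\<^sub>0 \<in> borel_measurable M" by (rule wien.F_measurable[OF order_refl u0])
  have stoch: "stochastic_schroedinger M F e Qh Q W torus_basis (torus_weight TYPE('d)) torus_J ?V V1 u\<^sub>0 u t"
    by (intro stochastic_schroedinger.intro stochastic_schroedinger_axioms.intro wiener V1 t u0 u_joint drift duhamel Qh_H1 Qh_N1)
  have grad_int: "integrable M (\<lambda>\<omega>. \<Sum>n. torus_weight TYPE('d) n * (u\<^sub>0 \<omega> \<bullet> torus_basis n)\<^sup>2)"
  proof (rule integrable_cong_AE_imp[OF init(2)])
    show "(\<lambda>\<omega>. \<Sum>n. torus_weight TYPE('d) n * (u\<^sub>0 \<omega> \<bullet> torus_basis n)\<^sup>2) \<in> borel_measurable M"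
      using u0_meas by measurable
    show "AE \<omega> in M. grad_norm_sq (u\<^sub>0 \<omega>) = (\<Sum>n. torus_weight TYPE('d) n * (u\<^sub>0 \<omega> \<bullet> torus_basis n)\<^sup>2)"
      using init(1) by eventually_elim (simp add: grad)
  qed
  define q where "q x = (LINT y|torus. \<bar>Re (fn_of V y)\<bar> * (cmod (fn_of x y))\<^sup>2)" for x :: "'d l2_torus"
  have fin: "finite_energy_solution M F e Qh Q W torus_basis (torus_weight TYPE('d)) torus_J ?V V1 u\<^sub>0 u t q K"
  proof (intro finite_energy_solution.intro finite_energy_solution_axioms.intro stoch init(1) grad_int)
    show "2 * \<bar>blinfun_apply ?V x \<bullet> y\<bar> \<le> q x + q y" for x y unfolding V_apply q_def by (rule pot(5))
    show "q x \<le> K * (norm x)\<^sup>2" for x unfolding q_def by (rule K)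
    show "integrable M (\<lambda>\<omega>. q (u\<^sub>0 \<omega>))" unfolding q_def by (rule init(3))
  qed
  note balance = finite_energy_solution.energy_balance[OF fin]
  have energy_V: "energy V x = 1/2 * grad_norm_sq x - 1/2 * (blinfun_apply ?V x \<bullet> x)" for x
    unfolding energy_def V_apply pot(4) ..
  have form: "sch.form x x = grad_norm_sq x - blinfun_apply ?V x \<bullet> x" if "x \<in> tor.H1" for x
    unfolding sch.form_def using grad[OF that] by (simp add: power2_eq_square mult.assoc)
  have energy_form: "energy V x = 1/2 * sch.form x x" if "x \<in> tor.H1" for x
    unfolding energy_V form[OF that] by simp
  \<comment> \<open>The solution lies in H1 only almost surely, so \<open>energy V\<close> has to be
    measurable on all of L2 before its identity with the form on H1 can be integrated.\<close>
  have energy_meas: "(\<lambda>\<omega>. energy V (X \<omega>)) \<in> borel_measurable M" if [measurable]: "X \<in> borel_measurable M" for X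
  proof -
    have [measurable]: "(\<lambda>\<omega>. blinfun_apply ?V (X \<omega>)) \<in> borel_measurable M" by (rule blinfun_measurable) measurable
    show ?thesis unfolding energy_V by measurable
  qed
  have ut_meas: "u t \<in> borel_measurable M" by (rule wien.F_measurable[OF t u_F[OF t]])
  have ut_ae: "AE \<omega> in M. 1/2 * sch.form (u t \<omega>) (u t \<omega>) = energy V (u t \<omega>)"
    using balance(1) by eventually_elim (simp add: energy_form)
  have u0_ae: "AE \<omega> in M. 1/2 * sch.form (u\<^sub>0 \<omega>) (u\<^sub>0 \<omega>) = energy V (u\<^sub>0 \<omega>)"
    using init(1) by eventually_elim (simp add: energy_form)
  have form_int: "integrable M (\<lambda>\<omega>. 1/2 * sch.form (u t \<omega>) (u t \<omega>))"
    by (rule integrable_mult_right[OF balance(2)])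
  have energy_int: "integrable M (\<lambda>\<omega>. energy V (u t \<omega>))"
    by (rule integrable_cong_AE_imp[OF form_int energy_meas[OF ut_meas] ut_ae])
  have "(LINT \<omega>|M. energy V (u t \<omega>)) = (LINT \<omega>|M. 1/2 * sch.form (u t \<omega>) (u t \<omega>))"
    by (rule integral_cong_AE[OF energy_meas[OF ut_meas] borel_measurable_integrable[OF form_int]])
      (use ut_ae in eventually_elim, simp)
  also have "\<dots> = 1/2 * ((LINT \<omega>|M. sch.form (u\<^sub>0 \<omega>) (u\<^sub>0 \<omega>)) + t * (\<Sum>i. sch.form (Qh (e i)) (Qh (e i))))"
    unfolding integral_mult_right_zero balance(3) ..
  also have "\<dots> = (LINT \<omega>|M. 1/2 * sch.form (u\<^sub>0 \<omega>) (u\<^sub>0 \<omega>)) + t / 2 * (\<Sum>i. sch.form (Qh (e i)) (Qh (e i)))"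
    unfolding integral_mult_right_zero by (simp add: distrib_left)
  also have "(LINT \<omega>|M. 1/2 * sch.form (u\<^sub>0 \<omega>) (u\<^sub>0 \<omega>)) = (LINT \<omega>|M. energy V (u\<^sub>0 \<omega>))"
    by (rule integral_cong_AE[OF borel_measurable_times[OF borel_measurable_const sch.form_measurable[OF u0_meas u0_meas]] energy_meas[OF u0_meas] u0_ae])
  \<comment> \<open>The two traces converge separately, the first dominated by \<open>N1\<close> and
    the second by \<open>K\<close> times the squared norm, so the series of differences
    splits.\<close>
  also have "(\<Sum>i. sch.form (Qh (e i)) (Qh (e i))) = trace_grad e Qh - trace_potential e V Qh"
  proof -
    have g: "summable (\<lambda>i. grad_norm_sq (Qh (e i)))"
    proof (rule summable_comparison_test'[OF Qh_N1, where N = 0])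
      fix i
      have "grad_norm_sq (Qh (e i)) \<le> tor.N1 (Qh (e i))"
        unfolding grad[OF Qh_H1, symmetric] tor.N1_def
        using Qh_H1[of "e i"] by (intro suminf_le sch.summable_grad Qh_H1 mult_right_mono) (simp_all add: tor.H1_def)
      then show "norm (grad_norm_sq (Qh (e i))) \<le> tor.N1 (Qh (e i))"
        using grad_norm_sq_nonneg[of "Qh (e i)"] by simp
    qed
    have v: "summable (\<lambda>i. potential_mult V (Qh (e i)) \<bullet> Qh (e i))"
    proof (rule summable_comparison_test'[OF summable_mult[OF Qh_norm, of K], where N = 0])
      fix i
      show "norm (potential_mult V (Qh (e i)) \<bullet> Qh (e i)) \<le> K * (norm (Qh (e i)))\<^sup>2"
        using pot(5)[of "Qh (e i)" "Qh (e i)"] K[of "Qh (e i)"]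
        unfolding real_norm_def by linarith
    qed
    show ?thesis
      unfolding trace_grad_def trace_potential_def suminf_diff[OF g v] form[OF Qh_H1] V_apply ..
  qed
  finally show ?thesis
    using balance(1) energy_int by (simp add: H1_eq_sobolev)
qed

end
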